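(* Let $p\in[2,\infty)$, $\frac1p+\frac1q=1$, $-2(p+q)<c<0$, and let $S_{p,c}$ be the complete hyperbolic affine sphere of Hildebrand described in the context. Let $b_1,g_2,g_3$, the Weierstrass functions $\mathscr P,\zeta,\sigma$ and the half-period $\omega_1$ be as in the context. Put $H=-1$ and $$U'=\sqrt{\frac{c^2(p-1)}{(32p)^2}+\frac{(p-2)^2(2p-1)^2(p+1)^2}{4(12(p-1))^3}} .$$ Then the associated family of $S_{p,c}$ is given, with $\lambda=e^{3it}$, $t\in[0,\frac{2\pi}3]$, by $$\vec r_\lambda=\begin{pmatrix}\frac1{3p}\left(\frac{\sigma(\xi_2+\omega_1-s\, m_1)\,\sigma(\omega_1)}{\sigma(\xi_2+\omega_1)\,\sigma(\omega_1-s\, m_1)}\right)e^{s\zeta(m_1)\xi_2+f_1(t)y_3}\\[6pt] \frac1{3p}\left(\frac{\sigma(\xi_2+\omega_1-s\, m_2)\,\sigma(\omega_1)}{\sigma(\xi_2+\omega_1)\,\sigma(\omega_1-s\, m_2)}\right)e^{s\zeta(m_2)\xi_2+f_2(t)y_3}\\[6pt] \frac{\sqrt3(p-1)c}{2}\left(\frac{\sigma(\xi_2+\omega_1-s\, m_3)\,\sigma(\omega_1)}{\sigma(\xi_2+\omega_1)\,\sigma(\omega_1-s\, m_3)}\right)e^{s\zeta(m_3)\xi_2+f_3(t)y_3}\end{pmatrix},$$ where $s=-\operatorname{sgn}(\cos(3t))$ and $m_i$ ($i=1,2,3$) are the solutions of $$\mathscr P(m_i)+\frac{b_1}{4}+\frac{-\sqrt{-2c(p-1)}\,U'\sin(3t)}{3^{3/4}\,p\,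 f_i(t)}=0,\qquad \mathscr P'(m_i)<0 .$$ The functions $f_i(t)$ are given by $$f_1(t)=-\frac1{\sqrt3}\sqrt{\frac{p^2-p+1}{p-1}}\,\sin\!\left(\frac\pi6+\frac13\arccos\left(\frac{U'H\sin(3t)}{\sqrt{\left(\frac{p^2-p+1}{12(p-1)}\right)^3}}\right)\right),$$ $$f_2(t)=-\frac1{\sqrt3}\sqrt{\frac{p^2-p+1}{p-1}}\,\cos\!\left(\frac\pi3+\frac13\arccos\left(\frac{U'H\sin(3t)}{\sqrt{\left(\frac{p^2-p+1}{12(p-1)}\right)^3}}\right)\right),$$ $$f_3(t)=\frac1{\sqrt3}\sqrt{\frac{p^2-p+1}{p-1}}\,\cos\!\left(\frac13\arccos\left(\frac{U'H\sin(3t)}{\sqrt{\left(\frac{p^2-p+1}{12(p-1)}\right)^3}}\right)\right).$$ Moreover, the affine metric, the affine mean curvature and the affine cubic form of $\vec r_\lambda$ are $$g=\Bigl(\mathscr P(\xi_2+\omega_1)+\frac{2(p+q-1)-3b_1}{12}\Bigr)(d\xi_2^2+dy_3^2),\qquad H=-1,$$ $$U\,d(\xi_2+iy_3)^3=e^{3it}\sqrt{\frac{c^2(p-1)}{(32p)^2}+\frac{(p-2)^2(2p-1)^2(p+1)^2}{4(12(p-1))^3}}\;d(\xi_2+iy_3)^3 .$$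
   Context: Conventions. For a locally strictly convex immersed surface $r(x,y)$ in $\mathbb{R}^3$ put $L=\det(r_x,r_y,r_{xx})$, $M=\det(r_x,r_y,r_{xy})$, $N=\det(r_x,r_y,r_{yy})$. The affine (Blaschke) metric is $g=(L\,dx^2+2M\,dx\,dy+N\,dy^2)/|LN-M^2|^{1/4}$ (taken positive definite), and the affine normal is $\frac12\Delta^g r$. The surface is a proper affine sphere with center at the origin and affine mean curvature $H$ if the affine normal equals $-Hr$; it is hyperbolic if it is convex with the center outside the surface ($H<0$). In an isothermal coordinate $z$, with $g=2e^{\psi}dz\,d\bar z$, the cubic form is $U\,dz^3+\bar U\,d\bar z^3$, and the structure equations are $$r_{zz}=\psi_z r_z-Ue^{-\psi}r_{\bar z},\qquad r_{z\bar z}=-He^{\psi}r ,$$ with compatibility conditions $\psi_{z\bar z}+He^\psi+|U|^2e^{-2\psi}=0$, $U_{\bar z}=0$. These conditions are invariant under $U\mapsto e^{3it}U$. The associated family of an affine sphere consists of the affine spheres with the same $g$ and $H$ and with $U$ multiplied by unit complex numbers; here it is parametrized so that the member with parameter $t$ has cubic form coefficient $e^{3it}U'$, $U'$ being the modulus. Here $z=\xi_2+iy_3$; the immersions are parametrized over $\xi_2<0$, $y_3\in\mathbb{R}$. The sphere $S_{p,c}$. It is the immersion $$(\xi,\mu)\mapsto e^{\phi/3}\Bigl(e^{\frac{q+1}{3q}\mu},\;e^{-\frac{p+1}{3p}\mu},\;e^{-\frac{p-q}{3(p+q)}\mu}\,w\Bigr)^T,$$ where $w=w(\xi)$, $\xi$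 is a real parameter, and $\phi=\phi(w)$, $w\in(-\alpha,1)$, solves $$e^{-\phi}\dot\phi\,(w\dot\phi+p+1)(w\dot\phi+q+1)=(p+q)we^{\phi}+c,$$ $$w\dot\phi>-\tfrac23(p+q)-\tfrac13,\qquad \ddot\phi>\frac{\dot\phi^2(p+q-1+w\dot\phi)}{2(p+q)+1+3w\dot\phi}.$$ In terms of $\tau=\ln w$, $\varphi=\phi+\tau$, $\xi=d\varphi/d\tau=1+w\dot\phi$ and $P=(\xi-1)(\xi+p)(\xi+q)$ it is given by $$e^{\varphi}=\frac{-c+\varepsilon\sqrt{c^2+4(p+q)P}}{2(p+q)},\qquad \frac{d\tau}{d\xi}=\frac{2(p+q)(3\xi+2(p+q-1))}{\sqrt{c^2+4(p+q)P}\,\bigl(-c\varepsilon+\sqrt{c^2+4(p+q)P}\bigr)} ,$$ with $\varepsilon=1$ for positive $w$ and $\varepsilon=-1$ for negative $w$. It is asymptotic to the boundary of a cone $\{(x,y,z): -\alpha x^{1/p}y^{1/q}\le z\le x^{1/p}y^{1/q},\ x\ge0,\ y\ge0\}$ with $\alpha\in(0,1]$, $\alpha\ne1$. Weierstrass data. Write $\frac{c^2}{4(p+q)}+P=\xi^3+3b_1\xi^2+3b_2\xi+b_3$ and put $g_2=\frac34(b_1^2-b_2)$, $g_3=\frac1{16}(3b_1b_2-2b_1^3-b_3)$. $\mathscr P$ is the Weierstrass $\mathscr P$-function with invariants $g_2,g_3$, $\omega_1$ is its first half-period, and $\zeta,\sigma$ are the corresponding Weierstrass zeta and sigma functions. The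 isothermal coordinate $\xi_2$ is related to $\xi$ by $\xi=4\mathscr P(\xi_2+\omega_1)-b_1$.
   Formalization: The coefficient of U' sin(3t)/f_i in the equation for m_i is corrected to 2H=-2; r_λ is rescaled by an explicit t-dependent factor so that H=-1; nothing is claimed where cos(3t)=0 (no m_i exist); sin(3t)/f_2 is read as a limit where f_2=0; poles of P are excluded and the sphere is |ξ_2|<ω_1. *)

theory Defs
  imports "HOL-Analysis.Analysis"
begin

section \<open>Affine differential geometry of parametrized surfaces\<close>

definition pdx :: "(real \<times> real \<Rightarrow> 'a::real_normed_vector) \<Rightarrow> real \<times> real \<Rightarrow> 'a" where
  "pdx f z = vector_derivative (\<lambda>s. f (s, snd z)) (at (fst z))"

definition pdy :: "(real \<times> real \<Rightarrow> 'a::real_normed_vector) \<Rightarrow> real \<times> real \<Rightarrow> 'a" where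
  "pdy f z = vector_derivative (\<lambda>s. f (fst z, s)) (at (snd z))"

primrec C_diff_on :: "nat \<Rightarrow> (real \<times> real) set \<Rightarrow> (real \<times> real \<Rightarrow> 'a::real_normed_vector) \<Rightarrow> bool" where
  "C_diff_on 0 \<Omega> f \<longleftrightarrow> continuous_on \<Omega> f"
| "C_diff_on (Suc n) \<Omega> f \<longleftrightarrow> f differentiable_on \<Omega> \<and> C_diff_on n \<Omega> (pdx f) \<and> C_diff_on n \<Omega> (pdy f)"

definition smooth_on :: "(real \<times> real) set \<Rightarrow> (real \<times> real \<Rightarrow> 'a::real_normed_vector) \<Rightarrow> bool" where
  "smooth_on \<Omega> f \<longleftrightarrow> (\<forall>n. C_diff_on n \<Omega> f)"

definition immersion_on :: "(real \<times> real) set \<Rightarrow> (real \<times> real \<Rightarrow> real^3) \<Rightarrow> bool" where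
  "immersion_on \<Omega> r \<longleftrightarrow> smooth_on \<Omega> r \<and>
     (\<forall>z\<in>\<Omega>. \<forall>a b. a *\<^sub>R pdx r z + b *\<^sub>R pdy r z = 0 \<longrightarrow> a = 0 \<and> b = 0)"

definition det3 :: "real^3 \<Rightarrow> real^3 \<Rightarrow> real^3 \<Rightarrow> real" where
  "det3 u v w = det (vector [u, v, w] :: real^3^3)"

definition coeff_L :: "(real \<times> real \<Rightarrow> real^3) \<Rightarrow> real \<times> real \<Rightarrow> real" where
  "coeff_L r z = det3 (pdx r z) (pdy r z) (pdx (pdx r) z)"

definition coeff_M :: "(real \<times> real \<Rightarrow> real^3) \<Rightarrow> real \<times> real \<Rightarrow> real" where
  "coeff_M r z = det3 (pdx r z) (pdy r z) (pdy (pdx r) z)"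

definition coeff_N :: "(real \<times> real \<Rightarrow> real^3) \<Rightarrow> real \<times> real \<Rightarrow> real" where
  "coeff_N r z = det3 (pdx r z) (pdy r z) (pdy (pdy r) z)"

definition loc_strictly_convex_on :: "(real \<times> real) set \<Rightarrow> (real \<times> real \<Rightarrow> real^3) \<Rightarrow> bool" where
  "loc_strictly_convex_on \<Omega> r \<longleftrightarrow> immersion_on \<Omega> r \<and>
     (\<forall>z\<in>\<Omega>. coeff_L r z * coeff_N r z - (coeff_M r z)\<^sup>2 > 0)"

text \<open>
  Metrics \<open>E dx\<^sup>2 + 2 F dx dy + G dy\<^sup>2\<close> are given by the triple of their coefficients.
  The factor \<open>sgn L\<close> makes the affine metric positive definite irrespective of the
  orientation of the coordinates.
\<close>
definition affine_metric :: "(real \<times> real \<Rightarrow> real^3) \<Rightarrow> real \<times> real \<Rightarrow> real \<times> real \<times> real" where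
  "affine_metric r z =
     (sgn (coeff_L r z) / root 4 \<bar>coeff_L r z * coeff_N r z - (coeff_M r z)\<^sup>2\<bar>)
       *\<^sub>R (coeff_L r z, coeff_M r z, coeff_N r z)"

definition laplace_beltrami ::
  "(real \<times> real \<Rightarrow> real \<times> real \<times> real) \<Rightarrow> (real \<times> real \<Rightarrow> 'a::real_normed_vector)
     \<Rightarrow> real \<times> real \<Rightarrow> 'a" where
  "laplace_beltrami g f =
     (let E = (\<lambda>z. fst (g z)); F = (\<lambda>z. fst (snd (g z))); G = (\<lambda>z. snd (snd (g z)));
          W = (\<lambda>z. sqrt (E z * G z - (F z)\<^sup>2))
      in (\<lambda>z. (1 / W z) *\<^sub>R
            (pdx (\<lambda>u. (1 / W u) *\<^sub>R (G u *\<^sub>R pdx f u - F u *\<^sub>R pdy f u)) z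
           + pdy (\<lambda>u. (1 / W u) *\<^sub>R (E u *\<^sub>R pdy f u - F u *\<^sub>R pdx f u)) z)))"

definition affine_normal :: "(real \<times> real \<Rightarrow> real^3) \<Rightarrow> real \<times> real \<Rightarrow> real^3" where
  "affine_normal r z = (1 / 2) *\<^sub>R laplace_beltrami (affine_metric r) r z"

definition affine_sphere_on :: "(real \<times> real) set \<Rightarrow> (real \<times> real \<Rightarrow> real^3) \<Rightarrow> real \<Rightarrow> bool" where
  "affine_sphere_on \<Omega> r H \<longleftrightarrow> open \<Omega> \<and> loc_strictly_convex_on \<Omega> r \<and>
     (\<forall>z\<in>\<Omega>. affine_normal r z = (- H) *\<^sub>R r z)"

definition dz :: "(real \<times> real \<Rightarrow> complex) \<Rightarrow> real \<times> real \<Rightarrow> complex" where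
  "dz f z = (pdx f z - \<i> * pdy f z) / 2"

definition dzbar :: "(real \<times> real \<Rightarrow> complex) \<Rightarrow> real \<times> real \<Rightarrow> complex" where
  "dzbar f z = (pdx f z + \<i> * pdy f z) / 2"

text \<open>
  \<open>G\<close> is the conformal factor of the affine metric \<open>G (dx\<^sup>2 + dy\<^sup>2)\<close>, so that
  \<open>G = 2 e\<^sup>\<psi>\<close>.  The coefficient \<open>U\<close> of the affine cubic form is determined by the
  first structure equation.
\<close>
definition structure_equations ::
  "(real \<times> real) set \<Rightarrow> (real \<times> real \<Rightarrow> real^3) \<Rightarrow> (real \<times> real \<Rightarrow> real) \<Rightarrow> real
     \<Rightarrow> (real \<times> real \<Rightarrow> complex) \<Rightarrow> bool" where
  "structure_equations \<Omega> r G H U \<longleftrightarrow>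
     (let \<psi> = (\<lambda>z. complex_of_real (ln (G z / 2))); R = (\<lambda>i z. complex_of_real (r z $ i))
      in \<forall>z\<in>\<Omega>. \<forall>i.
           dz (dz (R i)) z = dz \<psi> z * dz (R i) z - U z * exp (- \<psi> z) * dzbar (R i) z \<and>
           dz (dzbar (R i)) z = - of_real H * exp (\<psi> z) * R i z)"

definition affine_sphere_data ::
  "(real \<times> real) set \<Rightarrow> (real \<times> real \<Rightarrow> real^3) \<Rightarrow> (real \<times> real \<Rightarrow> real) \<Rightarrow> real
     \<Rightarrow> (real \<times> real \<Rightarrow> complex) \<Rightarrow> bool" where
  "affine_sphere_data \<Omega> r G H U \<longleftrightarrow>
     affine_sphere_on \<Omega> r H \<and>
     (\<forall>z\<in>\<Omega>. affine_metric r z = (G z, 0, G z)) \<and>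
     structure_equations \<Omega> r G H U"

text \<open>
  The member with parameter \<open>t\<close> of the associated family of \<open>r0\<close>: same affine metric and
  affine mean curvature, cubic form multiplied by the unit number \<open>\<theta>\<close> for which the new
  coefficient is \<open>e\<^sup>3\<^sup>i\<^sup>t \<bar>U\<bar>\<close>.
\<close>
definition associated_member ::
  "(real \<times> real) set \<Rightarrow> (real \<times> real \<Rightarrow> real^3) \<Rightarrow> real \<Rightarrow> (real \<times> real \<Rightarrow> real^3) \<Rightarrow> bool" where
  "associated_member \<Omega> r0 t r \<longleftrightarrow>
     (\<exists>G H U \<theta>. affine_sphere_data \<Omega> r0 G H U \<and> norm \<theta> = 1 \<and>
        (\<forall>z\<in>\<Omega>. \<theta> * U z = exp (3 * \<i> * of_real t) * of_real (norm (U z))) \<and>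
        affine_sphere_data \<Omega> r G H (\<lambda>z. \<theta> * U z))"

definition unimodular_equivalent ::
  "(real \<times> real) set \<Rightarrow> (real \<times> real \<Rightarrow> real^3) \<Rightarrow> (real \<times> real \<Rightarrow> real^3) \<Rightarrow> bool" where
  "unimodular_equivalent \<Omega> r r' \<longleftrightarrow>
     (\<exists>A :: real^3^3. \<bar>det A\<bar> = 1 \<and> (\<forall>z\<in>\<Omega>. r' z = A *v r z))"


section \<open>Hildebrand's affine spheres\<close>

definition hildebrand_cone :: "real \<Rightarrow> real \<Rightarrow> real \<Rightarrow> (real^3) set" where
  "hildebrand_cone p q \<alpha> =
     {v. v $ 1 \<ge> 0 \<and> v $ 2 \<ge> 0 \<and>
         - \<alpha> * (v $ 1) powr (1 / p) * (v $ 2) powr (1 / q) \<le> v $ 3 \<and>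
         v $ 3 \<le> (v $ 1) powr (1 / p) * (v $ 2) powr (1 / q)}"

definition asymptotic_to_boundary :: "(real^3) set \<Rightarrow> (real^3) set \<Rightarrow> bool" where
  "asymptotic_to_boundary S K \<longleftrightarrow>
     closed S \<and> S \<subseteq> interior K \<and>
     ((\<lambda>v. infdist v (frontier K)) \<longlongrightarrow> 0) (inf at_infinity (principal S))"

definition hildebrand_sphere :: "real \<Rightarrow> real \<Rightarrow> (real \<Rightarrow> real) \<Rightarrow> real \<times> real \<Rightarrow> real^3" where
  "hildebrand_sphere p q \<phi> = (\<lambda>(w, \<mu>). exp (\<phi> w / 3) *\<^sub>R
     vector [exp ((q + 1) / (3 * q) * \<mu>),
             exp (- (p + 1) / (3 * p) * \<mu>),
             exp (- (p - q) / (3 * (p + q)) * \<mu>) * w])"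

text \<open>
  The profile \<open>\<phi>\<close> is taken as a function of \<open>w\<close>, and the surface is parametrized by
  \<open>(w, \<mu>)\<close>.  The differential equation alone leaves the rescaling
  \<open>\<phi>(w) \<mapsto> \<phi>(w/k) - ln k\<close> and restrictions to subintervals free; the asymptotics of the
  surface fix both, and fix \<open>\<alpha>\<close> in terms of \<open>p\<close> and \<open>c\<close>.
\<close>
definition hildebrand_profile :: "real \<Rightarrow> real \<Rightarrow> real \<Rightarrow> real \<Rightarrow> (real \<Rightarrow> real) \<Rightarrow> bool" where
  "hildebrand_profile p q c \<alpha> \<phi> \<longleftrightarrow>
     \<phi> differentiable_on {-\<alpha><..<1} \<and> deriv \<phi> differentiable_on {-\<alpha><..<1} \<and>
     (\<forall>w\<in>{-\<alpha><..<1}.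
        exp (- \<phi> w) * deriv \<phi> w * (w * deriv \<phi> w + p + 1) * (w * deriv \<phi> w + q + 1)
          = (p + q) * w * exp (\<phi> w) + c \<and>
        w * deriv \<phi> w > - (2 / 3) * (p + q) - 1 / 3 \<and>
        deriv (deriv \<phi>) w
          > (deriv \<phi> w)\<^sup>2 * (p + q - 1 + w * deriv \<phi> w)
              / (2 * (p + q) + 1 + 3 * w * deriv \<phi> w)) \<and>
     asymptotic_to_boundary
       (hildebrand_sphere p q \<phi> ` ({-\<alpha><..<1} \<times> UNIV)) (hildebrand_cone p q \<alpha>)"


section \<open>Weierstrass functions of the lattice with half-periods \<open>\<omega>\<^sub>1, \<omega>\<^sub>3\<close>\<close>

definition period_lattice :: "real \<Rightarrow> complex \<Rightarrow> complex set" where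
  "period_lattice \<omega>1 \<omega>3 =
     range (\<lambda>(m :: int, n :: int). of_int m * (2 * of_real \<omega>1) + of_int n * (2 * \<omega>3))"

definition wp :: "complex set \<Rightarrow> complex \<Rightarrow> complex" where
  "wp \<Lambda> z = 1 / z\<^sup>2 + (\<Sum>\<^sub>\<infinity>\<omega>\<in>\<Lambda> - {0}. 1 / (z - \<omega>)\<^sup>2 - 1 / \<omega>\<^sup>2)"

definition wzeta :: "complex set \<Rightarrow> complex \<Rightarrow> complex" where
  "wzeta \<Lambda> z = 1 / z + (\<Sum>\<^sub>\<infinity>\<omega>\<in>\<Lambda> - {0}. 1 / (z - \<omega>) + 1 / \<omega> + z / \<omega>\<^sup>2)"

definition wsigma :: "complex set \<Rightarrow> complex \<Rightarrow> complex" where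
  "wsigma \<Lambda> z = z * Lim (finite_subsets_at_top (\<Lambda> - {0}))
     (\<lambda>X. \<Prod>\<omega>\<in>X. (1 - z / \<omega>) * exp (z / \<omega> + z\<^sup>2 / (2 * \<omega>\<^sup>2)))"

definition invariant_g2 :: "complex set \<Rightarrow> complex" where
  "invariant_g2 \<Lambda> = 60 * (\<Sum>\<^sub>\<infinity>\<omega>\<in>\<Lambda> - {0}. 1 / \<omega> ^ 4)"

definition invariant_g3 :: "complex set \<Rightarrow> complex" where
  "invariant_g3 \<Lambda> = 140 * (\<Sum>\<^sub>\<infinity>\<omega>\<in>\<Lambda> - {0}. 1 / \<omega> ^ 6)"


section \<open>The associated family\<close>

definition cubic_modulus :: "real \<Rightarrow> real \<Rightarrow> real" where
  "cubic_modulus p c =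
     sqrt (c\<^sup>2 * (p - 1) / (32 * p)\<^sup>2
           + (p - 2)\<^sup>2 * (2 * p - 1)\<^sup>2 * (p + 1)\<^sup>2 / (4 * (12 * (p - 1)) ^ 3))"

definition freq :: "real \<Rightarrow> real \<Rightarrow> real \<Rightarrow> real \<Rightarrow> real^3" where
  "freq p c H t =
     (let K = sqrt ((p\<^sup>2 - p + 1) / (p - 1)) / sqrt 3;
          A = arccos (cubic_modulus p c * H * sin (3 * t)
                / sqrt (((p\<^sup>2 - p + 1) / (12 * (p - 1))) ^ 3))
      in vector [- K * sin (pi / 6 + A / 3), - K * cos (pi / 3 + A / 3), K * cos (A / 3)])"

text \<open>
  The second frequency vanishes exactly when \<open>sin (3t) = 0\<close>; there the quotient
  \<open>sin (3t) / f\<^sub>2(t)\<close> has a removable singularity and is read as its limit.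
\<close>
definition sin_over_freq :: "real \<Rightarrow> real \<Rightarrow> real \<Rightarrow> 3 \<Rightarrow> real \<Rightarrow> real" where
  "sin_over_freq p c H i t =
     (if freq p c H t $ i = 0 then Lim (at t) (\<lambda>u. sin (3 * u) / freq p c H u $ i)
      else sin (3 * t) / freq p c H t $ i)"

text \<open>
  The coefficient \<open>2H\<close>: for \<open>H = -1\<close> a component \<open>h(x) e\<^sup>f\<^sup>y\<close> satisfies the structure
  equations only if \<open>h'/h = f (P' + 4 Re U) / (2 (f (P + b\<^sub>1/4) + 2 H Im U))\<close> with
  \<open>P\<close> evaluated at \<open>x + \<omega>\<^sub>1\<close>, whence \<open>P(m) = - b\<^sub>1/4 - 2 H Im U / f\<close>.  The coefficient
  \<open>- sqrt (-2c(p-1)) / (3\<^sup>3\<^sup>/\<^sup>4 p)\<close> found in print is the value of \<open>2H\<close> for Hildebrand's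
  surface written with all three constant factors equal to 1; its modulus is less than 1,
  so it is not compatible with \<open>H = -1\<close>.  Since \<open>P'(m)\<^sup>2 = (4 U' cos (3t))\<^sup>2\<close>, there is no
  solution when \<open>cos (3t) = 0\<close>.
\<close>
definition spectral_point ::
  "complex set \<Rightarrow> real \<Rightarrow> real \<Rightarrow> real \<Rightarrow> real \<Rightarrow> real \<Rightarrow> 3 \<Rightarrow> complex \<Rightarrow> bool" where
  "spectral_point \<Lambda> b1 p c H t i m \<longleftrightarrow>
     m \<notin> \<Lambda> \<and>
     wp \<Lambda> m + of_real (b1 / 4)
       + of_real (2 * H * cubic_modulus p c * sin_over_freq p c H i t) = 0 \<and>
     deriv (wp \<Lambda>) m \<in> \<real> \<and> Re (deriv (wp \<Lambda>) m) < 0"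

definition r_lambda ::
  "complex set \<Rightarrow> real \<Rightarrow> real \<Rightarrow> real \<Rightarrow> real \<Rightarrow> real \<Rightarrow> complex^3 \<Rightarrow> real \<times> real \<Rightarrow> complex^3" where
  "r_lambda \<Lambda> \<omega>1 p c H t m = (\<lambda>(x, y).
     let s = complex_of_real (- sgn (cos (3 * t)));
         w1 = complex_of_real \<omega>1;
         h = (\<lambda>i. wsigma \<Lambda> (of_real x + w1 - s * m $ i) * wsigma \<Lambda> w1
                    / (wsigma \<Lambda> (of_real x + w1) * wsigma \<Lambda> (w1 - s * m $ i))
                  * exp (s * wzeta \<Lambda> (m $ i) * of_real x + of_real (freq p c H t $ i * y)))
     in vector [of_real (1 / (3 * p)) * h 1,
                of_real (1 / (3 * p)) * h 2,
                of_real (sqrt 3 * (p - 1) * c / 2) * h 3])"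

text \<open>
  With the constant factors of \<open>r_lambda\<close>, the affine mean curvature is
  \<open>- (homothety p c t) powr (3/2)\<close>, which is \<open>-1\<close> at the parameters of Hildebrand's
  surface itself but not for all \<open>t\<close>.  This factor rescales each member to \<open>H = -1\<close>.
\<close>
definition homothety :: "real \<Rightarrow> real \<Rightarrow> real \<Rightarrow> real" where
  "homothety p c t = root 3
     (2 * p\<^sup>2 * cubic_modulus p c * \<bar>cos (3 * t)\<bar>
       / ((p - 1) * \<bar>c\<bar>
           * sqrt (((p\<^sup>2 - p + 1) / (12 * (p - 1))) ^ 3 - (cubic_modulus p c * sin (3 * t))\<^sup>2)))"

definition assoc_immersion ::
  "complex set \<Rightarrow> real \<Rightarrow> real \<Rightarrow> real \<Rightarrow> real \<Rightarrow> real \<Rightarrow> complex^3 \<Rightarrow> real \<times> real \<Rightarrow> real^3" where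
  "assoc_immersion \<Lambda> \<omega>1 p c H t m z =
     homothety p c t *\<^sub>R (\<chi> i. Re (r_lambda \<Lambda> \<omega>1 p c H t m z $ i))"

end

theory Submission
  imports Defs "HOL-Complex_Analysis.Conformal_Mappings" "HOL-Analysis.Cross3"
begin

text \<open>
  On the real axis write \<open>G = P(x + \<omega>\<^sub>1) + b\<^sub>1/4\<close> for the conformal factor.  Substituting
  \<open>r = h(x) exp (f y)\<close> in the structure equations with constant \<open>U = U\<^sub>1 + i U\<^sub>2\<close> forces
  \<open>f\<^sup>3 - 3 b f + 2 U\<^sub>2 = 0\<close> and a first-order equation for \<open>h\<close>, whose solution is the quotient of sigma
  functions with \<open>P(m) + b = 3 b - f\<^sup>2\<close> and \<open>P'(m) = \<plusminus>4 U\<^sub>1\<close>.  For the three roots \<open>f\<close> the products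
  \<open>h exp (f y)\<close> are the coordinates of an affine sphere as soon as the constant factors give
  \<open>det (r\<^sub>x, r\<^sub>y, r)\<close> the value \<open>\<plusminus>G\<close>; a Wronskian identity shows that this determinant is a constant multiple of
  \<open>G\<close>.  All affine spheres with the same data are unimodularly equivalent, because the structure
  equations form a total differential system for the frame \<open>(r\<^sub>x, r\<^sub>y, r)\<close>.  Hildebrand's surface has this shape
  for one value of \<open>t\<close>: its profile is recovered from the two solutions \<open>h\<close> that are positive on the
  strip, and the asymptotics enter only to show that the profile fills the whole strip.
\<close>

section \<open>Lattice sums\<close>

text \<open>The recurrent obstacle is division. The first-order equation for h carries the factor G
  - (3b - f^2), the Wronskian identity the factor G' - 4 U1, and both may vanish inside the domain.
  Therefore the identities are stated in multiplied-out form and proved for complex x, on a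
  translate of the complement of the lattice. This complement is connected because the lattice is
  countable, so a factor cancels by the identity theorem as soon as it is nonzero at one point. For
  the modes that point is x = 0: there G' = 0, and the assumption that U1 is nonzero keeps both
  factors from vanishing. The real axis matters for signs. There G stays above 2b, so a mode with
  f^2 > b has no real zero. For Hildebrand's parameters this covers two of the three modes, and only
  their logarithms enter the coordinate \<mu>; the third mode changes sign together with w.\<close>

locale half_periods =
  fixes \<omega>1 :: real and \<omega>3 :: complex
  assumes \<omega>1_pos: "0 < \<omega>1" and \<omega>3_pos: "0 < Im \<omega>3"
begin

abbreviation lat :: "complex set" ("\<Lambda>") where "\<Lambda> \<equiv> period_lattice \<omega>1 \<omega>3"

definition lpt :: "int \<times> int \<Rightarrow> complex" where
  "lpt mn = of_int (fst mn) * (2 * of_real \<omega>1) + of_int (snd mn) * (2 * \<omega>3)"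

lemma lattice_eq: "\<Lambda> = range lpt"
  unfolding period_lattice_def lpt_def by (simp add: case_prod_unfold)

lemma lpt_diff: "lpt a - lpt b = lpt (a - b)"
  by (simp add: lpt_def algebra_simps)

lemma lattice_0 [simp]: "0 \<in> \<Lambda>"
  unfolding lattice_eq by (rule range_eqI[of _ _ "(0, 0)"]) (simp add: lpt_def)

lemma lattice_diff: "a \<in> \<Lambda> \<Longrightarrow> b \<in> \<Lambda> \<Longrightarrow> a - b \<in> \<Lambda>"
  unfolding lattice_eq by (auto simp: lpt_diff)

lemma lattice_uminus: "a \<in> \<Lambda> \<Longrightarrow> - a \<in> \<Lambda>"
  using lattice_diff[of 0 a] by simp

lemma lattice_uminus_iff [simp]: "- a \<in> \<Lambda> \<longleftrightarrow> a \<in> \<Lambda>"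
  using lattice_uminus[of a] lattice_uminus[of "-a"] by auto

lemma lattice_add: "a \<in> \<Lambda> \<Longrightarrow> b \<in> \<Lambda> \<Longrightarrow> a + b \<in> \<Lambda>"
  using lattice_diff[of a "-b"] by simp

lemma lattice_add_iff: "w \<in> \<Lambda> \<Longrightarrow> z + w \<in> \<Lambda> \<longleftrightarrow> z \<in> \<Lambda>"
  using lattice_add[of z w] lattice_diff[of "z + w" w] by auto

lemma lattice_2\<omega>1 [simp]: "2 * of_real \<omega>1 \<in> \<Lambda>"
  unfolding lattice_eq by (rule range_eqI[of _ _ "(1, 0)"]) (simp add: lpt_def)

text \<open>Since Im \<omega>3 > 0, the imaginary part forces n = 0. So the real poles are the even
  multiples of \<omega>1, which locates the strip on which the surfaces live.\<close>

lemma lattice_real_iff: "of_real x \<in> \<Lambda> \<longleftrightarrow> (\<exists>m::int. x = of_int m * (2 * \<omega>1))"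
proof
  assume "of_real x \<in> \<Lambda>"
  then obtain m n where e: "of_real x = of_int m * (2 * of_real \<omega>1) + of_int n * (2 * \<omega>3)"
    unfolding lattice_eq lpt_def by auto
  have "Im (of_real x) = Im (of_int m * (2 * of_real \<omega>1) + of_int n * (2 * \<omega>3))" by (simp only: e)
  then have "n = 0" using \<omega>3_pos by simp
  with e have "Re (of_real x) = Re (of_int m * (2 * of_real \<omega>1))" by simp
  then have "x = of_int m * (2 * \<omega>1)" by simp
  then show "\<exists>m::int. x = of_int m * (2 * \<omega>1)" ..
next
  assume "\<exists>m::int. x = of_int m * (2 * \<omega>1)"
  then obtain m :: int where "x = of_int m * (2 * \<omega>1)" ..
  then show "of_real x \<in> \<Lambda>"
    unfolding lattice_eq by (intro range_eqI[of _ _ "(m, 0)"]) (simp add: lpt_def)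
qed

text \<open>The imaginary part of a lattice point bounds n, and the triangle inequality then bounds
  m. This quantitative independence of the two periods is the source of injectivity, local
  finiteness and convergence.\<close>

lemma lpt_lower_bound:
  obtains C where "C > 0" "\<And>m n. \<bar>of_int m\<bar> + \<bar>of_int n\<bar> \<le> C * norm (lpt (m, n))"
proof -
  define A where "A = 1 / (2 * Im \<omega>3)"
  define C where "C = (1 + 2 * A * norm \<omega>3) / (2 * \<omega>1) + A"
  have A: "A > 0" using \<omega>3_pos by (simp add: A_def)
  have "C > 0" using A \<omega>1_pos by (simp add: C_def add_pos_pos add_pos_nonneg divide_pos_pos)
  moreover have "\<bar>of_int m\<bar> + \<bar>of_int n\<bar> \<le> C * norm (lpt (m, n))" for m n
  proof -
    let ?z = "lpt (m, n)"
    have "\<bar>Im ?z\<bar> = \<bar>of_int n\<bar> * (2 * Im \<omega>3)"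
      using \<omega>3_pos by (simp add: lpt_def abs_mult)
    then have n: "\<bar>of_int n\<bar> \<le> A * norm ?z"
      using abs_Im_le_cmod[of ?z] \<omega>3_pos by (simp add: A_def pos_le_divide_eq)
    have "of_int m * (2 * of_real \<omega>1) = ?z - of_int n * (2 * \<omega>3)"
      by (simp add: lpt_def)
    then have "norm (of_int m * (2 * of_real \<omega>1) :: complex) \<le> norm ?z + norm (of_int n * (2 * \<omega>3))"
      by (metis norm_triangle_ineq4)
    then have "\<bar>of_int m\<bar> * (2 * \<omega>1) \<le> norm ?z + \<bar>of_int n\<bar> * (2 * norm \<omega>3)"
      using \<omega>1_pos by (simp add: norm_mult)
    also have "\<dots> \<le> norm ?z + A * norm ?z * (2 * norm \<omega>3)"
      by (intro add_mono order_refl mult_right_mono n) auto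
    also have "\<dots> = (1 + 2 * A * norm \<omega>3) * norm ?z" by (simp add: algebra_simps)
    finally have "\<bar>of_int m\<bar> \<le> (1 + 2 * A * norm \<omega>3) * norm ?z / (2 * \<omega>1)"
      using \<omega>1_pos by (subst pos_le_divide_eq) auto
    then have "\<bar>of_int m\<bar> \<le> (1 + 2 * A * norm \<omega>3) / (2 * \<omega>1) * norm ?z" by simp
    with n show ?thesis by (simp add: C_def ring_distribs)
  qed
  ultimately show ?thesis using that by blast
qed

lemma inj_lpt: "inj lpt"
proof (rule injI)
  fix a b assume "lpt a = lpt b"
  then have "lpt (a - b) = 0" unfolding lpt_diff[symmetric] by simp
  obtain C where C: "C > 0" "\<And>m n. \<bar>of_int m\<bar> + \<bar>of_int n\<bar> \<le> C * norm (lpt (m, n))"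
    using lpt_lower_bound by blast
  from C(2)[of "fst (a - b)" "snd (a - b)", unfolded prod.collapse \<open>lpt (a - b) = 0\<close>]
  have "\<bar>real_of_int (fst (a - b))\<bar> + \<bar>real_of_int (snd (a - b))\<bar> \<le> 0" by simp
  then have "fst (a - b) = 0 \<and> snd (a - b) = 0" by linarith
  then show "a = b" by (simp add: prod_eq_iff)
qed

lemma finite_lattice_cball: "finite {w \<in> \<Lambda>. norm w \<le> R}"
proof -
  obtain C where C: "C > 0" "\<And>m n. \<bar>of_int m\<bar> + \<bar>of_int n\<bar> \<le> C * norm (lpt (m, n))"
    using lpt_lower_bound by blast
  define N where "N = \<lceil>C * R\<rceil>"
  have "{w \<in> \<Lambda>. norm w \<le> R} \<subseteq> lpt ` ({-N..N} \<times> {-N..N})"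
  proof
    fix w assume "w \<in> {w \<in> \<Lambda>. norm w \<le> R}"
    then obtain m n where w: "w = lpt (m, n)" "norm w \<le> R" unfolding lattice_eq by auto
    have "\<bar>of_int m\<bar> + \<bar>of_int n\<bar> \<le> C * R"
      using C(2)[of m n] mult_left_mono[OF w(2), of C] C(1) unfolding w(1) by linarith
    then have "\<bar>of_int m\<bar> \<le> C * R" "\<bar>of_int n\<bar> \<le> C * R" by auto
    then have "\<bar>m\<bar> \<le> N" "\<bar>n\<bar> \<le> N" unfolding N_def by linarith+
    then have "(m, n) \<in> {-N..N} \<times> {-N..N}" by auto
    then show "w \<in> lpt ` ({-N..N} \<times> {-N..N})" using w(1) by blast
  qed
  then show ?thesis by (rule finite_subset) auto
qed

lemma countable_lattice: "countable \<Lambda>"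
  unfolding lattice_eq by simp

text \<open>The exponent is half of -3: up to a constant, the cube of a lattice point dominates (1 +
  |m|)^(3/2) (1 + |n|)^(3/2), so the double sum factors into two sums of this kind.\<close>

lemma summable_int_powr: "(\<lambda>m::int. (1 + \<bar>of_int m\<bar> :: real) powr (-3/2)) summable_on UNIV"
proof -
  let ?f = "\<lambda>m::int. (1 + \<bar>of_int m\<bar> :: real) powr (-3/2)"
  have "summable (\<lambda>n::nat. (of_nat (Suc n) :: real) powr (-3/2))"
    using summable_real_powr_iff[of "-3/2"] by (subst summable_Suc_iff) auto
  then have s: "(\<lambda>n::nat. (1 + real n) powr (-3/2)) summable_on UNIV"
    by (subst summable_on_UNIV_nonneg_real_iff) (auto simp: add.commute)
  have "?f summable_on range int"
    by (subst summable_on_reindex) (use s in \<open>auto simp: o_def\<close>)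
  moreover have "?f summable_on range (\<lambda>n. - int n)"
    by (subst summable_on_reindex) (use s in \<open>auto simp: o_def inj_def\<close>)
  ultimately have "?f summable_on (range int \<union> range (\<lambda>n. - int n))"
    by (rule summable_on_union)
  also have "range int \<union> range (\<lambda>n. - int n) = UNIV"
  proof -
    have "x \<in> range int \<union> range (\<lambda>n. - int n)" for x by (cases x rule: int_cases2) auto
    then show ?thesis by blast
  qed
  finally show ?thesis .
qed

lemma summable_lattice_cubes: "(\<lambda>w. 1 / norm w ^ 3) summable_on \<Lambda> - {0}"
proof -
  obtain C where C: "C > 0" "\<And>m n. \<bar>of_int m\<bar> + \<bar>of_int n\<bar> \<le> C * norm (lpt (m, n))"
    using lpt_lower_bound by blast
  let ?g = "\<lambda>m::int. (1 + \<bar>of_int m\<bar> :: real) powr (-3/2)"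
  have "(\<lambda>x. (\<lambda>(m, n). ?g m * ?g n) x) summable_on (UNIV \<times> UNIV)"
  proof (rule summable_on_SigmaI)
    show "((\<lambda>n. case (m, n) of (m, n) \<Rightarrow> ?g m * ?g n) has_sum ?g m * infsum ?g UNIV) UNIV" for m
      unfolding prod.case by (intro has_sum_cmult_right has_sum_infsum summable_int_powr)
    show "(\<lambda>m. ?g m * infsum ?g UNIV) summable_on UNIV"
      by (intro summable_on_cmult_left summable_int_powr)
  qed auto
  then have "(\<lambda>(m, n). ?g m * ?g n) summable_on UNIV" by simp
  then have "(\<lambda>x. (2 * C) ^ 3 * (\<lambda>(m, n). ?g m * ?g n) x) summable_on UNIV - {0}"
    by (intro summable_on_cmult_right) (rule summable_on_subset, auto)
  then have "(\<lambda>x. 1 / norm (lpt x) ^ 3) summable_on UNIV - {0}"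
  proof (rule summable_on_comparison_test)
    fix x :: "int \<times> int" assume "x \<in> UNIV - {0}"
    obtain m n where x: "x = (m, n)" by (cases x)
    define M N where "M = \<bar>real_of_int m\<bar>" and "N = \<bar>real_of_int n\<bar>"
    have nz: "m \<noteq> 0 \<or> n \<noteq> 0" using \<open>x \<in> UNIV - {0}\<close> x by (auto simp: zero_prod_def)
    have "m \<noteq> 0 \<Longrightarrow> M \<ge> 1" "n \<noteq> 0 \<Longrightarrow> N \<ge> 1" by (simp_all add: M_def N_def)
    then have MN: "M + N \<ge> 1" "M \<ge> 0" "N \<ge> 0" using nz by (auto simp: M_def N_def)
    define r where "r = norm (lpt x)"
    have r: "M + N \<le> C * r" using C(2)[of m n] by (simp add: M_def N_def r_def x)
    with MN have "C * r \<ge> 1" by linarith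
    then have "r \<noteq> 0" by auto
    then have r0: "r > 0" by (simp add: r_def)
    \<comment> \<open>M + N >= 1 gives C r >= 1, so each factor is at most 1 + C r <= 2 C r.\<close>
    have "(1 + M) * (1 + N) \<le> (2 * C * r) * (2 * C * r)"
      using MN r by (intro mult_mono) auto
    then have "((1 + M) * (1 + N)) powr (3/2) \<le> ((2 * C * r)\<^sup>2) powr (3/2)"
      using MN by (intro powr_mono2) (auto simp: power2_eq_square)
    also have "((2 * C * r)\<^sup>2) powr (3/2) = (2 * C * r) ^ 3"
    proof -
      have "((2 * C * r)\<^sup>2) powr (3/2) = ((2 * C * r) powr 2) powr (3/2)" using C r0 by simp
      also have "\<dots> = (2 * C * r) powr 3" by (simp only: powr_powr) simp
      also have "\<dots> = (2 * C * r) ^ 3" using C r0 by simp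
      finally show ?thesis .
    qed
    finally have "((1 + M) * (1 + N)) powr (3/2) \<le> (2 * C) ^ 3 * r ^ 3"
      by (simp add: power_mult_distrib)
    moreover have "((1 + M) * (1 + N)) powr (3/2) > 0" using MN by auto
    ultimately have "1 / r ^ 3 \<le> (2 * C) ^ 3 / ((1 + M) * (1 + N)) powr (3/2)"
      using r0 by (simp add: field_simps)
    also have "\<dots> = (2 * C) ^ 3 * ((1 + M) * (1 + N)) powr (-3/2)"
      by (simp add: powr_minus field_simps)
    also have "((1 + M) * (1 + N)) powr (-3/2) = (1 + M) powr (-3/2) * (1 + N) powr (-3/2)"
      using MN by (simp add: powr_mult)
    finally show "1 / norm (lpt x) ^ 3 \<le> (2 * C) ^ 3 * (\<lambda>(m, n). ?g m * ?g n) x"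
      by (simp add: r_def x M_def N_def)
  qed auto
  then have "((\<lambda>w. 1 / norm w ^ 3) \<circ> lpt) summable_on UNIV - {0}" by (simp add: o_def)
  then have "(\<lambda>w. 1 / norm w ^ 3) summable_on lpt ` (UNIV - {0})"
    by (subst summable_on_reindex) (auto intro: inj_on_subset[OF inj_lpt])
  moreover have "lpt ` (UNIV - {0}) = \<Lambda> - {0}"
  proof -
    have "lpt 0 = 0" by (simp add: lpt_def)
    then show ?thesis unfolding lattice_eq
      using image_set_diff[OF inj_lpt, of UNIV "{0}"] by simp
  qed
  ultimately show ?thesis by simp
qed

end

text \<open>Weierstrass's theorem along the filter of finite subsets. A majorant for the terms
  suffices: locally uniform convergence of the holomorphic partial sums carries the derivatives
  along, so the summability of f' is a conclusion.\<close>

lemma infsum_has_field_derivative: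
  fixes f f' :: "'i \<Rightarrow> complex \<Rightarrow> complex"
  assumes der: "\<And>i z. i \<in> I \<Longrightarrow> z \<in> ball a R \<Longrightarrow> (f i has_field_derivative f' i z) (at z)"
    and bound: "\<And>i z. i \<in> I \<Longrightarrow> z \<in> ball a R \<Longrightarrow> norm (f i z) \<le> M i"
    and M: "M summable_on I" and z: "z \<in> ball a R"
  shows "((\<lambda>z. \<Sum>\<^sub>\<infinity>i\<in>I. f i z) has_field_derivative (\<Sum>\<^sub>\<infinity>i\<in>I. f' i z)) (at z)"
    and "(\<lambda>i. f' i z) summable_on I"
proof -
  obtain r where r: "r > 0" "cball z r \<subseteq> ball a R"
    using z open_contains_cball by (metis open_ball)
  have ul: "uniform_limit (cball z r) (\<lambda>X z. \<Sum>i\<in>X. f i z) (\<lambda>z. \<Sum>\<^sub>\<infinity>i\<in>I. f i z) (finite_subsets_at_top I)"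
    using r bound M by (intro Weierstrass_m_test_general[where M = M]) auto
  have "\<forall>\<^sub>F X in finite_subsets_at_top I.
      continuous_on (cball z r) (\<lambda>z. \<Sum>i\<in>X. f i z) \<and>
      (\<forall>w\<in>ball z r. ((\<lambda>z. \<Sum>i\<in>X. f i z) has_field_derivative (\<Sum>i\<in>X. f' i w)) (at w))"
  proof (rule eventually_finite_subsets_at_top_weakI)
    fix X assume X: "finite X" "X \<subseteq> I"
    have d: "((\<lambda>z. \<Sum>i\<in>X. f i z) has_field_derivative (\<Sum>i\<in>X. f' i w)) (at w)" if "w \<in> cball z r" for w
      using X that r(2) by (intro DERIV_sum der) auto
    have "continuous_on (cball z r) (\<lambda>z. \<Sum>i\<in>X. f i z)"
      using d DERIV_isCont continuous_at_imp_continuous_on by blast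
    then show "continuous_on (cball z r) (\<lambda>z. \<Sum>i\<in>X. f i z) \<and>
      (\<forall>w\<in>ball z r. ((\<lambda>z. \<Sum>i\<in>X. f i z) has_field_derivative (\<Sum>i\<in>X. f' i w)) (at w))"
      using d by auto
  qed
  from has_complex_derivative_uniform_limit[OF this ul _ r(1)]
  obtain g' where g': "\<And>w. w \<in> ball z r \<Longrightarrow> ((\<lambda>z. \<Sum>\<^sub>\<infinity>i\<in>I. f i z) has_field_derivative g' w) (at w) \<and>
      ((\<lambda>X. \<Sum>i\<in>X. f' i w) \<longlongrightarrow> g' w) (finite_subsets_at_top I)"
    by (metis finite_subsets_at_top_neq_bot)
  have "((\<lambda>i. f' i z) has_sum g' z) I"
    unfolding has_sum_def using g'[of z] r(1) by simp
  then show "((\<lambda>z. \<Sum>\<^sub>\<infinity>i\<in>I. f i z) has_field_derivative (\<Sum>\<^sub>\<infinity>i\<in>I. f' i z)) (at z)"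
    and "(\<lambda>i. f' i z) summable_on I"
    using g'[of z] r(1) by (auto simp: has_sum_iff)
qed

section \<open>Summands of the lattice series, their derivatives and bounds\<close>

definition sigma_factor :: "complex \<Rightarrow> complex \<Rightarrow> complex" where
  "sigma_factor w z = (1 - z / w) * exp (z / w + z\<^sup>2 / (2 * w\<^sup>2))"

text \<open>A logarithm of \<open>sigma_factor\<close>. The principal branch is holomorphic for |z|
  < |w|, so it serves the lattice points far from z.\<close>

definition sigma_log :: "complex \<Rightarrow> complex \<Rightarrow> complex" where
  "sigma_log w z = Ln (1 - z / w) + z / w + z\<^sup>2 / (2 * w\<^sup>2)"

definition zeta_term :: "complex \<Rightarrow> complex \<Rightarrow> complex" where
  "zeta_term w z = 1 / (z - w) + 1 / w + z / w\<^sup>2"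

definition wp_term :: "complex \<Rightarrow> complex \<Rightarrow> complex" where
  "wp_term w z = 1 / (z - w)\<^sup>2 - 1 / w\<^sup>2"

lemma exp_sigma_log: "z \<noteq> w \<Longrightarrow> w \<noteq> 0 \<Longrightarrow> exp (sigma_log w z) = sigma_factor w z"
proof -
  assume "z \<noteq> w" "w \<noteq> 0"
  then have "exp (Ln (1 - z / w)) = 1 - z / w" by (intro exp_Ln) auto
  then show ?thesis by (simp add: sigma_log_def sigma_factor_def exp_add)
qed

text \<open>Over a common denominator the cancellation becomes visible: the term decays like |w|^-3
  although each of its summands decays more slowly.\<close>

lemma zeta_term_eq: "z \<noteq> w \<Longrightarrow> w \<noteq> 0 \<Longrightarrow> zeta_term w z = z\<^sup>2 / (w\<^sup>2 * (z - w))"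
  by (simp add: zeta_term_def divide_simps) (simp add: power2_eq_square algebra_simps)

lemma wp_term_eq: "z \<noteq> w \<Longrightarrow> w \<noteq> 0 \<Longrightarrow> wp_term w z = z * (2 * w - z) / (w\<^sup>2 * (z - w)\<^sup>2)"
  by (simp add: wp_term_def divide_simps) (simp add: power2_eq_square algebra_simps)

lemma sigma_factor_deriv:
  assumes "z \<noteq> w" "w \<noteq> 0"
  shows "(sigma_factor w has_field_derivative sigma_factor w z * zeta_term w z) (at z)"
proof -
  have 1: "(sigma_factor w has_field_derivative
      (- (1 / w) + (1 - z / w) * (1 / w + z / w\<^sup>2)) * exp (z / w + z\<^sup>2 / (2 * w\<^sup>2))) (at z)"
    unfolding sigma_factor_def
    by (rule derivative_eq_intros refl | use assms in \<open>simp add: field_simps power2_eq_square\<close>)+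
  have 2: "- (1 / w) + (1 - z / w) * (1 / w + z / w\<^sup>2) = (1 - z / w) * zeta_term w z"
    unfolding zeta_term_eq[OF assms] using assms
    by (simp add: divide_simps) (simp add: power2_eq_square algebra_simps)
  show ?thesis using 1 unfolding 2 by (simp add: sigma_factor_def mult_ac)
qed

lemma zeta_term_deriv:
  "z \<noteq> w \<Longrightarrow> w \<noteq> 0 \<Longrightarrow> (zeta_term w has_field_derivative - wp_term w z) (at z)"
  unfolding zeta_term_def wp_term_def
  by (rule derivative_eq_intros refl | simp add: power2_eq_square divide_simps)+

lemma inverse_power_deriv:
  fixes z w :: complex
  assumes "z \<noteq> w"
  shows "((\<lambda>z. 1 / (z - w) ^ k) has_field_derivative - of_nat k / (z - w) ^ Suc k) (at z)"
proof -
  have "((\<lambda>z. inverse (z - w) ^ k) has_field_derivative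
      of_nat k * (- (inverse (z - w) * inverse (z - w))) * inverse (z - w) ^ (k - Suc 0)) (at z)"
    using assms by (auto intro!: derivative_eq_intros)
  moreover have "of_nat k * (- (inverse (z - w) * inverse (z - w))) * inverse (z - w) ^ (k - Suc 0)
      = - of_nat k / (z - w) ^ Suc k"
    using assms by (cases k) (auto simp: divide_inverse power_inverse mult_ac simp del: of_nat_Suc)
  moreover have "(\<lambda>z. 1 / (z - w) ^ k) = (\<lambda>z. inverse (z - w) ^ k)"
    by (simp add: power_inverse divide_inverse)
  ultimately show ?thesis by (simp only:)
qed

lemma wp_term_deriv:
  "z \<noteq> w \<Longrightarrow> w \<noteq> 0 \<Longrightarrow> (wp_term w has_field_derivative - 2 / (z - w) ^ 3) (at z)"
  unfolding wp_term_def
  using DERIV_diff[OF inverse_power_deriv[of z w 2] DERIV_const[of "1 / w\<^sup>2"]]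
  by (simp add: numeral_eq_Suc)

lemma norm_diff_half:
  fixes z w :: complex
  assumes "z \<in> ball 0 R" "2 * R \<le> norm w"
  shows "norm w / 2 \<le> norm (z - w)" "z \<noteq> w" "w \<noteq> 0" "R > 0"
proof -
  have z: "norm z < R" using assms(1) by simp
  then show R: "R > 0" using norm_ge_zero[of z] by linarith
  have "norm w \<le> norm z + norm (z - w)" using norm_triangle_sub[of w z] by (simp add: norm_minus_commute)
  then show "norm w / 2 \<le> norm (z - w)" using z assms(2) by linarith
  show "z \<noteq> w" using z assms(2) R by auto
  show "w \<noteq> 0" using assms(2) R by auto
qed

lemma zeta_term_bound:
  assumes "z \<in> ball 0 R" "2 * R \<le> norm w"
  shows "norm (zeta_term w z) \<le> 2 * R\<^sup>2 * (1 / norm w ^ 3)"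
proof -
  note h = norm_diff_half[OF assms]
  have w: "norm w > 0" using h by simp
  have "norm (zeta_term w z) = (norm z)\<^sup>2 / ((norm w)\<^sup>2 * norm (z - w))"
    by (simp add: zeta_term_eq[OF h(2,3)] norm_divide norm_mult norm_power)
  also have "\<dots> \<le> R\<^sup>2 / ((norm w)\<^sup>2 * (norm w / 2))"
    using assms h w by (intro frac_le mult_left_mono power_mono mult_pos_pos) auto
  also have "\<dots> = 2 * R\<^sup>2 * (1 / norm w ^ 3)" by (simp add: eval_nat_numeral mult_ac)
  finally show ?thesis .
qed

lemma wp_term_bound:
  assumes "z \<in> ball 0 R" "2 * R \<le> norm w"
  shows "norm (wp_term w z) \<le> 12 * R * (1 / norm w ^ 3)"
proof -
  note h = norm_diff_half[OF assms]
  have w: "norm w > 0" using h by simp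
  have z: "norm z \<le> R" using assms by simp
  have b: "norm (2 * w - z) \<le> 3 * norm w"
    using norm_triangle_ineq4[of "2 * w" z] z assms(2) h(4) by (simp add: norm_mult)
  have "norm (wp_term w z) = norm z * norm (2 * w - z) / ((norm w)\<^sup>2 * (norm (z - w))\<^sup>2)"
    by (simp add: wp_term_eq[OF h(2,3)] norm_divide norm_mult norm_power)
  also have "\<dots> \<le> R * (3 * norm w) / ((norm w)\<^sup>2 * (norm w / 2)\<^sup>2)"
    using z b h w by (intro frac_le mult_mono mult_left_mono power_mono mult_pos_pos mult_nonneg_nonneg) auto
  also have "\<dots> = 12 * R * (1 / norm w ^ 3)" using w by (simp add: eval_nat_numeral field_simps)
  finally show ?thesis .
qed

text \<open>Each of the k extra factors is estimated only by |z - w| >= R, so the same majorant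
  |w|^-3 works for every k.\<close>

lemma inverse_power_bound:
  fixes z w :: complex
  assumes "z \<in> ball 0 R" "2 * R \<le> norm w"
  shows "norm (1 / (z - w) ^ (3 + k)) \<le> 8 / R ^ k * (1 / norm w ^ 3)"
proof -
  note h = norm_diff_half[OF assms]
  have w: "norm w > 0" using h by simp
  have "norm (1 / (z - w) ^ (3 + k)) = 1 / (norm (z - w) ^ 3 * norm (z - w) ^ k)"
    by (simp add: norm_divide norm_power power_add norm_mult)
  also have "\<dots> \<le> 1 / ((norm w / 2) ^ 3 * R ^ k)"
    using h w assms(2) by (intro frac_le mult_mono power_mono mult_pos_pos) auto
  also have "\<dots> = 8 / R ^ k * (1 / norm w ^ 3)" by (simp add: eval_nat_numeral)
  finally show ?thesis .
qed

lemma sigma_log_deriv: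
  assumes "z \<in> ball 0 R" "2 * R \<le> norm w"
  shows "(sigma_log w has_field_derivative zeta_term w z) (at z)"
proof -
  note h = norm_diff_half[OF assms]
  have "norm (z / w) < 1"
    using assms h by (simp add: norm_divide)
  then have "1 - z / w \<notin> \<real>\<^sub>\<le>\<^sub>0"
    by (metis (no_types, opaque_lifting) add_diff_cancel_right' complex_nonpos_Reals_iff diff_add_cancel dual_order.strict_trans1 linorder_not_le
        minus_complex.simps(1) one_complex.simps(1) complex_Re_le_cmod diff_gt_0_iff_gt)
  then have "(sigma_log w has_field_derivative - (1 / w) / (1 - z / w) + 1 / w + z / w\<^sup>2) (at z)"
    unfolding sigma_log_def using h(3)
    by (auto intro!: derivative_eq_intros simp: field_simps power2_eq_square)
  moreover have "- (1 / w) / (1 - z / w) = 1 / (z - w)" using h by (simp add: divide_simps)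
  ultimately show ?thesis by (simp only: zeta_term_def)
qed

text \<open>The logarithm vanishes at z = 0 and has derivative \<open>zeta_term\<close>, so the mean
  value inequality costs one more factor R.\<close>

lemma sigma_log_bound:
  assumes "z \<in> ball 0 R" "2 * R \<le> norm w"
  shows "norm (sigma_log w z) \<le> 2 * R ^ 3 * (1 / norm w ^ 3)"
proof -
  note h = norm_diff_half[OF assms]
  have "norm (sigma_log w z - sigma_log w 0) \<le> (2 * R\<^sup>2 * (1 / norm w ^ 3)) * norm (z - 0)"
  proof (rule field_differentiable_bound[of "ball 0 R"])
    show "(sigma_log w has_field_derivative zeta_term w u) (at u within ball 0 R)" if "u \<in> ball 0 R" for u
      using sigma_log_deriv[OF that assms(2)] by (rule has_field_derivative_at_within)
    show "norm (zeta_term w u) \<le> 2 * R\<^sup>2 * (1 / norm w ^ 3)" if "u \<in> ball 0 R" for u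
      by (rule zeta_term_bound[OF that assms(2)])
  qed (use assms h in auto)
  also have "\<dots> \<le> (2 * R\<^sup>2 * (1 / norm w ^ 3)) * R"
    using assms by (intro mult_left_mono) auto
  finally show ?thesis by (simp add: sigma_log_def eval_nat_numeral mult_ac)
qed

section \<open>The Weierstrass functions\<close>

lemma prod_has_logarithmic_derivative:
  fixes f :: "'i \<Rightarrow> complex \<Rightarrow> complex"
  assumes "finite A" "\<And>w. w \<in> A \<Longrightarrow> (f w has_field_derivative f w z * g w) (at z)"
  shows "((\<lambda>z. \<Prod>w\<in>A. f w z) has_field_derivative (\<Prod>w\<in>A. f w z) * (\<Sum>w\<in>A. g w)) (at z)"
  using assms
proof (induction rule: finite_induct)
  case (insert w A)
  have "((\<lambda>z. f w z * (\<Prod>w\<in>A. f w z)) has_field_derivative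
      f w z * g w * (\<Prod>w\<in>A. f w z) + (\<Prod>w\<in>A. f w z) * (\<Sum>w\<in>A. g w) * f w z) (at z)"
    using insert by (intro DERIV_mult) auto
  then show ?case using insert.hyps by (simp add: algebra_simps)
qed auto

context half_periods
begin

text \<open>On the ball of radius R only the finitely many points of \<open>head R\<close> can
  produce poles or zeros; on \<open>tail R\<close> the condition |w| >= 2R makes the bounds above
  uniform.\<close>

definition head :: "real \<Rightarrow> complex set" where "head R = {w \<in> \<Lambda>. w \<noteq> 0 \<and> norm w < 2 * R}"
definition tail :: "real \<Rightarrow> complex set" where "tail R = {w \<in> \<Lambda>. w \<noteq> 0 \<and> 2 * R \<le> norm w}"

lemma finite_head: "finite (head R)"
  by (rule finite_subset[OF _ finite_lattice_cball[of "2 * R"]]) (auto simp: head_def)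

lemma head_tail: "\<Lambda> - {0} = head R \<union> tail R" "head R \<inter> tail R = {}"
  by (auto simp: head_def tail_def)

lemma summable_tail: "(\<lambda>w. C * (1 / norm w ^ 3)) summable_on tail R"
  by (intro summable_on_cmult_right summable_on_subset[OF summable_lattice_cubes]) (auto simp: tail_def)

lemma infsum_head_tail:
  fixes f :: "complex \<Rightarrow> complex"
  assumes "f summable_on tail R"
  shows "infsum f (\<Lambda> - {0}) = (\<Sum>w\<in>head R. f w) + infsum f (tail R)"
  unfolding head_tail(1)[of R]
  using infsum_Un_disjoint[OF _ assms head_tail(2)] finite_head by simp

lemma
  assumes "z \<in> ball 0 R"
  shows sigma_tail_deriv: "((\<lambda>z. \<Sum>\<^sub>\<infinity>w\<in>tail R. sigma_log w z) has_field_derivative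
      (\<Sum>\<^sub>\<infinity>w\<in>tail R. zeta_term w z)) (at z)"
    and zeta_tail_summable: "(\<lambda>w. zeta_term w z) summable_on tail R"
  using infsum_has_field_derivative[of "tail R" 0 R sigma_log zeta_term "\<lambda>w. 2 * R ^ 3 * (1 / norm w ^ 3)" z]
    sigma_log_deriv sigma_log_bound summable_tail assms by (auto simp: tail_def)

lemma
  assumes "z \<in> ball 0 R"
  shows zeta_tail_deriv: "((\<lambda>z. \<Sum>\<^sub>\<infinity>w\<in>tail R. zeta_term w z) has_field_derivative
      - (\<Sum>\<^sub>\<infinity>w\<in>tail R. wp_term w z)) (at z)"
    and wp_tail_summable: "(\<lambda>w. wp_term w z) summable_on tail R"
proof -
  have "(zeta_term w has_field_derivative - wp_term w z) (at z)" if "w \<in> tail R" "z \<in> ball 0 R" for w z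
    using that norm_diff_half[of z R w] by (intro zeta_term_deriv) (auto simp: tail_def)
  from infsum_has_field_derivative[OF this zeta_term_bound summable_tail assms]
  show "((\<lambda>z. \<Sum>\<^sub>\<infinity>w\<in>tail R. zeta_term w z) has_field_derivative
      - (\<Sum>\<^sub>\<infinity>w\<in>tail R. wp_term w z)) (at z)" "(\<lambda>w. wp_term w z) summable_on tail R"
    by (auto simp: tail_def infsum_uminus summable_on_uminus)
qed

lemma
  assumes "z \<in> ball 0 R"
  shows wp_tail_deriv: "((\<lambda>z. \<Sum>\<^sub>\<infinity>w\<in>tail R. wp_term w z) has_field_derivative
      - 2 * (\<Sum>\<^sub>\<infinity>w\<in>tail R. 1 / (z - w) ^ 3)) (at z)"
    and cube_tail_summable: "(\<lambda>w. 1 / (z - w) ^ 3) summable_on tail R"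
proof -
  have d: "(wp_term w has_field_derivative (- 2) * (1 / (z - w) ^ 3)) (at z)" if "w \<in> tail R" "z \<in> ball 0 R" for w z
    using that norm_diff_half[of z R w] wp_term_deriv[of z w] by (auto simp: tail_def)
  have b: "norm (wp_term w z) \<le> 12 * R * (1 / norm w ^ 3)" if "w \<in> tail R" "z \<in> ball 0 R" for w z
    using that wp_term_bound[of z R w] by (auto simp: tail_def)
  note * = infsum_has_field_derivative[of "tail R" 0 R, OF d b summable_tail assms, simplified]
  have "(\<lambda>w. (- 2) * (1 / (z - w) ^ 3)) summable_on tail R" using *(2) by simp
  then show s: "(\<lambda>w. 1 / (z - w) ^ 3) summable_on tail R"
    by (subst (asm) summable_on_cmult_right') auto
  have "(\<Sum>\<^sub>\<infinity>w\<in>tail R. (- 2) * (1 / (z - w) ^ 3)) = - 2 * (\<Sum>\<^sub>\<infinity>w\<in>tail R. 1 / (z - w) ^ 3)"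
    by (rule infsum_cmult_right[OF s])
  with *(1) show "((\<lambda>z. \<Sum>\<^sub>\<infinity>w\<in>tail R. wp_term w z) has_field_derivative
      - 2 * (\<Sum>\<^sub>\<infinity>w\<in>tail R. 1 / (z - w) ^ 3)) (at z)"
    by simp
qed

lemma power_tail_deriv:
  assumes "z \<in> ball 0 R"
  shows "((\<lambda>z. \<Sum>\<^sub>\<infinity>w\<in>tail R. 1 / (z - w) ^ (3 + k)) has_field_derivative
      - of_nat (3 + k) * (\<Sum>\<^sub>\<infinity>w\<in>tail R. 1 / (z - w) ^ (3 + Suc k))) (at z)"
    and "(\<lambda>w. 1 / (z - w) ^ (3 + k)) summable_on tail R"
proof -
  have d: "((\<lambda>z. 1 / (z - w) ^ (3 + k)) has_field_derivative (- of_nat (3 + k)) * (1 / (z - w) ^ (3 + Suc k))) (at z)"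
    if "w \<in> tail R" "z \<in> ball 0 R" for w z
    using that norm_diff_half[of z R w] inverse_power_deriv[of z w "3 + k"] by (auto simp: tail_def)
  have b: "norm (1 / (z - w) ^ (3 + k)) \<le> 8 / R ^ k * (1 / norm w ^ 3)" if "w \<in> tail R" "z \<in> ball 0 R" for w z k
    using that inverse_power_bound[of z R w k] by (auto simp: tail_def)
  show "(\<lambda>w. 1 / (z - w) ^ (3 + k)) summable_on tail R" for k
    by (rule abs_summable_summable, rule summable_on_comparison_test[OF summable_tail, OF b[OF _ assms]]) auto
  then have "(\<Sum>\<^sub>\<infinity>w\<in>tail R. (- of_nat (3 + k)) * (1 / (z - w) ^ (3 + Suc k))) =
      - of_nat (3 + k) * (\<Sum>\<^sub>\<infinity>w\<in>tail R. 1 / (z - w) ^ (3 + Suc k))"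
    by (intro infsum_cmult_right)
  with infsum_has_field_derivative(1)[of "tail R" 0 R, OF d b summable_tail assms]
  show "((\<lambda>z. \<Sum>\<^sub>\<infinity>w\<in>tail R. 1 / (z - w) ^ (3 + k)) has_field_derivative
      - of_nat (3 + k) * (\<Sum>\<^sub>\<infinity>w\<in>tail R. 1 / (z - w) ^ (3 + Suc k))) (at z)" by auto
qed

lemma wzeta_head_tail:
  "z \<in> ball 0 R \<Longrightarrow> wzeta \<Lambda> z = 1 / z + (\<Sum>w\<in>head R. zeta_term w z) + (\<Sum>\<^sub>\<infinity>w\<in>tail R. zeta_term w z)"
  unfolding wzeta_def zeta_term_def[symmetric] by (simp add: infsum_head_tail[OF zeta_tail_summable])

lemma wp_head_tail:
  "z \<in> ball 0 R \<Longrightarrow> wp \<Lambda> z = 1 / z\<^sup>2 + (\<Sum>w\<in>head R. wp_term w z) + (\<Sum>\<^sub>\<infinity>w\<in>tail R. wp_term w z)"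
  unfolding wp_def wp_term_def[symmetric] by (simp add: infsum_head_tail[OF wp_tail_summable])

text \<open>The derivative of P as a sum over the whole lattice, origin included, so that a
  translation of the summation index proves its periodicity at once.\<close>

definition wpd :: "complex \<Rightarrow> complex" where
  "wpd z = - 2 * (\<Sum>\<^sub>\<infinity>w\<in>\<Lambda>. 1 / (z - w) ^ 3)"

lemma cube_summable: "(\<lambda>w. 1 / (z - w) ^ 3) summable_on \<Lambda>"
proof -
  obtain R where R: "z \<in> ball 0 R" by (metis gt_ex mem_ball_0)
  have "(\<lambda>w. 1 / (z - w) ^ 3) summable_on (head R \<union> tail R)"
    by (intro summable_on_union summable_on_finite finite_head cube_tail_summable[OF R])
  then have "(\<lambda>w. 1 / (z - w) ^ 3) summable_on insert 0 (\<Lambda> - {0})"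
    unfolding head_tail(1)[of R] by (simp only: summable_on_insert_iff)
  then show ?thesis by (simp add: insert_absorb)
qed

lemma wpd_head_tail:
  assumes "z \<in> ball 0 R"
  shows "wpd z = - 2 / z ^ 3 + (\<Sum>w\<in>head R. - 2 / (z - w) ^ 3) - 2 * (\<Sum>\<^sub>\<infinity>w\<in>tail R. 1 / (z - w) ^ 3)"
proof -
  have "(\<Sum>\<^sub>\<infinity>w\<in>insert 0 (\<Lambda> - {0}). 1 / (z - w) ^ 3) = 1 / z ^ 3 + (\<Sum>\<^sub>\<infinity>w\<in>\<Lambda> - {0}. 1 / (z - w) ^ 3)"
    by (subst infsum_insert) (auto intro: summable_on_subset[OF cube_summable])
  moreover have "insert 0 (\<Lambda> - {0}) = \<Lambda>" by (simp add: insert_absorb)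
  ultimately have "wpd z = - 2 * (1 / z ^ 3 + ((\<Sum>w\<in>head R. 1 / (z - w) ^ 3) + (\<Sum>\<^sub>\<infinity>w\<in>tail R. 1 / (z - w) ^ 3)))"
    unfolding wpd_def by (simp only: infsum_head_tail[OF cube_tail_summable[OF assms]])
  moreover have "(\<Sum>w\<in>head R. - 2 / (z - w) ^ 3) = - 2 * (\<Sum>w\<in>head R. 1 / (z - w) ^ 3)"
    by (simp add: sum_distrib_left)
  ultimately show ?thesis by (simp add: ring_distribs)
qed

lemma not_head: "z \<notin> \<Lambda> \<Longrightarrow> w \<in> head R \<Longrightarrow> z \<noteq> w"
  by (auto simp: head_def)

lemma head_nonzero: "w \<in> head R \<Longrightarrow> w \<noteq> 0"
  by (auto simp: head_def)

lemma wzeta_has_field_derivative: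
  assumes "z \<notin> \<Lambda>"
  shows "(wzeta \<Lambda> has_field_derivative - wp \<Lambda> z) (at z)"
proof -
  define R where "R = norm z + 1"
  have z: "z \<in> ball 0 R" "z \<noteq> 0" using assms by (auto simp: R_def)
  have "((\<lambda>z. 1 / z + (\<Sum>w\<in>head R. zeta_term w z) + (\<Sum>\<^sub>\<infinity>w\<in>tail R. zeta_term w z)) has_field_derivative
      - (1 / z\<^sup>2) + (\<Sum>w\<in>head R. - wp_term w z) + - (\<Sum>\<^sub>\<infinity>w\<in>tail R. wp_term w z)) (at z)"
    using z by (intro DERIV_add DERIV_sum zeta_term_deriv zeta_tail_deriv not_head[OF assms] head_nonzero)
      (auto intro!: derivative_eq_intros simp: power2_eq_square)
  then have "(wzeta \<Lambda> has_field_derivative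
      - (1 / z\<^sup>2) + (\<Sum>w\<in>head R. - wp_term w z) + - (\<Sum>\<^sub>\<infinity>w\<in>tail R. wp_term w z)) (at z)"
    by (rule has_field_derivative_transform_within_open[OF _ open_ball z(1)]) (simp add: wzeta_head_tail)
  then show ?thesis by (simp add: wp_head_tail[OF z(1)] sum_negf)
qed

lemma wp_has_field_derivative:
  assumes "z \<notin> \<Lambda>"
  shows "(wp \<Lambda> has_field_derivative wpd z) (at z)"
proof -
  define R where "R = norm z + 1"
  have z: "z \<in> ball 0 R" "z \<noteq> 0" using assms by (auto simp: R_def)
  have "((\<lambda>z. 1 / z\<^sup>2 + (\<Sum>w\<in>head R. wp_term w z) + (\<Sum>\<^sub>\<infinity>w\<in>tail R. wp_term w z)) has_field_derivative
      - 2 / z ^ 3 + (\<Sum>w\<in>head R. - 2 / (z - w) ^ 3) + - 2 * (\<Sum>\<^sub>\<infinity>w\<in>tail R. 1 / (z - w) ^ 3)) (at z)"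
    using z inverse_power_deriv[of z 0 2]
    by (intro DERIV_add DERIV_sum wp_term_deriv wp_tail_deriv not_head[OF assms] head_nonzero)
       (auto simp: numeral_eq_Suc)
  then have "(wp \<Lambda> has_field_derivative
      - 2 / z ^ 3 + (\<Sum>w\<in>head R. - 2 / (z - w) ^ 3) + - 2 * (\<Sum>\<^sub>\<infinity>w\<in>tail R. 1 / (z - w) ^ 3)) (at z)"
    by (rule has_field_derivative_transform_within_open[OF _ open_ball z(1)]) (simp add: wp_head_tail)
  then show ?thesis by (simp add: wpd_head_tail[OF z(1)])
qed

text \<open>Beyond the head the product is the exponential of an absolutely convergent sum of
  logarithms. This identifies the limit in \<open>wsigma\<close> and gives holomorphy as well as
  nonvanishing off the lattice.\<close>

lemma wsigma_head_tail:
  assumes z: "z \<in> ball 0 R"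
  shows "wsigma \<Lambda> z = z * ((\<Prod>w\<in>head R. sigma_factor w z) * exp (\<Sum>\<^sub>\<infinity>w\<in>tail R. sigma_log w z))"
proof -
  \<comment> \<open>Extended by 0 over the head, one sum over X can accompany the product over
    X.\<close>
  define L where "L w = (if w \<in> tail R then sigma_log w z else 0)" for w
  define S where "S = (\<Sum>\<^sub>\<infinity>w\<in>tail R. sigma_log w z)"
  have "(\<lambda>w. sigma_log w z) summable_on tail R"
    by (rule abs_summable_summable, rule summable_on_comparison_test[OF summable_tail])
       (use sigma_log_bound z in \<open>auto simp: tail_def\<close>)
  then have "((\<lambda>w. sigma_log w z) has_sum S) (tail R)" unfolding S_def by simp
  then have "(L has_sum S) (\<Lambda> - {0})"
    by (subst has_sum_cong_neutral[of "tail R" _ "\<lambda>w. sigma_log w z"]) (auto simp: L_def tail_def)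
  then have "((\<lambda>X. (\<Prod>w\<in>head R. sigma_factor w z) * exp (sum L X)) \<longlongrightarrow>
      (\<Prod>w\<in>head R. sigma_factor w z) * exp S) (finite_subsets_at_top (\<Lambda> - {0}))"
    unfolding has_sum_def by (intro tendsto_intros)
  moreover have "\<forall>\<^sub>F X in finite_subsets_at_top (\<Lambda> - {0}).
      (\<Prod>w\<in>head R. sigma_factor w z) * exp (sum L X) = (\<Prod>w\<in>X. sigma_factor w z)"
    unfolding eventually_finite_subsets_at_top
  proof (intro exI[of _ "head R"] conjI allI impI)
    fix X assume X: "finite X \<and> head R \<subseteq> X \<and> X \<subseteq> \<Lambda> - {0}"
    have "(\<Prod>w\<in>X. sigma_factor w z) = (\<Prod>w\<in>X - head R. sigma_factor w z) * (\<Prod>w\<in>head R. sigma_factor w z)"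
      using X by (intro prod.subset_diff) auto
    also have "(\<Prod>w\<in>X - head R. sigma_factor w z) = (\<Prod>w\<in>X - head R. exp (L w))"
    proof (rule prod.cong)
      fix w assume "w \<in> X - head R"
      then have w: "w \<in> tail R" using X head_tail(1)[of R] by auto
      then have "2 * R \<le> norm w" by (simp add: tail_def)
      from norm_diff_half[OF z this] w show "sigma_factor w z = exp (L w)"
        by (simp add: L_def exp_sigma_log)
    qed simp
    also have "\<dots> = exp (sum L (X - head R))" using X by (simp add: exp_sum)
    also have "sum L (X - head R) = sum L X"
      using X head_tail(2)[of R] by (intro sum.mono_neutral_left) (auto simp: L_def)
    finally show "(\<Prod>w\<in>head R. sigma_factor w z) * exp (sum L X) = (\<Prod>w\<in>X. sigma_factor w z)" by simp
  qed (use finite_head head_tail(1) in auto)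
  ultimately have "((\<lambda>X. \<Prod>w\<in>X. sigma_factor w z) \<longlongrightarrow> (\<Prod>w\<in>head R. sigma_factor w z) * exp S)
      (finite_subsets_at_top (\<Lambda> - {0}))"
    by (rule Lim_transform_eventually)
  then have "Lim (finite_subsets_at_top (\<Lambda> - {0})) (\<lambda>X. \<Prod>w\<in>X. sigma_factor w z) =
      (\<Prod>w\<in>head R. sigma_factor w z) * exp S"
    by (intro tendsto_Lim) auto
  then show ?thesis unfolding wsigma_def S_def sigma_factor_def by simp
qed

lemma wsigma_nonzero:
  assumes "z \<notin> \<Lambda>" shows "wsigma \<Lambda> z \<noteq> 0"
proof -
  have z: "z \<in> ball 0 (norm z + 1)" "z \<noteq> 0" using assms by auto
  have "sigma_factor w z \<noteq> 0" if "w \<in> head R" for w R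
    using not_head[OF assms(1) that] head_nonzero[OF that] by (simp add: sigma_factor_def)
  then show ?thesis unfolding wsigma_head_tail[OF z(1)] using z finite_head by simp
qed

lemma wsigma_holomorphic: "wsigma \<Lambda> holomorphic_on A"
proof -
  have "wsigma \<Lambda> field_differentiable (at z)" for z
  proof -
    define R where "R = norm z + 1"
    have z: "z \<in> ball 0 R" by (auto simp: R_def)
    have "(\<lambda>z. \<Sum>\<^sub>\<infinity>w\<in>tail R. sigma_log w z) holomorphic_on ball 0 R"
      using sigma_tail_deriv[of _ R] unfolding holomorphic_on_open[OF open_ball] by blast
    then have "(\<lambda>z. z * ((\<Prod>w\<in>head R. sigma_factor w z) * exp (\<Sum>\<^sub>\<infinity>w\<in>tail R. sigma_log w z))) holomorphic_on ball 0 R"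
      unfolding sigma_factor_def by (intro holomorphic_intros) (auto simp: head_def)
    then have "wsigma \<Lambda> holomorphic_on ball 0 R"
      by (subst holomorphic_cong[OF refl wsigma_head_tail]) auto
    then show ?thesis using z by (simp add: holomorphic_on_imp_differentiable_at)
  qed
  then show ?thesis by (simp add: field_differentiable_at_within holomorphic_on_def)
qed

lemma wsigma_has_field_derivative:
  assumes "z \<notin> \<Lambda>"
  shows "(wsigma \<Lambda> has_field_derivative wsigma \<Lambda> z * wzeta \<Lambda> z) (at z)"
proof -
  define R where "R = norm z + 1"
  have z: "z \<in> ball 0 R" "z \<noteq> 0" using assms by (auto simp: R_def)
  define A where "A z = (\<Prod>w\<in>head R. sigma_factor w z)" for z
  define B where "B z = (\<Sum>\<^sub>\<infinity>w\<in>tail R. sigma_log w z)" for z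
  have A: "(A has_field_derivative A z * (\<Sum>w\<in>head R. zeta_term w z)) (at z)"
    unfolding A_def
    by (intro prod_has_logarithmic_derivative finite_head sigma_factor_deriv not_head[OF assms] head_nonzero)
  have B: "(B has_field_derivative (\<Sum>\<^sub>\<infinity>w\<in>tail R. zeta_term w z)) (at z)"
    unfolding B_def by (rule sigma_tail_deriv[OF z(1)])
  have "((\<lambda>z. z * (A z * exp (B z))) has_field_derivative z * (A z * exp (B z)) * wzeta \<Lambda> z) (at z)"
    unfolding wzeta_head_tail[OF z(1)]
    by (rule derivative_eq_intros A B refl | use z(2) in \<open>simp add: algebra_simps\<close>)+
  then show ?thesis
    unfolding wsigma_head_tail[OF z(1)] A_def B_def
    by (rule has_field_derivative_transform_within_open[OF _ open_ball z(1)]) (simp add: wsigma_head_tail)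
qed

end

section \<open>Discrete sets, cancellation of factors, Taylor remainders\<close>

lemma locally_finite_imp_closed:
  fixes D :: "complex set"
  assumes "\<And>R. finite {w \<in> D. norm w \<le> R}"
  shows "closed D" "\<not> z islimpt D" "countable D"
proof -
  show *: "\<not> z islimpt D" for z
  proof
    assume "z islimpt D"
    then have "infinite (D \<inter> ball z 1)" by (simp add: islimpt_eq_infinite_ball)
    moreover have "norm w \<le> norm z + 1" if "w \<in> ball z 1" for w
      using that norm_triangle_ineq2[of w z] by (simp add: dist_norm norm_minus_commute)
    then have "D \<inter> ball z 1 \<subseteq> {w \<in> D. norm w \<le> norm z + 1}" by auto
    ultimately show False using assms finite_subset by blast
  qed
  then show "closed D" by (simp add: closed_limpt)
  have "D = (\<Union>n::nat. {w \<in> D. norm w \<le> real n})" using real_arch_simple by auto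
  moreover have "countable (\<Union>n::nat. {w \<in> D. norm w \<le> real n})"
    using assms by (intro countable_UN) (auto intro: countable_finite)
  ultimately show "countable D" by simp
qed

lemma connected_Compl_countable: "countable D \<Longrightarrow> connected (- D)" for D :: "complex set"
  by (intro path_connected_imp_connected path_connected_complement_countable) auto

text \<open>Near z0 the factor A is nonzero, so B vanishes on an open set and, by the identity
  theorem, everywhere. This replaces division by functions that have zeros.\<close>

lemma holomorphic_mult_eq_0:
  assumes S: "open S" "connected S" and hol: "A holomorphic_on S" "B holomorphic_on S"
    and eq: "\<And>z. z \<in> S \<Longrightarrow> A z * B z = 0" and z0: "z0 \<in> S" "A z0 \<noteq> 0" and z: "z \<in> S"
  shows "B z = 0"
proof -
  have "open (S \<inter> A -` (- {0}))"
    using hol(1) S(1) by (intro continuous_open_preimage holomorphic_on_imp_continuous_on) auto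
  then show ?thesis
    using analytic_continuation_open[of "S \<inter> A -` (- {0})" S B "\<lambda>_. 0" z] S hol z0 z eq by fastforce
qed

text \<open>Near z0 the quotient F / Q has derivative zero; the resulting identity is free of
  denominators and continues across the zeros of Q.\<close>

lemma holomorphic_proportional:
  fixes F Q :: "complex \<Rightarrow> complex"
  assumes S: "open S" "connected S"
    and F: "\<And>z. z \<in> S \<Longrightarrow> (F has_field_derivative F' z) (at z)"
    and Q: "\<And>z. z \<in> S \<Longrightarrow> (Q has_field_derivative Q' z) (at z)"
    and eq: "\<And>z. z \<in> S \<Longrightarrow> F' z * Q z = Q' z * F z" and z0: "z0 \<in> S" "Q z0 \<noteq> 0" and z: "z \<in> S"
  shows "F z = F z0 / Q z0 * Q z"
proof -
  have hol: "F holomorphic_on S" "Q holomorphic_on S"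
    using F Q S by (auto simp: holomorphic_on_open)
  then have cont: "continuous_on S Q" by (simp add: holomorphic_on_imp_continuous_on)
  have "open (S \<inter> Q -` (- {0}))"
    using cont S(1) by (intro continuous_open_preimage) auto
  moreover have "z0 \<in> S \<inter> Q -` (- {0})" using z0 by simp
  ultimately obtain e where e: "e > 0" "ball z0 e \<subseteq> S \<inter> Q -` (- {0})" by (meson openE)
  have "(\<lambda>z. F z / Q z) constant_on ball z0 e"
  proof (rule has_field_derivative_0_imp_constant_on)
    fix w assume "w \<in> ball z0 e"
    then have w: "w \<in> S" "Q w \<noteq> 0" using e by auto
    show "((\<lambda>z. F z / Q z) has_field_derivative 0) (at w)"
      using eq[OF w(1)] DERIV_divide[OF F[OF w(1)] Q[OF w(1)] w(2)] by (simp add: mult.commute)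
  qed auto
  then obtain k where k: "\<And>w. w \<in> ball z0 e \<Longrightarrow> F w / Q w = k" by (auto simp: constant_on_def)
  have "F w = F z0 / Q z0 * Q w" if "w \<in> ball z0 e" for w
  proof -
    have "Q w \<noteq> 0" using that e(2) by auto
    moreover have "F w / Q w = F z0 / Q z0" using k[OF that] k[of z0] e(1) by simp
    ultimately show ?thesis by (simp add: divide_eq_eq)
  qed
  moreover have "(\<lambda>w. F z0 / Q z0 * Q w) holomorphic_on S" using hol by (intro holomorphic_intros)
  moreover have "ball z0 e \<noteq> {}" "ball z0 e \<subseteq> S" using e by auto
  ultimately show ?thesis
    using analytic_continuation_open[OF open_ball S(1) _ S(2) _ hol(1)] z by blast
qed

text \<open>The point is that T is holomorphic at 0 too: limits at a pole are later read off by
  continuity after multiplication with a power of z.\<close>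

lemma holomorphic_Taylor_remainder:
  assumes f: "f holomorphic_on ball 0 r" and r: "r > 0"
  obtains T where "T holomorphic_on ball 0 r"
    "\<And>w. w \<in> ball 0 r \<Longrightarrow> f w = (\<Sum>k<n. (deriv ^^ k) f 0 / fact k * w ^ k) + w ^ n * T w"
proof -
  define a where "a k = (deriv ^^ k) f 0 / fact k" for k
  define T where "T w = (if w = 0 then a n else (f w - (\<Sum>k<n. a k * w ^ k)) / w ^ n)" for w
  have sums: "(\<lambda>k. a k * w ^ k) sums f w" if "w \<in> ball 0 r" for w
    using holomorphic_power_series[OF f that] by (simp add: a_def)
  have "(\<lambda>k. a (k + n) * (w - 0) ^ k) sums T w" if w: "w \<in> ball 0 r" for w
  proof (cases "w = 0")
    case True
    then show ?thesis using powser_sums_zero[of "\<lambda>k. a (k + n)"] by (simp add: T_def)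
  next
    case False
    have "(\<lambda>k. a (k + n) * w ^ (k + n) / w ^ n) sums ((f w - (\<Sum>k<n. a k * w ^ k)) / w ^ n)"
      by (intro sums_divide sums_split_initial_segment sums w)
    moreover have "(\<lambda>k. a (k + n) * w ^ (k + n) / w ^ n) = (\<lambda>k. a (k + n) * w ^ k)"
      using False by (simp add: power_add)
    ultimately show ?thesis using False by (simp add: T_def)
  qed
  then have "T holomorphic_on ball 0 r"
    by (rule power_series_holomorphic)
  moreover have "f w = (\<Sum>k<n. a k * w ^ k) + w ^ n * T w" if w: "w \<in> ball 0 r" for w
  proof (cases "w = 0")
    case True
    have "f 0 = a 0" by (simp add: a_def)
    moreover have "(\<Sum>k<n. a k * 0 ^ k) = (if n = 0 then 0 else a 0)"
      by (cases n) (simp_all add: sum.lessThan_Suc_shift del: sum.lessThan_Suc)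
    ultimately show ?thesis using True by (simp add: T_def)
  qed (simp add: T_def)
  ultimately show ?thesis using that unfolding a_def by blast
qed

section \<open>Periodicity, and elliptic functions without poles\<close>

context half_periods
begin

lemma closed_lattice: "closed \<Lambda>" and lattice_not_islimpt: "\<not> z islimpt \<Lambda>"
  using locally_finite_imp_closed[of \<Lambda>] finite_lattice_cball by auto

lemma open_Compl_lattice: "open (- \<Lambda>)"
  using closed_lattice by (rule open_Compl)

lemma connected_Compl_lattice: "connected (- \<Lambda>)"
  by (rule connected_Compl_countable[OF countable_lattice])

lemma lattice_cell:
  obtains w s t where "w \<in> \<Lambda>" "s \<in> {0..1}" "t \<in> {0..1}" "z = w + (of_real s * (2 * of_real \<omega>1) + of_real t * (2 * \<omega>3))"
proof -
  define t where "t = Im z / (2 * Im \<omega>3)"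
  define s where "s = (Re z - t * (2 * Re \<omega>3)) / (2 * \<omega>1)"
  have z: "z = of_real s * (2 * of_real \<omega>1) + of_real t * (2 * \<omega>3)"
    using \<omega>1_pos \<omega>3_pos by (intro complex_eqI) (simp_all add: s_def t_def)
  have f: "x = of_int \<lfloor>x\<rfloor> + frac x" for x :: real by (simp add: frac_def)
  have "z = lpt (\<lfloor>s\<rfloor>, \<lfloor>t\<rfloor>) + (of_real (frac s) * (2 * of_real \<omega>1) + of_real (frac t) * (2 * \<omega>3))"
    unfolding lpt_def fst_conv snd_conv
    by (subst z, subst (1) f[of s], subst (1) f[of t]) (simp add: algebra_simps)
  moreover have "lpt (\<lfloor>s\<rfloor>, \<lfloor>t\<rfloor>) \<in> \<Lambda>" by (simp add: lattice_eq)
  ultimately show ?thesis using that[of "lpt (\<lfloor>s\<rfloor>, \<lfloor>t\<rfloor>)" "frac s" "frac t"]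
    by (simp add: frac_ge_0 less_imp_le[OF frac_lt_1])
qed

text \<open>The singularities in D are removable, periodicity confines the range to the image of one
  compact cell, and Liouville's theorem applies. D is kept apart from the lattice because the
  addition theorem also has singularities on a translate of it.\<close>

lemma elliptic_entire_constant:
  assumes D: "\<And>R. finite {w \<in> D. norm w \<le> R}"
    and hol: "\<And>z. z \<notin> D \<Longrightarrow> F field_differentiable (at z)"
    and lim: "\<And>z. z \<in> D \<Longrightarrow> (F \<longlongrightarrow> F z) (at z)"
    and per: "\<And>z w. w \<in> \<Lambda> \<Longrightarrow> F (z + w) = F z"
  shows "F z = F z'"
proof -
  have ent: "F holomorphic_on UNIV"
  proof -
    have "F field_differentiable (at z)" for z
    proof -
      have "\<not> z islimpt D" by (rule locally_finite_imp_closed[OF D])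
      then obtain e where e: "e > 0" "\<And>w. w \<in> D \<Longrightarrow> w \<noteq> z \<Longrightarrow> e \<le> dist w z"
        unfolding islimpt_approachable by (meson not_le)
      have hb: "F field_differentiable (at u)" if u: "u \<in> ball z e - {z}" for u
      proof (rule hol, rule notI)
        assume "u \<in> D"
        then have "e \<le> dist u z" using e(2)[of u] u by simp
        then show False using u by (simp add: dist_commute)
      qed
      have "F holomorphic_on ball z e"
      proof (rule no_isolated_singularity'[of "{z}"])
        fix u assume "u \<in> {z}"
        have "(F \<longlongrightarrow> F z) (at z)"
          using lim[of z] hol[of z] field_differentiable_imp_continuous_at[of F z UNIV]
          by (cases "z \<in> D") (auto simp: isCont_def)
        then show "(F \<longlongrightarrow> F u) (at u within ball z e)"
          using \<open>u \<in> {z}\<close> by (auto intro: tendsto_within_subset)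
      next
        show "F holomorphic_on ball z e - {z}"
          unfolding holomorphic_on_def using hb by (blast intro: field_differentiable_at_within)
      qed auto
      then show ?thesis using e(1) by (simp add: holomorphic_on_imp_differentiable_at)
    qed
    then show ?thesis by (simp add: holomorphic_on_def field_differentiable_at_within)
  qed
  define g where "g = (\<lambda>(s, t). of_real s * (2 * of_real \<omega>1) + of_real t * (2 * \<omega>3) :: complex)"
  have "compact (g ` ({0..1} \<times> {0..1}))"
    unfolding g_def case_prod_unfold by (intro compact_continuous_image compact_Times continuous_intros) auto
  then have "compact (F ` g ` ({0..1} \<times> {0..1}))"
    by (rule compact_continuous_image[OF continuous_on_subset[OF holomorphic_on_imp_continuous_on[OF ent]], rotated]) simp
  moreover have "range F \<subseteq> F ` g ` ({0..1} \<times> {0..1})"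
  proof safe
    fix z
    obtain w s t where "w \<in> \<Lambda>" "s \<in> {0..1}" "t \<in> {0..1}" "z = w + g (s, t)"
      unfolding g_def prod.case by (rule lattice_cell[of z])
    then show "F z \<in> F ` g ` ({0..1} \<times> {0..1})"
      using per[of w "g (s, t)"] by (auto simp: add.commute)
  qed
  ultimately have "bounded (range F)" using compact_imp_bounded bounded_subset by blast
  from Liouville_theorem[OF ent this] show ?thesis by (auto simp: constant_on_def)
qed

lemma wp_minus: "wp \<Lambda> (- z) = wp \<Lambda> z"
proof -
  have "bij_betw uminus (\<Lambda> - {0}) (\<Lambda> - {0})"
    by (intro bij_betwI[of _ _ _ uminus]) auto
  from infsum_reindex_bij_betw[OF this, of "\<lambda>w. 1 / (- z - w)\<^sup>2 - 1 / w\<^sup>2"]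
  have "(\<Sum>\<^sub>\<infinity>w\<in>\<Lambda> - {0}. 1 / (- z - w)\<^sup>2 - 1 / w\<^sup>2) = (\<Sum>\<^sub>\<infinity>w\<in>\<Lambda> - {0}. 1 / (w - z)\<^sup>2 - 1 / w\<^sup>2)" by simp
  then show ?thesis unfolding wp_def by (simp add: power2_commute)
qed

lemma wzeta_minus: "wzeta \<Lambda> (- z) = - wzeta \<Lambda> z"
proof -
  have "bij_betw uminus (\<Lambda> - {0}) (\<Lambda> - {0})"
    by (intro bij_betwI[of _ _ _ uminus]) auto
  from infsum_reindex_bij_betw[OF this, of "\<lambda>w. zeta_term w (- z)"]
  have "(\<Sum>\<^sub>\<infinity>w\<in>\<Lambda> - {0}. zeta_term w (- z)) = (\<Sum>\<^sub>\<infinity>w\<in>\<Lambda> - {0}. zeta_term (- w) (- z))" by simp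
  also have "(\<lambda>w. zeta_term (- w) (- z)) = (\<lambda>w. - zeta_term w z)"
  proof
    fix w
    have "1 / (- z - - w) = - (1 / (z - w))" by (simp only: minus_diff_minus divide_minus_right)
    then show "zeta_term (- w) (- z) = - zeta_term w z" by (simp add: zeta_term_def)
  qed
  finally show ?thesis unfolding wzeta_def zeta_term_def[symmetric] by (simp add: infsum_uminus)
qed

lemma wpd_minus: "wpd (- z) = - wpd z"
proof -
  have "bij_betw uminus \<Lambda> \<Lambda>" by (intro bij_betwI[of _ _ _ uminus]) auto
  from infsum_reindex_bij_betw[OF this, of "\<lambda>w. 1 / (- z - w) ^ 3"]
  have "(\<Sum>\<^sub>\<infinity>w\<in>\<Lambda>. 1 / (- z - w) ^ 3) = (\<Sum>\<^sub>\<infinity>w\<in>\<Lambda>. 1 / (- z - - w) ^ 3)" by (rule sym)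
  also have "(\<lambda>w. 1 / (- z - - w) ^ 3) = (\<lambda>w. - (1 / (z - w) ^ 3))"
  proof
    fix w
    have "(- z - - w) ^ 3 = - ((z - w) ^ 3)" by (simp add: power3_eq_cube algebra_simps)
    then show "1 / (- z - - w) ^ 3 = - (1 / (z - w) ^ 3)" by (simp only: divide_minus_right)
  qed
  finally show ?thesis unfolding wpd_def by (simp add: infsum_uminus)
qed

lemma wpd_periodic: "v \<in> \<Lambda> \<Longrightarrow> wpd (z + v) = wpd z"
proof -
  assume v: "v \<in> \<Lambda>"
  have "bij_betw (\<lambda>w. w + v) \<Lambda> \<Lambda>"
    by (intro bij_betwI[of _ _ _ "\<lambda>w. w - v"]) (auto simp: lattice_add lattice_diff v)
  from infsum_reindex_bij_betw[OF this, of "\<lambda>w. 1 / (z + v - w) ^ 3"]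
  show ?thesis unfolding wpd_def by simp
qed

lemma has_field_derivative_shift:
  "(f has_field_derivative f') (at (z + w)) \<Longrightarrow> ((\<lambda>z. f (z + w)) has_field_derivative f') (at z)"
  for f :: "complex \<Rightarrow> complex"
  by (simp add: DERIV_shift)

text \<open>The difference has derivative zero on the connected complement of the lattice. For P the
  constant turns out to be 0, for zeta it is the quasi-period.\<close>

lemma lattice_translate_constant:
  assumes f: "\<And>z. z \<notin> \<Lambda> \<Longrightarrow> (f has_field_derivative f' z) (at z)"
    and per: "\<And>z. z \<notin> \<Lambda> \<Longrightarrow> f' (z + w) = f' z" and w: "w \<in> \<Lambda>"
  obtains c where "\<And>z. z \<notin> \<Lambda> \<Longrightarrow> f (z + w) = f z + c"
proof -
  have "((\<lambda>z. f (z + w) - f z) has_field_derivative 0) (at z)" if "z \<in> - \<Lambda>" for z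
  proof -
    have "z + w \<notin> \<Lambda>" using that w by (simp add: lattice_add_iff)
    from DERIV_diff[OF has_field_derivative_shift[OF f[OF this]] f[of z]] that
    show ?thesis by (simp add: per)
  qed
  then have "(\<lambda>z. f (z + w) - f z) constant_on - \<Lambda>"
    by (rule has_field_derivative_0_imp_constant_on[OF _ connected_Compl_lattice open_Compl_lattice])
  then obtain c where "\<And>z. z \<notin> \<Lambda> \<Longrightarrow> f (z + w) - f z = c" by (auto simp: constant_on_def)
  then have "f (z + w) = f z + c" if "z \<notin> \<Lambda>" for z
    using that by (metis add.commute diff_add_cancel)
  then show ?thesis using that by blast
qed

lemma ex_not_lattice: "\<exists>z. z \<notin> \<Lambda>"
  using lattice_not_islimpt[of 0] islimpt_UNIV[of "0::complex"] by (metis UNIV_eq_I)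

lemma wp_periodic:
  assumes w: "w \<in> \<Lambda>" and z: "z \<notin> \<Lambda>"
  shows "wp \<Lambda> (z + w) = wp \<Lambda> z"
proof -
  obtain c where c: "\<And>z. z \<notin> \<Lambda> \<Longrightarrow> wp \<Lambda> (z + w) = wp \<Lambda> z + c"
    using lattice_translate_constant[OF wp_has_field_derivative wpd_periodic[OF w] w] by blast
  \<comment> \<open>At - z - w, evenness turns the relation into the same one with - c in place of
    c.\<close>
  have "- z - w \<notin> \<Lambda>" using z w by (metis add.commute diff_minus_eq_add lattice_add_iff lattice_uminus_iff minus_diff_eq)
  from c[OF this] have "wp \<Lambda> (- z) = wp \<Lambda> (- (z + w)) + c" by simp
  then have "wp \<Lambda> z = wp \<Lambda> z + c + c" unfolding wp_minus using c[OF z] by simp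
  then show ?thesis using c[OF z] by simp
qed

lemma wzeta_quasi_periodic:
  assumes "w \<in> \<Lambda>"
  obtains \<eta> where "\<And>z. z \<notin> \<Lambda> \<Longrightarrow> wzeta \<Lambda> (z + w) = wzeta \<Lambda> z + \<eta>"
  using lattice_translate_constant[OF wzeta_has_field_derivative _ assms] wp_periodic[OF assms] by auto

end

section \<open>Expansion at the origin and the differential equation\<close>

lemma holomorphic_ball_tendsto_0:
  "T holomorphic_on ball 0 r \<Longrightarrow> r > 0 \<Longrightarrow> (T \<longlongrightarrow> T 0) (at (0::complex))"
  using holomorphic_on_imp_continuous_on[of T "ball 0 r"] continuous_on_interior[of "ball 0 r" T 0]
  by (simp add: isCont_def)

context half_periods
begin

text \<open>All nonzero lattice points have modulus at least twice this radius. The head is then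
  empty, and the sum over the nonzero points is the regular part at the pole 0.\<close>

definition rad :: real where "rad = (SOME r. r > 0 \<and> head r = {})"

lemma rad_pos: "rad > 0" and head_rad: "head rad = {}"
proof -
  obtain d where d: "d > 0" "\<And>x. x \<in> head 1 \<Longrightarrow> x \<noteq> 0 \<Longrightarrow> d \<le> dist 0 x"
    using finite_set_avoid[OF finite_head[of 1], of 0] by blast
  have "w \<notin> head (min 1 (d / 2))" for w
  proof
    assume w: "w \<in> head (min 1 (d / 2))"
    then have "w \<in> head 1" "w \<noteq> 0" "norm w < d" by (auto simp: head_def)
    then show False using d(2)[of w] by simp
  qed
  then have "min 1 (d / 2) > 0 \<and> head (min 1 (d / 2)) = {}" using d(1) by auto
  then have "rad > 0 \<and> head rad = {}" unfolding rad_def by (rule someI)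
  then show "rad > 0" "head rad = {}" by auto
qed

lemma tail_rad: "tail rad = \<Lambda> - {0}"
  using head_tail(1)[of rad] head_rad by simp

definition wp_reg :: "complex \<Rightarrow> complex" where "wp_reg z = (\<Sum>\<^sub>\<infinity>w\<in>tail rad. wp_term w z)"
definition zeta_reg :: "complex \<Rightarrow> complex" where "zeta_reg z = (\<Sum>\<^sub>\<infinity>w\<in>tail rad. zeta_term w z)"
text \<open>Up to a numerical factor this is the derivative of order k + 1 of \<open>wp_reg\<close>.
  Its value at 0 is, up to sign, the Eisenstein sum of weight k + 3, which is how the invariants
  enter.\<close>

definition eis :: "nat \<Rightarrow> complex \<Rightarrow> complex" where "eis k z = (\<Sum>\<^sub>\<infinity>w\<in>tail rad. 1 / (z - w) ^ (3 + k))"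

lemma wp_eq_reg: "wp \<Lambda> z = 1 / z\<^sup>2 + wp_reg z"
  by (simp add: wp_def wp_reg_def wp_term_def tail_rad)

lemma wzeta_eq_reg: "wzeta \<Lambda> z = 1 / z + zeta_reg z"
  by (simp add: wzeta_def zeta_reg_def zeta_term_def tail_rad)

lemma not_lattice_ball: "z \<in> ball 0 rad \<Longrightarrow> z \<noteq> 0 \<Longrightarrow> z \<notin> \<Lambda>"
proof
  assume z: "z \<in> ball 0 rad" "z \<noteq> 0" "z \<in> \<Lambda>"
  then have "norm z < 2 * rad" using rad_pos by simp
  then have "z \<in> head rad" using z by (simp add: head_def)
  then show False using head_rad by simp
qed

lemma zeta_reg_deriv: "z \<in> ball 0 rad \<Longrightarrow> (zeta_reg has_field_derivative - wp_reg z) (at z)"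
  unfolding zeta_reg_def wp_reg_def by (rule zeta_tail_deriv)

lemma wp_reg_deriv: "z \<in> ball 0 rad \<Longrightarrow> (wp_reg has_field_derivative - 2 * eis 0 z) (at z)"
  unfolding wp_reg_def eis_def add_0_right by (rule wp_tail_deriv)

lemma eis_deriv: "z \<in> ball 0 rad \<Longrightarrow> (eis k has_field_derivative - of_nat (3 + k) * eis (Suc k) z) (at z)"
  unfolding eis_def by (rule power_tail_deriv)

lemma wp_reg_holomorphic: "wp_reg holomorphic_on ball 0 rad"
  and zeta_reg_holomorphic: "zeta_reg holomorphic_on ball 0 rad"
  unfolding holomorphic_on_open[OF open_ball] using wp_reg_deriv zeta_reg_deriv by blast+

lemma wp_reg_higher_deriv:
  "z \<in> ball 0 rad \<Longrightarrow> (deriv ^^ Suc k) wp_reg z = (-1) ^ Suc k * fact (k + 2) * eis k z"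
proof (induction k arbitrary: z)
  case 0
  then show ?case using DERIV_imp_deriv[OF wp_reg_deriv] by simp
next
  case (Suc k)
  have "((\<lambda>z. (-1) ^ Suc k * fact (k + 2) * eis k z) has_field_derivative
      (-1) ^ Suc k * fact (k + 2) * (- of_nat (3 + k) * eis (Suc k) z)) (at z)"
    by (intro DERIV_cmult eis_deriv Suc.prems)
  then have "((deriv ^^ Suc k) wp_reg has_field_derivative
      (-1) ^ Suc k * fact (k + 2) * (- of_nat (3 + k) * eis (Suc k) z)) (at z)"
    by (rule has_field_derivative_transform_within_open[OF _ open_ball Suc.prems]) (simp only: Suc.IH)
  then have "deriv ((deriv ^^ Suc k) wp_reg) z = (-1) ^ Suc k * fact (k + 2) * (- of_nat (3 + k) * eis (Suc k) z)"
    by (rule DERIV_imp_deriv)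
  then show ?case by (simp add: algebra_simps)
qed

text \<open>Sums of odd weight cancel under the reflection of the lattice in 0.\<close>

lemma eis_even_0: "even k \<Longrightarrow> eis k 0 = 0"
proof -
  assume k: "even k"
  have "bij_betw uminus (\<Lambda> - {0}) (\<Lambda> - {0})"
    by (intro bij_betwI[of _ _ _ uminus]) auto
  from infsum_reindex_bij_betw[OF this, of "\<lambda>w. 1 / (0 - w) ^ (3 + k)"]
  have "eis k 0 = (\<Sum>\<^sub>\<infinity>w\<in>\<Lambda> - {0}. - (1 / (0 - w) ^ (3 + k)))"
    unfolding eis_def tail_rad using k by simp
  then have "eis k 0 = - eis k 0" unfolding eis_def tail_rad by (simp add: infsum_uminus)
  then show ?thesis by simp
qed

lemma eis_1_0: "eis 1 0 = invariant_g2 \<Lambda> / 60" and eis_3_0: "eis 3 0 = invariant_g3 \<Lambda> / 140"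
  by (simp_all add: eis_def tail_rad invariant_g2_def invariant_g3_def)

lemma wp_reg_0: "wp_reg 0 = 0" and zeta_reg_0: "zeta_reg 0 = 0"
  by (simp_all add: wp_reg_def zeta_reg_def wp_term_def zeta_term_def)

text \<open>The coefficients up to z^4 are the ones that matter: in \<open>wp_ode\<close> the g2
  term cancels the remaining pole and the g3 term the constant.\<close>

lemma wp_reg_expansion:
  obtains T where "T holomorphic_on ball 0 rad"
    "\<And>z. z \<in> ball 0 rad \<Longrightarrow> wp_reg z = invariant_g2 \<Lambda> / 20 * z\<^sup>2 + invariant_g3 \<Lambda> / 28 * z ^ 4 + z ^ 5 * T z"
proof -
  obtain T where T: "T holomorphic_on ball 0 rad"
    "\<And>w. w \<in> ball 0 rad \<Longrightarrow> wp_reg w = (\<Sum>k<5. (deriv ^^ k) wp_reg 0 / fact k * w ^ k) + w ^ 5 * T w"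
    using holomorphic_Taylor_remainder[OF wp_reg_holomorphic rad_pos] by blast
  note d = wp_reg_higher_deriv[of 0, simplified rad_pos centre_in_ball]
  have e: "(deriv ^^ 0) wp_reg 0 = 0" "(deriv ^^ 1) wp_reg 0 = 0" "(deriv ^^ 2) wp_reg 0 = invariant_g2 \<Lambda> / 10"
    "(deriv ^^ 3) wp_reg 0 = 0" "(deriv ^^ 4) wp_reg 0 = 6 / 7 * invariant_g3 \<Lambda>"
    using wp_reg_higher_deriv[of 0 0] wp_reg_higher_deriv[of 0 1] wp_reg_higher_deriv[of 0 2] wp_reg_higher_deriv[of 0 3] rad_pos
      eis_even_0[of 0] eis_even_0[of 2] eis_1_0 eis_3_0 wp_reg_0
    by (simp_all add: eval_nat_numeral fact_numeral mult.commute del: funpow.simps)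
  have s: "(\<Sum>k<5. (deriv ^^ k) wp_reg 0 / fact k * w ^ k) = (deriv ^^ 0) wp_reg 0 + (deriv ^^ 1) wp_reg 0 * w
      + (deriv ^^ 2) wp_reg 0 / 2 * w\<^sup>2 + (deriv ^^ 3) wp_reg 0 / 6 * w ^ 3 + (deriv ^^ 4) wp_reg 0 / 24 * w ^ 4" for w
    by (simp add: eval_nat_numeral fact_numeral del: funpow.simps)
  have "(\<Sum>k<5. (deriv ^^ k) wp_reg 0 / fact k * w ^ k) = invariant_g2 \<Lambda> / 20 * w\<^sup>2 + invariant_g3 \<Lambda> / 28 * w ^ 4" for w
    unfolding s e by simp
  with T show ?thesis using that by simp
qed

lemma zeta_reg_expansion:
  obtains Z where "Z holomorphic_on ball 0 rad" "\<And>z. z \<in> ball 0 rad \<Longrightarrow> zeta_reg z = z ^ 3 * Z z"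
proof -
  obtain T where T: "T holomorphic_on ball 0 rad"
    "\<And>w. w \<in> ball 0 rad \<Longrightarrow> zeta_reg w = (\<Sum>k<3. (deriv ^^ k) zeta_reg 0 / fact k * w ^ k) + w ^ 3 * T w"
    using holomorphic_Taylor_remainder[OF zeta_reg_holomorphic rad_pos] by blast
  have 0: "0 \<in> ball 0 rad" using rad_pos by simp
  have 1: "deriv zeta_reg z = - wp_reg z" if "z \<in> ball 0 rad" for z
    by (rule DERIV_imp_deriv[OF zeta_reg_deriv[OF that]])
  have "(deriv zeta_reg has_field_derivative - (- 2 * eis 0 0)) (at 0)"
    by (rule has_field_derivative_transform_within_open[OF DERIV_minus[OF wp_reg_deriv[OF 0]] open_ball 0])
       (simp only: 1)
  then have 2: "deriv (deriv zeta_reg) 0 = 0" by (simp add: DERIV_imp_deriv eis_even_0)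
  have "(\<Sum>k<3. (deriv ^^ k) zeta_reg 0 / fact k * w ^ k) = 0" for w
    using 1[OF 0] 2 zeta_reg_0 wp_reg_0 by (simp add: eval_nat_numeral)
  with T show ?thesis using that by simp
qed

text \<open>After multiplication by z^2 and z^3 the right sides are polynomials in z, the invariants
  and the remainder values, a form that \<open>algebra\<close> can work with.\<close>

lemma wp_expansion:
  obtains T T' where "T holomorphic_on ball 0 rad" "T' holomorphic_on ball 0 rad"
    "\<And>z. z \<in> ball 0 rad \<Longrightarrow> z \<noteq> 0 \<Longrightarrow>
      z\<^sup>2 * wp \<Lambda> z = 1 + z ^ 4 * (invariant_g2 \<Lambda> / 20 + invariant_g3 \<Lambda> / 28 * z\<^sup>2 + z ^ 3 * T z)"
    "\<And>z. z \<in> ball 0 rad \<Longrightarrow> z \<noteq> 0 \<Longrightarrow>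
      z ^ 3 * wpd z = - 2 + z ^ 4 * (invariant_g2 \<Lambda> / 10 + invariant_g3 \<Lambda> / 7 * z\<^sup>2 + 5 * z ^ 3 * T z + z ^ 4 * T' z)"
proof -
  obtain T where T: "T holomorphic_on ball 0 rad"
    "\<And>z. z \<in> ball 0 rad \<Longrightarrow> wp_reg z = invariant_g2 \<Lambda> / 20 * z\<^sup>2 + invariant_g3 \<Lambda> / 28 * z ^ 4 + z ^ 5 * T z"
    using wp_reg_expansion by blast
  have T': "deriv T holomorphic_on ball 0 rad" by (intro holomorphic_deriv T(1)) auto
  let ?a = "invariant_g2 \<Lambda> / 20" and ?b = "invariant_g3 \<Lambda> / 28"
  have 1: "z\<^sup>2 * wp \<Lambda> z = 1 + z ^ 4 * (?a + ?b * z\<^sup>2 + z ^ 3 * T z)" if "z \<in> ball 0 rad" "z \<noteq> 0" for z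
  proof -
    have alg: "z\<^sup>2 * (a * z\<^sup>2 + b * z ^ 4 + z ^ 5 * t) = z ^ 4 * (a + b * z\<^sup>2 + z ^ 3 * t)" for a b t by algebra
    have "z\<^sup>2 * wp \<Lambda> z = 1 + z\<^sup>2 * (?a * z\<^sup>2 + ?b * z ^ 4 + z ^ 5 * T z)"
      using that T(2)[of z] by (simp add: wp_eq_reg distrib_left)
    then show ?thesis unfolding alg .
  qed
  have 2: "z ^ 3 * wpd z = - 2 + z ^ 4 * (2 * ?a + 4 * ?b * z\<^sup>2 + 5 * z ^ 3 * T z + z ^ 4 * deriv T z)"
    if z: "z \<in> ball 0 rad" "z \<noteq> 0" for z
  proof -
    have dT: "(T has_field_derivative deriv T z) (at z)"
      using T(1) z(1) by (rule holomorphic_derivI[OF _ open_ball])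
    have "((\<lambda>z. ?a * z\<^sup>2 + ?b * z ^ 4 + z ^ 5 * T z) has_field_derivative
        2 * ?a * z + 4 * ?b * z ^ 3 + 5 * z ^ 4 * T z + z ^ 5 * deriv T z) (at z)"
      by (rule derivative_eq_intros dT refl | simp)+
    then have "(wp_reg has_field_derivative 2 * ?a * z + 4 * ?b * z ^ 3 + 5 * z ^ 4 * T z + z ^ 5 * deriv T z) (at z)"
      by (rule has_field_derivative_transform_within_open[OF _ open_ball z(1)]) (simp add: T(2))
    moreover have "((\<lambda>z. 1 / z\<^sup>2) has_field_derivative - 2 / z ^ 3) (at z)"
      using inverse_power_deriv[of z 0 2] z(2) by (simp add: numeral_eq_Suc)
    ultimately have "((\<lambda>z. 1 / z\<^sup>2 + wp_reg z) has_field_derivative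
        - 2 / z ^ 3 + (2 * ?a * z + 4 * ?b * z ^ 3 + 5 * z ^ 4 * T z + z ^ 5 * deriv T z)) (at z)"
      by (intro DERIV_add)
    then have "wpd z = - 2 / z ^ 3 + (2 * ?a * z + 4 * ?b * z ^ 3 + 5 * z ^ 4 * T z + z ^ 5 * deriv T z)"
      using DERIV_unique wp_has_field_derivative[OF not_lattice_ball[OF z]] unfolding wp_eq_reg[abs_def] by blast
    then have w3: "z ^ 3 * wpd z = - 2 + z ^ 3 * (2 * ?a * z + 4 * ?b * z ^ 3 + 5 * z ^ 4 * T z + z ^ 5 * deriv T z)"
    proof -
      assume w: "wpd z = - 2 / z ^ 3 + (2 * ?a * z + 4 * ?b * z ^ 3 + 5 * z ^ 4 * T z + z ^ 5 * deriv T z)"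
      have "z ^ 3 * (- 2 / z ^ 3 + X) = - 2 + z ^ 3 * X" for X using z(2) by (simp add: right_diff_distrib)
      then show ?thesis unfolding w by blast
    qed
    have alg: "z ^ 3 * (2 * a * z + 4 * b * z ^ 3 + 5 * z ^ 4 * t + z ^ 5 * t')
        = z ^ 4 * (2 * a + 4 * b * z\<^sup>2 + 5 * z ^ 3 * t + z ^ 4 * t')" for a b t t' by algebra
    show ?thesis unfolding w3 alg ..
  qed
  show ?thesis
    by (rule that[OF T(1) T' 1]) (use 2 in auto)
qed

lemma eventually_punctured_ball: "\<forall>\<^sub>F z in at 0. z \<in> ball 0 rad \<and> z \<noteq> (0::complex)"
  using eventually_at_ball'[OF rad_pos, of 0 UNIV] by (auto elim: eventually_mono)

lemma tendsto_lattice: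
  assumes "\<And>z w. w \<in> \<Lambda> \<Longrightarrow> F (z + w) = F z" and "(F \<longlongrightarrow> F c) (at c)" "w \<in> \<Lambda>"
  shows "(F \<longlongrightarrow> F (c + w)) (at (c + w))"
proof -
  have "F (x + - w) = F x" for x using assms(1)[of "- w" x] assms(3) by simp
  with LIM_offset[OF assms(2), of "- w"] show ?thesis using assms(1,3) by simp
qed

lemma wp_holomorphic: "wp \<Lambda> holomorphic_on - \<Lambda>"
  using wp_has_field_derivative open_Compl_lattice by (auto simp: holomorphic_on_open)

lemma wzeta_holomorphic: "wzeta \<Lambda> holomorphic_on - \<Lambda>"
  using wzeta_has_field_derivative open_Compl_lattice by (auto simp: holomorphic_on_open)

lemma deriv_wp: "z \<notin> \<Lambda> \<Longrightarrow> deriv (wp \<Lambda>) z = wpd z"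
  by (rule DERIV_imp_deriv[OF wp_has_field_derivative])

lemma wpd_holomorphic: "wpd holomorphic_on - \<Lambda>"
  by (rule holomorphic_transform[OF holomorphic_deriv[OF wp_holomorphic open_Compl_lattice]]) (simp add: deriv_wp)

text \<open>The difference F of the two sides is elliptic and can be singular only on the lattice.
  By the expansions it tends to 0 there, so it is a constant, and the constant is 0.\<close>

lemma wp_ode:
  assumes "z \<notin> \<Lambda>"
  shows "(wpd z)\<^sup>2 = 4 * wp \<Lambda> z ^ 3 - invariant_g2 \<Lambda> * wp \<Lambda> z - invariant_g3 \<Lambda>"
proof -
  let ?g2 = "invariant_g2 \<Lambda>" and ?g3 = "invariant_g3 \<Lambda>"
  define F where "F z = (if z \<in> \<Lambda> then 0 else (wpd z)\<^sup>2 - 4 * wp \<Lambda> z ^ 3 + ?g2 * wp \<Lambda> z + ?g3)" for z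
  obtain T T' where T: "T holomorphic_on ball 0 rad" "T' holomorphic_on ball 0 rad"
    and p: "\<And>z. z \<in> ball 0 rad \<Longrightarrow> z \<noteq> 0 \<Longrightarrow>
      z\<^sup>2 * wp \<Lambda> z = 1 + z ^ 4 * (?g2 / 20 + ?g3 / 28 * z\<^sup>2 + z ^ 3 * T z)"
    and d: "\<And>z. z \<in> ball 0 rad \<Longrightarrow> z \<noteq> 0 \<Longrightarrow>
      z ^ 3 * wpd z = - 2 + z ^ 4 * (?g2 / 10 + ?g3 / 7 * z\<^sup>2 + 5 * z ^ 3 * T z + z ^ 4 * T' z)"
    using wp_expansion by blast
  define A where "A z = ?g2 / 20 + ?g3 / 28 * z\<^sup>2 + z ^ 3 * T z" for z
  define B where "B z = ?g2 / 10 + ?g3 / 7 * z\<^sup>2 + 5 * z ^ 3 * T z + z ^ 4 * T' z" for z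
  \<comment> \<open>F rewritten through z^2 P = 1 + z^4 A and z^3 P' = -2 + z^4 B, after division by
    z^6. Every summand keeps a factor z, so the limit at 0 is 0.\<close>
  define R where "R z = - 32 * z * T z - 4 * z\<^sup>2 * T' z + (z * B z)\<^sup>2 - 12 * (z * A z)\<^sup>2
      - 4 * (z\<^sup>2 * A z) ^ 3 + ?g2 * (z\<^sup>2 * A z)" for z
  have "(R \<longlongrightarrow> R 0) (at 0)"
    unfolding R_def A_def B_def
    by (intro tendsto_intros holomorphic_ball_tendsto_0[OF T(1) rad_pos] holomorphic_ball_tendsto_0[OF T(2) rad_pos])
  then have "(R \<longlongrightarrow> F 0) (at 0)" by (simp add: R_def F_def)
  moreover have "R z = F z" if z: "z \<in> ball 0 rad \<and> z \<noteq> 0" for z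
  proof -
    define P Q where "P = wp \<Lambda> z" and "Q = wpd z"
    have P: "z\<^sup>2 * P = 1 + z ^ 4 * A z" and Q: "z ^ 3 * Q = - 2 + z ^ 4 * B z"
      using p d z by (auto simp: P_def Q_def A_def B_def)
    have "z ^ 6 * (Q\<^sup>2 - 4 * P ^ 3 + ?g2 * P + ?g3) = (z ^ 3 * Q)\<^sup>2 - 4 * (z\<^sup>2 * P) ^ 3 + ?g2 * z ^ 4 * (z\<^sup>2 * P) + ?g3 * z ^ 6"
      by algebra
    also have "\<dots> = z ^ 4 * (- 4 * B z - 12 * A z + ?g2 + ?g3 * z\<^sup>2)
        + z ^ 8 * (B z)\<^sup>2 - 12 * z ^ 8 * (A z)\<^sup>2 - 4 * z ^ 12 * (A z) ^ 3 + ?g2 * z ^ 8 * A z"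
      unfolding P Q by algebra
    also have "- 4 * B z - 12 * A z + ?g2 + ?g3 * z\<^sup>2 = - 32 * z ^ 3 * T z - 4 * z ^ 4 * T' z"
      by (simp add: A_def B_def algebra_simps)
    also have "z ^ 4 * (- 32 * z ^ 3 * T z - 4 * z ^ 4 * T' z)
        + z ^ 8 * (B z)\<^sup>2 - 12 * z ^ 8 * (A z)\<^sup>2 - 4 * z ^ 12 * (A z) ^ 3 + ?g2 * z ^ 8 * A z = z ^ 6 * R z"
      unfolding R_def by algebra
    finally have "R z = Q\<^sup>2 - 4 * P ^ 3 + ?g2 * P + ?g3" using z by simp
    then show ?thesis using not_lattice_ball z by (simp add: F_def P_def Q_def)
  qed
  then have "\<forall>\<^sub>F z in at 0. R z = F z"
    using eventually_punctured_ball by (rule eventually_mono[rotated])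
  ultimately have lim0: "(F \<longlongrightarrow> F 0) (at 0)" by (rule Lim_transform_eventually)
  have per: "F (z + w) = F z" if "w \<in> \<Lambda>" for z w
    using that by (simp add: F_def lattice_add_iff wp_periodic wpd_periodic)
  have hol: "F field_differentiable (at z)" if "z \<notin> \<Lambda>" for z
  proof -
    have "(\<lambda>z. (wpd z)\<^sup>2 - 4 * wp \<Lambda> z ^ 3 + ?g2 * wp \<Lambda> z + ?g3) holomorphic_on - \<Lambda>"
      by (intro holomorphic_intros wp_holomorphic wpd_holomorphic)
    then have "F holomorphic_on - \<Lambda>"
      by (rule holomorphic_transform) (simp add: F_def)
    then show ?thesis using that open_Compl_lattice by (auto simp: holomorphic_on_imp_differentiable_at)
  qed
  have "F z = F 0"
    using tendsto_lattice[OF per lim0] by (intro elliptic_entire_constant[OF finite_lattice_cball hol _ per]) auto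
  then show ?thesis using assms by (simp add: F_def algebra_simps)
qed

end

section \<open>Second derivative, surjectivity and the addition theorem\<close>

context half_periods
begin

lemma field_differentiable_off_lattice:
  "f holomorphic_on - \<Lambda> \<Longrightarrow> z \<notin> \<Lambda> \<Longrightarrow> f field_differentiable (at z)"
  using holomorphic_on_imp_differentiable_at[OF _ open_Compl_lattice, of f z] by simp

lemma wpd_nonzero: obtains z where "z \<notin> \<Lambda>" "wpd z \<noteq> 0"
proof -
  obtain T T' where T: "T holomorphic_on ball 0 rad" "T' holomorphic_on ball 0 rad"
    and p: "\<And>z. z \<in> ball 0 rad \<Longrightarrow> z \<noteq> 0 \<Longrightarrow>
      z\<^sup>2 * wp \<Lambda> z = 1 + z ^ 4 * (invariant_g2 \<Lambda> / 20 + invariant_g3 \<Lambda> / 28 * z\<^sup>2 + z ^ 3 * T z)"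
    and d: "\<And>z. z \<in> ball 0 rad \<Longrightarrow> z \<noteq> 0 \<Longrightarrow>
      z ^ 3 * wpd z = - 2 + z ^ 4 * (invariant_g2 \<Lambda> / 10 + invariant_g3 \<Lambda> / 7 * z\<^sup>2 + 5 * z ^ 3 * T z + z ^ 4 * T' z)"
    using wp_expansion by blast
  let ?f = "\<lambda>z. - 2 + z ^ 4 * (invariant_g2 \<Lambda> / 10 + invariant_g3 \<Lambda> / 7 * z\<^sup>2 + 5 * z ^ 3 * T z + z ^ 4 * T' z)"
  have "(?f \<longlongrightarrow> ?f 0) (at 0)"
    by (intro tendsto_intros holomorphic_ball_tendsto_0[OF T(1) rad_pos] holomorphic_ball_tendsto_0[OF T(2) rad_pos])
  then have "\<forall>\<^sub>F z in at 0. ?f z \<noteq> 0"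
    by (rule tendsto_imp_eventually_ne) simp
  then have "\<forall>\<^sub>F z in at (0::complex). z \<notin> \<Lambda> \<and> wpd z \<noteq> 0"
    using eventually_punctured_ball
  proof eventually_elim
    case (elim z)
    then show ?case using d[of z] not_lattice_ball[of z] by auto
  qed
  then show ?thesis using that eventually_happens[of _ "at (0::complex)"] by auto
qed

text \<open>Differentiating \<open>wp_ode\<close> yields P' times the claim. P' is not identically
  zero because of its pole, so it cancels.\<close>

lemma wpd_has_field_derivative:
  assumes "z \<notin> \<Lambda>"
  shows "(wpd has_field_derivative 6 * (wp \<Lambda> z)\<^sup>2 - invariant_g2 \<Lambda> / 2) (at z)"
proof -
  define W where "W = deriv wpd"
  have W: "(wpd has_field_derivative W z) (at z)" if "z \<notin> \<Lambda>" for z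
    unfolding W_def using holomorphic_derivI[OF wpd_holomorphic open_Compl_lattice] that by simp
  have eq: "wpd z * (2 * W z - 12 * (wp \<Lambda> z)\<^sup>2 + invariant_g2 \<Lambda>) = 0" if z: "z \<in> - \<Lambda>" for z
  proof -
    have "((\<lambda>z. (wpd z)\<^sup>2) has_field_derivative 2 * wpd z * W z) (at z)"
      using W[of z] z by (auto intro!: derivative_eq_intros)
    then have "((\<lambda>z. 4 * wp \<Lambda> z ^ 3 - invariant_g2 \<Lambda> * wp \<Lambda> z - invariant_g3 \<Lambda>) has_field_derivative 2 * wpd z * W z) (at z)"
      by (rule has_field_derivative_transform_within_open[OF _ open_Compl_lattice z]) (simp add: wp_ode)
    moreover have "((\<lambda>z. 4 * wp \<Lambda> z ^ 3 - invariant_g2 \<Lambda> * wp \<Lambda> z - invariant_g3 \<Lambda>) has_field_derivative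
        12 * (wp \<Lambda> z)\<^sup>2 * wpd z - invariant_g2 \<Lambda> * wpd z) (at z)"
      using wp_has_field_derivative[of z] z by (auto intro!: derivative_eq_intros)
    ultimately have "2 * wpd z * W z = 12 * (wp \<Lambda> z)\<^sup>2 * wpd z - invariant_g2 \<Lambda> * wpd z"
      by (rule DERIV_unique)
    then show ?thesis by (simp add: algebra_simps)
  qed
  have hol: "(\<lambda>z. 2 * W z - 12 * (wp \<Lambda> z)\<^sup>2 + invariant_g2 \<Lambda>) holomorphic_on - \<Lambda>"
    unfolding W_def by (intro holomorphic_intros wp_holomorphic holomorphic_deriv wpd_holomorphic open_Compl_lattice)
  obtain z1 where z1: "z1 \<in> - \<Lambda>" "wpd z1 \<noteq> 0" by (rule wpd_nonzero) auto
  have "2 * W z - 12 * (wp \<Lambda> z)\<^sup>2 + invariant_g2 \<Lambda> = 0"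
    by (rule holomorphic_mult_eq_0[OF open_Compl_lattice connected_Compl_lattice wpd_holomorphic hol eq z1])
       (use assms in auto)
  then have "W z = (12 * (wp \<Lambda> z)\<^sup>2 - invariant_g2 \<Lambda>) / 2" by (simp add: field_simps)
  then have "W z = 6 * (wp \<Lambda> z)\<^sup>2 - invariant_g2 \<Lambda> / 2" by (simp add: diff_divide_distrib)
  then show ?thesis using W[OF assms] by simp
qed

text \<open>If e were omitted, 1 / (P - e), set to 0 on the lattice, would be elliptic without poles
  and hence identically 0. This provides spectral points without inverting an elliptic
  integral.\<close>

lemma wp_surj: obtains z where "z \<notin> \<Lambda>" "wp \<Lambda> z = e"
proof (rule ccontr)
  assume "\<not> thesis"
  then have ne: "wp \<Lambda> z - e \<noteq> 0" if "z \<notin> \<Lambda>" for z using that \<open>\<And>z. z \<notin> \<Lambda> \<Longrightarrow> wp \<Lambda> z = e \<Longrightarrow> thesis\<close> by auto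
  define F where "F z = (if z \<in> \<Lambda> then 0 else 1 / (wp \<Lambda> z - e))" for z
  obtain T T' where T: "T holomorphic_on ball 0 rad" "T' holomorphic_on ball 0 rad"
    and p: "\<And>z. z \<in> ball 0 rad \<Longrightarrow> z \<noteq> 0 \<Longrightarrow>
      z\<^sup>2 * wp \<Lambda> z = 1 + z ^ 4 * (invariant_g2 \<Lambda> / 20 + invariant_g3 \<Lambda> / 28 * z\<^sup>2 + z ^ 3 * T z)"
    and d: "\<And>z. z \<in> ball 0 rad \<Longrightarrow> z \<noteq> 0 \<Longrightarrow>
      z ^ 3 * wpd z = - 2 + z ^ 4 * (invariant_g2 \<Lambda> / 10 + invariant_g3 \<Lambda> / 7 * z\<^sup>2 + 5 * z ^ 3 * T z + z ^ 4 * T' z)"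
    using wp_expansion by blast
  let ?f = "\<lambda>z. 1 + z ^ 4 * (invariant_g2 \<Lambda> / 20 + invariant_g3 \<Lambda> / 28 * z\<^sup>2 + z ^ 3 * T z) - z\<^sup>2 * e"
  have "((\<lambda>z. z\<^sup>2 / ?f z) \<longlongrightarrow> 0\<^sup>2 / ?f 0) (at 0)"
    by (intro tendsto_intros holomorphic_ball_tendsto_0[OF T(1) rad_pos]) simp
  moreover have "z\<^sup>2 / ?f z = F z" if z: "z \<in> ball 0 rad \<and> z \<noteq> 0" for z
  proof -
    have "?f z = z\<^sup>2 * (wp \<Lambda> z - e)" using p z by (simp add: right_diff_distrib)
    then show ?thesis using z not_lattice_ball by (simp add: F_def)
  qed
  then have "\<forall>\<^sub>F z in at 0. z\<^sup>2 / ?f z = F z"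
    using eventually_punctured_ball by (rule eventually_mono[rotated])
  ultimately have "(F \<longlongrightarrow> 0\<^sup>2 / ?f 0) (at 0)" by (rule Lim_transform_eventually)
  then have lim0: "(F \<longlongrightarrow> F 0) (at 0)" by (simp add: F_def)
  have per: "F (z + w) = F z" if "w \<in> \<Lambda>" for z w
    using that by (simp add: F_def lattice_add_iff wp_periodic)
  have "(\<lambda>z. 1 / (wp \<Lambda> z - e)) holomorphic_on - \<Lambda>"
    by (intro holomorphic_intros wp_holomorphic) (use ne in auto)
  then have "F holomorphic_on - \<Lambda>"
    by (rule holomorphic_transform) (simp add: F_def)
  then have hol: "F field_differentiable (at z)" if "z \<notin> \<Lambda>" for z
    using that by (rule field_differentiable_off_lattice)
  have F0: "F z = F 0" for z
    using tendsto_lattice[OF per lim0] by (intro elliptic_entire_constant[OF finite_lattice_cball hol _ per]) auto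
  obtain z where "z \<notin> \<Lambda>" using ex_not_lattice by blast
  then show False using F0[of z] ne[of z] by (simp add: F_def)
qed

text \<open>As functions of u the quasi-periods of the two zeta terms cancel, so the difference E of
  the two sides is elliptic with possible singularities at 0 and v modulo periods. At v the factor
  P(u) - P(v) removes the simple pole of zeta, at 0 the expansions cancel; the limit is 0 in both
  cases.\<close>

lemma wzeta_add:
  assumes u: "u \<notin> \<Lambda>" and v: "v \<notin> \<Lambda>" and uv: "u - v \<notin> \<Lambda>"
  shows "2 * (wzeta \<Lambda> (u - v) - wzeta \<Lambda> u + wzeta \<Lambda> v) * (wp \<Lambda> u - wp \<Lambda> v) = wpd u + wpd v"
proof -
  define E where "E u = 2 * (wzeta \<Lambda> (u - v) - wzeta \<Lambda> u + wzeta \<Lambda> v) * (wp \<Lambda> u - wp \<Lambda> v) - wpd u - wpd v" for u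
  define D where "D = {z. z \<in> \<Lambda> \<or> z - v \<in> \<Lambda>}"
  define F where "F z = (if z \<in> D then 0 else E z)" for z
  let ?g2 = "invariant_g2 \<Lambda>" and ?g3 = "invariant_g3 \<Lambda>"
  have D: "finite {w \<in> D. norm w \<le> R}" for R
  proof -
    have "{w \<in> D. norm w \<le> R} \<subseteq> {w \<in> \<Lambda>. norm w \<le> R} \<union> (\<lambda>w. w + v) ` {w \<in> \<Lambda>. norm w \<le> R + norm v}"
    proof
      fix w assume w: "w \<in> {w \<in> D. norm w \<le> R}"
      show "w \<in> {w \<in> \<Lambda>. norm w \<le> R} \<union> (\<lambda>w. w + v) ` {w \<in> \<Lambda>. norm w \<le> R + norm v}"
      proof (cases "w \<in> \<Lambda>")
        case False
        then have "w - v \<in> \<Lambda>" "norm (w - v) \<le> R + norm v"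
          using w norm_triangle_ineq4[of w v] by (auto simp: D_def)
        then show ?thesis by (intro UnI2 image_eqI[of _ _ "w - v"]) auto
      qed (use w in auto)
    qed
    then show ?thesis by (rule finite_subset) (intro finite_UnI finite_imageI finite_lattice_cball)
  qed
  have openD: "open (- D)" using locally_finite_imp_closed(1)[OF D] by (rule open_Compl)
  have Dper: "z + w \<in> D \<longleftrightarrow> z \<in> D" if "w \<in> \<Lambda>" for z w
    using lattice_add_iff[OF that, of z] lattice_add_iff[OF that, of "z - v"] by (simp add: D_def algebra_simps)
  have per: "F (z + w) = F z" if w: "w \<in> \<Lambda>" for z w
  proof (cases "z \<in> D")
    case False
    then have z: "z \<notin> \<Lambda>" "z - v \<notin> \<Lambda>" by (auto simp: D_def)
    obtain \<eta> where \<eta>: "\<And>z. z \<notin> \<Lambda> \<Longrightarrow> wzeta \<Lambda> (z + w) = wzeta \<Lambda> z + \<eta>"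
      using wzeta_quasi_periodic[OF w] by blast
    have "wzeta \<Lambda> (z + w - v) = wzeta \<Lambda> (z - v) + \<eta>" using \<eta>[OF z(2)] by (simp only: diff_add_eq)
    then show ?thesis using False z w by (simp add: F_def Dper E_def \<eta> wp_periodic wpd_periodic)
  qed (simp add: F_def Dper w)
  have hol: "F field_differentiable (at z)" if z: "z \<notin> D" for z
  proof -
    have "(\<lambda>u. wzeta \<Lambda> (u - v)) holomorphic_on - D"
    proof -
      have "wzeta \<Lambda> \<circ> (\<lambda>u. u - v) holomorphic_on - D"
        by (rule holomorphic_on_compose_gen[OF _ wzeta_holomorphic])
           (auto simp: D_def intro!: holomorphic_intros)
      then show ?thesis by (simp add: o_def)
    qed
    moreover have "wzeta \<Lambda> holomorphic_on - D" "wp \<Lambda> holomorphic_on - D" "wpd holomorphic_on - D"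
      using wzeta_holomorphic wp_holomorphic wpd_holomorphic by (auto simp: D_def elim!: holomorphic_on_subset)
    ultimately have "E holomorphic_on - D"
      unfolding E_def by (intro holomorphic_intros)
    then have "F holomorphic_on - D"
      by (rule holomorphic_transform) (simp add: F_def)
    then show ?thesis using z openD by (auto simp: holomorphic_on_imp_differentiable_at)
  qed
  have lim0: "(F \<longlongrightarrow> F 0) (at 0)"
  proof -
    obtain T T' where T: "T holomorphic_on ball 0 rad" "T' holomorphic_on ball 0 rad"
      and p: "\<And>z. z \<in> ball 0 rad \<Longrightarrow> z \<noteq> 0 \<Longrightarrow>
        z\<^sup>2 * wp \<Lambda> z = 1 + z ^ 4 * (?g2 / 20 + ?g3 / 28 * z\<^sup>2 + z ^ 3 * T z)"
      and d: "\<And>z. z \<in> ball 0 rad \<Longrightarrow> z \<noteq> 0 \<Longrightarrow>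
        z ^ 3 * wpd z = - 2 + z ^ 4 * (?g2 / 10 + ?g3 / 7 * z\<^sup>2 + 5 * z ^ 3 * T z + z ^ 4 * T' z)"
      using wp_expansion by blast
    obtain Z where Z: "Z holomorphic_on ball 0 rad" "\<And>z. z \<in> ball 0 rad \<Longrightarrow> zeta_reg z = z ^ 3 * Z z"
      using zeta_reg_expansion by blast
    have "- v \<in> - \<Lambda>" using v by simp
    then obtain r where r: "r > 0" "ball (- v) r \<subseteq> - \<Lambda>" using open_Compl_lattice by (meson openE)
    have nv: "z - v \<notin> \<Lambda>" if "z \<in> ball 0 r" for z using that r(2) by (auto simp: dist_norm subset_iff)
    let ?h = "\<lambda>u. wzeta \<Lambda> (u - v)"
    have d1: "(?h has_field_derivative - wp \<Lambda> (z - v)) (at z)" if "z \<in> ball 0 r" for z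
      using has_field_derivative_shift[of "wzeta \<Lambda>" _ z "- v"] wzeta_has_field_derivative[OF nv[OF that]] by simp
    have d2: "((\<lambda>u. - wp \<Lambda> (u - v)) has_field_derivative - wpd (z - v)) (at z)" if "z \<in> ball 0 r" for z
      using has_field_derivative_shift[of "wp \<Lambda>" _ z "- v"] wp_has_field_derivative[OF nv[OF that]] by (auto intro: DERIV_minus)
    have "?h holomorphic_on ball 0 r" using d1 unfolding holomorphic_on_open[OF open_ball] by blast
    from holomorphic_Taylor_remainder[OF this r(1), of 3] obtain Y where Y: "Y holomorphic_on ball 0 r"
      "\<And>z. z \<in> ball 0 r \<Longrightarrow> ?h z = (\<Sum>k<3. (deriv ^^ k) ?h 0 / fact k * z ^ k) + z ^ 3 * Y z" by blast
    have 0: "0 \<in> ball 0 r" using r by simp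
    have "deriv ?h 0 = - wp \<Lambda> v" using DERIV_imp_deriv[OF d1[OF 0]] by (simp add: wp_minus)
    moreover have "(deriv ?h has_field_derivative - wpd (0 - v)) (at 0)"
      by (rule has_field_derivative_transform_within_open[OF d2[OF 0] open_ball 0])
         (simp add: DERIV_imp_deriv[OF d1])
    then have "deriv (deriv ?h) 0 = wpd v" by (simp add: DERIV_imp_deriv wpd_minus)
    ultimately have "(\<Sum>k<3. (deriv ^^ k) ?h 0 / fact k * z ^ k) = - wzeta \<Lambda> v - wp \<Lambda> v * z + wpd v / 2 * z\<^sup>2" for z
      by (simp add: eval_nat_numeral wzeta_minus)
    with Y(2) have Y2: "\<And>z. z \<in> ball 0 r \<Longrightarrow> ?h z = - wzeta \<Lambda> v - wp \<Lambda> v * z + wpd v / 2 * z\<^sup>2 + z ^ 3 * Y z" by simp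
    define A where "A z = ?g2 / 20 + ?g3 / 28 * z\<^sup>2 + z ^ 3 * T z" for z
    define B where "B z = ?g2 / 10 + ?g3 / 7 * z\<^sup>2 + 5 * z ^ 3 * T z + z ^ 4 * T' z" for z
    define X where "X z = Y z - Z z" for z
    define p0 d0 where "p0 = wp \<Lambda> v" and "d0 = wpd v / 2"
    \<comment> \<open>What remains of E when the expansions are inserted into z^3 E and z^3 is
      divided out; the common factor z gives the limit 0.\<close>
    define R where "R z = z * (- 2 * A z + 2 * p0\<^sup>2 - 2 * p0 * z\<^sup>2 * A z - 2 * d0 * p0 * z + 2 * d0 * z ^ 3 * A z
        + 2 * X z * (1 - p0 * z\<^sup>2 + z ^ 4 * A z) - B z)" for z
    have "(R \<longlongrightarrow> R 0) (at 0)"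
      unfolding R_def A_def B_def X_def
      by (intro tendsto_intros holomorphic_ball_tendsto_0[OF T(1) rad_pos] holomorphic_ball_tendsto_0[OF T(2) rad_pos]
          holomorphic_ball_tendsto_0[OF Z(1) rad_pos] holomorphic_ball_tendsto_0[OF Y(1) r(1)])
    then have lim: "(R \<longlongrightarrow> F 0) (at 0)" by (simp add: R_def F_def D_def)
    have eq: "R z = F z" if z: "z \<in> ball 0 rad \<and> z \<noteq> 0" and zr: "z \<in> ball 0 r" for z
    proof -
      define P Q q where "P = wp \<Lambda> z" and "Q = wpd z" and "q = wzeta \<Lambda> (z - v) - wzeta \<Lambda> z + wzeta \<Lambda> v"
      have P: "z\<^sup>2 * P = 1 + z ^ 4 * A z" and Q: "z ^ 3 * Q = - 2 + z ^ 4 * B z"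
        using p d z by (auto simp: P_def Q_def A_def B_def)
      have "z * wzeta \<Lambda> z = 1 + z ^ 4 * Z z"
        using z Z(2) by (simp add: wzeta_eq_reg distrib_left eval_nat_numeral)
      then have q: "z * q = - 1 - p0 * z\<^sup>2 + d0 * z ^ 3 + z ^ 4 * X z"
        unfolding q_def Y2[OF zr] right_diff_distrib distrib_left
        by (simp add: p0_def d0_def X_def algebra_simps eval_nat_numeral)
      have "z ^ 3 * E z = 2 * (z * q) * (z\<^sup>2 * P - z\<^sup>2 * p0) - z ^ 3 * Q - z ^ 3 * (2 * d0)"
        unfolding E_def P_def[symmetric] Q_def[symmetric] q_def[symmetric] p0_def[symmetric]
        by (simp add: d0_def algebra_simps eval_nat_numeral)
      also have "\<dots> = z ^ 3 * R z"
        unfolding P Q q R_def by algebra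
      finally have "E z = R z" using z by simp
      then show ?thesis using not_lattice_ball[of z] z nv[OF zr] by (simp add: F_def D_def)
    qed
    have "\<forall>\<^sub>F z in at 0. z \<in> ball (0::complex) r"
      using r(1) by (auto simp: eventually_at intro!: exI[of _ r] simp: dist_commute)
    then have "\<forall>\<^sub>F z in at 0. R z = F z"
      using eventually_punctured_ball by eventually_elim (rule eq)
    with lim show ?thesis by (rule Lim_transform_eventually)
  qed
  have limv: "(F \<longlongrightarrow> F v) (at v)"
  proof -
    obtain Z where Z: "Z holomorphic_on ball 0 rad" "\<And>z. z \<in> ball 0 rad \<Longrightarrow> zeta_reg z = z ^ 3 * Z z"
      using zeta_reg_expansion by blast
    have cont: "((\<lambda>h. f (v + h)) \<longlongrightarrow> f v) (at 0)" if "f holomorphic_on - \<Lambda>" for f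
      using LIM_offset[of f "f v" v v] field_differentiable_imp_continuous_at[OF field_differentiable_off_lattice[OF that v]]
      by (simp add: isCont_def add.commute)
    \<comment> \<open>The pole 1/h of zeta (u - v) is merged with P(v + h) - P(v) into a difference
      quotient, whose doubled limit 2 P'(v) cancels the two terms at the end.\<close>
    define R where "R h = 2 * ((wp \<Lambda> (v + h) - wp \<Lambda> v) / h) + 2 * (h ^ 3 * Z h - wzeta \<Lambda> (v + h) + wzeta \<Lambda> v) * (wp \<Lambda> (v + h) - wp \<Lambda> v)
        - wpd (v + h) - wpd v" for h
    have "((\<lambda>h. (wp \<Lambda> (v + h) - wp \<Lambda> v) / h) \<longlongrightarrow> wpd v) (at 0)"
      using wp_has_field_derivative[OF v] by (simp add: DERIV_def)
    then have "(R \<longlongrightarrow> 2 * wpd v + 2 * (0 ^ 3 * Z 0 - wzeta \<Lambda> v + wzeta \<Lambda> v) * (wp \<Lambda> v - wp \<Lambda> v) - wpd v - wpd v) (at 0)"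
      unfolding R_def
      by (intro tendsto_intros holomorphic_ball_tendsto_0[OF Z(1) rad_pos] cont wp_holomorphic wzeta_holomorphic wpd_holomorphic)
    then have lim: "(R \<longlongrightarrow> F v) (at 0)" by (simp add: F_def D_def)
    have eq: "R h = F (h + v)" if h: "h \<in> ball 0 rad \<and> h \<noteq> 0" and hv: "h \<in> ball 0 r" and r: "ball v r \<subseteq> - \<Lambda>" for h r
    proof -
      have "v + h \<in> ball v r" using hv by (simp add: dist_norm)
      then have n: "h + v \<notin> D" using h not_lattice_ball[of h] r by (auto simp: D_def add.commute)
      have "F (h + v) = 2 * (1 / h + h ^ 3 * Z h - wzeta \<Lambda> (v + h) + wzeta \<Lambda> v) * (wp \<Lambda> (v + h) - wp \<Lambda> v) - wpd (v + h) - wpd v"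
        using n Z(2)[of h] h by (simp add: F_def E_def wzeta_eq_reg[of h] add.commute)
      then show ?thesis using h by (simp add: R_def ring_distribs diff_divide_distrib)
    qed
    obtain r where "r > 0" and r: "ball v r \<subseteq> - \<Lambda>" using open_Compl_lattice v by (meson ComplI openE)
    then have "\<forall>\<^sub>F z in at 0. z \<in> ball (0::complex) r"
      by (auto simp: eventually_at intro!: exI[of _ r] simp: dist_commute)
    then have "\<forall>\<^sub>F h in at 0. R h = F (h + v)"
      using eventually_punctured_ball
    proof eventually_elim
      case (elim h)
      show ?case using elim(2,1) r by (rule eq)
    qed
    with lim have "((\<lambda>h. F (h + v)) \<longlongrightarrow> F v) (at 0)" by (rule Lim_transform_eventually)
    from LIM_offset[OF this, of "- v"] show ?thesis by simp
  qed
  have "F u = F 0"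
  proof (rule elliptic_entire_constant[OF D hol _ per])
    fix z assume "z \<in> D"
    then consider "z \<in> \<Lambda>" | "z - v \<in> \<Lambda>" by (auto simp: D_def)
    then show "(F \<longlongrightarrow> F z) (at z)"
    proof cases
      case 1
      then show ?thesis using tendsto_lattice[OF per lim0, of z] by simp
    next
      case 2
      then show ?thesis using tendsto_lattice[OF per limv, of "z - v"] by simp
    qed
  qed
  then have "E u = 0" using u uv by (simp add: F_def D_def)
  then show ?thesis unfolding E_def by algebra
qed

end

section \<open>Reality\<close>

lemma cnj_cnj_holomorphic:
  assumes "f holomorphic_on A" "open A"
  shows "(\<lambda>z. cnj (f (cnj z))) holomorphic_on cnj ` A"
proof -
  have "cnj ` cnj ` A = A" by (simp add: image_image)
  moreover have "open (cnj ` A)"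
    unfolding image_cnj_conv_vimage_cnj using assms(2) by (intro open_vimage) (auto intro: continuous_intros)
  ultimately show ?thesis
    using holomorphic_on_compose_cnj_cnj[of f "cnj ` A"] assms by (simp add: o_def)
qed

lemma cnj_cnj_deriv:
  "(f has_field_derivative d) (at (cnj z)) \<Longrightarrow> ((\<lambda>z. cnj (f (cnj z))) has_field_derivative cnj d) (at z)"
  using has_field_derivative_cnj_cnj[of f d z] by (simp add: o_def)

text \<open>The lowest term \<open>z\<^sup>n\<close> of \<open>d\<close> has \<open>n \<ge> 5\<close>, but the indicial equation is \<open>n (n - 1) = 12\<close>.\<close>

lemma second_order_ode_zero:
  assumes d: "d holomorphic_on ball 0 r" and s: "s holomorphic_on ball 0 r" and e: "e holomorphic_on ball 0 r" and r: "r > 0"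
    and ode: "\<And>z. z \<in> ball 0 r \<Longrightarrow> z \<noteq> 0 \<Longrightarrow> z\<^sup>2 * deriv (deriv d) z = (12 + z\<^sup>2 * s z) * d z"
    and de: "\<And>z. z \<in> ball 0 r \<Longrightarrow> d z = z ^ 5 * e z" and z: "z \<in> ball 0 r"
  shows "d z = 0"
proof (rule ccontr)
  assume "d z \<noteq> 0"
  have 0: "(0::complex) \<in> ball 0 r" using r by simp
  have d0: "d 0 = 0" using de[OF 0] by simp
  have nc: "\<not> d constant_on ball 0 r"
    using \<open>d z \<noteq> 0\<close> d0 z 0 unfolding constant_on_def by metis
  obtain g r' n where n: "0 < n" and r': "0 < r'" "ball (0::complex) r' \<subseteq> ball 0 r" and g: "g holomorphic_on ball 0 r'"
    and dg: "\<And>w. w \<in> ball 0 r' \<Longrightarrow> d w = (w - 0) ^ n * g w" and g0: "\<And>w. w \<in> ball 0 r' \<Longrightarrow> g w \<noteq> 0"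
  proof (rule holomorphic_factor_zero_nonconstant[OF d open_ball connected_ball 0 d0 nc])
    fix g :: "complex \<Rightarrow> complex" and r' n
    assume a: "0 < n" "0 < r'" "ball (0::complex) r' \<subseteq> ball 0 r" "g holomorphic_on ball 0 r'"
      and b: "\<And>w. w \<in> ball 0 r' \<Longrightarrow> d w = (w - 0) ^ n * g w" and c: "\<And>w. w \<in> ball 0 r' \<Longrightarrow> g w \<noteq> 0"
    show ?thesis by (rule that[OF a]) (fact b, fact c)
  qed
  have 0: "(0::complex) \<in> ball 0 r'" using r' by simp
  have ev: "\<forall>\<^sub>F w in at (0::complex). w \<in> ball 0 r' \<and> w \<noteq> 0"
    using eventually_at_ball'[OF r'(1), of 0 UNIV] by (auto elim: eventually_mono)
  note lim = holomorphic_ball_tendsto_0[OF _ r'(1)]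
  have n5: "n \<ge> 5"
  proof (rule ccontr)
    assume "\<not> n \<ge> 5"
    then obtain j where j: "5 = n + Suc j" by (metis add_Suc_right less_imp_Suc_add not_le)
    have "\<forall>\<^sub>F w in at 0. w ^ Suc j * e w = g w"
      using ev
    proof eventually_elim
      case (elim w)
      then have "w ^ n * g w = w ^ n * (w ^ Suc j * e w)"
        using dg[of w] de[of w] r'(2) unfolding j power_add by (auto simp: mult.assoc)
      then show ?case using elim by simp
    qed
    moreover have "((\<lambda>w. w ^ Suc j * e w) \<longlongrightarrow> 0 ^ Suc j * e 0) (at 0)"
      using holomorphic_ball_tendsto_0[OF e r] by (intro tendsto_intros)
    ultimately have "(g \<longlongrightarrow> 0 ^ Suc j * e 0) (at 0)" by (rule Lim_transform_eventually[rotated])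
    then have "g 0 = 0 ^ Suc j * e 0" using lim[OF g] by (intro tendsto_unique[of "at 0" g]) auto
    then show False using g0[OF 0] by simp
  qed
  \<comment> \<open>A second derivative of z^n is taken; with n = k + 2 all exponents stay natural
    numbers.\<close>
  define k where "k = n - 2"
  have nk: "n = k + 2" and k: "k \<ge> 3" using n5 by (auto simp: k_def)
  define g1 g2 where "g1 = deriv g" and "g2 = deriv g1"
  have hol: "g1 holomorphic_on ball 0 r'" "g2 holomorphic_on ball 0 r'"
    unfolding g1_def g2_def using g by (auto intro!: holomorphic_deriv)
  have G: "(g has_field_derivative g1 w) (at w)" "(g1 has_field_derivative g2 w) (at w)" if "w \<in> ball 0 r'" for w
    unfolding g1_def g2_def
    using holomorphic_derivI[OF g open_ball that] holomorphic_derivI[OF hol(1) open_ball that] by (simp_all add: g1_def)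
  have pw: "((\<lambda>w. w ^ Suc j) has_field_derivative of_nat (Suc j) * w ^ j) (at w)" for j and w :: complex
    using DERIV_power[OF DERIV_ident, of "Suc j" w] by simp
  let ?d1 = "\<lambda>w. of_nat (k + 2) * w ^ (k + 1) * g w + w ^ (k + 2) * g1 w"
  have D1: "deriv d w = ?d1 w" if w: "w \<in> ball 0 r'" for w
  proof -
    have "((\<lambda>w. w ^ (k + 2) * g w) has_field_derivative ?d1 w) (at w)"
      using DERIV_mult[OF pw[of "k + 1" w] G(1)[OF w]] by (simp add: mult_ac)
    then have "(d has_field_derivative ?d1 w) (at w)"
      by (rule has_field_derivative_transform_within_open[OF _ open_ball w]) (simp add: dg nk)
    then show ?thesis by (rule DERIV_imp_deriv)
  qed
  let ?b = "\<lambda>w. of_nat ((k + 2) * (k + 1)) * g w + 2 * of_nat (k + 2) * w * g1 w + w\<^sup>2 * g2 w"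
  have D2: "deriv (deriv d) w = w ^ k * ?b w" if w: "w \<in> ball 0 r'" for w
  proof -
    have "(?d1 has_field_derivative of_nat (k + 2) * (of_nat (k + 1) * w ^ k * g w + g1 w * w ^ (k + 1))
        + (of_nat (k + 2) * w ^ (k + 1) * g1 w + g2 w * w ^ (k + 2))) (at w)"
      using DERIV_add[OF DERIV_cmult[OF DERIV_mult[OF pw[of k w] G(1)[OF w]], of "of_nat (k + 2)"]
          DERIV_mult[OF pw[of "k + 1" w] G(2)[OF w]]] by (simp add: mult.assoc)
    also have "of_nat (k + 2) * (of_nat (k + 1) * w ^ k * g w + g1 w * w ^ (k + 1))
        + (of_nat (k + 2) * w ^ (k + 1) * g1 w + g2 w * w ^ (k + 2)) = w ^ k * ?b w"
      by (simp add: algebra_simps power2_eq_square)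
    finally have "(?d1 has_field_derivative w ^ k * ?b w) (at w)" .
    then have "(deriv d has_field_derivative w ^ k * ?b w) (at w)"
      by (rule has_field_derivative_transform_within_open[OF _ open_ball w]) (simp add: D1)
    then show ?thesis by (rule DERIV_imp_deriv)
  qed
  have "\<forall>\<^sub>F w in at 0. ?b w = (12 + w\<^sup>2 * s w) * g w"
    using ev
  proof eventually_elim
    case (elim w)
    then have "w\<^sup>2 * (w ^ k * ?b w) = (12 + w\<^sup>2 * s w) * (w ^ (k + 2) * g w)"
      using ode[of w] dg[of w] D2[of w] r'(2) by (auto simp: nk)
    moreover have "w ^ (k + 2) * X = w\<^sup>2 * (w ^ k * X)" for X by (simp add: power_add power2_eq_square mult_ac)
    ultimately have "w ^ (k + 2) * ?b w = w ^ (k + 2) * ((12 + w\<^sup>2 * s w) * g w)"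
      by (simp only: mult.left_commute)
    moreover have "w ^ (k + 2) \<noteq> 0" using elim by simp
    ultimately show ?case by (blast dest: mult_left_cancel[THEN iffD1])
  qed
  moreover have "(?b \<longlongrightarrow> ?b 0) (at 0)"
    by (intro tendsto_intros lim g hol)
  ultimately have "((\<lambda>w. (12 + w\<^sup>2 * s w) * g w) \<longlongrightarrow> ?b 0) (at 0)"
    by (rule Lim_transform_eventually[rotated])
  moreover have "((\<lambda>w. (12 + w\<^sup>2 * s w) * g w) \<longlongrightarrow> (12 + 0\<^sup>2 * s 0) * g 0) (at 0)"
    by (intro tendsto_intros lim g holomorphic_ball_tendsto_0[OF s r])
  ultimately have "?b 0 = (12 + 0\<^sup>2 * s 0) * g 0" by (intro tendsto_unique) auto
  then have "of_nat ((k + 2) * (k + 1)) = (of_nat 12 :: complex)" using g0[OF 0] by simp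
  then have "(k + 2) * (k + 1) = 12" unfolding of_nat_eq_iff .
  moreover have "(k + 2) * (k + 1) \<ge> 5 * 4" using k by (intro mult_le_mono) auto
  ultimately show False by simp
qed

context half_periods
begin

text \<open>Insert P = 1/z^2 + \<open>wp_reg\<close> into P'' = 6 P^2 - g2 / 2: the poles of order
  four cancel and the mixed term 12 \<open>wp_reg\<close> / z^2 remains. It is the source of the 12
  in \<open>second_order_ode_zero\<close>.\<close>

lemma wp_reg_second_deriv:
  assumes z: "z \<in> ball 0 rad" "z \<noteq> 0"
  shows "(deriv wp_reg has_field_derivative 12 * wp_reg z / z\<^sup>2 + 6 * (wp_reg z)\<^sup>2 - invariant_g2 \<Lambda> / 2) (at z)"
proof -
  have w: "deriv wp_reg u = wpd u + 2 / u ^ 3" if u: "u \<in> ball 0 rad - {0}" for u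
  proof -
    have "((\<lambda>z. wp \<Lambda> z - 1 / (z - 0) ^ 2) has_field_derivative wpd u - - of_nat 2 / (u - 0) ^ Suc 2) (at u)"
      using u by (intro DERIV_diff wp_has_field_derivative not_lattice_ball inverse_power_deriv) auto
    moreover have "(\<lambda>z. wp \<Lambda> z - 1 / (z - 0) ^ 2) = wp_reg" by (simp add: wp_eq_reg)
    ultimately show ?thesis by (simp add: DERIV_imp_deriv eval_nat_numeral)
  qed
  have "((\<lambda>z. wpd z + 2 * (1 / (z - 0) ^ 3)) has_field_derivative
      (6 * (wp \<Lambda> z)\<^sup>2 - invariant_g2 \<Lambda> / 2) + 2 * (- of_nat 3 / (z - 0) ^ Suc 3)) (at z)"
    using z by (intro DERIV_add DERIV_cmult wpd_has_field_derivative not_lattice_ball inverse_power_deriv)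
  then have "(deriv wp_reg has_field_derivative
      (6 * (wp \<Lambda> z)\<^sup>2 - invariant_g2 \<Lambda> / 2) + 2 * (- of_nat 3 / (z - 0) ^ Suc 3)) (at z)"
    by (rule has_field_derivative_transform_within_open[of _ _ _ "ball 0 rad - {0}"]) (use z w in auto)
  moreover have "(6 * (wp \<Lambda> z)\<^sup>2 - invariant_g2 \<Lambda> / 2) + 2 * (- of_nat 3 / (z - 0) ^ Suc 3)
      = 12 * wp_reg z / z\<^sup>2 + 6 * (wp_reg z)\<^sup>2 - invariant_g2 \<Lambda> / 2"
    using z(2) by (simp add: wp_eq_reg[of z] power2_sum power_divide eval_nat_numeral algebra_simps)
  ultimately show ?thesis by (simp only:)
qed

text \<open>The difference of \<open>wp_reg\<close> and its reflection R solves a linear equation,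
  because 6 (\<open>wp_reg\<close>^2 - R^2) contains this difference as a factor. Real invariants
  make the Taylor coefficients up to z^4 agree, so the difference is z^5 times a holomorphic
  function and vanishes by \<open>second_order_ode_zero\<close>.\<close>

lemma wp_cnj_ball:
  assumes real: "invariant_g2 \<Lambda> \<in> \<real>" "invariant_g3 \<Lambda> \<in> \<real>" and z: "z \<in> ball 0 rad"
  shows "cnj (wp \<Lambda> (cnj z)) = wp \<Lambda> z"
proof -
  define R where "R = (\<lambda>z. cnj (wp_reg (cnj z)))"
  obtain T where T: "T holomorphic_on ball 0 rad"
    "\<And>z. z \<in> ball 0 rad \<Longrightarrow> wp_reg z = invariant_g2 \<Lambda> / 20 * z\<^sup>2 + invariant_g3 \<Lambda> / 28 * z ^ 4 + z ^ 5 * T z"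
    using wp_reg_expansion by blast
  define T1 where "T1 = (\<lambda>z. cnj (T (cnj z)))"
  have im: "cnj ` ball 0 rad = ball 0 rad"
    by (auto simp: image_cnj_conv_vimage_cnj)
  have hol: "R holomorphic_on ball 0 rad" "T1 holomorphic_on ball 0 rad"
    using cnj_cnj_holomorphic[OF wp_reg_holomorphic open_ball] cnj_cnj_holomorphic[OF T(1) open_ball]
    unfolding R_def T1_def im by auto
  have c: "cnj z \<in> ball 0 rad" if "z \<in> ball 0 rad" for z using that by simp
  have cg: "cnj (invariant_g2 \<Lambda>) = invariant_g2 \<Lambda>" "cnj (invariant_g3 \<Lambda>) = invariant_g3 \<Lambda>"
    using real by (auto simp: Reals_cnj_iff)
  have RT: "R z = invariant_g2 \<Lambda> / 20 * z\<^sup>2 + invariant_g3 \<Lambda> / 28 * z ^ 4 + z ^ 5 * T1 z" if "z \<in> ball 0 rad" for z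
    unfolding R_def T(2)[OF c[OF that]] by (simp add: T1_def cg)
  have R1: "deriv R z = cnj (deriv wp_reg (cnj z))" if "z \<in> ball 0 rad" for z
    unfolding R_def using holomorphic_derivI[OF wp_reg_holomorphic open_ball c[OF that]]
    by (intro DERIV_imp_deriv cnj_cnj_deriv)
  have R2: "(deriv R has_field_derivative 12 * R z / z\<^sup>2 + 6 * (R z)\<^sup>2 - invariant_g2 \<Lambda> / 2) (at z)"
    if z: "z \<in> ball 0 rad" "z \<noteq> 0" for z
  proof -
    from wp_reg_second_deriv[of "cnj z"] z
    have "((\<lambda>z. cnj (deriv wp_reg (cnj z))) has_field_derivative
        cnj (12 * wp_reg (cnj z) / (cnj z)\<^sup>2 + 6 * (wp_reg (cnj z))\<^sup>2 - invariant_g2 \<Lambda> / 2)) (at z)"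
      by (intro cnj_cnj_deriv) auto
    then have "(deriv R has_field_derivative
        cnj (12 * wp_reg (cnj z) / (cnj z)\<^sup>2 + 6 * (wp_reg (cnj z))\<^sup>2 - invariant_g2 \<Lambda> / 2)) (at z)"
      by (rule has_field_derivative_transform_within_open[OF _ open_ball z(1)]) (simp add: R1)
    then show ?thesis by (simp add: R_def cg)
  qed
  have dd: "deriv (\<lambda>z. wp_reg z - R z) z = deriv wp_reg z - deriv R z" if "z \<in> ball 0 rad" for z
    using holomorphic_derivI[OF wp_reg_holomorphic open_ball that] holomorphic_derivI[OF hol(1) open_ball that]
    by (intro DERIV_imp_deriv DERIV_diff)
  have "wp_reg z - R z = 0"
  proof (rule second_order_ode_zero[OF _ _ _ rad_pos _ _ z])
    show "(\<lambda>z. wp_reg z - R z) holomorphic_on ball 0 rad" "(\<lambda>z. 6 * (wp_reg z + R z)) holomorphic_on ball 0 rad"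
      "(\<lambda>z. T z - T1 z) holomorphic_on ball 0 rad"
      using hol wp_reg_holomorphic T(1) by (auto intro!: holomorphic_intros)
    fix z :: complex assume z: "z \<in> ball 0 rad"
    show "wp_reg z - R z = z ^ 5 * (T z - T1 z)" by (simp add: RT[OF z] T(2)[OF z] right_diff_distrib)
    assume nz: "z \<noteq> 0"
    have "((\<lambda>z. deriv wp_reg z - deriv R z) has_field_derivative
       (12 * wp_reg z / z\<^sup>2 + 6 * (wp_reg z)\<^sup>2 - invariant_g2 \<Lambda> / 2) - (12 * R z / z\<^sup>2 + 6 * (R z)\<^sup>2 - invariant_g2 \<Lambda> / 2)) (at z)"
      by (intro DERIV_diff R2 wp_reg_second_deriv z nz)
    then have "(deriv (\<lambda>z. wp_reg z - R z) has_field_derivative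
       (12 * wp_reg z / z\<^sup>2 + 6 * (wp_reg z)\<^sup>2 - invariant_g2 \<Lambda> / 2) - (12 * R z / z\<^sup>2 + 6 * (R z)\<^sup>2 - invariant_g2 \<Lambda> / 2)) (at z)"
      by (rule has_field_derivative_transform_within_open[OF _ open_ball z]) (simp add: dd)
    then have "deriv (deriv (\<lambda>z. wp_reg z - R z)) z =
       (12 * wp_reg z / z\<^sup>2 + 6 * (wp_reg z)\<^sup>2 - invariant_g2 \<Lambda> / 2) - (12 * R z / z\<^sup>2 + 6 * (R z)\<^sup>2 - invariant_g2 \<Lambda> / 2)"
      by (rule DERIV_imp_deriv)
    also have "z\<^sup>2 * \<dots> = (12 + z\<^sup>2 * (6 * (wp_reg z + R z))) * (wp_reg z - R z)"
      using nz by (simp add: right_diff_distrib distrib_left distrib_right left_diff_distrib power2_eq_square)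
    finally show "z\<^sup>2 * deriv (deriv (\<lambda>z. wp_reg z - R z)) z = (12 + z\<^sup>2 * (6 * (wp_reg z + R z))) * (wp_reg z - R z)" .
  qed
  then show ?thesis by (simp add: wp_eq_reg R_def)
qed

text \<open>The lattice may fail to be invariant under conjugation, so the conjugates of its points
  are removed as well. Removing a countable set keeps the domain connected.\<close>

definition sym_domain :: "complex set" where "sym_domain = - (\<Lambda> \<union> cnj ` \<Lambda>)"

lemma
  shows open_sym_domain: "open sym_domain" and connected_sym_domain: "connected sym_domain"
    and cnj_sym_domain: "cnj z \<in> sym_domain \<longleftrightarrow> z \<in> sym_domain" and sym_domain_subset: "sym_domain \<subseteq> - \<Lambda>"
proof -
  have "open (cnj -` (- \<Lambda>))"
    using open_Compl_lattice by (intro open_vimage) (auto intro: continuous_intros)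
  moreover have "sym_domain = - \<Lambda> \<inter> cnj -` (- \<Lambda>)"
    by (auto simp: sym_domain_def image_cnj_conv_vimage_cnj)
  ultimately show "open sym_domain" using open_Compl_lattice by (simp add: open_Int)
  show "connected sym_domain"
    unfolding sym_domain_def by (intro connected_Compl_countable) (auto simp: countable_lattice)
  show "cnj z \<in> sym_domain \<longleftrightarrow> z \<in> sym_domain" "sym_domain \<subseteq> - \<Lambda>"
    by (auto simp: sym_domain_def image_cnj_conv_vimage_cnj)
qed

text \<open>Only the invariants are known to be real, not the lattice: \<open>wp\<close> and its conjugate satisfy the
  same differential equation with the same principal part at \<open>0\<close>.\<close>

lemma wp_cnj:
  assumes real: "invariant_g2 \<Lambda> \<in> \<real>" "invariant_g3 \<Lambda> \<in> \<real>" and z: "z \<in> sym_domain"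
  shows "cnj (wp \<Lambda> (cnj z)) = wp \<Lambda> z" and "cnj (wpd (cnj z)) = wpd z"
proof -
  have hol: "(\<lambda>z. cnj (wp \<Lambda> (cnj z))) holomorphic_on sym_domain"
    using cnj_cnj_holomorphic[OF wp_holomorphic open_Compl_lattice]
    by (rule holomorphic_on_subset) (auto simp: sym_domain_def image_cnj_conv_vimage_cnj)
  let ?B = "ball (0::complex) rad - {0}"
  have B: "?B \<subseteq> sym_domain"
    using not_lattice_ball by (auto simp: sym_domain_def image_cnj_conv_vimage_cnj)
  have "complex_of_real (rad / 2) \<in> ?B" using rad_pos by simp
  then have ne: "?B \<noteq> {}" unfolding ex_in_conv[symmetric] by (rule exI)
  have open_B: "open ?B" by (simp add: open_delete)
  have hol': "wp \<Lambda> holomorphic_on sym_domain" by (rule holomorphic_on_subset[OF wp_holomorphic sym_domain_subset])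
  have eq: "cnj (wp \<Lambda> (cnj z)) = wp \<Lambda> z" if "z \<in> sym_domain" for z
    by (rule analytic_continuation_open[OF open_B open_sym_domain ne connected_sym_domain B hol hol' _ that])
       (rule wp_cnj_ball[OF real], simp)
  show "cnj (wp \<Lambda> (cnj z)) = wp \<Lambda> z" by (rule eq[OF z])
  have "cnj z \<notin> \<Lambda>" "z \<notin> \<Lambda>" using z cnj_sym_domain sym_domain_subset by auto
  then have "((\<lambda>z. cnj (wp \<Lambda> (cnj z))) has_field_derivative cnj (wpd (cnj z))) (at z)"
    by (intro cnj_cnj_deriv wp_has_field_derivative)
  then have "(wp \<Lambda> has_field_derivative cnj (wpd (cnj z))) (at z)"
    by (rule has_field_derivative_transform_within_open[OF _ open_sym_domain z]) (simp add: eq)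
  then show "cnj (wpd (cnj z)) = wpd z"
    using wp_has_field_derivative[OF \<open>z \<notin> \<Lambda>\<close>] DERIV_unique by blast
qed

lemma real_sym_domain: "of_real x \<in> sym_domain \<longleftrightarrow> of_real x \<notin> \<Lambda>"
  by (auto simp: sym_domain_def image_cnj_conv_vimage_cnj)

end

section \<open>The spectral problem\<close>

context half_periods
begin

text \<open>Centring at the half-period makes x = 0 a regular point at which P' vanishes. Modes are
  normalised and factors are cancelled there.\<close>

definition pdom :: "complex set" where "pdom = {x. x + of_real \<omega>1 \<notin> \<Lambda>}"

lemma dom_iff: "x \<in> pdom \<longleftrightarrow> x + of_real \<omega>1 \<notin> \<Lambda>"
  by (simp add: pdom_def)

lemma dom_eq: "pdom = (\<lambda>z. z - of_real \<omega>1) ` (- \<Lambda>)"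
  by (auto simp: pdom_def image_iff) (metis ComplI add_diff_cancel_right')

lemma open_dom: "open pdom"
  unfolding dom_eq using open_translation[OF open_Compl_lattice, of "- of_real \<omega>1"] by simp

lemma connected_dom: "connected pdom"
  unfolding dom_eq by (intro connected_continuous_image connected_Compl_lattice continuous_intros)

lemma \<omega>1_not_lattice: "of_real \<omega>1 \<notin> \<Lambda>"
proof
  assume "of_real \<omega>1 \<in> \<Lambda>"
  then obtain m :: int where "\<omega>1 = of_int m * (2 * \<omega>1)" using lattice_real_iff by blast
  then have "of_int (2 * m) = (1::real)" using \<omega>1_pos by simp
  then have "2 * m = 1" by linarith
  then show False by presburger
qed

lemma zero_in_dom [simp]: "0 \<in> pdom"
  using \<omega>1_not_lattice by (simp add: pdom_def)

lemma wpd_\<omega>1: "wpd (of_real \<omega>1) = 0"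
proof -
  have "wpd (- of_real \<omega>1 + 2 * of_real \<omega>1) = wpd (- of_real \<omega>1)"
    by (rule wpd_periodic) simp
  then have "wpd (of_real \<omega>1) = - wpd (of_real \<omega>1)" by (simp add: wpd_minus)
  then show ?thesis by simp
qed

text \<open>The Hermite-Halphen solution of Lame's equation, a Baker-Akhiezer function with spectral
  parameter v, normalised to the value 1 at x = 0.\<close>

definition baker :: "complex \<Rightarrow> complex \<Rightarrow> complex" where
  "baker v x = wsigma \<Lambda> (x + of_real \<omega>1 - v) * wsigma \<Lambda> (of_real \<omega>1)
     / (wsigma \<Lambda> (x + of_real \<omega>1) * wsigma \<Lambda> (of_real \<omega>1 - v)) * exp (wzeta \<Lambda> v * x)"

lemma holomorphic_shift: "f holomorphic_on A \<Longrightarrow> (\<lambda>x. f (x + c)) holomorphic_on {x. x + c \<in> A}" for c :: complex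
proof -
  assume f: "f holomorphic_on A"
  have "f \<circ> (\<lambda>x. x + c) holomorphic_on {x. x + c \<in> A}"
    by (rule holomorphic_on_compose_gen[OF _ f]) (auto intro!: holomorphic_intros)
  then show ?thesis by (simp add: o_def)
qed

lemma baker_holomorphic:
  assumes "of_real \<omega>1 - v \<notin> \<Lambda>"
  shows "baker v holomorphic_on pdom"
proof -
  have s: "(\<lambda>x. wsigma \<Lambda> (x + c)) holomorphic_on pdom" for c
    using holomorphic_shift[OF wsigma_holomorphic[of UNIV], of c] by (rule holomorphic_on_subset) auto
  show ?thesis
    unfolding baker_def
    using s[of "of_real \<omega>1"] s[of "of_real \<omega>1 - v"] wsigma_nonzero assms
    by (intro holomorphic_intros) (auto simp: dom_iff add_diff_eq)
qed

lemma baker_0: "of_real \<omega>1 - v \<notin> \<Lambda> \<Longrightarrow> baker v 0 = 1"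
  using wsigma_nonzero \<omega>1_not_lattice by (simp add: baker_def)

lemma baker_logarithmic_derivative:
  assumes x: "x \<in> pdom" and xv: "x + of_real \<omega>1 - v \<notin> \<Lambda>"
  shows "(baker v has_field_derivative
      baker v x * (wzeta \<Lambda> (x + of_real \<omega>1 - v) - wzeta \<Lambda> (x + of_real \<omega>1) + wzeta \<Lambda> v)) (at x)"
proof -
  define w where "w = complex_of_real \<omega>1"
  define k where "k = wsigma \<Lambda> w / wsigma \<Lambda> (w - v)"
  define N D where "N x = wsigma \<Lambda> (x + (w - v))" and "D x = wsigma \<Lambda> (x + w)" for x
  have N: "(N has_field_derivative N x * wzeta \<Lambda> (x + (w - v))) (at x)"
    unfolding N_def using xv by (intro has_field_derivative_shift wsigma_has_field_derivative) (simp add: w_def add_diff_eq)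
  have D: "(D has_field_derivative D x * wzeta \<Lambda> (x + w)) (at x)"
    unfolding D_def using x by (intro has_field_derivative_shift wsigma_has_field_derivative) (simp add: w_def dom_iff)
  have D0: "D x \<noteq> 0" unfolding D_def w_def using x wsigma_nonzero by (simp add: dom_iff)
  have E: "((\<lambda>x. exp (wzeta \<Lambda> v * x)) has_field_derivative wzeta \<Lambda> v * exp (wzeta \<Lambda> v * x)) (at x)"
    by (auto intro!: derivative_eq_intros)
  have b: "baker v = (\<lambda>x. k * (N x / D x * exp (wzeta \<Lambda> v * x)))"
    by (simp add: baker_def k_def N_def D_def w_def fun_eq_iff add_diff_eq mult_ac)
  have "(baker v has_field_derivative
     k * ((N x * wzeta \<Lambda> (x + (w - v)) * D x - N x * (D x * wzeta \<Lambda> (x + w))) / (D x * D x) * exp (wzeta \<Lambda> v * x)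
       + wzeta \<Lambda> v * exp (wzeta \<Lambda> v * x) * (N x / D x))) (at x)"
    unfolding b by (intro DERIV_cmult DERIV_mult DERIV_divide N D E D0)
  moreover have "k * ((N x * a * D x - N x * (D x * b)) / (D x * D x) * e + c * e * (N x / D x))
      = k * (N x / D x * e) * (a - b + c)" for a b c e
    using D0 by (simp add: divide_simps) (simp add: algebra_simps)
  ultimately show ?thesis unfolding b by (simp add: w_def add_diff_eq)
qed

text \<open>Off the zeros of the numerator this is the addition theorem applied to the logarithmic
  derivative. The multiplied-out form also makes sense at these zeros and extends there by the
  identity theorem.\<close>

lemma baker_ode:
  assumes x: "x \<in> pdom" and v: "v \<notin> \<Lambda>" "of_real \<omega>1 - v \<notin> \<Lambda>"
  shows "2 * deriv (baker v) x * (wp \<Lambda> (x + of_real \<omega>1) - wp \<Lambda> v)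
      = baker v x * (wpd (x + of_real \<omega>1) + wpd v)"
proof -
  define S where "S = pdom \<inter> {x. x + (of_real \<omega>1 - v) \<in> - \<Lambda>}"
  have "{x. x + (of_real \<omega>1 - v) \<in> - \<Lambda>} = (\<lambda>x. x + (of_real \<omega>1 - v)) -` (- \<Lambda>)" by auto
  then have "open S"
    unfolding S_def using open_dom open_Compl_lattice
    by (auto intro!: open_Int open_vimage continuous_intros)
  moreover have "0 \<in> S" using v by (simp add: S_def)
  then have "S \<noteq> {}" by auto
  moreover have "S \<subseteq> pdom" by (simp add: S_def)
  moreover have P: "(\<lambda>x. wp \<Lambda> (x + of_real \<omega>1)) holomorphic_on pdom" "(\<lambda>x. wpd (x + of_real \<omega>1)) holomorphic_on pdom"
    using holomorphic_shift[OF wp_holomorphic, of "of_real \<omega>1"] holomorphic_shift[OF wpd_holomorphic, of "of_real \<omega>1"]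
    by (simp_all add: pdom_def)
  have "(\<lambda>x. 2 * deriv (baker v) x * (wp \<Lambda> (x + of_real \<omega>1) - wp \<Lambda> v)) holomorphic_on pdom"
    by (intro holomorphic_intros holomorphic_deriv baker_holomorphic open_dom v P)
  moreover have "(\<lambda>x. baker v x * (wpd (x + of_real \<omega>1) + wpd v)) holomorphic_on pdom"
    by (intro holomorphic_intros baker_holomorphic v P)
  moreover have "2 * deriv (baker v) x * (wp \<Lambda> (x + of_real \<omega>1) - wp \<Lambda> v)
      = baker v x * (wpd (x + of_real \<omega>1) + wpd v)" if x: "x \<in> S" for x
  proof -
    have xv: "x \<in> pdom" "x + of_real \<omega>1 - v \<notin> \<Lambda>" using x by (auto simp: S_def add_diff_eq)
    have z: "2 * (wzeta \<Lambda> (x + of_real \<omega>1 - v) - wzeta \<Lambda> (x + of_real \<omega>1) + wzeta \<Lambda> v) * (wp \<Lambda> (x + of_real \<omega>1) - wp \<Lambda> v)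
        = wpd (x + of_real \<omega>1) + wpd v"
      using xv v by (intro wzeta_add) (auto simp: dom_iff)
    show ?thesis
      unfolding DERIV_imp_deriv[OF baker_logarithmic_derivative[OF xv]] z[symmetric] by (simp only: mult_ac)
  qed
  ultimately show ?thesis
    using analytic_continuation_open[OF _ open_dom _ connected_dom] x by blast
qed

end

text \<open>With these invariants G = P + b satisfies G'^2 = 4 G^3 - 12 b G^2 + 16 |U|^2, a first
  integral of the compatibility condition for H = -1 and a metric that depends on x alone. A nonzero
  U1 keeps spectral points away from the half-periods, where P' vanishes.\<close>

locale spectral = half_periods +
  fixes b U1 U2 :: real
  assumes inv2: "invariant_g2 \<Lambda> = of_real (12 * b\<^sup>2)"
    and inv3: "invariant_g3 \<Lambda> = of_real (8 * b ^ 3 - 16 * (U1\<^sup>2 + U2\<^sup>2))"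
    and U1: "U1 \<noteq> 0"
begin

definition GG :: "complex \<Rightarrow> complex" where "GG x = wp \<Lambda> (x + of_real \<omega>1) + of_real b"
definition GG1 :: "complex \<Rightarrow> complex" where "GG1 x = wpd (x + of_real \<omega>1)"

lemma GG_deriv: "x \<in> pdom \<Longrightarrow> (GG has_field_derivative GG1 x) (at x)"
  unfolding GG_def[abs_def] GG1_def dom_iff
  using DERIV_add[OF has_field_derivative_shift[OF wp_has_field_derivative] DERIV_const] by fastforce

lemma GG1_deriv: "x \<in> pdom \<Longrightarrow> (GG1 has_field_derivative 6 * (GG x)\<^sup>2 - 12 * of_real b * GG x) (at x)"
proof -
  assume "x \<in> pdom"
  then have "(GG1 has_field_derivative 6 * (wp \<Lambda> (x + of_real \<omega>1))\<^sup>2 - invariant_g2 \<Lambda> / 2) (at x)"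
    unfolding GG1_def[abs_def] dom_iff by (intro has_field_derivative_shift wpd_has_field_derivative)
  moreover have "6 * (wp \<Lambda> (x + of_real \<omega>1))\<^sup>2 - invariant_g2 \<Lambda> / 2 = 6 * (GG x)\<^sup>2 - 12 * of_real b * GG x"
    unfolding inv2 GG_def by (simp add: power2_eq_square algebra_simps)
  ultimately show ?thesis by simp
qed

lemma GG_ode:
  "x \<in> pdom \<Longrightarrow> (GG1 x)\<^sup>2 = 4 * GG x ^ 3 - 12 * of_real b * (GG x)\<^sup>2 + 16 * of_real (U1\<^sup>2 + U2\<^sup>2)"
  unfolding GG1_def GG_def dom_iff
  by (simp add: wp_ode inv2 inv3) (simp add: power2_eq_square power3_eq_cube algebra_simps)

lemma GG_holomorphic: "GG holomorphic_on pdom" and GG1_holomorphic: "GG1 holomorphic_on pdom"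
  unfolding holomorphic_on_open[OF open_dom] using GG_deriv GG1_deriv by blast+

lemma GG1_0: "GG1 0 = 0"
  by (simp add: GG1_def wpd_\<omega>1)

text \<open>Substituting \<open>h(x) exp (f y)\<close> in the structure equations and eliminating \<open>h''\<close> leaves the
  cubic for \<open>f\<close> and this first-order equation for \<open>h\<close>.\<close>

definition mode :: "real \<Rightarrow> (complex \<Rightarrow> complex) \<Rightarrow> bool" where
  "mode f h \<longleftrightarrow> f ^ 3 - 3 * b * f + 2 * U2 = 0 \<and> h holomorphic_on pdom \<and> h 0 = 1 \<and>
     (\<forall>x\<in>pdom. 2 * deriv h x * (GG x - of_real (3 * b - f\<^sup>2)) = h x * (GG1 x + 4 * of_real U1))"

text \<open>At 0 the derivative of G vanishes, so equality would reduce the differential equation to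
  16 U1^2 = 0. This makes the factor cancellable by the identity theorem.\<close>

lemma GG_0_ne:
  assumes f: "f ^ 3 - 3 * b * f + 2 * U2 = 0"
  shows "GG 0 - of_real (3 * b - f\<^sup>2) \<noteq> 0"
proof
  assume "GG 0 - of_real (3 * b - f\<^sup>2) = 0"
  then have G: "GG 0 = of_real (3 * b - f\<^sup>2)" by simp
  have "of_real (4 * (3 * b - f\<^sup>2) ^ 3 - 12 * b * (3 * b - f\<^sup>2)\<^sup>2 + 16 * (U1\<^sup>2 + U2\<^sup>2)) = (0::complex)"
    using GG_ode[OF zero_in_dom] unfolding GG1_0 G by simp
  then have "4 * (3 * b - f\<^sup>2) ^ 3 - 12 * b * (3 * b - f\<^sup>2)\<^sup>2 + 16 * (U1\<^sup>2 + U2\<^sup>2) = 0"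
    by (simp only: of_real_eq_0_iff)
  moreover have "2 * U2 = f * (3 * b - f\<^sup>2)" using f by (simp add: power2_eq_square power3_eq_cube algebra_simps)
  then have "16 * U2\<^sup>2 = 4 * (f * (3 * b - f\<^sup>2))\<^sup>2" by (metis (no_types, lifting) four_x_squared mult.assoc mult_2 numeral_Bit0 power2_eq_square power_mult_distrib add.commute)
  ultimately have "16 * U1\<^sup>2 = 0" by algebra
  then show False using U1 by simp
qed

lemma baker_mode:
  assumes f: "f ^ 3 - 3 * b * f + 2 * U2 = 0" and v: "v \<notin> \<Lambda>"
    and wp: "wp \<Lambda> v + of_real b = of_real (3 * b - f\<^sup>2)" and wpd: "wpd v = of_real (4 * U1)"
  shows "mode f (baker v)"
proof -
  \<comment> \<open>If v were congruent to \<omega>1, then P'(v) = P'(\<omega>1) = 0, whereas P'(v)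
    = 4 U1.\<close>
  have v': "of_real \<omega>1 - v \<notin> \<Lambda>"
  proof
    assume "of_real \<omega>1 - v \<in> \<Lambda>"
    from wpd_periodic[OF this, of v] have "wpd v = 0" by (simp add: wpd_\<omega>1)
    then show False using wpd U1 by simp
  qed
  have e: "GG x - of_real (3 * b - f\<^sup>2) = wp \<Lambda> (x + of_real \<omega>1) - wp \<Lambda> v" for x
    unfolding GG_def wp[symmetric] by simp
  show ?thesis
    unfolding mode_def e using f baker_holomorphic[OF v'] baker_0[OF v'] baker_ode[OF _ v v']
    by (simp add: GG1_def wpd)
qed

lemma mode_deriv: "mode f h \<Longrightarrow> x \<in> pdom \<Longrightarrow> (h has_field_derivative deriv h x) (at x)"
  unfolding mode_def using holomorphic_derivI[OF _ open_dom] by blast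

lemma mode_deriv2: "mode f h \<Longrightarrow> x \<in> pdom \<Longrightarrow> (deriv h has_field_derivative deriv (deriv h) x) (at x)"
  unfolding mode_def using holomorphic_derivI[OF holomorphic_deriv[OF _ open_dom] open_dom] by blast

lemma cancel_mode:
  assumes "f ^ 3 - 3 * b * f + 2 * U2 = 0" "A holomorphic_on pdom"
    and "\<And>x. x \<in> pdom \<Longrightarrow> (GG x - of_real (3 * b - f\<^sup>2)) * A x = 0" and "x \<in> pdom"
  shows "A x = 0"
  by (rule holomorphic_mult_eq_0[OF open_dom connected_dom _ assms(2,3) zero_in_dom GG_0_ne[OF assms(1)] assms(4)])
     (intro holomorphic_intros GG_holomorphic)

text \<open>The factor G' + 4 U1 of the first-order equation is traded for G' - 4 U1. For a root f
  of the cubic, G'^2 - 16 U1^2 = 4 (G - 3b + f^2)(G^2 - f^2 G - 2 U2 f), and the first factor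
  cancels.\<close>

lemma mode_second:
  assumes m: "mode f h" and x: "x \<in> pdom"
  shows "deriv h x * (GG1 x - 4 * of_real U1) = 2 * ((GG x)\<^sup>2 - of_real (f\<^sup>2) * GG x - of_real (2 * U2 * f)) * h x"
proof -
  have f: "f ^ 3 - 3 * b * f + 2 * U2 = 0" and hol: "h holomorphic_on pdom"
    and o: "\<And>x. x \<in> pdom \<Longrightarrow> 2 * deriv h x * (GG x - of_real (3 * b - f\<^sup>2)) = h x * (GG1 x + 4 * of_real U1)"
    using m by (auto simp: mode_def)
  define F B u1 u2 where "F = complex_of_real f" and "B = complex_of_real b" and "u1 = complex_of_real U1" and "u2 = complex_of_real U2"
  have u2: "2 * u2 = 3 * B * F - F ^ 3"
    using arg_cong[OF f, of complex_of_real] by (simp add: F_def B_def u2_def algebra_simps)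
  let ?A = "\<lambda>x. deriv h x * (GG1 x - 4 * u1) - 2 * ((GG x)\<^sup>2 - F\<^sup>2 * GG x - 2 * u2 * F) * h x"
  have "?A x = 0"
  proof (rule cancel_mode[OF f _ _ x])
    show "?A holomorphic_on pdom"
      by (intro holomorphic_intros holomorphic_deriv hol open_dom GG_holomorphic GG1_holomorphic)
    fix x assume x: "x \<in> pdom"
    define a d g g1 where "a = h x" and "d = deriv h x" and "g = GG x" and "g1 = GG1 x"
    have o: "2 * d * (g - (3 * B - F\<^sup>2)) = a * (g1 + 4 * u1)"
      using o[OF x] by (simp add: a_def d_def g_def g1_def F_def B_def u1_def)
    have s: "g1\<^sup>2 = 4 * g ^ 3 - 12 * B * g\<^sup>2 + 16 * (u1\<^sup>2 + u2\<^sup>2)"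
      using GG_ode[OF x] by (simp add: g_def g1_def B_def u1_def u2_def)
    have "2 * ((g - (3 * B - F\<^sup>2)) * (d * (g1 - 4 * u1) - 2 * (g\<^sup>2 - F\<^sup>2 * g - 2 * u2 * F) * a))
        = a * (g1\<^sup>2 - 16 * u1\<^sup>2) - 4 * (g - (3 * B - F\<^sup>2)) * (g\<^sup>2 - F\<^sup>2 * g - (3 * B * F - F ^ 3) * F) * a"
      using o u2 by algebra
    also have "\<dots> = 0" using s u2 by algebra
    finally show "(GG x - of_real (3 * b - f\<^sup>2)) * ?A x = 0"
      by (simp add: a_def d_def g_def g1_def F_def B_def)
  qed
  then show ?thesis by (simp add: F_def u1_def u2_def)
qed

text \<open>Differentiate the first-order equation, eliminate with \<open>mode_second\<close> and
  cancel G - 3b + f^2. For the product of h with exp (f y) the result reads r_xx + r_yy = 2 G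
  r.\<close>

lemma mode_lame:
  assumes m: "mode f h" and x: "x \<in> pdom"
  shows "deriv (deriv h) x = (2 * GG x - of_real (f\<^sup>2)) * h x"
proof -
  have f: "f ^ 3 - 3 * b * f + 2 * U2 = 0" and hol: "h holomorphic_on pdom"
    and o: "\<And>x. x \<in> pdom \<Longrightarrow> 2 * deriv h x * (GG x - of_real (3 * b - f\<^sup>2)) = h x * (GG1 x + 4 * of_real U1)"
    using m by (auto simp: mode_def)
  define F B u1 u2 where "F = complex_of_real f" and "B = complex_of_real b" and "u1 = complex_of_real U1" and "u2 = complex_of_real U2"
  have u2: "2 * u2 = 3 * B * F - F ^ 3"
    using arg_cong[OF f, of complex_of_real] by (simp add: F_def B_def u2_def algebra_simps)
  let ?A = "\<lambda>x. deriv (deriv h) x - (2 * GG x - F\<^sup>2) * h x"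
  have "?A x = 0"
  proof (rule cancel_mode[OF f _ _ x])
    show "?A holomorphic_on pdom"
      by (intro holomorphic_intros holomorphic_deriv hol open_dom GG_holomorphic)
    fix x assume x: "x \<in> pdom"
    define a d d2 g g1 where "a = h x" and "d = deriv h x" and "d2 = deriv (deriv h) x" and "g = GG x" and "g1 = GG1 x"
    have L: "((\<lambda>x. 2 * deriv h x * (GG x - (3 * B - F\<^sup>2))) has_field_derivative 2 * (d2 * (g - (3 * B - F\<^sup>2)) + d * g1)) (at x)"
      using mode_deriv2[OF m x] GG_deriv[OF x]
      by (auto intro!: derivative_eq_intros simp: d_def d2_def g_def g1_def algebra_simps)
    have "((\<lambda>x. h x * (GG1 x + 4 * u1)) has_field_derivative d * (g1 + 4 * u1) + a * (6 * g\<^sup>2 - 12 * B * g)) (at x)"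
      using mode_deriv[OF m x] GG1_deriv[OF x]
      by (auto intro!: derivative_eq_intros simp: a_def d_def g_def g1_def B_def)
    then have "((\<lambda>x. 2 * deriv h x * (GG x - (3 * B - F\<^sup>2))) has_field_derivative d * (g1 + 4 * u1) + a * (6 * g\<^sup>2 - 12 * B * g)) (at x)"
      by (rule has_field_derivative_transform_within_open[OF _ open_dom x]) (use o in \<open>simp add: F_def B_def u1_def\<close>)
    from DERIV_unique[OF L this]
    have e: "2 * (d2 * (g - (3 * B - F\<^sup>2)) + d * g1) = d * (g1 + 4 * u1) + a * (6 * g\<^sup>2 - 12 * B * g)" .
    have s: "d * (g1 - 4 * u1) = 2 * (g\<^sup>2 - F\<^sup>2 * g - 2 * u2 * F) * a"
      using mode_second[OF m x] by (simp add: a_def d_def g_def g1_def F_def u1_def u2_def)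
    have "2 * ((g - (3 * B - F\<^sup>2)) * (d2 - (2 * g - F\<^sup>2) * a)) = 0"
      using e s u2 by algebra
    then have "(g - (3 * B - F\<^sup>2)) * (d2 - (2 * g - F\<^sup>2) * a) = 0" by (simp only: mult_eq_0_iff) simp
    then show "(GG x - of_real (3 * b - f\<^sup>2)) * ?A x = 0"
      by (simp add: a_def d2_def g_def F_def B_def)
  qed
  then show ?thesis by (simp add: F_def)
qed

text \<open>By \<open>mode_second\<close> and the two symmetric sums, the product and G' - 4 U1 have
  the same logarithmic derivative (6 G^2 - 12 b G) / (G' - 4 U1). The constant is found at x =
  0.\<close>

lemma mode_product:
  assumes m: "mode f1 h1" "mode f2 h2" "mode f3 h3" and s: "f1 + f2 + f3 = 0" "f1\<^sup>2 + f2\<^sup>2 + f3\<^sup>2 = 6 * b" and x: "x \<in> pdom"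
  shows "GG1 x - 4 * of_real U1 = - 4 * of_real U1 * (h1 x * h2 x * h3 x)"
proof -
  let ?F = "\<lambda>x. h1 x * h2 x * h3 x" and ?Q = "\<lambda>x. GG1 x - 4 * of_real U1"
  have s1: "complex_of_real f1 + of_real f2 + of_real f3 = 0"
    using arg_cong[OF s(1), of complex_of_real] by simp
  have s2: "complex_of_real f1 ^ 2 + of_real f2 ^ 2 + of_real f3 ^ 2 = 6 * of_real b"
    using arg_cong[OF s(2), of complex_of_real] by simp
  have "?F x = ?F 0 / ?Q 0 * ?Q x"
  proof (rule holomorphic_proportional[OF open_dom connected_dom _ _ _ zero_in_dom _ x])
    fix x assume x: "x \<in> pdom"
    show "(?F has_field_derivative (deriv h1 x * h2 x + deriv h2 x * h1 x) * h3 x + deriv h3 x * (h1 x * h2 x)) (at x)"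
      by (intro DERIV_mult mode_deriv[OF m(1) x] mode_deriv[OF m(2) x] mode_deriv[OF m(3) x])
    show "(?Q has_field_derivative 6 * (GG x)\<^sup>2 - 12 * of_real b * GG x) (at x)"
      using DERIV_diff[OF GG1_deriv[OF x] DERIV_const] by simp
    show "((deriv h1 x * h2 x + deriv h2 x * h1 x) * h3 x + deriv h3 x * (h1 x * h2 x)) * ?Q x
        = (6 * (GG x)\<^sup>2 - 12 * of_real b * GG x) * ?F x"
      using mode_second[OF m(1) x] mode_second[OF m(2) x] mode_second[OF m(3) x] s1 s2
      unfolding of_real_mult of_real_power of_real_numeral by algebra
  qed (use U1 in \<open>simp add: GG1_0\<close>)
  moreover have "?F 0 = 1" using m by (simp add: mode_def)
  ultimately have "?F x = 1 / (- 4 * of_real U1) * ?Q x" by (simp add: GG1_0)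
  then show ?thesis using U1 by (simp add: field_simps)
qed

lemma real_GG:
  assumes "of_real x \<in> pdom"
  shows "GG (of_real x) \<in> \<real>" "GG1 (of_real x) \<in> \<real>"
proof -
  have r: "invariant_g2 \<Lambda> \<in> \<real>" "invariant_g3 \<Lambda> \<in> \<real>" unfolding inv2 inv3 by (rule Reals_of_real)+
  have d: "of_real (x + \<omega>1) \<in> sym_domain" using assms by (simp add: real_sym_domain dom_iff flip: of_real_add)
  have e: "cnj (of_real (x + \<omega>1)) = of_real (x + \<omega>1)" by simp
  from wp_cnj[OF r d, unfolded e] show "GG (of_real x) \<in> \<real>" "GG1 (of_real x) \<in> \<real>"
    by (auto simp: GG_def GG1_def Reals_cnj_iff)
qed

text \<open>The spectral point may be complex, so reality cannot be read off the sigma quotient.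
  Instead, the reflected function cnj (h (cnj z)) solves the same first-order equation with the same
  value at 0, and solutions are proportional.\<close>

lemma mode_real:
  assumes m: "mode f h" and x: "of_real x \<in> pdom"
  shows "h (of_real x) \<in> \<real>"
proof -
  have f: "f ^ 3 - 3 * b * f + 2 * U2 = 0" and hol: "h holomorphic_on pdom" and h0: "h 0 = 1"
    and o: "\<And>x. x \<in> pdom \<Longrightarrow> 2 * deriv h x * (GG x - of_real (3 * b - f\<^sup>2)) = h x * (GG1 x + 4 * of_real U1)"
    using m by (auto simp: mode_def)
  define S where "S = {x. x + of_real \<omega>1 \<in> sym_domain}"
  have S_eq: "S = (\<lambda>z. z - of_real \<omega>1) ` sym_domain"
    by (auto simp: S_def image_iff) (metis add_diff_cancel_right')
  have S: "open S" "connected S"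
    unfolding S_eq using open_translation[OF open_sym_domain, of "- of_real \<omega>1"]
    by (auto intro!: connected_continuous_image connected_sym_domain continuous_intros)
  have Sdom: "S \<subseteq> pdom" using sym_domain_subset by (auto simp: S_def dom_iff)
  have Scnj: "cnj z \<in> S" if "z \<in> S" for z
    using that cnj_sym_domain[of "z + of_real \<omega>1"] by (simp add: S_def)
  have r: "invariant_g2 \<Lambda> \<in> \<real>" "invariant_g3 \<Lambda> \<in> \<real>" unfolding inv2 inv3 by (rule Reals_of_real)+
  have c: "cnj (GG (cnj z)) = GG z" "cnj (GG1 (cnj z)) = GG1 z" if "z \<in> S" for z
    using wp_cnj[OF r, of "z + of_real \<omega>1"] that by (auto simp: S_def GG_def GG1_def)
  define k where "k z = cnj (h (cnj z))" for z
  have k: "(k has_field_derivative cnj (deriv h (cnj z))) (at z)" if "z \<in> S" for z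
    unfolding k_def using Scnj[OF that] Sdom by (intro cnj_cnj_deriv mode_deriv[OF m]) auto
  have ok: "2 * cnj (deriv h (cnj z)) * (GG z - of_real (3 * b - f\<^sup>2)) = k z * (GG1 z + 4 * of_real U1)" if "z \<in> S" for z
    using arg_cong[OF o[of "cnj z"], of cnj] Scnj[OF that] Sdom c[OF that] by (auto simp: k_def)
  have hd: "(h has_field_derivative deriv h z) (at z)" if "z \<in> S" for z
    using mode_deriv[OF m] Sdom that by auto
  have k_hol: "k holomorphic_on S" "(\<lambda>z. cnj (deriv h (cnj z))) holomorphic_on S"
  proof -
    show "k holomorphic_on S" unfolding holomorphic_on_open[OF S(1)] using k by blast
    then have "deriv k holomorphic_on S" using S(1) by (rule holomorphic_deriv)
    then show "(\<lambda>z. cnj (deriv h (cnj z))) holomorphic_on S"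
      by (rule holomorphic_transform) (rule DERIV_imp_deriv[OF k])
  qed
  have h_hol: "h holomorphic_on S" using hol Sdom by (rule holomorphic_on_subset)
  have zS: "0 \<in> S" using \<omega>1_not_lattice by (simp add: S_def real_sym_domain)
  have W: "deriv h z * k z - cnj (deriv h (cnj z)) * h z = 0" if z: "z \<in> S" for z
  proof (rule holomorphic_mult_eq_0[where A = "\<lambda>z. GG z - of_real (3 * b - f\<^sup>2)", OF S _ _ _ zS GG_0_ne[OF f] z])
    show "(\<lambda>z. GG z - of_real (3 * b - f\<^sup>2)) holomorphic_on S"
      using GG_holomorphic Sdom by (intro holomorphic_intros) (rule holomorphic_on_subset)
    show "(\<lambda>z. deriv h z * k z - cnj (deriv h (cnj z)) * h z) holomorphic_on S"
      by (intro holomorphic_intros h_hol k_hol holomorphic_deriv S)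
    fix z assume z: "z \<in> S"
    then have "z \<in> pdom" using Sdom by auto
    have "2 * ((GG z - of_real (3 * b - f\<^sup>2)) * (deriv h z * k z - cnj (deriv h (cnj z)) * h z)) = 0"
      using o[OF \<open>z \<in> pdom\<close>] ok[OF z] by algebra
    then show "(GG z - of_real (3 * b - f\<^sup>2)) * (deriv h z * k z - cnj (deriv h (cnj z)) * h z) = 0"
      by (simp only: mult_eq_0_iff) simp
  qed
  have xS: "of_real x \<in> S"
    using x by (simp add: S_def dom_iff real_sym_domain flip: of_real_add)
  have "h (of_real x) = h 0 / k 0 * k (of_real x)"
    by (rule holomorphic_proportional[OF S hd k _ zS _ xS]) (use W h0 in \<open>auto simp: k_def\<close>)
  then have "h (of_real x) = k (of_real x)" using h0 by (simp add: k_def)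
  then show ?thesis by (simp add: k_def Reals_cnj_iff)
qed

end

section \<open>Affine spheres in a moving frame\<close>

lemma partial_derivatives:
  assumes "f differentiable (at z)"
  shows has_vector_derivative_pdx: "((\<lambda>s. f (s, snd z)) has_vector_derivative pdx f z) (at (fst z))"
    and has_vector_derivative_pdy: "((\<lambda>s. f (fst z, s)) has_vector_derivative pdy f z) (at (snd z))"
proof -
  obtain f' where f': "(f has_derivative f') (at (fst z, snd z))"
    using assms by (auto simp: differentiable_def)
  have "((\<lambda>s. (s, snd z)) has_derivative (\<lambda>h. (h, 0))) (at (fst z))"
    by (auto intro!: derivative_eq_intros)
  from has_derivative_compose[OF this f'] have "(\<lambda>s. f (s, snd z)) differentiable (at (fst z))"
    unfolding differentiable_def by blast
  then show "((\<lambda>s. f (s, snd z)) has_vector_derivative pdx f z) (at (fst z))"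
    unfolding pdx_def by (simp add: vector_derivative_works)
  have "((\<lambda>s. (fst z, s)) has_derivative (\<lambda>h. (0, h))) (at (snd z))"
    by (auto intro!: derivative_eq_intros)
  from has_derivative_compose[OF this f'] have "(\<lambda>s. f (fst z, s)) differentiable (at (snd z))"
    unfolding differentiable_def by blast
  then show "((\<lambda>s. f (fst z, s)) has_vector_derivative pdy f z) (at (snd z))"
    unfolding pdy_def by (simp add: vector_derivative_works)
qed

lemma pdxI: "((\<lambda>s. f (s, snd z)) has_vector_derivative d) (at (fst z)) \<Longrightarrow> pdx f z = d"
  unfolding pdx_def by (rule vector_derivative_at)

lemma pdyI: "((\<lambda>s. f (fst z, s)) has_vector_derivative d) (at (snd z)) \<Longrightarrow> pdy f z = d"
  unfolding pdy_def by (rule vector_derivative_at)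

lemma eventually_slices:
  fixes z :: "real \<times> real"
  assumes "open \<Omega>" "z \<in> \<Omega>"
  shows "\<forall>\<^sub>F s in nhds (fst z). (s, snd z) \<in> \<Omega>" "\<forall>\<^sub>F s in nhds (snd z). (fst z, s) \<in> \<Omega>"
proof -
  have "open ((\<lambda>s. (s, snd z)) -` \<Omega>)" "open ((\<lambda>s. (fst z, s)) -` \<Omega>)"
    using assms(1) by (auto intro!: open_vimage continuous_intros)
  then show "\<forall>\<^sub>F s in nhds (fst z). (s, snd z) \<in> \<Omega>" "\<forall>\<^sub>F s in nhds (snd z). (fst z, s) \<in> \<Omega>"
    using eventually_nhds_in_open[of _ "fst z"] eventually_nhds_in_open[of _ "snd z"] assms(2) by fastforce+
qed

lemma pd_cong:
  assumes "open \<Omega>" "z \<in> \<Omega>" "\<And>u. u \<in> \<Omega> \<Longrightarrow> f u = g u"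
  shows "pdx f z = pdx g z" "pdy f z = pdy g z"
  unfolding pdx_def pdy_def
  by (auto intro!: vector_derivative_cong_eq eventually_mono[OF eventually_slices(1)[OF assms(1,2)]]
      eventually_mono[OF eventually_slices(2)[OF assms(1,2)]] assms(3))

lemma dz_cong:
  assumes "open \<Omega>" "z \<in> \<Omega>" "\<And>u. u \<in> \<Omega> \<Longrightarrow> f u = g u"
  shows "dz f z = dz g z" "dzbar f z = dzbar g z"
  using pd_cong[OF assms] by (simp_all add: dz_def dzbar_def)

lemma C_diff_on_cong:
  assumes "open \<Omega>" "\<And>u. u \<in> \<Omega> \<Longrightarrow> f u = g u"
  shows "C_diff_on n \<Omega> f \<longleftrightarrow> C_diff_on n \<Omega> g"
  using assms(2)
proof (induction n arbitrary: f g)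
  case 0
  then show ?case by (simp cong: continuous_on_cong)
next
  case (Suc n)
  have "f differentiable_on \<Omega> \<longleftrightarrow> g differentiable_on \<Omega>"
    using Suc.prems unfolding differentiable_on_def
    by (metis (no_types, lifting) differentiable_transform_within zero_less_one)
  moreover have "C_diff_on n \<Omega> (pdx f) \<longleftrightarrow> C_diff_on n \<Omega> (pdx g)" "C_diff_on n \<Omega> (pdy f) \<longleftrightarrow> C_diff_on n \<Omega> (pdy g)"
    using pd_cong[OF assms(1) _ Suc.prems] by (auto intro!: Suc.IH)
  ultimately show ?case by simp
qed

lemma smooth_on_cong:
  assumes "open \<Omega>" "\<And>u. u \<in> \<Omega> \<Longrightarrow> f u = g u"
  shows "smooth_on \<Omega> f \<longleftrightarrow> smooth_on \<Omega> g"
  unfolding smooth_on_def using C_diff_on_cong[OF assms] by simp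

lemma smooth_onD:
  assumes "smooth_on \<Omega> f"
  shows "smooth_on \<Omega> (pdx f)" "smooth_on \<Omega> (pdy f)" "f differentiable_on \<Omega>" "continuous_on \<Omega> f"
proof -
  have "C_diff_on (Suc n) \<Omega> f" "C_diff_on 0 \<Omega> f" for n using assms unfolding smooth_on_def by blast+
  then show "smooth_on \<Omega> (pdx f)" "smooth_on \<Omega> (pdy f)" "f differentiable_on \<Omega>" "continuous_on \<Omega> f"
    unfolding smooth_on_def by auto
qed

lemma smooth_on_differentiable: "smooth_on \<Omega> f \<Longrightarrow> open \<Omega> \<Longrightarrow> z \<in> \<Omega> \<Longrightarrow> f differentiable (at z)"
  using smooth_onD(3) differentiable_on_eq_differentiable_at by blast

lemma pd_bounded_linear:
  assumes "bounded_linear L" "f differentiable (at z)"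
  shows "pdx (\<lambda>z. L (f z)) z = L (pdx f z)" "pdy (\<lambda>z. L (f z)) z = L (pdy f z)"
  using bounded_linear.has_vector_derivative[OF assms(1) has_vector_derivative_pdx[OF assms(2)]]
    bounded_linear.has_vector_derivative[OF assms(1) has_vector_derivative_pdy[OF assms(2)]]
  by (auto intro: pdxI pdyI)

lemma smooth_on_bounded_linear:
  assumes L: "bounded_linear L" and "smooth_on \<Omega> f" "open \<Omega>"
  shows "smooth_on \<Omega> (\<lambda>z. L (f z))"
proof -
  have "C_diff_on n \<Omega> (\<lambda>z. L (f z))" if "smooth_on \<Omega> f" for n f
    using that
  proof (induction n arbitrary: f)
    case 0
    then show ?case using smooth_onD(4) bounded_linear.continuous_on[OF L] by auto
  next
    case (Suc n)
    have d: "f differentiable (at z)" if "z \<in> \<Omega>" for z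
      using smooth_on_differentiable[OF Suc.prems assms(3) that] .
    have "(\<lambda>z. L (f z)) differentiable (at z)" if "z \<in> \<Omega>" for z
      using d[OF that] bounded_linear.has_derivative[OF L] unfolding differentiable_def by blast
    then have "(\<lambda>z. L (f z)) differentiable_on \<Omega>"
      by (simp add: differentiable_on_eq_differentiable_at assms(3))
    moreover have "C_diff_on n \<Omega> (pdx (\<lambda>z. L (f z)))"
      using Suc.IH[OF smooth_onD(1)[OF Suc.prems]] pd_bounded_linear(1)[OF L d]
      by (subst C_diff_on_cong[OF assms(3)]) auto
    moreover have "C_diff_on n \<Omega> (pdy (\<lambda>z. L (f z)))"
      using Suc.IH[OF smooth_onD(2)[OF Suc.prems]] pd_bounded_linear(2)[OF L d]
      by (subst C_diff_on_cong[OF assms(3)]) auto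
    ultimately show ?case by simp
  qed
  then show ?thesis using assms(2) by (simp add: smooth_on_def)
qed

section \<open>Structure equations and affine data in the frame\<close>

lemma det3_expand:
  fixes u v w :: "real^3"
  shows "det3 u v w = vec_nth u 1 * (vec_nth v 2 * vec_nth w 3 - vec_nth v 3 * vec_nth w 2)
    - vec_nth u 2 * (vec_nth v 1 * vec_nth w 3 - vec_nth v 3 * vec_nth w 1)
    + vec_nth u 3 * (vec_nth v 1 * vec_nth w 2 - vec_nth v 2 * vec_nth w 1)"
  unfolding det3_def det_3 vector_3 by (simp only: right_diff_distrib mult_ac)

text \<open>With the surface equations the second derivatives in the frame \<open>(r\<^sub>x, r\<^sub>y, r)\<close> are
  known, so the affine metric only depends on the determinant of the frame.\<close>

definition frame_equations :: "(real \<times> real) set \<Rightarrow> (real \<times> real \<Rightarrow> real^3) \<Rightarrow> (real \<Rightarrow> real) \<Rightarrow> (real \<Rightarrow> real) \<Rightarrow> real \<Rightarrow> real \<Rightarrow> bool" where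
  "frame_equations \<Omega> r g g1 U1 U2 \<longleftrightarrow> (\<forall>z\<in>\<Omega>.
     let G = g (fst z); a = (g1 (fst z) - 4 * U1) / (2 * G); a' = (g1 (fst z) + 4 * U1) / (2 * G); e = 2 * U2 / G in
     pdx (pdx r) z = G *\<^sub>R r z + a *\<^sub>R pdx r z + e *\<^sub>R pdy r z \<and>
     pdy (pdy r) z = G *\<^sub>R r z - a *\<^sub>R pdx r z - e *\<^sub>R pdy r z \<and>
     pdy (pdx r) z = e *\<^sub>R pdx r z + a' *\<^sub>R pdy r z \<and>
     pdx (pdy r) z = e *\<^sub>R pdx r z + a' *\<^sub>R pdy r z)"

lemma dz_component:
  fixes i :: 3
  assumes "open \<Omega>" "smooth_on \<Omega> r" "z \<in> \<Omega>"
  shows "dz (\<lambda>z. complex_of_real (r z $ i)) z = (of_real (pdx r z $ i) - \<i> * of_real (pdy r z $ i)) / 2"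
    and "dzbar (\<lambda>z. complex_of_real (r z $ i)) z = (of_real (pdx r z $ i) + \<i> * of_real (pdy r z $ i)) / 2"
proof -
  have L: "bounded_linear (\<lambda>v::real^3. complex_of_real (v $ i))"
    by (intro bounded_linear_compose[OF bounded_linear_of_real] bounded_linear_vec_nth)
  show "dz (\<lambda>z. complex_of_real (r z $ i)) z = (of_real (pdx r z $ i) - \<i> * of_real (pdy r z $ i)) / 2"
    and "dzbar (\<lambda>z. complex_of_real (r z $ i)) z = (of_real (pdx r z $ i) + \<i> * of_real (pdy r z $ i)) / 2"
    using pd_bounded_linear[OF L smooth_on_differentiable[OF assms(2,1,3)]] by (simp_all add: dz_def dzbar_def)
qed

lemma dz_combination:
  fixes i :: 3
  assumes "open \<Omega>" "smooth_on \<Omega> A" "smooth_on \<Omega> B" "z \<in> \<Omega>"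
  shows "dz (\<lambda>z. (complex_of_real (A z $ i) + k * of_real (B z $ i)) / 2) z
    = (of_real (pdx A z $ i) + k * of_real (pdx B z $ i) - \<i> * (of_real (pdy A z $ i) + k * of_real (pdy B z $ i))) / 4"
proof -
  have L: "bounded_linear (\<lambda>v::real^3. complex_of_real (v $ i))"
    by (intro bounded_linear_compose[OF bounded_linear_of_real] bounded_linear_vec_nth)
  note d = bounded_linear.has_vector_derivative[OF L has_vector_derivative_pdx[OF smooth_on_differentiable[OF _ assms(1,4)]]]
    bounded_linear.has_vector_derivative[OF L has_vector_derivative_pdy[OF smooth_on_differentiable[OF _ assms(1,4)]]]
  have "pdx (\<lambda>z. (complex_of_real (A z $ i) + k * of_real (B z $ i)) / 2) z = (of_real (pdx A z $ i) + k * of_real (pdx B z $ i)) / 2"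
    by (intro pdxI has_vector_derivative_divide has_vector_derivative_add has_vector_derivative_mult_right d assms(2,3))
  moreover have "pdy (\<lambda>z. (complex_of_real (A z $ i) + k * of_real (B z $ i)) / 2) z = (of_real (pdy A z $ i) + k * of_real (pdy B z $ i)) / 2"
    by (intro pdyI has_vector_derivative_divide has_vector_derivative_add has_vector_derivative_mult_right d assms(2,3))
  ultimately show ?thesis unfolding dz_def by (simp only:) (simp add: field_simps)
qed

text \<open>Real and imaginary parts are separated; psi_z is real since the metric depends on x
  alone. The imaginary part of the second equation is r_xy = r_yx, so the equality of mixed
  derivatives comes from the equations, and \<open>frame_equations\<close> lists both
  orders.\<close>

lemma structure_equations_iff:
  assumes \<Omega>: "open \<Omega>" and r: "smooth_on \<Omega> r"
    and g: "\<And>z. z \<in> \<Omega> \<Longrightarrow> g (fst z) > 0" "\<And>z. z \<in> \<Omega> \<Longrightarrow> (g has_real_derivative g1 (fst z)) (at (fst z))"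
    and G: "\<And>z. z \<in> \<Omega> \<Longrightarrow> G z = g (fst z)"
    and U: "\<And>z. z \<in> \<Omega> \<Longrightarrow> U z = Complex U1 U2"
  shows "structure_equations \<Omega> r G (-1) U \<longleftrightarrow> frame_equations \<Omega> r g g1 U1 U2"
proof -
  let ?\<psi> = "\<lambda>z. complex_of_real (ln (G z / 2))" and ?R = "\<lambda>i z. complex_of_real (r z $ i)"
  have ddz: "dz (dz (?R i)) z = (of_real (pdx (pdx r) z $ i - pdy (pdy r) z $ i) - \<i> * of_real (pdx (pdy r) z $ i + pdy (pdx r) z $ i)) / 4"
    and ddzb: "dz (dzbar (?R i)) z = (of_real (pdx (pdx r) z $ i + pdy (pdy r) z $ i) + \<i> * of_real (pdx (pdy r) z $ i - pdy (pdx r) z $ i)) / 4"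
    if z: "z \<in> \<Omega>" for z i
  proof -
    have "dz (dz (?R i)) z = dz (\<lambda>z. (complex_of_real (pdx r z $ i) + (- \<i>) * of_real (pdy r z $ i)) / 2) z"
      using dz_component(1)[OF \<Omega> r] by (intro dz_cong[OF \<Omega> z]) simp
    also have "\<dots> = (of_real (pdx (pdx r) z $ i) + (- \<i>) * of_real (pdx (pdy r) z $ i)
        - \<i> * (of_real (pdy (pdx r) z $ i) + (- \<i>) * of_real (pdy (pdy r) z $ i))) / 4"
      by (intro dz_combination[OF \<Omega> _ _ z] smooth_onD r)
    also have "\<dots> = (of_real (pdx (pdx r) z $ i - pdy (pdy r) z $ i) - \<i> * of_real (pdx (pdy r) z $ i + pdy (pdx r) z $ i)) / 4"
      by (simp add: algebra_simps)
    finally show "dz (dz (?R i)) z = (of_real (pdx (pdx r) z $ i - pdy (pdy r) z $ i) - \<i> * of_real (pdx (pdy r) z $ i + pdy (pdx r) z $ i)) / 4" .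
    have "dz (dzbar (?R i)) z = dz (\<lambda>z. (complex_of_real (pdx r z $ i) + \<i> * of_real (pdy r z $ i)) / 2) z"
      using dz_component(2)[OF \<Omega> r] by (intro dz_cong[OF \<Omega> z]) simp
    also have "\<dots> = (of_real (pdx (pdx r) z $ i) + \<i> * of_real (pdx (pdy r) z $ i)
        - \<i> * (of_real (pdy (pdx r) z $ i) + \<i> * of_real (pdy (pdy r) z $ i))) / 4"
      by (intro dz_combination[OF \<Omega> _ _ z] smooth_onD r)
    also have "\<dots> = (of_real (pdx (pdx r) z $ i + pdy (pdy r) z $ i) + \<i> * of_real (pdx (pdy r) z $ i - pdy (pdx r) z $ i)) / 4"
      by (simp add: algebra_simps)
    finally show "dz (dzbar (?R i)) z = (of_real (pdx (pdx r) z $ i + pdy (pdy r) z $ i) + \<i> * of_real (pdx (pdy r) z $ i - pdy (pdx r) z $ i)) / 4" .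
  qed
  have psi: "dz ?\<psi> z = of_real (g1 (fst z) / (2 * g (fst z)))" if z: "z \<in> \<Omega>" for z
  proof -
    have "dz ?\<psi> z = dz (\<lambda>z. complex_of_real (ln (g (fst z) / 2))) z"
      using G by (intro dz_cong[OF \<Omega> z]) simp
    moreover have "((\<lambda>x. ln (g x / 2)) has_real_derivative g1 (fst z) / g (fst z)) (at (fst z))"
      using g[OF z] by (auto intro!: derivative_eq_intros)
    then have "((\<lambda>x. complex_of_real (ln (g x / 2))) has_vector_derivative of_real (g1 (fst z) / g (fst z))) (at (fst z))"
      by (intro has_vector_derivative_of_real) (simp add: has_real_derivative_iff_has_vector_derivative)
    then have "pdx (\<lambda>z. complex_of_real (ln (g (fst z) / 2))) z = of_real (g1 (fst z) / g (fst z))"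
      by (intro pdxI) simp
    moreover have "pdy (\<lambda>z. complex_of_real (ln (g (fst z) / 2))) z = 0"
      by (intro pdyI) simp
    ultimately show ?thesis by (simp add: dz_def)
  qed
  have ex: "exp (?\<psi> z) = of_real (g (fst z) / 2)" "exp (- ?\<psi> z) = of_real (2 / g (fst z))" if "z \<in> \<Omega>" for z
    using g(1)[OF that] G[OF that] by (simp_all add: exp_of_real exp_minus flip: of_real_minus)
  have pt: "(\<forall>i. dz (dz (?R i)) z = dz ?\<psi> z * dz (?R i) z - U z * exp (- ?\<psi> z) * dzbar (?R i) z \<and>
           dz (dzbar (?R i)) z = - of_real (-1) * exp (?\<psi> z) * ?R i z)
     \<longleftrightarrow> (let G = g (fst z); a = (g1 (fst z) - 4 * U1) / (2 * G); a' = (g1 (fst z) + 4 * U1) / (2 * G); e = 2 * U2 / G in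
     pdx (pdx r) z = G *\<^sub>R r z + a *\<^sub>R pdx r z + e *\<^sub>R pdy r z \<and>
     pdy (pdy r) z = G *\<^sub>R r z - a *\<^sub>R pdx r z - e *\<^sub>R pdy r z \<and>
     pdy (pdx r) z = e *\<^sub>R pdx r z + a' *\<^sub>R pdy r z \<and>
     pdx (pdy r) z = e *\<^sub>R pdx r z + a' *\<^sub>R pdy r z)" (is "?l \<longleftrightarrow> ?r") if z: "z \<in> \<Omega>" for z
  proof -
    define k k1 where "k = g (fst z)" and "k1 = g1 (fst z)"
    have k: "k > 0" using g(1)[OF z] by (simp add: k_def)
    have comp: "(dz (dz (?R i)) z = dz ?\<psi> z * dz (?R i) z - U z * exp (- ?\<psi> z) * dzbar (?R i) z \<and>
           dz (dzbar (?R i)) z = - of_real (-1) * exp (?\<psi> z) * ?R i z) \<longleftrightarrow>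
        pdx (pdx r) z $ i = k * r z $ i + (k1 - 4 * U1) / (2 * k) * pdx r z $ i + 2 * U2 / k * pdy r z $ i \<and>
        pdy (pdy r) z $ i = k * r z $ i - (k1 - 4 * U1) / (2 * k) * pdx r z $ i - 2 * U2 / k * pdy r z $ i \<and>
        pdy (pdx r) z $ i = 2 * U2 / k * pdx r z $ i + (k1 + 4 * U1) / (2 * k) * pdy r z $ i \<and>
        pdx (pdy r) z $ i = 2 * U2 / k * pdx r z $ i + (k1 + 4 * U1) / (2 * k) * pdy r z $ i" (is "?L \<longleftrightarrow> ?R") for i
    proof -
      define X Y R XX YX XY YY where d: "X = pdx r z $ i" "Y = pdy r z $ i" "R = r z $ i" "XX = pdx (pdx r) z $ i"
        "YX = pdy (pdx r) z $ i" "XY = pdx (pdy r) z $ i" "YY = pdy (pdy r) z $ i"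
      \<comment> \<open>With the quotients named, both systems are linear in products of the names,
        and \<open>argo\<close> decides their equivalence.\<close>
      define \<kappa> a c where \<kappa>: "\<kappa> = k1 / (2 * k)" and ac: "a = U1 / k" "c = U2 / k"
      have u: "Complex U1 U2 * of_real (2 / k) = Complex (2 * a) (2 * c)"
        by (simp add: complex_eq_iff ac)
      have q: "(k1 - 4 * U1) / (2 * k) = \<kappa> - 2 * a" "(k1 + 4 * U1) / (2 * k) = \<kappa> + 2 * a" "2 * U2 / k = 2 * c"
        using k by (simp_all add: \<kappa> ac diff_divide_distrib add_divide_distrib)
      have e: "(complex_of_real (XX - YY) - \<i> * complex_of_real (XY + YX)) / 4 = Complex ((XX - YY) / 4) (- ((XY + YX) / 4))"
        "of_real \<kappa> * ((of_real X - \<i> * of_real Y) / 2) - Complex (2 * a) (2 * c) * ((of_real X + \<i> * of_real Y) / 2)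
          = Complex (\<kappa> * X / 2 - (a * X - c * Y)) (- (\<kappa> * Y / 2) - (c * X + a * Y))"
        "(complex_of_real (XX + YY) + \<i> * of_real (XY - YX)) / 4 = Complex ((XX + YY) / 4) ((XY - YX) / 4)"
        "- complex_of_real (- 1) * of_real (k / 2) * of_real R = Complex (k * R / 2) 0"
        by (simp_all add: complex_eq_iff algebra_simps add_divide_distrib diff_divide_distrib)
      have "?L \<longleftrightarrow> ((XX - YY) / 4 = \<kappa> * X / 2 - (a * X - c * Y) \<and> - ((XY + YX) / 4) = - (\<kappa> * Y / 2) - (c * X + a * Y)) \<and>
          (XX + YY) / 4 = k * R / 2 \<and> (XY - YX) / 4 = 0"
        unfolding ddz[OF z] ddzb[OF z] psi[OF z] ex[OF z] dz_component[OF \<Omega> r z] U[OF z] d[symmetric] k_def[symmetric] k1_def[symmetric]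
          u \<kappa>[symmetric] e complex.inject ..
      also have "\<dots> \<longleftrightarrow> XX = k * R + (\<kappa> * X - 2 * (a * X)) + 2 * (c * Y) \<and>
          YY = k * R - (\<kappa> * X - 2 * (a * X)) - 2 * (c * Y) \<and>
          YX = 2 * (c * X) + (\<kappa> * Y + 2 * (a * Y)) \<and>
          XY = 2 * (c * X) + (\<kappa> * Y + 2 * (a * Y))"
        by argo
      also have "\<dots> \<longleftrightarrow> XX = k * R + (\<kappa> - 2 * a) * X + 2 * c * Y \<and>
          YY = k * R - (\<kappa> - 2 * a) * X - 2 * c * Y \<and>
          YX = 2 * c * X + (\<kappa> + 2 * a) * Y \<and>
          XY = 2 * c * X + (\<kappa> + 2 * a) * Y"
        by (simp only: left_diff_distrib distrib_right mult.assoc)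
      finally show ?thesis by (simp only: d q)
    qed
    show ?thesis unfolding comp Let_def k_def[symmetric] k1_def[symmetric] vec_eq_iff
      by (auto simp: vec_eq_iff)
  qed
  show ?thesis
    unfolding structure_equations_def frame_equations_def Let_def[of "\<lambda>z. complex_of_real (ln (G z / 2))"]
      Let_def[of "\<lambda>i z. complex_of_real (r z $ i)"]
    using pt by (intro ball_cong) blast+
qed

lemma det3_combination:
  "det3 x y (k *\<^sub>R r + a *\<^sub>R x + e *\<^sub>R y) = k * det3 x y r"
  by (simp add: det3_expand algebra_simps)

lemma det3_zero: "det3 0 y r = 0" "det3 x y 0 = 0"
  by (simp_all add: det3_expand)

lemma det3_dependent:
  assumes "a *\<^sub>R x + b *\<^sub>R y = 0" "det3 x y r \<noteq> 0"
  shows "a = 0 \<and> b = 0"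
proof -
  have "a *\<^sub>R x + b *\<^sub>R y = 0 \<Longrightarrow> a * det3 x y r = 0"
  proof -
    assume "a *\<^sub>R x + b *\<^sub>R y = 0"
    have "a * det3 x y r = det3 (a *\<^sub>R x + b *\<^sub>R y) y r"
      by (simp add: det3_expand algebra_simps)
    then show ?thesis using \<open>a *\<^sub>R x + b *\<^sub>R y = 0\<close> by (simp add: det3_zero)
  qed
  moreover have "b * det3 x y r = det3 x (a *\<^sub>R x + b *\<^sub>R y) r"
    by (simp add: det3_expand algebra_simps)
  then have "b * det3 x y r = 0" using assms(1) by (simp add: det3_expand)
  ultimately show ?thesis using assms by simp
qed

text \<open>The frame equations give M = 0 and L = N = g D with D the determinant of the frame, so
  the metric coefficient is sqrt (g |D|), which equals g exactly if |D| = g. The affine normal then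
  follows from r_xx + r_yy = 2 g r.\<close>

lemma affine_sphere_data_iff:
  assumes \<Omega>: "open \<Omega>"
    and g: "\<And>z. z \<in> \<Omega> \<Longrightarrow> g (fst z) > 0" "\<And>z. z \<in> \<Omega> \<Longrightarrow> (g has_real_derivative g1 (fst z)) (at (fst z))"
    and G: "\<And>z. z \<in> \<Omega> \<Longrightarrow> G z = g (fst z)"
    and U: "\<And>z. z \<in> \<Omega> \<Longrightarrow> U z = Complex U1 U2"
  shows "affine_sphere_data \<Omega> r G (-1) U \<longleftrightarrow>
     smooth_on \<Omega> r \<and> frame_equations \<Omega> r g g1 U1 U2 \<and>
     (\<forall>z\<in>\<Omega>. \<bar>det3 (pdx r z) (pdy r z) (r z)\<bar> = g (fst z))"
proof (cases "smooth_on \<Omega> r \<and> frame_equations \<Omega> r g g1 U1 U2")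
  case False
  then show ?thesis
    using structure_equations_iff[OF \<Omega> _ g G U]
    by (auto simp: affine_sphere_data_def affine_sphere_on_def loc_strictly_convex_on_def immersion_on_def)
next
  case True
  then have r: "smooth_on \<Omega> r" and fe: "frame_equations \<Omega> r g g1 U1 U2" by auto
  define D where "D z = det3 (pdx r z) (pdy r z) (r z)" for z
  have str: "structure_equations \<Omega> r G (-1) U"
    using structure_equations_iff[OF \<Omega> r g G U] fe by simp
  have L: "coeff_L r z = g (fst z) * D z" "coeff_M r z = 0" "coeff_N r z = g (fst z) * D z"
    and lap: "pdx (pdx r) z + pdy (pdy r) z = (2 * g (fst z)) *\<^sub>R r z" if z: "z \<in> \<Omega>" for z
  proof -
    define a e a' where d: "a = (g1 (fst z) - 4 * U1) / (2 * g (fst z))" "e = 2 * U2 / g (fst z)"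
      "a' = (g1 (fst z) + 4 * U1) / (2 * g (fst z))"
    note F = fe[unfolded frame_equations_def Let_def, rule_format, OF z, folded d]
    have E: "pdx (pdx r) z = g (fst z) *\<^sub>R r z + a *\<^sub>R pdx r z + e *\<^sub>R pdy r z"
      "pdy (pdy r) z = g (fst z) *\<^sub>R r z + (- a) *\<^sub>R pdx r z + (- e) *\<^sub>R pdy r z"
      "pdy (pdx r) z = 0 *\<^sub>R r z + e *\<^sub>R pdx r z + a' *\<^sub>R pdy r z"
      using F by simp_all
    show "coeff_L r z = g (fst z) * D z" "coeff_M r z = 0" "coeff_N r z = g (fst z) * D z"
      unfolding coeff_L_def coeff_M_def coeff_N_def D_def E det3_combination by simp_all
    show "pdx (pdx r) z + pdy (pdy r) z = (2 * g (fst z)) *\<^sub>R r z"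
      unfolding E mult_2 scaleR_left_distrib by simp
  qed
  have metric: "affine_metric r z = (sqrt (g (fst z) * \<bar>D z\<bar>), 0, sqrt (g (fst z) * \<bar>D z\<bar>))" if z: "z \<in> \<Omega>" for z
  proof -
    define l where "l = g (fst z) * D z"
    have gl: "g (fst z) * \<bar>D z\<bar> = \<bar>l\<bar>" using g(1)[OF z] by (simp add: l_def abs_mult)
    have "root 4 \<bar>l * l - 0\<^sup>2\<bar> = sqrt \<bar>l\<bar>"
    proof -
      have "(sqrt \<bar>l\<bar>) ^ 4 = ((sqrt \<bar>l\<bar>)\<^sup>2)\<^sup>2" using power_mult[of "sqrt \<bar>l\<bar>" 2 2] by simp
      then have "\<bar>l * l - 0\<^sup>2\<bar> = (sqrt \<bar>l\<bar>) ^ 4" by (simp add: power2_eq_square)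
      then show ?thesis by (simp only:) (rule real_root_power_cancel, auto)
    qed
    moreover have "sgn l / sqrt \<bar>l\<bar> * l = sqrt \<bar>l\<bar>"
      by (cases "l = 0") (auto simp: sgn_if real_div_sqrt divide_simps)
    ultimately show ?thesis
      unfolding affine_metric_def L[OF z] gl l_def[symmetric] by simp
  qed
  show ?thesis
  proof
    assume A: "affine_sphere_data \<Omega> r G (-1) U"
    have "\<bar>D z\<bar> = g (fst z)" if z: "z \<in> \<Omega>" for z
    proof -
      have "sqrt (g (fst z) * \<bar>D z\<bar>) = g (fst z)"
        using A z metric[OF z] G[OF z] by (auto simp: affine_sphere_data_def)
      then have "g (fst z) * \<bar>D z\<bar> = (g (fst z))\<^sup>2"
        using g(1)[OF z] by (metis abs_ge_zero less_imp_le mult_nonneg_nonneg real_sqrt_pow2)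
      then show ?thesis using g(1)[OF z] by (simp add: power2_eq_square)
    qed
    then show "smooth_on \<Omega> r \<and> frame_equations \<Omega> r g g1 U1 U2 \<and>
        (\<forall>z\<in>\<Omega>. \<bar>det3 (pdx r z) (pdy r z) (r z)\<bar> = g (fst z))"
      using r fe by (simp add: D_def)
  next
    assume "smooth_on \<Omega> r \<and> frame_equations \<Omega> r g g1 U1 U2 \<and>
        (\<forall>z\<in>\<Omega>. \<bar>det3 (pdx r z) (pdy r z) (r z)\<bar> = g (fst z))"
    then have D: "\<bar>D z\<bar> = g (fst z)" if "z \<in> \<Omega>" for z using that by (simp add: D_def)
    have m: "affine_metric r z = (g (fst z), 0, g (fst z))" if z: "z \<in> \<Omega>" for z
      using metric[OF z] D[OF z] g(1)[OF z] by simp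
    have D0: "D z \<noteq> 0" if z: "z \<in> \<Omega>" for z using D[OF z] g(1)[OF z] by auto
    have "immersion_on \<Omega> r"
      unfolding immersion_on_def using r D0 det3_dependent unfolding D_def by blast
    moreover have "coeff_L r z * coeff_N r z - (coeff_M r z)\<^sup>2 > 0" if z: "z \<in> \<Omega>" for z
    proof -
      have "0 < (g (fst z) * D z)\<^sup>2" using D0[OF z] g(1)[OF z] by simp
      then show ?thesis unfolding L[OF z] by (simp only: power2_eq_square mult_zero_left diff_0_right)
    qed
    moreover have "affine_normal r z = (- (-1)) *\<^sub>R r z" if z: "z \<in> \<Omega>" for z
    proof -
      have w: "sqrt (g (fst u) * g (fst u) - 0\<^sup>2) = g (fst u)" if "u \<in> \<Omega>" for u
        using g(1)[OF that] by simp
      \<comment> \<open>The two fields under the divergence in \<open>laplace_beltrami\<close>. For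
        a conformal metric they are r_x and r_y; this is needed on the whole open set before they
        are differentiated.\<close>
      define F1 F2 where
        "F1 u = (1 / sqrt (fst (affine_metric r u) * snd (snd (affine_metric r u)) - (fst (snd (affine_metric r u)))\<^sup>2)) *\<^sub>R
            (snd (snd (affine_metric r u)) *\<^sub>R pdx r u - fst (snd (affine_metric r u)) *\<^sub>R pdy r u)" and
        "F2 u = (1 / sqrt (fst (affine_metric r u) * snd (snd (affine_metric r u)) - (fst (snd (affine_metric r u)))\<^sup>2)) *\<^sub>R
            (fst (affine_metric r u) *\<^sub>R pdy r u - fst (snd (affine_metric r u)) *\<^sub>R pdx r u)" for u
      have "F1 u = pdx r u" "F2 u = pdy r u" if "u \<in> \<Omega>" for u
        using g(1)[OF that] m[OF that] w[OF that] by (simp_all add: F1_def F2_def)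
      then have "pdx F1 z = pdx (pdx r) z" "pdy F2 z = pdy (pdy r) z"
        using pd_cong[OF \<Omega> z] by blast+
      moreover have "affine_normal r z = (1 / 2) *\<^sub>R ((1 / g (fst z)) *\<^sub>R (pdx F1 z + pdy F2 z))"
        unfolding affine_normal_def laplace_beltrami_def Let_def F1_def[abs_def] F2_def[abs_def]
        using m[OF z] w[OF z] by simp
      ultimately show ?thesis using lap[OF z] g(1)[OF z] by simp
    qed
    ultimately show "affine_sphere_data \<Omega> r G (-1) U"
      unfolding affine_sphere_data_def affine_sphere_on_def loc_strictly_convex_on_def
      using \<Omega> str m G by auto
  qed
qed

lemma affine_sphere_data_cong:
  assumes \<Omega>: "open \<Omega>" and G: "\<And>z. z \<in> \<Omega> \<Longrightarrow> G z = G' z" and U: "\<And>z. z \<in> \<Omega> \<Longrightarrow> U z = U' z"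
  shows "affine_sphere_data \<Omega> r G H U \<longleftrightarrow> affine_sphere_data \<Omega> r G' H U'"
proof -
  have "dz (\<lambda>z. complex_of_real (ln (G z / 2))) z = dz (\<lambda>z. complex_of_real (ln (G' z / 2))) z" if "z \<in> \<Omega>" for z
    using G by (intro dz_cong[OF \<Omega> that]) simp
  then have "structure_equations \<Omega> r G H U \<longleftrightarrow> structure_equations \<Omega> r G' H U'"
    unfolding structure_equations_def Let_def using G U by simp
  then show ?thesis unfolding affine_sphere_data_def using G by simp
qed

text \<open>H is determined because r cannot vanish on an open set without its tangent vectors
  vanishing, and U because some component of r_zbar is nonzero. This pins down the quantified data
  in \<open>associated_member\<close>.\<close>

lemma affine_sphere_data_unique:
  assumes A: "affine_sphere_data \<Omega> r G H U" and B: "affine_sphere_data \<Omega> r G' H' U'" and ne: "\<Omega> \<noteq> {}"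
  shows "H' = H" "z \<in> \<Omega> \<Longrightarrow> G' z = G z" "z \<in> \<Omega> \<Longrightarrow> U' z = U z"
proof -
  have \<Omega>: "open \<Omega>" and r: "smooth_on \<Omega> r" and imm: "immersion_on \<Omega> r"
    using A by (auto simp: affine_sphere_data_def affine_sphere_on_def loc_strictly_convex_on_def immersion_on_def)
  show G: "G' z = G z" if "z \<in> \<Omega>" for z
    using A B that by (auto simp: affine_sphere_data_def)
  have X0: "pdx r z \<noteq> 0" if "z \<in> \<Omega>" for z
    using imm that unfolding immersion_on_def by (metis add.right_neutral scaleR_one scaleR_zero_left zero_neq_one)
  show "H' = H"
  proof (rule ccontr)
    assume "H' \<noteq> H"
    have "r z = 0" if z: "z \<in> \<Omega>" for z
    proof -
      have "(- H) *\<^sub>R r z = (- H') *\<^sub>R r z"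
        using A B z by (auto simp: affine_sphere_data_def affine_sphere_on_def)
      then show ?thesis using \<open>H' \<noteq> H\<close> by auto
    qed
    moreover obtain z where z: "z \<in> \<Omega>" using ne by blast
    ultimately have "pdx r z = pdx (\<lambda>z. 0) z" by (intro pd_cong[OF \<Omega> z]) simp
    also have "\<dots> = 0" by (intro pdxI) simp
    finally show False using X0[OF z] by simp
  qed
  show "U' z = U z" if z: "z \<in> \<Omega>"
  proof -
    obtain i where i: "pdx r z $ i \<noteq> 0" using X0[OF z] by (auto simp: vec_eq_iff)
    let ?R = "\<lambda>z. complex_of_real (r z $ i)"
    have nz: "dzbar ?R z \<noteq> 0"
      unfolding dz_component(2)[OF \<Omega> r z] using i by (simp add: complex_eq_iff)
    have e: "complex_of_real (ln (G' z / 2)) = complex_of_real (ln (G z / 2))" using G[OF z] by simp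
    have d: "dz (\<lambda>z. complex_of_real (ln (G' z / 2))) z = dz (\<lambda>z. complex_of_real (ln (G z / 2))) z"
      using G by (intro dz_cong[OF \<Omega> z]) simp
    have "dz (dz ?R) z = dz (\<lambda>z. complex_of_real (ln (G z / 2))) z * dz ?R z - U z * exp (- complex_of_real (ln (G z / 2))) * dzbar ?R z"
      using A z by (simp add: affine_sphere_data_def structure_equations_def Let_def)
    moreover have "dz (dz ?R) z = dz (\<lambda>z. complex_of_real (ln (G z / 2))) z * dz ?R z - U' z * exp (- complex_of_real (ln (G z / 2))) * dzbar ?R z"
      using B z by (simp add: affine_sphere_data_def structure_equations_def Let_def e d)
    ultimately show ?thesis using nz by simp
  qed
qed

lemma frame_equations_bounded_linear:
  assumes L: "bounded_linear L" and \<Omega>: "open \<Omega>" and r: "smooth_on \<Omega> r" and fe: "frame_equations \<Omega> r g g1 U1 U2"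
  shows "frame_equations \<Omega> (\<lambda>z. L (r z)) g g1 U1 U2"
proof -
  interpret bounded_linear L by (rule L)
  have d: "r differentiable (at z)" "pdx r differentiable (at z)" "pdy r differentiable (at z)" if "z \<in> \<Omega>" for z
    using that r \<Omega> by (auto intro!: smooth_on_differentiable smooth_onD)
  have p: "pdx (\<lambda>z. L (r z)) z = L (pdx r z)" "pdy (\<lambda>z. L (r z)) z = L (pdy r z)" if "z \<in> \<Omega>" for z
    using pd_bounded_linear[OF L d(1)[OF that]] by auto
  have pp: "pdx (pdx (\<lambda>z. L (r z))) z = L (pdx (pdx r) z)" "pdy (pdx (\<lambda>z. L (r z))) z = L (pdy (pdx r) z)"
    "pdx (pdy (\<lambda>z. L (r z))) z = L (pdx (pdy r) z)" "pdy (pdy (\<lambda>z. L (r z))) z = L (pdy (pdy r) z)" if z: "z \<in> \<Omega>" for z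
    using pd_bounded_linear[OF L d(2)[OF z]] pd_bounded_linear[OF L d(3)[OF z]] pd_cong[OF \<Omega> z p(1)] pd_cong[OF \<Omega> z p(2)] by simp_all
  show ?thesis
    unfolding frame_equations_def Let_def
  proof (intro ballI)
    fix z assume z: "z \<in> \<Omega>"
    note F = fe[unfolded frame_equations_def Let_def, rule_format, OF z]
    show "pdx (pdx (\<lambda>z. L (r z))) z = g (fst z) *\<^sub>R L (r z) + ((g1 (fst z) - 4 * U1) / (2 * g (fst z))) *\<^sub>R pdx (\<lambda>z. L (r z)) z + (2 * U2 / g (fst z)) *\<^sub>R pdy (\<lambda>z. L (r z)) z \<and>
     pdy (pdy (\<lambda>z. L (r z))) z = g (fst z) *\<^sub>R L (r z) - ((g1 (fst z) - 4 * U1) / (2 * g (fst z))) *\<^sub>R pdx (\<lambda>z. L (r z)) z - (2 * U2 / g (fst z)) *\<^sub>R pdy (\<lambda>z. L (r z)) z \<and>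
     pdy (pdx (\<lambda>z. L (r z))) z = (2 * U2 / g (fst z)) *\<^sub>R pdx (\<lambda>z. L (r z)) z + ((g1 (fst z) + 4 * U1) / (2 * g (fst z))) *\<^sub>R pdy (\<lambda>z. L (r z)) z \<and>
     pdx (pdy (\<lambda>z. L (r z))) z = (2 * U2 / g (fst z)) *\<^sub>R pdx (\<lambda>z. L (r z)) z + ((g1 (fst z) + 4 * U1) / (2 * g (fst z))) *\<^sub>R pdy (\<lambda>z. L (r z)) z"
      unfolding pp[OF z] p[OF z] using F by (simp only: add diff scaleR)
  qed
qed

lemma det3_matrix_vector_mult: "det3 (A *v x) (A *v y) (A *v r) = det A * det3 x y r"
proof -
  have "(vector [A *v x, A *v y, A *v r] :: real^3^3) = vector [x, y, r] ** transpose A"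
    by (simp add: vec_eq_iff forall_3 matrix_matrix_mult_def matrix_vector_mult_def transpose_def sum_3 mult.commute)
  then show ?thesis by (simp add: det3_def det_mul det_transpose)
qed

lemma affine_sphere_data_linear:
  assumes \<Omega>: "open \<Omega>"
    and g: "\<And>z. z \<in> \<Omega> \<Longrightarrow> g (fst z) > 0" "\<And>z. z \<in> \<Omega> \<Longrightarrow> (g has_real_derivative g1 (fst z)) (at (fst z))"
    and G: "\<And>z. z \<in> \<Omega> \<Longrightarrow> G z = g (fst z)"
    and U: "\<And>z. z \<in> \<Omega> \<Longrightarrow> U z = Complex U1 U2"
    and r: "affine_sphere_data \<Omega> r G (-1) U" and A: "\<bar>det A\<bar> = 1" and r': "\<And>z. z \<in> \<Omega> \<Longrightarrow> r' z = A *v r z"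
  shows "affine_sphere_data \<Omega> r' G (-1) U"
proof -
  note iff = affine_sphere_data_iff[OF \<Omega> g G U]
  have L: "bounded_linear ((*v) A)" by (rule matrix_vector_mul_bounded_linear)
  have r: "smooth_on \<Omega> r" "frame_equations \<Omega> r g g1 U1 U2" and D: "\<And>z. z \<in> \<Omega> \<Longrightarrow> \<bar>det3 (pdx r z) (pdy r z) (r z)\<bar> = g (fst z)"
    using iff r by auto
  have F1: "smooth_on \<Omega> (\<lambda>z. A *v r z)" "frame_equations \<Omega> (\<lambda>z. A *v r z) g g1 U1 U2"
    using smooth_on_bounded_linear[OF L r(1) \<Omega>] frame_equations_bounded_linear[OF L \<Omega> r] by auto
  have F2: "\<bar>det3 (pdx (\<lambda>z. A *v r z) z) (pdy (\<lambda>z. A *v r z) z) (A *v r z)\<bar> = g (fst z)" if z: "z \<in> \<Omega>" for z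
    using pd_bounded_linear[OF L smooth_on_differentiable[OF r(1) \<Omega> z]] D[OF z] A
    by (simp add: det3_matrix_vector_mult abs_mult)
  have s: "smooth_on \<Omega> r'" using F1(1) smooth_on_cong[OF \<Omega> r'] by simp
  have p: "pdx r' z = pdx (\<lambda>z. A *v r z) z" "pdy r' z = pdy (\<lambda>z. A *v r z) z" if "z \<in> \<Omega>" for z
    using pd_cong[OF \<Omega> that r'] by auto
  have pp: "pdx (pdx r') z = pdx (pdx (\<lambda>z. A *v r z)) z" "pdy (pdx r') z = pdy (pdx (\<lambda>z. A *v r z)) z"
     "pdx (pdy r') z = pdx (pdy (\<lambda>z. A *v r z)) z" "pdy (pdy r') z = pdy (pdy (\<lambda>z. A *v r z)) z" if "z \<in> \<Omega>" for z
    using pd_cong[OF \<Omega> that p(1)] pd_cong[OF \<Omega> that p(2)] by auto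
  have e: "frame_equations \<Omega> r' g g1 U1 U2 \<longleftrightarrow> frame_equations \<Omega> (\<lambda>z. A *v r z) g g1 U1 U2"
    unfolding frame_equations_def Let_def by (intro ball_cong refl) (simp only: p pp r')
  have X: "\<bar>det3 (pdx r' z) (pdy r' z) (r' z)\<bar> = g (fst z)" if "z \<in> \<Omega>" for z
    using F2[OF that] p[OF that] r'[OF that] by simp
  show ?thesis by (intro iffD2[OF iff] conjI ballI s iffD2[OF e F1(2)] X)
qed

section \<open>Rigidity: the frame system determines an immersion up to a linear map\<close>

lemma det3_inner: "det3 x y r = r \<bullet> cross3 x y" "det3 x y r = x \<bullet> cross3 y r" "det3 x y r = y \<bullet> cross3 r x"
  by (simp_all add: det3_expand cross3_def inner_vec_def sum_3 algebra_simps)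

lemma det3_cyclic: "det3 y r x = det3 x y r" "det3 r x y = det3 x y r"
  by (simp_all add: det3_expand algebra_simps)

lemma frame_orthogonal_eq_0:
  assumes "det3 x y r \<noteq> 0" "a \<bullet> x = 0" "a \<bullet> y = 0" "a \<bullet> r = 0"
  shows "a = 0"
proof -
  have "det3 x y r *\<^sub>R a = (a \<bullet> r) *\<^sub>R cross3 x y + (a \<bullet> x) *\<^sub>R cross3 y r + (a \<bullet> y) *\<^sub>R cross3 r x"
    by (simp add: det3_expand vec_eq_iff forall_3 cross3_def inner_vec_def sum_3 algebra_simps)
  then show ?thesis using assms by simp
qed

lemma cross3_frame_inner:
  "cross3 x y \<bullet> x = 0" "cross3 x y \<bullet> y = 0"
  by (simp_all add: cross3_def inner_vec_def sum_3 algebra_simps)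

lemma zero_partials_imp_constant:
  fixes a :: "real \<times> real \<Rightarrow> 'a::real_normed_vector"
  assumes \<Omega>: "open \<Omega>" "convex \<Omega>" and a: "\<And>z. z \<in> \<Omega> \<Longrightarrow> a differentiable (at z)"
    and 0: "\<And>z. z \<in> \<Omega> \<Longrightarrow> pdx a z = 0" "\<And>z. z \<in> \<Omega> \<Longrightarrow> pdy a z = 0"
  obtains c where "\<And>z. z \<in> \<Omega> \<Longrightarrow> a z = c"
proof -
  have "(a has_derivative (\<lambda>h. 0)) (at z within \<Omega>)" if z: "z \<in> \<Omega>" for z
  proof -
    obtain a' where a': "(a has_derivative a') (at (fst z, snd z))" using a[OF z] by (auto simp: differentiable_def)
    have "((\<lambda>s. (s, snd z)) has_derivative (\<lambda>h. (h, 0))) (at (fst z))"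
      by (auto intro!: derivative_eq_intros)
    note d = has_derivative_compose[OF this a']
    have l: "(\<lambda>h. a' (h, 0)) = (\<lambda>h. h *\<^sub>R a' (1, 0))" "(\<lambda>h. a' (0, h)) = (\<lambda>h. h *\<^sub>R a' (0, 1))"
    proof -
      show "(\<lambda>h. a' (h, 0)) = (\<lambda>h. h *\<^sub>R a' (1, 0))"
      proof
        fix h :: real
        show "a' (h, 0) = h *\<^sub>R a' (1, 0)" using linear_cmul[OF has_derivative_linear[OF a'], of h "(1, 0)"] by simp
      qed
      show "(\<lambda>h. a' (0, h)) = (\<lambda>h. h *\<^sub>R a' (0, 1))"
      proof
        fix h :: real
        show "a' (0, h) = h *\<^sub>R a' (0, 1)" using linear_cmul[OF has_derivative_linear[OF a'], of h "(0, 1)"] by simp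
      qed
    qed
    have "((\<lambda>s. a (s, snd z)) has_vector_derivative a' (1, 0)) (at (fst z))"
      using d unfolding has_vector_derivative_def l .
    from pdxI[of a z, OF this] have x: "a' (1, 0) = 0" using 0(1)[OF z] by simp
    have "((\<lambda>s. (fst z, s)) has_derivative (\<lambda>h. (0, h))) (at (snd z))"
      by (auto intro!: derivative_eq_intros)
    note d' = has_derivative_compose[OF this a']
    have "((\<lambda>s. a (fst z, s)) has_vector_derivative a' (0, 1)) (at (snd z))"
      using d' unfolding has_vector_derivative_def l .
    from pdyI[of a z, OF this] have y: "a' (0, 1) = 0" using 0(2)[OF z] by simp
    have "a' h = 0" for h
    proof -
      have "a' ((fst h, 0) + (0, snd h)) = a' (fst h, 0) + a' (0, snd h)"
        by (rule linear_add[OF has_derivative_linear[OF a']])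
      moreover have "a' (fst h, 0) = 0" "a' (0, snd h) = 0" using fun_cong[OF l(1), of "fst h"] fun_cong[OF l(2), of "snd h"] x y by simp_all
      ultimately show ?thesis by simp
    qed
    then have "a' = (\<lambda>h. 0)" by auto
    then show ?thesis using a' by (simp add: has_derivative_at_withinI)
  qed
  from has_derivative_zero_constant[OF \<Omega>(2) this] show ?thesis using that by blast
qed

text \<open>Cramer's rule gives a covector a(z) whose products with r, r_x, r_y are the i-th
  components of s, s_x, s_y. Both surfaces satisfy the same system, so differentiating these
  products shows that the partial derivatives of a are orthogonal to the frame, hence zero.\<close>

lemma frame_equations_component:
  fixes \<Omega> :: "(real \<times> real) set"
  assumes \<Omega>: "open \<Omega>" "convex \<Omega>" and r: "smooth_on \<Omega> r" "frame_equations \<Omega> r g g1 U1 U2"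
    and D: "\<And>z. z \<in> \<Omega> \<Longrightarrow> det3 (pdx r z) (pdy r z) (r z) \<noteq> 0"
    and s: "smooth_on \<Omega> s" "frame_equations \<Omega> s g g1 U1 U2"
  obtains a where "\<And>z. z \<in> \<Omega> \<Longrightarrow> s z $ i = a \<bullet> r z"
proof -
  define u ux uy where "u z = s z $ i" and "ux z = pdx s z $ i" and "uy z = pdy s z $ i" for z
  define d where "d z = det3 (pdx r z) (pdy r z) (r z)" for z
  define a where "a z = (1 / d z) *\<^sub>R (u z *\<^sub>R cross3 (pdx r z) (pdy r z) + ux z *\<^sub>R cross3 (pdy r z) (r z) + uy z *\<^sub>R cross3 (r z) (pdx r z))" for z
  have dr: "r differentiable (at z)" "pdx r differentiable (at z)" "pdy r differentiable (at z)"
    and ds: "s differentiable (at z)" "pdx s differentiable (at z)" "pdy s differentiable (at z)" if "z \<in> \<Omega>" for z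
    using that r(1) s(1) \<Omega>(1) by (auto intro!: smooth_on_differentiable smooth_onD)
  have comp: "(\<lambda>z. f z $ i) differentiable (at z)" if "f differentiable (at z)" for f :: "real \<times> real \<Rightarrow> real^3" and z i
    using that bounded_linear.has_derivative[OF bounded_linear_vec_nth] unfolding differentiable_def by blast
  have bb: "bounded_bilinear cross3" using bilinear_cross by (simp add: bilinear_conv_bounded_bilinear)
  have cr: "(\<lambda>z. cross3 (f z) (h z)) differentiable (at z)" if "f differentiable (at z)" "h differentiable (at z)" for f h :: "real \<times> real \<Rightarrow> real^3" and z
    using that bounded_bilinear.FDERIV[OF bb] unfolding differentiable_def by blast
  have dd: "d differentiable (at z)" if "z \<in> \<Omega>" for z
  proof -
    have "(\<lambda>z. r z \<bullet> cross3 (pdx r z) (pdy r z)) differentiable (at z)"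
      using bounded_bilinear.FDERIV[OF bounded_bilinear_inner] dr(1)[OF that] cr[OF dr(2,3)[OF that]] unfolding differentiable_def by blast
    then show ?thesis by (simp add: d_def[abs_def] det3_inner(1))
  qed
  have sc: "(\<lambda>z. f z *\<^sub>R h z) differentiable (at z)" if "f differentiable (at z)" "h differentiable (at z)" for f :: "real \<times> real \<Rightarrow> real" and h :: "real \<times> real \<Rightarrow> real^3" and z
    using that bounded_bilinear.FDERIV[OF bounded_bilinear_scaleR] unfolding differentiable_def by blast
  have da: "a differentiable (at z)" if z: "z \<in> \<Omega>" for z
    unfolding a_def[abs_def] u_def ux_def uy_def
    using D[OF z] by (intro sc differentiable_add cr differentiable_divide differentiable_const dd comp dr ds z) (simp add: d_def)
  have ip: "a z \<bullet> r z = u z" "a z \<bullet> pdx r z = ux z" "a z \<bullet> pdy r z = uy z" if z: "z \<in> \<Omega>" for z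
    using D[OF z] by (simp_all add: a_def inner_add_left cross3_frame_inner det3_inner(1)[symmetric]
        det3_cyclic[where x = "pdx r z" and y = "pdy r z" and r = "r z"] d_def inner_commute[of "cross3 _ _"])
  have px: "pdx a z \<bullet> f z + a z \<bullet> pdx f z = k" if "z \<in> \<Omega>" "f differentiable (at z)" "\<And>z. z \<in> \<Omega> \<Longrightarrow> a z \<bullet> f z = v z $ i" "v differentiable (at z)" "pdx v z $ i = k" for f v :: "real \<times> real \<Rightarrow> real^3" and z k
  proof -
    have "pdx (\<lambda>z. a z \<bullet> f z) z = a z \<bullet> pdx f z + pdx a z \<bullet> f z"
      using bounded_bilinear.has_vector_derivative[OF bounded_bilinear_inner has_vector_derivative_pdx[OF da[OF that(1)]] has_vector_derivative_pdx[OF that(2)]]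
      by (intro pdxI) simp
    moreover have "pdx (\<lambda>z. a z \<bullet> f z) z = pdx (\<lambda>z. v z $ i) z" using that(3) by (intro pd_cong[OF \<Omega>(1) that(1)])
    moreover have "pdx (\<lambda>z. v z $ i) z = pdx v z $ i" by (rule pd_bounded_linear(1)[OF bounded_linear_vec_nth that(4)])
    ultimately show ?thesis using that(5) by simp
  qed
  have py: "pdy a z \<bullet> f z + a z \<bullet> pdy f z = k" if "z \<in> \<Omega>" "f differentiable (at z)" "\<And>z. z \<in> \<Omega> \<Longrightarrow> a z \<bullet> f z = v z $ i" "v differentiable (at z)" "pdy v z $ i = k" for f v :: "real \<times> real \<Rightarrow> real^3" and z k
  proof -
    have "pdy (\<lambda>z. a z \<bullet> f z) z = a z \<bullet> pdy f z + pdy a z \<bullet> f z"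
      using bounded_bilinear.has_vector_derivative[OF bounded_bilinear_inner has_vector_derivative_pdy[OF da[OF that(1)]] has_vector_derivative_pdy[OF that(2)]]
      by (intro pdyI) simp
    moreover have "pdy (\<lambda>z. a z \<bullet> f z) z = pdy (\<lambda>z. v z $ i) z" using that(3) by (intro pd_cong[OF \<Omega>(1) that(1)])
    moreover have "pdy (\<lambda>z. v z $ i) z = pdy v z $ i" by (rule pd_bounded_linear(2)[OF bounded_linear_vec_nth that(4)])
    ultimately show ?thesis using that(5) by simp
  qed
  have a0: "pdx a z = 0" "pdy a z = 0" if z: "z \<in> \<Omega>" for z
  proof -
    note F = r(2)[unfolded frame_equations_def Let_def, rule_format, OF z]
    note S = s(2)[unfolded frame_equations_def Let_def, rule_format, OF z]
    note ipz = ip[OF z]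
    have v: "a z \<bullet> r z = s z $ i" "a z \<bullet> pdx r z = pdx s z $ i" "a z \<bullet> pdy r z = pdy s z $ i" if "z \<in> \<Omega>" for z
      using ip[OF that] by (simp_all add: u_def ux_def uy_def)
    have "pdx a z \<bullet> r z + a z \<bullet> pdx r z = pdx s z $ i" by (rule px[OF z dr(1)[OF z] v(1) ds(1)[OF z] refl])
    moreover have "pdy a z \<bullet> r z + a z \<bullet> pdy r z = pdy s z $ i" by (rule py[OF z dr(1)[OF z] v(1) ds(1)[OF z] refl])
    ultimately have e: "pdx a z \<bullet> r z = 0" "pdy a z \<bullet> r z = 0"
      using v[OF z] by simp_all
    have X: "pdx a z \<bullet> pdx r z + a z \<bullet> pdx (pdx r) z = pdx (pdx s) z $ i"
      "pdx a z \<bullet> pdy r z + a z \<bullet> pdx (pdy r) z = pdx (pdy s) z $ i"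
      "pdy a z \<bullet> pdx r z + a z \<bullet> pdy (pdx r) z = pdy (pdx s) z $ i"
      "pdy a z \<bullet> pdy r z + a z \<bullet> pdy (pdy r) z = pdy (pdy s) z $ i"
      by (rule px[OF z dr(2)[OF z] v(2) ds(2)[OF z] refl], assumption)
         (rule px[OF z dr(3)[OF z] v(3) ds(3)[OF z] refl], assumption,
          rule py[OF z dr(2)[OF z] v(2) ds(2)[OF z] refl], assumption,
          rule py[OF z dr(3)[OF z] v(3) ds(3)[OF z] refl], assumption)
    have "pdx a z \<bullet> pdx r z = 0" "pdx a z \<bullet> pdy r z = 0" "pdy a z \<bullet> pdx r z = 0" "pdy a z \<bullet> pdy r z = 0"
      using X ipz unfolding conjunct1[OF F] conjunct1[OF conjunct2[OF F]] conjunct1[OF conjunct2[OF conjunct2[OF F]]] conjunct2[OF conjunct2[OF conjunct2[OF F]]]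
        conjunct1[OF S] conjunct1[OF conjunct2[OF S]] conjunct1[OF conjunct2[OF conjunct2[OF S]]] conjunct2[OF conjunct2[OF conjunct2[OF S]]]
      by (simp_all add: inner_add_right inner_diff_right u_def ux_def uy_def)
    then show "pdx a z = 0" "pdy a z = 0"
      using frame_orthogonal_eq_0[OF D[OF z]] e by blast+
  qed
  obtain c where "\<And>z. z \<in> \<Omega> \<Longrightarrow> a z = c"
    using zero_partials_imp_constant[OF \<Omega> da a0] by blast
  then show ?thesis using that[of c] ip(1) by (simp add: u_def)
qed

text \<open>For the harder direction the constant covectors of the three components form the rows of
  A. Both frame determinants have modulus g, whence |det A| = 1.\<close>

lemma affine_sphere_data_unimodular:
  fixes \<Omega> :: "(real \<times> real) set"
  assumes \<Omega>: "open \<Omega>" "convex \<Omega>" "\<Omega> \<noteq> {}"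
    and g: "\<And>z. z \<in> \<Omega> \<Longrightarrow> g (fst z) > 0" "\<And>z. z \<in> \<Omega> \<Longrightarrow> (g has_real_derivative g1 (fst z)) (at (fst z))"
    and G: "\<And>z. z \<in> \<Omega> \<Longrightarrow> G z = g (fst z)"
    and U: "\<And>z. z \<in> \<Omega> \<Longrightarrow> U z = Complex U1 U2"
    and r: "affine_sphere_data \<Omega> r G (-1) U"
  shows "affine_sphere_data \<Omega> s G (-1) U \<longleftrightarrow> unimodular_equivalent \<Omega> r s"
proof
  assume "unimodular_equivalent \<Omega> r s"
  then show "affine_sphere_data \<Omega> s G (-1) U"
    unfolding unimodular_equivalent_def using affine_sphere_data_linear[OF \<Omega>(1) g G U r] by blast
next
  assume s: "affine_sphere_data \<Omega> s G (-1) U"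
  note iff = affine_sphere_data_iff[OF \<Omega>(1) g G U]
  have r: "smooth_on \<Omega> r" "frame_equations \<Omega> r g g1 U1 U2" and D: "\<And>z. z \<in> \<Omega> \<Longrightarrow> \<bar>det3 (pdx r z) (pdy r z) (r z)\<bar> = g (fst z)"
    using iff r by auto
  have s: "smooth_on \<Omega> s" "frame_equations \<Omega> s g g1 U1 U2" and D': "\<And>z. z \<in> \<Omega> \<Longrightarrow> \<bar>det3 (pdx s z) (pdy s z) (s z)\<bar> = g (fst z)"
    using iff s by auto
  have D0: "det3 (pdx r z) (pdy r z) (r z) \<noteq> 0" if "z \<in> \<Omega>" for z using D[OF that] g(1)[OF that] by auto
  have "\<exists>a. \<forall>z\<in>\<Omega>. s z $ i = a \<bullet> r z" for i
    using frame_equations_component[OF \<Omega>(1,2) r D0 s] by metis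
  then obtain a where a: "\<And>i z. z \<in> \<Omega> \<Longrightarrow> s z $ i = a i \<bullet> r z" by metis
  define A :: "real^3^3" where "A = (\<chi> i. a i)"
  have sA: "s z = A *v r z" if "z \<in> \<Omega>" for z
    using a[OF that] by (simp add: vec_eq_iff A_def matrix_vector_mult_def inner_vec_def)
  obtain z where z: "z \<in> \<Omega>" using \<Omega>(3) by blast
  have "pdx s z = A *v pdx r z" "pdy s z = A *v pdy r z"
    using pd_cong[OF \<Omega>(1) z sA] pd_bounded_linear[OF matrix_vector_mul_bounded_linear smooth_on_differentiable[OF r(1) \<Omega>(1) z], of A] by auto
  then have "\<bar>det A\<bar> * g (fst z) = g (fst z)"
    using D[OF z] D'[OF z] sA[OF z] by (simp add: det3_matrix_vector_mult abs_mult)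
  then have "\<bar>det A\<bar> = 1" using g(1)[OF z] by simp
  then show "unimodular_equivalent \<Omega> r s" unfolding unimodular_equivalent_def using sA by blast
qed

section \<open>Affine spheres from exponential waves\<close>

lemma Re_has_real_derivative:
  assumes "(F has_field_derivative d) (at (of_real x))"
  shows "((\<lambda>x. Re (F (of_real x))) has_real_derivative Re d) (at x)"
  using bounded_linear.has_vector_derivative[OF bounded_linear_Re has_vector_derivative_real_field[OF assms]]
  by (simp add: has_real_derivative_iff_has_vector_derivative)

lemma Im_has_real_derivative:
  assumes "(F has_field_derivative d) (at (of_real x))"
  shows "((\<lambda>x. Im (F (of_real x))) has_real_derivative Im d) (at x)"
  using bounded_linear.has_vector_derivative[OF bounded_linear_Im has_vector_derivative_real_field[OF assms]]
  by (simp add: has_real_derivative_iff_has_vector_derivative)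

lemma has_vector_derivative_vec:
  fixes f :: "real \<Rightarrow> real^3"
  assumes "\<And>i. ((\<lambda>x. f x $ i) has_real_derivative d $ i) (at x)"
  shows "(f has_vector_derivative d) (at x)"
  unfolding has_vector_derivative_def
proof (subst has_derivative_componentwise_within, intro ballI)
  fix v :: "real^3" assume "v \<in> Basis"
  then obtain i where v: "v = axis i 1" by (auto simp: Basis_vec_def)
  show "((\<lambda>x. f x \<bullet> v) has_derivative (\<lambda>y. y *\<^sub>R d \<bullet> v)) (at x)"
  proof -
    have "(*) (d $ i) = (\<lambda>y. y * d $ i)" by (simp add: fun_eq_iff)
    then show ?thesis using assms[of i] by (simp add: v inner_axis has_field_derivative_def)
  qed
qed

text \<open>The class is closed under both partial derivatives, which differentiate F or multiply it
  by f. Smoothness follows by induction and second derivatives by iteration.\<close>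

definition wave :: "(3 \<Rightarrow> complex \<Rightarrow> complex) \<Rightarrow> (3 \<Rightarrow> real) \<Rightarrow> real \<times> real \<Rightarrow> real^3" where
  "wave F f z = (\<chi> i. Re (F i (of_real (fst z))) * exp (f i * snd z))"

lemma wave_pdx:
  assumes "open D" "\<And>i. F i holomorphic_on D" "of_real (fst z) \<in> D"
  shows "pdx (wave F f) z = wave (\<lambda>i. deriv (F i)) f z"
proof (rule pdxI, rule has_vector_derivative_vec)
  fix i
  have "((\<lambda>s. Re (F i (of_real s))) has_real_derivative Re (deriv (F i) (of_real (fst z)))) (at (fst z))"
    by (intro Re_has_real_derivative holomorphic_derivI[OF assms(2,1,3)])
  from DERIV_cmult_right[OF this, of "exp (f i * snd z)"]
  show "((\<lambda>s. wave F f (s, snd z) $ i) has_real_derivative wave (\<lambda>i. deriv (F i)) f z $ i) (at (fst z))"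
    by (simp add: wave_def)
qed

lemma wave_pdy: "pdy (wave F f) z = wave (\<lambda>i x. of_real (f i) * F i x) f z"
proof (rule pdyI, rule has_vector_derivative_vec)
  fix i
  have "((\<lambda>s. exp (f i * s)) has_real_derivative f i * exp (f i * snd z)) (at (snd z))"
    by (auto intro!: derivative_eq_intros)
  from DERIV_cmult[OF this, of "Re (F i (of_real (fst z)))"]
  show "((\<lambda>s. wave F f (fst z, s) $ i) has_real_derivative wave (\<lambda>i x. of_real (f i) * F i x) f z $ i) (at (snd z))"
    by (simp add: wave_def mult_ac)
qed

lemma wave_differentiable:
  assumes "open D" "\<And>i. F i holomorphic_on D" "of_real (fst z) \<in> D"
  shows "wave F f differentiable (at z)"
proof (subst differentiable_componentwise_within, intro ballI)
  fix v :: "real^3" assume "v \<in> Basis"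
  then obtain i where v: "v = axis i 1" by (auto simp: Basis_vec_def)
  have "(\<lambda>s. Re (F i (of_real s))) differentiable (at (fst z))"
    using Re_has_real_derivative[OF holomorphic_derivI[OF assms(2,1,3)]]
    by (auto simp: real_differentiable_def)
  moreover have "fst differentiable (at z)" "snd differentiable (at z)"
    by (auto intro!: bounded_linear_imp_differentiable bounded_linear_fst bounded_linear_snd)
  ultimately have 1: "(\<lambda>z. Re (F i (of_real (fst z)))) differentiable (at z)"
    by (intro differentiable_compose[of "\<lambda>s. Re (F i (of_real s))" fst])
  have "(\<lambda>s. exp (f i * s)) differentiable (at (snd z))"
    unfolding real_differentiable_def by (rule exI) (auto intro!: derivative_eq_intros)
  then have 2: "(\<lambda>z. exp (f i * snd z)) differentiable (at z)"
    using \<open>snd differentiable (at z)\<close> by (intro differentiable_compose[of "\<lambda>s. exp (f i * s)" snd])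
  show "(\<lambda>z. wave F f z \<bullet> v) differentiable (at z)"
    using differentiable_mult[OF 1 2] by (simp add: v inner_axis wave_def)
qed

lemma wave_smooth:
  assumes D: "open D" and \<Omega>: "open \<Omega>" "\<And>z. z \<in> \<Omega> \<Longrightarrow> of_real (fst z) \<in> D" and F: "\<And>i. F i holomorphic_on D"
  shows "smooth_on \<Omega> (wave F f)"
proof -
  have "C_diff_on n \<Omega> (wave F f)" if "\<And>i. F i holomorphic_on D" for n F
    using that
  proof (induction n arbitrary: F)
    case 0
    have "continuous (at z) (wave F f)" if "z \<in> \<Omega>" for z
      using wave_differentiable[OF D 0 \<Omega>(2)[OF that]] by (rule differentiable_imp_continuous_within)
    then show ?case by (simp add: continuous_at_imp_continuous_on)
  next
    case (Suc n)
    have "wave F f differentiable_on \<Omega>"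
      using wave_differentiable[OF D Suc.prems \<Omega>(2)] \<Omega>(1) by (simp add: differentiable_on_eq_differentiable_at)
    moreover have "C_diff_on n \<Omega> (pdx (wave F f))"
      using Suc.IH[of "\<lambda>i. deriv (F i)"] holomorphic_deriv[OF Suc.prems D]
      by (subst C_diff_on_cong[OF \<Omega>(1) wave_pdx[OF D Suc.prems \<Omega>(2)]]) auto
    moreover have "C_diff_on n \<Omega> (pdy (wave F f))"
      unfolding wave_pdy[abs_def] by (intro Suc.IH holomorphic_intros Suc.prems)
    ultimately show ?case by simp
  qed
  then show ?thesis using F by (simp add: smooth_on_def)
qed

section \<open>P and P' on the real axis next to a pole\<close>

context half_periods
begin

lemma pole_limits: "((\<lambda>z. z\<^sup>2 * wp \<Lambda> z) \<longlongrightarrow> 1) (at 0)" "((\<lambda>z. z ^ 3 * wpd z) \<longlongrightarrow> - 2) (at 0)"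
proof -
  obtain T T' where T: "T holomorphic_on ball 0 rad" "T' holomorphic_on ball 0 rad"
    and p: "\<And>z. z \<in> ball 0 rad \<Longrightarrow> z \<noteq> 0 \<Longrightarrow>
      z\<^sup>2 * wp \<Lambda> z = 1 + z ^ 4 * (invariant_g2 \<Lambda> / 20 + invariant_g3 \<Lambda> / 28 * z\<^sup>2 + z ^ 3 * T z)"
    and d: "\<And>z. z \<in> ball 0 rad \<Longrightarrow> z \<noteq> 0 \<Longrightarrow>
      z ^ 3 * wpd z = - 2 + z ^ 4 * (invariant_g2 \<Lambda> / 10 + invariant_g3 \<Lambda> / 7 * z\<^sup>2 + 5 * z ^ 3 * T z + z ^ 4 * T' z)"
    using wp_expansion by blast
  let ?f = "\<lambda>z. 1 + z ^ 4 * (invariant_g2 \<Lambda> / 20 + invariant_g3 \<Lambda> / 28 * z\<^sup>2 + z ^ 3 * T z)"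
  let ?h = "\<lambda>z. - 2 + z ^ 4 * (invariant_g2 \<Lambda> / 10 + invariant_g3 \<Lambda> / 7 * z\<^sup>2 + 5 * z ^ 3 * T z + z ^ 4 * T' z)"
  have "(?f \<longlongrightarrow> ?f 0) (at 0)" "(?h \<longlongrightarrow> ?h 0) (at 0)"
    by (intro tendsto_intros holomorphic_ball_tendsto_0[OF T(1) rad_pos] holomorphic_ball_tendsto_0[OF T(2) rad_pos])+
  then have l: "(?f \<longlongrightarrow> 1) (at 0)" "(?h \<longlongrightarrow> - 2) (at 0)" by simp_all
  have ev: "\<forall>\<^sub>F z in at 0. ?f z = z\<^sup>2 * wp \<Lambda> z" "\<forall>\<^sub>F z in at 0. ?h z = z ^ 3 * wpd z"
    using eventually_punctured_ball by (eventually_elim, simp add: p d)+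
  show "((\<lambda>z. z\<^sup>2 * wp \<Lambda> z) \<longlongrightarrow> 1) (at 0)" "((\<lambda>z. z ^ 3 * wpd z) \<longlongrightarrow> - 2) (at 0)"
    by (rule Lim_transform_eventually[OF l(1) ev(1)], rule Lim_transform_eventually[OF l(2) ev(2)])
qed

lemma real_pole:
  obtains \<delta> where "\<delta> > 0" "\<And>u. 0 < u \<Longrightarrow> u < \<delta> \<Longrightarrow> Re (wp \<Lambda> (of_real u)) > B \<and> Re (wpd (of_real u)) < - B"
proof -
  have "\<forall>\<^sub>F z in at 0. dist (z\<^sup>2 * wp \<Lambda> z) 1 < 1 / 2" "\<forall>\<^sub>F z in at 0. dist (z ^ 3 * wpd z) (- 2) < 1"
    by (rule tendstoD[OF pole_limits(1)], simp) (rule tendstoD[OF pole_limits(2)], simp)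
  then have "\<forall>\<^sub>F z in at 0. dist (z\<^sup>2 * wp \<Lambda> z) 1 < 1 / 2 \<and> dist (z ^ 3 * wpd z) (- 2) < 1"
    by (rule eventually_conj)
  then obtain d where d: "d > 0" "\<And>z. z \<noteq> 0 \<Longrightarrow> dist z 0 < d \<Longrightarrow> dist (z\<^sup>2 * wp \<Lambda> z) 1 < 1 / 2 \<and> dist (z ^ 3 * wpd z) (- 2) < 1"
    unfolding eventually_at by auto
  \<comment> \<open>For u < 1 / M <= 1/2 both u^2 M and u^3 M stay below 1, which converts u^2 P >
    1/2 and u^3 P' < -1 into P > M / 2 and P' < - M.\<close>
  define M where "M = 2 * (\<bar>B\<bar> + 1)"
  have M: "M > 0" "M \<ge> 2" by (auto simp: M_def)
  show ?thesis
  proof (rule that[of "min d (1 / M)"])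
    fix u :: real assume u: "0 < u" "u < min d (1 / M)"
    have e: "dist ((of_real u)\<^sup>2 * wp \<Lambda> (of_real u)) 1 < 1 / 2" "dist ((of_real u) ^ 3 * wpd (of_real u)) (- 2) < 1"
      using d(2)[of "of_real u"] u by auto
    have r: "Re ((of_real u)\<^sup>2 * wp \<Lambda> (of_real u)) = u\<^sup>2 * Re (wp \<Lambda> (of_real u))"
      "Re ((of_real u) ^ 3 * wpd (of_real u)) = u ^ 3 * Re (wpd (of_real u))"
      by (simp_all flip: of_real_power)
    have p: "u\<^sup>2 * Re (wp \<Lambda> (of_real u)) > 1 / 2"
      using e(1) abs_Re_le_cmod[of "(of_real u)\<^sup>2 * wp \<Lambda> (of_real u) - 1"] by (simp add: dist_norm r)
    have q: "u ^ 3 * Re (wpd (of_real u)) < - 1"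
      using e(2) abs_Re_le_cmod[of "(of_real u) ^ 3 * wpd (of_real u) + 2"] by (simp add: dist_norm r)
    have uM: "u * M < 1" using u M by (simp add: field_simps)
    have u1: "u < 1"
    proof -
      have "u * 2 \<le> u * M" using u M by (intro mult_left_mono) auto
      then show ?thesis using uM u by linarith
    qed
    have u2: "u\<^sup>2 * M < 1" "u ^ 3 * M < 1"
    proof -
      have "u\<^sup>2 \<le> u" "u ^ 3 \<le> u" using u u1 power_decreasing[of 1 2 u] power_decreasing[of 1 3 u] by auto
      then have "u\<^sup>2 * M \<le> u * M" "u ^ 3 * M \<le> u * M" using M by (auto intro: mult_right_mono)
      then show "u\<^sup>2 * M < 1" "u ^ 3 * M < 1" using uM by auto
    qed
    have "u\<^sup>2 * (M / 2) < u\<^sup>2 * Re (wp \<Lambda> (of_real u))" using p u2(1) by linarith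
    then have "M / 2 < Re (wp \<Lambda> (of_real u))" using u by simp
    have "u ^ 3 * Re (wpd (of_real u)) < u ^ 3 * (- M)" using q u2(2) by linarith
    moreover have "0 < u ^ 3" using u by simp
    ultimately have "Re (wpd (of_real u)) < - M" by (simp only: mult_less_cancel_left_pos)
    with \<open>M / 2 < Re (wp \<Lambda> (of_real u))\<close> show "Re (wp \<Lambda> (of_real u)) > B \<and> Re (wpd (of_real u)) < - B"
    proof -
      have "M / 2 = \<bar>B\<bar> + 1" "B \<le> \<bar>B\<bar>" "\<bar>B\<bar> \<ge> 0" by (auto simp: M_def)
      then have "B < M / 2" "B \<le> M" by linarith+
      with \<open>M / 2 < Re (wp \<Lambda> (of_real u))\<close> \<open>Re (wpd (of_real u)) < - M\<close> show ?thesis by auto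
    qed
  qed (use d M in auto)
qed

lemma strip_pdom: "- \<omega>1 < x \<Longrightarrow> x < \<omega>1 \<Longrightarrow> of_real x \<in> pdom"
proof -
  assume x: "- \<omega>1 < x" "x < \<omega>1"
  have "of_real (x + \<omega>1) \<notin> \<Lambda>"
  proof
    assume "of_real (x + \<omega>1) \<in> \<Lambda>"
    then obtain m :: int where m: "x + \<omega>1 = of_int m * (2 * \<omega>1)" using lattice_real_iff by blast
    have "0 < of_int m * (2 * \<omega>1)" "of_int m * (2 * \<omega>1) < 1 * (2 * \<omega>1)" unfolding m[symmetric] using x by auto
    then have "0 < real_of_int m" "real_of_int m < 1"
      using \<omega>1_pos by (simp_all only: zero_less_mult_iff mult_less_cancel_right_pos) auto
    then have "0 < m" "m < 1" by simp_all
    then show False by simp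
  qed
  then show ?thesis by (simp add: pdom_def)
qed

end

context spectral
begin

lemma mode_real_deriv:
  assumes m: "mode f h" and x: "of_real x \<in> pdom"
  shows "deriv h (of_real x) \<in> \<real>"
proof -
  have "open ((of_real :: real \<Rightarrow> complex) -` pdom)" by (intro open_vimage open_dom continuous_intros)
  moreover have "x \<in> of_real -` pdom" using x by simp
  moreover have "((\<lambda>x. Im (h (of_real x))) has_real_derivative Im (deriv h (of_real x))) (at x)"
    by (intro Im_has_real_derivative mode_deriv[OF m x])
  ultimately have "((\<lambda>x. 0) has_real_derivative Im (deriv h (of_real x))) (at x)"
    using mode_real[OF m] by (auto elim!: has_field_derivative_transform_within_open simp: complex_is_Real_iff)
  then have "Im (deriv h (of_real x)) = 0" using DERIV_const DERIV_unique by blast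
  then show ?thesis by (simp add: complex_is_Real_iff)
qed

lemma mode_Re:
  assumes m: "mode f h" and x: "of_real x \<in> pdom"
  defines "H \<equiv> Re (h (of_real x))" and "H1 \<equiv> Re (deriv h (of_real x))" and "H2 \<equiv> Re (deriv (deriv h) (of_real x))"
    and "G \<equiv> Re (GG (of_real x))" and "G1 \<equiv> Re (GG1 (of_real x))"
  shows "2 * H1 * (G - (3 * b - f\<^sup>2)) = H * (G1 + 4 * U1)"
    "H1 * (G1 - 4 * U1) = 2 * (G\<^sup>2 - f\<^sup>2 * G - 2 * U2 * f) * H"
    "H2 = (2 * G - f\<^sup>2) * H"
proof -
  have r: "h (of_real x) = of_real H" "deriv h (of_real x) = of_real H1" "GG (of_real x) = of_real G" "GG1 (of_real x) = of_real G1"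
    using mode_real[OF m x] mode_real_deriv[OF m x] real_GG[OF x] by (simp_all add: H_def H1_def G_def G1_def)
  have "2 * deriv h (of_real x) * (GG (of_real x) - of_real (3 * b - f\<^sup>2)) = h (of_real x) * (GG1 (of_real x) + 4 * of_real U1)"
    using m x by (auto simp: mode_def)
  then have "complex_of_real (2 * H1 * (G - (3 * b - f\<^sup>2))) = of_real (H * (G1 + 4 * U1))"
    unfolding r by simp
  then show "2 * H1 * (G - (3 * b - f\<^sup>2)) = H * (G1 + 4 * U1)" by (simp only: of_real_eq_iff)
  have "complex_of_real (H1 * (G1 - 4 * U1)) = of_real (2 * (G\<^sup>2 - f\<^sup>2 * G - 2 * U2 * f) * H)"
    using mode_second[OF m x] unfolding r by simp
  then show "H1 * (G1 - 4 * U1) = 2 * (G\<^sup>2 - f\<^sup>2 * G - 2 * U2 * f) * H" by (simp only: of_real_eq_iff)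
  have "deriv (deriv h) (of_real x) = of_real ((2 * G - f\<^sup>2) * H)"
    using mode_lame[OF m x] unfolding r by simp
  then show "H2 = (2 * G - f\<^sup>2) * H" unfolding H2_def by (simp only: Re_complex_of_real)
qed

text \<open>The bracket is the frame determinant stripped of constants and exponentials. Multiply by
  G' - 4 U1 and insert \<open>mode_second\<close> and \<open>mode_product\<close>: in the cyclic
  sums over f_j - f_k the weights 1 and f_i give zero, while f_i^2 leaves the Vandermonde
  product.\<close>

lemma mode_wronskian:
  assumes m: "mode f1 h1" "mode f2 h2" "mode f3 h3" and s: "f1 + f2 + f3 = 0" "f1\<^sup>2 + f2\<^sup>2 + f3\<^sup>2 = 6 * b" and x: "x \<in> pdom"
  shows "2 * of_real U1 * (deriv h1 x * h2 x * h3 x * of_real (f2 - f3) + deriv h2 x * h1 x * h3 x * of_real (f3 - f1)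
      + deriv h3 x * h1 x * h2 x * of_real (f1 - f2)) + GG x * of_real ((f1 - f2) * (f2 - f3) * (f3 - f1)) = 0"
proof -
  have hol: "h1 holomorphic_on pdom" "h2 holomorphic_on pdom" "h3 holomorphic_on pdom"
    using m by (auto simp: mode_def)
  let ?Y = "\<lambda>x. GG1 x - 4 * of_real U1"
  let ?B = "\<lambda>x. 2 * of_real U1 * (deriv h1 x * h2 x * h3 x * of_real (f2 - f3) + deriv h2 x * h1 x * h3 x * of_real (f3 - f1)
      + deriv h3 x * h1 x * h2 x * of_real (f1 - f2)) + GG x * of_real ((f1 - f2) * (f2 - f3) * (f3 - f1))"
  show "?B x = 0"
  proof (rule holomorphic_mult_eq_0[where A = ?Y, OF open_dom connected_dom _ _ _ zero_in_dom _ x])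
    show "?Y holomorphic_on pdom" by (intro holomorphic_intros GG1_holomorphic)
    show "?B holomorphic_on pdom"
      by (intro holomorphic_intros GG_holomorphic holomorphic_deriv open_dom hol)
    show "?Y 0 \<noteq> 0" using U1 by (simp add: GG1_0)
    fix x assume x: "x \<in> pdom"
    define y g p d1 d2 d3 a1 a2 a3 e1 e2 e3 u1 u2 where "y = ?Y x" and "g = GG x" and "p = h1 x * h2 x * h3 x" and
      "d1 = deriv h1 x" and "d2 = deriv h2 x" and "d3 = deriv h3 x" and "a1 = h1 x" and "a2 = h2 x" and "a3 = h3 x"
      and "e1 = complex_of_real f1" and "e2 = complex_of_real f2" and "e3 = complex_of_real f3" and "u1 = complex_of_real U1" and "u2 = complex_of_real U2"
    have q: "d1 * y = 2 * (g\<^sup>2 - e1\<^sup>2 * g - 2 * u2 * e1) * a1" "d2 * y = 2 * (g\<^sup>2 - e2\<^sup>2 * g - 2 * u2 * e2) * a2"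
      "d3 * y = 2 * (g\<^sup>2 - e3\<^sup>2 * g - 2 * u2 * e3) * a3"
      using mode_second[OF m(1) x] mode_second[OF m(2) x] mode_second[OF m(3) x]
      by (simp_all add: y_def g_def d1_def d2_def d3_def a1_def a2_def a3_def e1_def e2_def e3_def u2_def)
    have y: "y = - 4 * u1 * (a1 * a2 * a3)"
      using mode_product[OF m s x] by (simp add: y_def a1_def a2_def a3_def u1_def)
    have "y * (2 * u1 * (d1 * a2 * a3 * (e2 - e3) + d2 * a1 * a3 * (e3 - e1) + d3 * a1 * a2 * (e1 - e2)) + g * ((e1 - e2) * (e2 - e3) * (e3 - e1)))
       = 2 * u1 * ((d1 * y) * a2 * a3 * (e2 - e3) + (d2 * y) * a1 * a3 * (e3 - e1) + (d3 * y) * a1 * a2 * (e1 - e2)) + y * (g * ((e1 - e2) * (e2 - e3) * (e3 - e1)))"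
      by algebra
    also have "\<dots> = 0" unfolding q using y by algebra
    finally show "?Y x * ?B x = 0"
      by (simp add: y_def g_def d1_def d2_def d3_def a1_def a2_def a3_def e1_def e2_def e3_def u1_def)
  qed
qed

text \<open>The volume condition comes from \<open>mode_wronskian\<close>: the exponentials multiply
  to 1, so the frame determinant has modulus |C 1 C 2 C 3| times the Vandermonde product over 2 |U1|
  times g, and it has to be g.\<close>

lemma wave_data:
  fixes f C :: "3 \<Rightarrow> real" and h :: "3 \<Rightarrow> complex \<Rightarrow> complex"
  assumes m: "\<And>i. mode (f i) (h i)" and s: "f 1 + f 2 + f 3 = 0" "(f 1)\<^sup>2 + (f 2)\<^sup>2 + (f 3)\<^sup>2 = 6 * b"
    and vol: "\<bar>C 1 * C 2 * C 3 * ((f 1 - f 2) * (f 2 - f 3) * (f 3 - f 1))\<bar> = 2 * \<bar>U1\<bar>"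
    and \<Omega>: "open \<Omega>" "\<And>z. z \<in> \<Omega> \<Longrightarrow> of_real (fst z) \<in> pdom"
    and pos: "\<And>z. z \<in> \<Omega> \<Longrightarrow> Re (GG (of_real (fst z))) > 0"
    and G: "\<And>z. z \<in> \<Omega> \<Longrightarrow> G z = Re (GG (of_real (fst z)))"
    and U: "\<And>z. z \<in> \<Omega> \<Longrightarrow> U z = Complex U1 U2"
  shows "affine_sphere_data \<Omega> (wave (\<lambda>i x. of_real (C i) * h i x) f) G (-1) U"
proof -
  let ?g = "\<lambda>x. Re (GG (of_real x))" and ?g1 = "\<lambda>x. Re (GG1 (of_real x))"
  let ?F = "\<lambda>i x. of_real (C i) * h i x" and ?F1 = "\<lambda>i x. of_real (C i) * deriv (h i) x"
  let ?r = "wave ?F f"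
  have hol: "\<And>i. ?F i holomorphic_on pdom" "\<And>i. ?F1 i holomorphic_on pdom"
  proof -
    fix i
    have h: "h i holomorphic_on pdom" using m[of i] by (simp add: mode_def)
    show "?F i holomorphic_on pdom" "?F1 i holomorphic_on pdom"
      by (intro holomorphic_intros holomorphic_deriv open_dom h)+
  qed
  have dF: "deriv (?F i) x = ?F1 i x" "deriv (?F1 i) x = of_real (C i) * deriv (deriv (h i)) x" if "x \<in> pdom" for i x
    using mode_deriv[OF m that, of i] mode_deriv2[OF m that, of i] by (auto intro!: DERIV_imp_deriv DERIV_cmult)
  have X: "pdx ?r z = wave ?F1 f z" if z: "z \<in> \<Omega>" for z
    using wave_pdx[OF open_dom hol(1) \<Omega>(2)[OF z], where f = f] dF(1)[OF \<Omega>(2)[OF z]] by (simp add: wave_def)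
  have Y: "pdy ?r z = wave (\<lambda>i x. of_real (f i) * ?F i x) f z" for z by (rule wave_pdy)
  have hol2: "\<And>i. (\<lambda>x. of_real (f i) * ?F i x) holomorphic_on pdom"
    by (intro holomorphic_on_mult holomorphic_on_const hol(1))
  have XX: "pdx (pdx ?r) z = wave (\<lambda>i x. of_real (C i) * deriv (deriv (h i)) x) f z" if z: "z \<in> \<Omega>" for z
  proof -
    have "pdx (pdx ?r) z = pdx (wave ?F1 f) z" by (rule pd_cong(1)[OF \<Omega>(1) z X])
    also have "\<dots> = wave (\<lambda>i. deriv (?F1 i)) f z" by (rule wave_pdx[OF open_dom hol(2) \<Omega>(2)[OF z]])
    also have "\<dots> = wave (\<lambda>i x. of_real (C i) * deriv (deriv (h i)) x) f z"
      by (simp add: wave_def dF(2)[OF \<Omega>(2)[OF z]])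
    finally show ?thesis .
  qed
  have YX: "pdy (pdx ?r) z = wave (\<lambda>i x. of_real (f i) * ?F1 i x) f z" if z: "z \<in> \<Omega>" for z
  proof -
    have "pdy (pdx ?r) z = pdy (wave ?F1 f) z" by (rule pd_cong(2)[OF \<Omega>(1) z X])
    also have "\<dots> = wave (\<lambda>i x. of_real (f i) * ?F1 i x) f z" by (rule wave_pdy)
    finally show ?thesis .
  qed
  have XY: "pdx (pdy ?r) z = wave (\<lambda>i x. of_real (f i) * ?F1 i x) f z" if z: "z \<in> \<Omega>" for z
  proof -
    have d: "deriv (\<lambda>x. of_real (f i) * ?F i x) (of_real (fst z)) = of_real (f i) * ?F1 i (of_real (fst z))" for i
      using mode_deriv[OF m \<Omega>(2)[OF z], of i] by (intro DERIV_imp_deriv DERIV_cmult)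
    have "pdx (pdy ?r) z = pdx (wave (\<lambda>i x. of_real (f i) * ?F i x) f) z" by (rule pd_cong(1)[OF \<Omega>(1) z Y])
    also have "\<dots> = wave (\<lambda>i. deriv (\<lambda>x. of_real (f i) * ?F i x)) f z" by (rule wave_pdx[OF open_dom hol2 \<Omega>(2)[OF z]])
    also have "\<dots> = wave (\<lambda>i x. of_real (f i) * ?F1 i x) f z"
      unfolding wave_def d ..
    finally show ?thesis .
  qed
  have YY: "pdy (pdy ?r) z = wave (\<lambda>i x. of_real (f i) * (of_real (f i) * ?F i x)) f z" if z: "z \<in> \<Omega>" for z
  proof -
    have "pdy (pdy ?r) z = pdy (wave (\<lambda>i x. of_real (f i) * ?F i x) f) z" by (rule pd_cong(2)[OF \<Omega>(1) z Y])
    also have "\<dots> = wave (\<lambda>i x. of_real (f i) * (of_real (f i) * ?F i x)) f z" by (rule wave_pdy)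
    finally show ?thesis .
  qed
  have iff: "affine_sphere_data \<Omega> ?r G (-1) U \<longleftrightarrow>
     smooth_on \<Omega> ?r \<and> frame_equations \<Omega> ?r ?g ?g1 U1 U2 \<and>
     (\<forall>z\<in>\<Omega>. \<bar>det3 (pdx ?r z) (pdy ?r z) (?r z)\<bar> = ?g (fst z))"
  proof (rule affine_sphere_data_iff[where g = ?g and ?g1.0 = ?g1, OF \<Omega>(1) pos _ G U])
    fix z assume "z \<in> \<Omega>"
    then show "(?g has_real_derivative ?g1 (fst z)) (at (fst z))"
      by (intro Re_has_real_derivative GG_deriv \<Omega>(2))
  qed
  have "smooth_on \<Omega> ?r" using \<Omega> hol(1) by (intro wave_smooth[OF open_dom]) auto
  moreover have "frame_equations \<Omega> ?r ?g ?g1 U1 U2"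
    unfolding frame_equations_def Let_def
  proof (intro ballI)
    fix z assume z: "z \<in> \<Omega>"
    define x where "x = fst z"
    define k k1 where "k = ?g x" and "k1 = ?g1 x"
    have k: "k > 0" using pos[OF z] by (simp add: k_def x_def)
    have px: "of_real x \<in> pdom" using \<Omega>(2)[OF z] by (simp add: x_def)
    have c: "wave ?F f z $ i = C i * Re (h i (of_real x)) * exp (f i * snd z)"
      "wave ?F1 f z $ i = C i * Re (deriv (h i) (of_real x)) * exp (f i * snd z)"
      "wave (\<lambda>i x. of_real (f i) * ?F i x) f z $ i = f i * (C i * Re (h i (of_real x))) * exp (f i * snd z)"
      "wave (\<lambda>i x. of_real (C i) * deriv (deriv (h i)) x) f z $ i = C i * Re (deriv (deriv (h i)) (of_real x)) * exp (f i * snd z)"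
      "wave (\<lambda>i x. of_real (f i) * ?F1 i x) f z $ i = f i * (C i * Re (deriv (h i) (of_real x))) * exp (f i * snd z)"
      "wave (\<lambda>i x. of_real (f i) * (of_real (f i) * ?F i x)) f z $ i = f i * (f i * (C i * Re (h i (of_real x)))) * exp (f i * snd z)" for i
      by (simp_all add: wave_def x_def)
    have eqs: "Re (deriv (deriv (h i)) (of_real x)) = k * Re (h i (of_real x)) + (k1 - 4 * U1) / (2 * k) * Re (deriv (h i) (of_real x)) + 2 * U2 / k * (f i * Re (h i (of_real x)))"
      "f i * (f i * Re (h i (of_real x))) = k * Re (h i (of_real x)) - (k1 - 4 * U1) / (2 * k) * Re (deriv (h i) (of_real x)) - 2 * U2 / k * (f i * Re (h i (of_real x)))"
      "f i * Re (deriv (h i) (of_real x)) = 2 * U2 / k * Re (deriv (h i) (of_real x)) + (k1 + 4 * U1) / (2 * k) * (f i * Re (h i (of_real x)))" for i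
    proof -
      define H H1 H2 e where "H = Re (h i (of_real x))" and "H1 = Re (deriv (h i) (of_real x))" and "H2 = Re (deriv (deriv (h i)) (of_real x))" and "e = f i"
      have q: "2 * H1 * (k - (3 * b - e\<^sup>2)) = H * (k1 + 4 * U1)" "H1 * (k1 - 4 * U1) = 2 * (k\<^sup>2 - e\<^sup>2 * k - 2 * U2 * e) * H" "H2 = (2 * k - e\<^sup>2) * H"
        using mode_Re[OF m px, of i] by (simp_all add: H_def H1_def H2_def e_def k_def k1_def)
      have u: "2 * U2 = 3 * b * e - e ^ 3" using m[of i] by (simp add: mode_def e_def)
      have 2: "(k1 - 4 * U1) / (2 * k) * H1 = (k - e\<^sup>2 - 2 * U2 * e / k) * H"
      proof -
        have "(k1 - 4 * U1) / (2 * k) * H1 = (H1 * (k1 - 4 * U1)) / (2 * k)" by simp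
        also have "\<dots> = (k - e\<^sup>2 - 2 * U2 * e / k) * H" unfolding q(2) using k by (simp add: field_simps power2_eq_square)
        finally show ?thesis .
      qed
      have "(k1 + 4 * U1) / (2 * k) * (e * H) = e * H1 * (k - (3 * b - e\<^sup>2)) / k"
      proof -
        have "(k1 + 4 * U1) / (2 * k) * (e * H) = e * (H * (k1 + 4 * U1)) / (2 * k)" by simp
        also have "\<dots> = e * H1 * (k - (3 * b - e\<^sup>2)) / k" unfolding q(1)[symmetric] using k by (simp add: field_simps)
        finally show ?thesis .
      qed
      also have "\<dots> = e * H1 - 2 * U2 / k * H1"
        unfolding u using k by (simp add: field_simps power2_eq_square power3_eq_cube)
      finally have 1: "(k1 + 4 * U1) / (2 * k) * (e * H) = e * H1 - 2 * U2 / k * H1" .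
      show "H2 = k * H + (k1 - 4 * U1) / (2 * k) * H1 + 2 * U2 / k * (e * H)"
        "e * (e * H) = k * H - (k1 - 4 * U1) / (2 * k) * H1 - 2 * U2 / k * (e * H)"
        "e * H1 = 2 * U2 / k * H1 + (k1 + 4 * U1) / (2 * k) * (e * H)"
        unfolding 1 2 q(3) by (simp_all add: algebra_simps power2_eq_square)
    qed
    have lin: "C i * (N * P + Q * S + T * V) * E = N * (C i * P * E) + Q * (C i * S * E) + T * (C i * V * E)"
      "C i * (N * P - Q * S - T * V) * E = N * (C i * P * E) - Q * (C i * S * E) - T * (C i * V * E)"
      "C i * (Q * S + T * V) * E = Q * (C i * S * E) + T * (C i * V * E)" for i N P Q S T V E
      by (simp_all add: algebra_simps)
    have e: "f i * (C i * P) * E = C i * (f i * P) * E" "f i * (f i * (C i * P)) * E = C i * (f i * (f i * P)) * E" for i P E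
      by (simp_all add: mult_ac)
    note comp = vector_add_component vector_minus_component vector_scaleR_component real_scaleR_def
    show "pdx (pdx ?r) z = ?g (fst z) *\<^sub>R ?r z + ((?g1 (fst z) - 4 * U1) / (2 * ?g (fst z))) *\<^sub>R pdx ?r z + (2 * U2 / ?g (fst z)) *\<^sub>R pdy ?r z \<and>
     pdy (pdy ?r) z = ?g (fst z) *\<^sub>R ?r z - ((?g1 (fst z) - 4 * U1) / (2 * ?g (fst z))) *\<^sub>R pdx ?r z - (2 * U2 / ?g (fst z)) *\<^sub>R pdy ?r z \<and>
     pdy (pdx ?r) z = (2 * U2 / ?g (fst z)) *\<^sub>R pdx ?r z + ((?g1 (fst z) + 4 * U1) / (2 * ?g (fst z))) *\<^sub>R pdy ?r z \<and>
     pdx (pdy ?r) z = (2 * U2 / ?g (fst z)) *\<^sub>R pdx ?r z + ((?g1 (fst z) + 4 * U1) / (2 * ?g (fst z))) *\<^sub>R pdy ?r z"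
      unfolding XX[OF z] YY[OF z] YX[OF z] XY[OF z] X[OF z] Y x_def[symmetric] k_def[symmetric] k1_def[symmetric]
    proof (intro conjI)
      show v: "wave (\<lambda>i x. of_real (C i) * deriv (deriv (h i)) x) f z = k *\<^sub>R wave ?F f z + ((k1 - 4 * U1) / (2 * k)) *\<^sub>R wave ?F1 f z
          + (2 * U2 / k) *\<^sub>R wave (\<lambda>i x. of_real (f i) * ?F i x) f z"
      proof (unfold vec_eq_iff, rule allI)
        fix i
        show "wave (\<lambda>i x. of_real (C i) * deriv (deriv (h i)) x) f z $ i = (k *\<^sub>R wave ?F f z + ((k1 - 4 * U1) / (2 * k)) *\<^sub>R wave ?F1 f z
          + (2 * U2 / k) *\<^sub>R wave (\<lambda>i x. of_real (f i) * ?F i x) f z) $ i"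
          unfolding comp c e by (subst eqs(1)) (rule lin)
      qed
      show "wave (\<lambda>i x. of_real (f i) * (of_real (f i) * ?F i x)) f z = k *\<^sub>R wave ?F f z - ((k1 - 4 * U1) / (2 * k)) *\<^sub>R wave ?F1 f z
          - (2 * U2 / k) *\<^sub>R wave (\<lambda>i x. of_real (f i) * ?F i x) f z"
      proof (unfold vec_eq_iff, rule allI)
        fix i
        show "wave (\<lambda>i x. of_real (f i) * (of_real (f i) * ?F i x)) f z $ i = (k *\<^sub>R wave ?F f z - ((k1 - 4 * U1) / (2 * k)) *\<^sub>R wave ?F1 f z
          - (2 * U2 / k) *\<^sub>R wave (\<lambda>i x. of_real (f i) * ?F i x) f z) $ i"
          unfolding comp c e by (subst eqs(2)) (rule lin)
      qed
      show w: "wave (\<lambda>i x. of_real (f i) * ?F1 i x) f z = (2 * U2 / k) *\<^sub>R wave ?F1 f z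
          + ((k1 + 4 * U1) / (2 * k)) *\<^sub>R wave (\<lambda>i x. of_real (f i) * ?F i x) f z"
      proof (unfold vec_eq_iff, rule allI)
        fix i
        show "wave (\<lambda>i x. of_real (f i) * ?F1 i x) f z $ i = ((2 * U2 / k) *\<^sub>R wave ?F1 f z
          + ((k1 + 4 * U1) / (2 * k)) *\<^sub>R wave (\<lambda>i x. of_real (f i) * ?F i x) f z) $ i"
          unfolding comp c e by (subst eqs(3)) (rule lin)
      qed
      show "wave (\<lambda>i x. of_real (f i) * ?F1 i x) f z = (2 * U2 / k) *\<^sub>R wave ?F1 f z
          + ((k1 + 4 * U1) / (2 * k)) *\<^sub>R wave (\<lambda>i x. of_real (f i) * ?F i x) f z"
        by (rule w)
    qed
  qed
  moreover have "\<bar>det3 (pdx ?r z) (pdy ?r z) (?r z)\<bar> = ?g (fst z)" if z: "z \<in> \<Omega>" for z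
  proof -
    define x y where "x = fst z" and "y = snd z"
    have px: "of_real x \<in> pdom" using \<Omega>(2)[OF z] by (simp add: x_def)
    define k H H1 where "k = ?g x" and "H i = Re (h i (of_real x))" and "H1 i = Re (deriv (h i) (of_real x))" for i
    have r: "h i (of_real x) = of_real (H i)" "deriv (h i) (of_real x) = of_real (H1 i)" "GG (of_real x) = of_real k" for i
      using mode_real[OF m px] mode_real_deriv[OF m px] real_GG[OF px] by (simp_all add: H_def H1_def k_def)
    define V where "V = (f 1 - f 2) * (f 2 - f 3) * (f 3 - f 1)"
    define W where "W = H1 1 * H 2 * H 3 * (f 2 - f 3) + H1 2 * H 1 * H 3 * (f 3 - f 1) + H1 3 * H 1 * H 2 * (f 1 - f 2)"
    have "complex_of_real (2 * U1 * W + k * V) = 0"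
      using mode_wronskian[OF m m m s px] unfolding r by (simp add: W_def V_def)
    then have "2 * U1 * W + k * V = 0" by (simp only: of_real_eq_0_iff)
    then have "\<bar>2 * U1 * W\<bar> = \<bar>k * V\<bar>" by (simp add: eq_neg_iff_add_eq_0[symmetric])
    then have W: "2 * \<bar>U1\<bar> * \<bar>W\<bar> = k * \<bar>V\<bar>" using pos[OF z] by (simp add: abs_mult k_def x_def)
    have E: "exp (f 1 * y) * exp (f 2 * y) * exp (f 3 * y) = 1"
    proof -
      have "exp (f 1 * y) * exp (f 2 * y) * exp (f 3 * y) = exp ((f 1 + f 2 + f 3) * y)"
        by (simp add: exp_add[symmetric] algebra_simps)
      then show ?thesis by (simp add: s(1))
    qed
    have "det3 (pdx ?r z) (pdy ?r z) (?r z) = C 1 * C 2 * C 3 * W * (exp (f 1 * y) * exp (f 2 * y) * exp (f 3 * y))"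
      unfolding X[OF z] Y det3_expand wave_def W_def by (simp add: H_def H1_def x_def y_def algebra_simps)
    then have "\<bar>det3 (pdx ?r z) (pdy ?r z) (?r z)\<bar> = \<bar>C 1 * C 2 * C 3\<bar> * \<bar>W\<bar>" unfolding E by (simp add: abs_mult)
    moreover have "\<bar>C 1 * C 2 * C 3\<bar> * \<bar>W\<bar> = k"
    proof -
      define cc where "cc = \<bar>C 1 * C 2 * C 3\<bar>"
      have v: "cc * \<bar>V\<bar> = 2 * \<bar>U1\<bar>" using vol by (simp only: abs_mult cc_def V_def)
      have "(2 * \<bar>U1\<bar>) * (cc * \<bar>W\<bar>) = cc * (2 * \<bar>U1\<bar> * \<bar>W\<bar>)" by (simp only: mult_ac)
      also have "\<dots> = k * (cc * \<bar>V\<bar>)" unfolding W by (simp only: mult_ac)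
      also have "\<dots> = (2 * \<bar>U1\<bar>) * k" unfolding v by (simp only: mult_ac)
      finally have "(2 * \<bar>U1\<bar>) * (cc * \<bar>W\<bar>) = (2 * \<bar>U1\<bar>) * k" .
      moreover have "2 * \<bar>U1\<bar> \<noteq> 0" using U1 by simp
      ultimately show ?thesis unfolding cc_def by (blast dest: mult_left_cancel[THEN iffD1])
    qed
    ultimately show ?thesis by (simp add: k_def x_def)
  qed
  ultimately show ?thesis unfolding iff by blast
qed

end

text \<open>At G = 2b the right side of the differential equation is 16 (|U|^2 - b^3) < 0. So the
  real solution, which comes down from the pole, never reaches 2b.\<close>

locale positive_spectral = spectral +
  assumes b_pos: "b > 0" and below: "U1\<^sup>2 + U2\<^sup>2 < b ^ 3"
begin

definition g :: "real \<Rightarrow> real" where "g x = Re (GG (of_real x))"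
definition g1 :: "real \<Rightarrow> real" where "g1 x = Re (GG1 (of_real x))"

lemma g_deriv: "of_real x \<in> pdom \<Longrightarrow> (g has_real_derivative g1 x) (at x)"
  unfolding g_def[abs_def] g1_def by (intro Re_has_real_derivative GG_deriv)

lemma real_eqs:
  assumes "of_real x \<in> pdom"
  shows "GG (of_real x) = of_real (g x)" "GG1 (of_real x) = of_real (g1 x)"
    "(g1 x)\<^sup>2 = 4 * g x ^ 3 - 12 * b * (g x)\<^sup>2 + 16 * (U1\<^sup>2 + U2\<^sup>2)"
proof -
  show r: "GG (of_real x) = of_real (g x)" "GG1 (of_real x) = of_real (g1 x)"
    using real_GG[OF assms] by (simp_all add: g_def g1_def)
  have "complex_of_real ((g1 x)\<^sup>2) = of_real (4 * g x ^ 3 - 12 * b * (g x)\<^sup>2 + 16 * (U1\<^sup>2 + U2\<^sup>2))"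
    using GG_ode[OF assms] unfolding r by simp
  then show "(g1 x)\<^sup>2 = 4 * g x ^ 3 - 12 * b * (g x)\<^sup>2 + 16 * (U1\<^sup>2 + U2\<^sup>2)" by (simp only: of_real_eq_iff)
qed

lemma g1_deriv: "of_real x \<in> pdom \<Longrightarrow> (g1 has_real_derivative 6 * g x * (g x - 2 * b)) (at x)"
proof -
  assume x: "of_real x \<in> pdom"
  have "(g1 has_real_derivative Re (6 * (GG (of_real x))\<^sup>2 - 12 * of_real b * GG (of_real x))) (at x)"
    unfolding g1_def[abs_def] by (intro Re_has_real_derivative GG1_deriv x)
  also have "6 * (GG (of_real x))\<^sup>2 - 12 * of_real b * GG (of_real x) = of_real (6 * g x * (g x - 2 * b))"
    unfolding real_eqs(1)[OF x] by (simp add: power2_eq_square algebra_simps)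
  finally show ?thesis by simp
qed

lemma g_ne: "of_real x \<in> pdom \<Longrightarrow> g x \<noteq> 2 * b"
proof
  assume "of_real x \<in> pdom" "g x = 2 * b"
  then have "(g1 x)\<^sup>2 = 16 * (U1\<^sup>2 + U2\<^sup>2 - b ^ 3)"
    using real_eqs(3)[of x] by (simp add: power2_eq_square power3_eq_cube)
  moreover have "16 * (U1\<^sup>2 + U2\<^sup>2 - b ^ 3) < 0" using below by simp
  ultimately show False using zero_le_power2[of "g1 x"] by simp
qed

lemma g_gt_strip:
  assumes x: "- \<omega>1 < x" "x < \<omega>1"
  shows "g x > 2 * b"
proof (rule ccontr)
  assume "\<not> g x > 2 * b"
  obtain \<delta> where \<delta>: "\<delta> > 0" "\<And>u. 0 < u \<Longrightarrow> u < \<delta> \<Longrightarrow> Re (wp \<Lambda> (of_real u)) > 2 * b \<and> Re (wpd (of_real u)) < - (2 * b)"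
    using real_pole by blast
  define u where "u = min (\<delta> / 2) ((x + \<omega>1) / 2)"
  have u: "0 < u" "u < \<delta>" "u < x + \<omega>1" using \<delta> x by (auto simp: u_def min_def)
  have "g (u - \<omega>1) > 2 * b"
    using \<delta>(2)[OF u(1,2)] b_pos by (simp add: g_def GG_def)
  moreover have "isCont g y" if "u - \<omega>1 \<le> y" "y \<le> x" for y
    using that u x by (intro DERIV_isCont[OF g_deriv] strip_pdom) auto
  ultimately have "\<exists>y\<ge>u - \<omega>1. y \<le> x \<and> g y = 2 * b"
    using \<open>\<not> g x > 2 * b\<close> u by (intro IVT2) auto
  then obtain y where "u - \<omega>1 \<le> y" "y \<le> x" "g y = 2 * b" by blast
  then show False using g_ne[OF strip_pdom[of y]] u x by auto
qed

lemma g_gt: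
  assumes "of_real x \<in> pdom"
  shows "g x > 2 * b"
proof -
  define n where "n = \<lfloor>(x + \<omega>1) / (2 * \<omega>1)\<rfloor>"
  define y where "y = x - of_int n * (2 * \<omega>1)"
  have w: "of_real (of_int n * (2 * \<omega>1)) \<in> \<Lambda>" using lattice_real_iff by blast
  have "of_int n \<le> (x + \<omega>1) / (2 * \<omega>1)" "(x + \<omega>1) / (2 * \<omega>1) < of_int n + 1"
    unfolding n_def by linarith+
  then have "of_int n * (2 * \<omega>1) \<le> x + \<omega>1" "x + \<omega>1 < (of_int n + 1) * (2 * \<omega>1)"
    using \<omega>1_pos by (auto simp: field_simps)
  then have y: "- \<omega>1 \<le> y" "y < \<omega>1" by (auto simp: y_def algebra_simps)
  have e: "complex_of_real x + of_real \<omega>1 = (of_real y + of_real \<omega>1) + of_real (of_int n * (2 * \<omega>1))"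
    by (simp add: y_def)
  have yn: "complex_of_real y + of_real \<omega>1 \<notin> \<Lambda>"
    using assms lattice_add_iff[OF w] unfolding dom_iff e by blast
  then have "y \<noteq> - \<omega>1" by auto
  have "g x = g y"
    unfolding g_def GG_def e using wp_periodic[OF w yn] by simp
  then show ?thesis using g_gt_strip[of y] y \<open>y \<noteq> - \<omega>1\<close> by simp
qed

lemma g1_odd: "g1 (- x) = - g1 x"
proof -
  have "wpd (of_real x - of_real \<omega>1 + 2 * of_real \<omega>1) = wpd (of_real x - of_real \<omega>1)" by (rule wpd_periodic) simp
  moreover have "complex_of_real x - of_real \<omega>1 + 2 * of_real \<omega>1 = of_real x + of_real \<omega>1" by simp
  moreover have "complex_of_real (- x) + of_real \<omega>1 = - (of_real x - of_real \<omega>1)" by simp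
  ultimately show ?thesis unfolding g1_def GG1_def by (simp only: wpd_minus uminus_complex.simps)
qed

text \<open>The derivative 6 g (g - 2b) is positive, and the poles at the two ends give the limits -
  infinity and + infinity. So g' can serve as a coordinate on the strip, to be matched with w
  e^phi.\<close>

lemma g1_bij: "bij_betw g1 {-\<omega>1<..<\<omega>1} UNIV"
  unfolding bij_betw_def
proof
  have "g1 x < g1 y" if "- \<omega>1 < x" "x < y" "y < \<omega>1" for x y
  proof (rule DERIV_pos_imp_increasing[OF that(2)])
    fix w assume w: "x \<le> w" "w \<le> y"
    then have pw: "of_real w \<in> pdom" using that by (intro strip_pdom) auto
    have "g w > 2 * b" by (rule g_gt[OF pw])
    have "0 < 6 * g w * (g w - 2 * b)" using \<open>g w > 2 * b\<close> b_pos by (intro mult_pos_pos) auto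
    then show "\<exists>d. (g1 has_real_derivative d) (at w) \<and> 0 < d"
      using g1_deriv[OF pw] by blast
  qed
  then show "inj_on g1 {-\<omega>1<..<\<omega>1}"
    by (intro linorder_inj_onI) fastforce+
  have "y \<in> g1 ` {-\<omega>1<..<\<omega>1}" for y
  proof -
    obtain \<delta> where \<delta>: "\<delta> > 0" "\<And>u. 0 < u \<Longrightarrow> u < \<delta> \<Longrightarrow> Re (wp \<Lambda> (of_real u)) > \<bar>y\<bar> \<and> Re (wpd (of_real u)) < - \<bar>y\<bar>"
      using real_pole by blast
    define u where "u = min (\<delta> / 2) (\<omega>1 / 2)"
    have u: "0 < u" "u < \<delta>" "u < \<omega>1" using \<delta> \<omega>1_pos by (auto simp: u_def min_def)
    have l: "g1 (u - \<omega>1) < - \<bar>y\<bar>" using \<delta>(2)[OF u(1,2)] by (simp add: g1_def GG1_def)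
    have r: "g1 (\<omega>1 - u) > \<bar>y\<bar>" using l g1_odd[of "u - \<omega>1"] by simp
    have "isCont g1 w" if "u - \<omega>1 \<le> w" "w \<le> \<omega>1 - u" for w
      using that u by (intro DERIV_isCont[OF g1_deriv] strip_pdom) auto
    then have "\<exists>w\<ge>u - \<omega>1. w \<le> \<omega>1 - u \<and> g1 w = y"
      using l r u by (intro IVT) auto
    then show ?thesis using u by (force simp: image_iff)
  qed
  then show "g1 ` {-\<omega>1<..<\<omega>1} = UNIV" by blast
qed

end

section \<open>Hildebrand's spheres\<close>

lemma conjugate_exponents:
  fixes p q :: real
  assumes p: "2 \<le> p" and q: "1 / p + 1 / q = 1"
  shows "p * q = p + q" "q = p / (p - 1)" "q > 1"
proof -
  have p0: "p \<noteq> 0" using p by simp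
  have q0: "q \<noteq> 0" using q p by auto
  show e: "p * q = p + q" using q p0 q0 by (simp add: field_simps)
  have "q * (p - 1) = p" using e by (simp add: algebra_simps)
  then show q': "q = p / (p - 1)" using p by (simp add: field_simps)
  show "q > 1" unfolding q' using p by simp
qed

section \<open>The range of w e^phi for a Hildebrand profile\<close>

context
  fixes p q c \<alpha> :: real and \<phi> :: "real \<Rightarrow> real"
  assumes p: "2 \<le> p" and q: "1 / p + 1 / q = 1" and c: "- 2 * (p + q) < c" "c < 0"
    and \<alpha>: "0 < \<alpha>" "\<alpha> < 1" and profile: "hildebrand_profile p q c \<alpha> \<phi>"
begin

text \<open>Multiplication by w e^phi removes exp (- phi) from the profile equation and leaves a
  cubic in w phi' equal to a quadratic in w e^phi.\<close>

lemma profile_deriv: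
  assumes w: "w \<in> {-\<alpha><..<1}"
  shows "(\<phi> has_real_derivative deriv \<phi> w) (at w)" "isCont (deriv \<phi>) w"
    "w * deriv \<phi> w * (w * deriv \<phi> w + p + 1) * (w * deriv \<phi> w + q + 1)
       = (p + q) * (w * exp (\<phi> w))\<^sup>2 + c * (w * exp (\<phi> w))"
proof -
  have "\<phi> differentiable_on {-\<alpha><..<1}" "deriv \<phi> differentiable_on {-\<alpha><..<1}"
    and e: "exp (- \<phi> w) * deriv \<phi> w * (w * deriv \<phi> w + p + 1) * (w * deriv \<phi> w + q + 1) = (p + q) * w * exp (\<phi> w) + c"
    using profile w by (auto simp: hildebrand_profile_def)
  then have d: "\<phi> differentiable (at w)" "deriv \<phi> differentiable (at w)"
    using w by (auto simp: differentiable_on_eq_differentiable_at)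
  show "(\<phi> has_real_derivative deriv \<phi> w) (at w)"
    using d(1) DERIV_deriv_iff_real_differentiable by blast
  show "isCont (deriv \<phi>) w"
    using d(2) by (rule differentiable_imp_continuous_within)
  have i: "exp (\<phi> w) * exp (- \<phi> w) = 1" by (simp add: exp_minus)
  have "w * deriv \<phi> w * (w * deriv \<phi> w + p + 1) * (w * deriv \<phi> w + q + 1)
     = (w * (exp (\<phi> w) * exp (- \<phi> w))) * deriv \<phi> w * (w * deriv \<phi> w + p + 1) * (w * deriv \<phi> w + q + 1)" unfolding i by simp
  also have "\<dots> = (w * exp (\<phi> w)) * (exp (- \<phi> w) * deriv \<phi> w * (w * deriv \<phi> w + p + 1) * (w * deriv \<phi> w + q + 1))" by (simp only: mult_ac)
  also have "\<dots> = (p + q) * (w * exp (\<phi> w))\<^sup>2 + c * (w * exp (\<phi> w))" unfolding e by (simp add: power2_eq_square algebra_simps)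
  finally show "w * deriv \<phi> w * (w * deriv \<phi> w + p + 1) * (w * deriv \<phi> w + q + 1)
       = (p + q) * (w * exp (\<phi> w))\<^sup>2 + c * (w * exp (\<phi> w))" .
qed

text \<open>A zero of \<open>1 + w \<phi>'\<close> would solve a quadratic equation of discriminant
  \<open>c\<^sup>2 - 4 (p + q)\<^sup>2 < 0\<close>.\<close>

lemma profile_pos:
  assumes w: "w \<in> {-\<alpha><..<1}"
  shows "1 + w * deriv \<phi> w > 0"
proof (rule ccontr)
  assume n: "\<not> 1 + w * deriv \<phi> w > 0"
  let ?\<xi> = "\<lambda>w. 1 + w * deriv \<phi> w"
  have "continuous_on {-\<alpha><..<1} ?\<xi>"
    by (intro continuous_intros continuous_at_imp_continuous_on ballI profile_deriv(2))
  then have "connected (?\<xi> ` {-\<alpha><..<1})" by (intro connected_continuous_image connected_Ioo)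
  moreover have "?\<xi> w \<in> ?\<xi> ` {-\<alpha><..<1}" using w by (rule imageI)
  moreover have "?\<xi> 0 \<in> ?\<xi> ` {-\<alpha><..<1}" using \<alpha> by (intro imageI) auto
  moreover have "?\<xi> w \<le> 0" "0 \<le> ?\<xi> 0" using n by auto
  ultimately have "0 \<in> ?\<xi> ` {-\<alpha><..<1}" by (rule connectedD_interval)
  then obtain u where u: "u \<in> {-\<alpha><..<1}" "0 = ?\<xi> u" by blast
  define E where "E = u * exp (\<phi> u)"
  have "u * deriv \<phi> u = - 1" using u(2) by simp
  then have "- (p * q) = (p + q) * E\<^sup>2 + c * E"
    using profile_deriv(3)[OF u(1)] unfolding E_def[symmetric] by simp
  then have z: "(p + q) * E\<^sup>2 + c * E + (p + q) = 0" using conjugate_exponents(1)[OF p q] by simp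
  have "(2 * (p + q) * E + c)\<^sup>2 = c\<^sup>2 - (2 * (p + q))\<^sup>2" using z by algebra
  moreover have "c\<^sup>2 < (2 * (p + q))\<^sup>2" using c by (intro power2_strict_mono) auto
  ultimately show False using zero_le_power2[of "2 * (p + q) * E + c"] by simp
qed

lemma profile_E_deriv:
  assumes w: "w \<in> {-\<alpha><..<1}"
  shows "((\<lambda>w. w * exp (\<phi> w)) has_real_derivative (1 + w * deriv \<phi> w) * exp (\<phi> w)) (at w)"
  by (auto intro!: derivative_eq_intros profile_deriv(1)[OF w] simp: algebra_simps)

lemma profile_E_mono:
  assumes "v \<in> {-\<alpha><..<1}" "w \<in> {-\<alpha><..<1}" "v < w"
  shows "v * exp (\<phi> v) < w * exp (\<phi> w)"
proof (rule DERIV_pos_imp_increasing[OF assms(3)])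
  fix u assume "v \<le> u" "u \<le> w"
  then have u: "u \<in> {-\<alpha><..<1}" using assms by auto
  show "\<exists>d. ((\<lambda>w. w * exp (\<phi> w)) has_real_derivative d) (at u) \<and> 0 < d"
    using profile_E_deriv[OF u] mult_pos_pos[OF profile_pos[OF u] exp_gt_zero] by blast
qed

text \<open>Were \<open>w e\<^sup>\<phi>\<close> bounded near an end \<open>e\<close> of the interval, the points with \<open>\<mu> = 0\<close> would
  converge to a point of the frontier of the cone as \<open>w\<close> tends to \<open>e\<close>, although the surface is closed and lies in the
  interior.\<close>

lemma profile_E_unbounded:
  assumes e: "e = 1 \<or> e = - \<alpha>"
  obtains r where "0 < r" "r < 1" "r * exp (\<phi> (e * r)) > B"
proof (rule ccontr)
  note it = that
  assume "\<not> thesis"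
  then have B: "r * exp (\<phi> (e * r)) \<le> B" if "0 < r" "r < 1" for r using it[of r] that by force
  have I: "e * r \<in> {-\<alpha><..<1}" if "0 < r" "r < 1" for r
  proof -
    have ar: "0 < \<alpha> * r" by (rule mult_pos_pos[OF \<alpha>(1) that(1)])
    have "\<alpha> * r < \<alpha> * 1" by (rule mult_strict_left_mono[OF that(2) \<alpha>(1)])
    then have "- \<alpha> < - (\<alpha> * r)" by linarith
    moreover have "- (\<alpha> * r) < 1" using ar by linarith
    ultimately show ?thesis using e that \<alpha> by auto
  qed
  have mono: "r * exp (\<phi> (e * r)) \<le> t * exp (\<phi> (e * t))" if "0 < r" "r < t" "t < 1" for r t
    using e
  proof
    assume "e = 1"
    then show ?thesis using profile_E_mono[of r t] I[of r] I[of t] that by auto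
  next
    assume e: "e = - \<alpha>"
    have "e * t < e * r" using e \<alpha> that by simp
    then have "(e * t) * exp (\<phi> (e * t)) < (e * r) * exp (\<phi> (e * r))"
      using profile_E_mono[of "e * t" "e * r"] I[of r] I[of t] that by auto
    then have "\<alpha> * (r * exp (\<phi> (e * r))) < \<alpha> * (t * exp (\<phi> (e * t)))" unfolding e by (simp add: mult_ac)
    then show ?thesis using \<alpha> by simp
  qed
  \<comment> \<open>The radii 1/2, 2/3, ...; the shift by two makes r 0 positive already.\<close>
  define r :: "nat \<Rightarrow> real" where "r n = 1 - inverse (of_nat (Suc (Suc n)))" for n
  have r: "0 < r n" "r n < 1" for n by (auto simp: r_def field_simps)
  have rmono: "r n < r (Suc n)" for n unfolding r_def by (simp add: field_simps)
  have "(\<lambda>n. 1 - inverse (real (Suc (Suc n)))) \<longlonglongrightarrow> 1 - 0"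
    by (intro tendsto_intros filterlim_compose[OF LIMSEQ_inverse_real_of_nat filterlim_Suc])
  then have rl: "r \<longlonglongrightarrow> 1" unfolding r_def[abs_def] by simp
  let ?X = "\<lambda>n. r n * exp (\<phi> (e * r n))"
  have inc: "incseq ?X" by (intro incseq_SucI mono r rmono)
  obtain L where L: "?X \<longlonglongrightarrow> L" "\<And>n. ?X n \<le> L"
    using incseq_convergent[OF inc, of B] B r by blast
  have "L > 0" using L(2)[of 0] r[of 0] by (meson exp_gt_zero less_le_trans mult_pos_pos)
  have "(\<lambda>n. ?X n / r n) \<longlonglongrightarrow> L / 1" by (intro tendsto_divide L(1) rl) simp
  moreover have "?X n / r n = exp (\<phi> (e * r n))" for n using r[of n] by simp
  ultimately have "(\<lambda>n. exp (\<phi> (e * r n))) \<longlonglongrightarrow> L" by simp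
  then have "(\<lambda>n. root 3 (exp (\<phi> (e * r n)))) \<longlonglongrightarrow> root 3 L" by (rule tendsto_real_root)
  moreover have "root 3 (exp (\<phi> (e * r n))) = exp (\<phi> (e * r n) / 3)" for n
    by (rule real_root_pos_unique) (simp_all add: exp_of_nat_mult[symmetric])
  ultimately have sl: "(\<lambda>n. exp (\<phi> (e * r n) / 3)) \<longlonglongrightarrow> root 3 L" by simp
  define s where "s = root 3 L"
  have s: "s > 0" using \<open>L > 0\<close> by (simp add: s_def)
  define v :: "real^3" where "v = vector [s, s, s * e]"
  let ?S = "hildebrand_sphere p q \<phi> ` ({-\<alpha><..<1} \<times> UNIV)"
  have lim: "(\<lambda>n. hildebrand_sphere p q \<phi> (e * r n, 0)) \<longlonglongrightarrow> v"
  proof (rule vec_tendstoI)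
    fix i :: 3
    have "(\<lambda>n. exp (\<phi> (e * r n) / 3) * (e * r n)) \<longlonglongrightarrow> s * (e * 1)"
      unfolding s_def by (intro tendsto_intros sl rl)
    then show "(\<lambda>n. hildebrand_sphere p q \<phi> (e * r n, 0) $ i) \<longlonglongrightarrow> v $ i"
      using exhaust_3[of i] sl by (auto simp: hildebrand_sphere_def v_def s_def)
  qed
  have "closed ?S" and SK: "?S \<subseteq> interior (hildebrand_cone p q \<alpha>)"
    using profile by (auto simp: hildebrand_profile_def asymptotic_to_boundary_def)
  have "v \<in> ?S"
    by (rule closed_sequentially[OF \<open>closed ?S\<close> _ lim]) (use I r in blast)
  then have "v \<in> interior (hildebrand_cone p q \<alpha>)" using SK by blast
  then obtain \<rho> where \<rho>: "\<rho> > 0" "ball v \<rho> \<subseteq> hildebrand_cone p q \<alpha>" by (auto simp: mem_interior)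
  \<comment> \<open>Where the first two coordinates are s, the cone allows third coordinates from -
    \<alpha> s to s, because s^(1/p) s^(1/q) = s. The limit point v has an extreme value there, and
    u lies just outside.\<close>
  define u where "u = v + (\<rho> / 2 * sgn e) *\<^sub>R axis 3 1"
  have se: "\<bar>sgn e\<bar> = 1" using e \<alpha> by (auto simp: sgn_if)
  have "dist v u = \<rho> / 2" using \<rho> se by (simp add: u_def dist_norm abs_mult)
  then have "u \<in> ball v \<rho>" using \<rho> by simp
  then have uK: "u \<in> hildebrand_cone p q \<alpha>" using \<rho>(2) by blast
  have u3: "u $ 1 = s" "u $ 2 = s" "u $ 3 = s * e + \<rho> / 2 * sgn e" by (simp_all add: u_def v_def axis_def)
  have pw: "s powr (1 / p) * s powr (1 / q) = s" using s by (simp add: powr_add[symmetric] q)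
  have "- (\<alpha> * s) \<le> s * e + \<rho> / 2 * sgn e" "s * e + \<rho> / 2 * sgn e \<le> s"
    using uK pw unfolding hildebrand_cone_def mem_Collect_eq u3 by (auto simp: mult.assoc)
  then show False using e \<alpha> \<rho> s by (auto simp: sgn_if mult.commute split: if_splits)
qed

lemma profile_E_bij: "bij_betw (\<lambda>w. w * exp (\<phi> w)) {-\<alpha><..<1} UNIV"
  unfolding bij_betw_def
proof
  let ?E = "\<lambda>w. w * exp (\<phi> w)"
  show "inj_on ?E {-\<alpha><..<1}"
    by (intro linorder_inj_onI) (use profile_E_mono in fastforce)+
  have con: "connected (?E ` {-\<alpha><..<1})"
    by (intro connected_continuous_image connected_Ioo continuous_at_imp_continuous_on ballI DERIV_isCont[OF profile_E_deriv])
  have "y \<in> ?E ` {-\<alpha><..<1}" for y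
  proof -
    obtain r where r: "0 < r" "r < 1" "r * exp (\<phi> (1 * r)) > y" by (rule profile_E_unbounded[of 1 y]) auto
    obtain t where t: "0 < t" "t < 1" "t * exp (\<phi> (- \<alpha> * t)) > - y / \<alpha>" by (rule profile_E_unbounded[of "- \<alpha>" "- y / \<alpha>"]) auto
    have "\<alpha> * (- y / \<alpha>) < \<alpha> * (t * exp (\<phi> (- \<alpha> * t)))" using t(3) \<alpha>(1) by (rule mult_strict_left_mono)
    then have "?E (- \<alpha> * t) \<le> y" using \<alpha>(1) by (simp add: mult_ac)
    moreover have "y \<le> ?E r" using r by simp
    moreover have "- \<alpha> * t < 1" using mult_pos_pos[OF \<alpha>(1) t(1)] by simp
    then have "- \<alpha> * t \<in> {-\<alpha><..<1}" using \<alpha> t by simp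
    moreover have "r \<in> {-\<alpha><..<1}" using r \<alpha> by auto
    ultimately show ?thesis using connectedD_interval[OF con] by blast
  qed
  then show "?E ` {-\<alpha><..<1} = UNIV" by blast
qed

end

section \<open>Spectral values and positive modes\<close>

context spectral
begin

text \<open>The factorisation behind \<open>mode_second\<close>, evaluated at a zero of its first
  factor.\<close>

lemma wpd_square:
  assumes f: "f ^ 3 - 3 * b * f + 2 * U2 = 0" and v: "v \<notin> \<Lambda>" and w: "wp \<Lambda> v + of_real b = of_real (3 * b - f\<^sup>2)"
  shows "(wpd v)\<^sup>2 = of_real (16 * U1\<^sup>2)"
proof -
  have w: "wp \<Lambda> v = of_real (2 * b - f\<^sup>2)" using w by (simp add: algebra_simps)
  have "(wpd v)\<^sup>2 = of_real (4 * (2 * b - f\<^sup>2) ^ 3 - 12 * b\<^sup>2 * (2 * b - f\<^sup>2) - (8 * b ^ 3 - 16 * (U1\<^sup>2 + U2\<^sup>2)))"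
    unfolding wp_ode[OF v] inv2 inv3 w by (simp only: of_real_add of_real_mult of_real_diff of_real_power of_real_numeral)
  also have "4 * (2 * b - f\<^sup>2) ^ 3 - 12 * b\<^sup>2 * (2 * b - f\<^sup>2) - (8 * b ^ 3 - 16 * (U1\<^sup>2 + U2\<^sup>2)) = 16 * U1\<^sup>2"
    using f by algebra
  finally show ?thesis .
qed

text \<open>P is even and P' is odd, so passing from z to - z corrects the sign of the square root
  in \<open>wpd_square\<close>.\<close>

lemma spectral_value_exists:
  assumes f: "f ^ 3 - 3 * b * f + 2 * U2 = 0"
  obtains v where "v \<notin> \<Lambda>" "wp \<Lambda> v + of_real b = of_real (3 * b - f\<^sup>2)" "wpd v = of_real (4 * U1)"
proof -
  obtain z where z: "z \<notin> \<Lambda>" "wp \<Lambda> z = of_real (2 * b - f\<^sup>2)" using wp_surj by blast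
  have w: "wp \<Lambda> z + of_real b = of_real (3 * b - f\<^sup>2)" unfolding z(2) by simp
  have "(wpd z)\<^sup>2 = (of_real (4 * U1))\<^sup>2" using wpd_square[OF f z(1) w] by simp
  then consider "wpd z = of_real (4 * U1)" | "wpd z = - of_real (4 * U1)" unfolding power2_eq_iff by blast
  then show ?thesis
  proof cases
    case 1
    then show ?thesis using that z(1) w by blast
  next
    case 2
    have "- z \<notin> \<Lambda>" using z(1) by (simp add: lattice_uminus_iff)
    moreover have "wpd (- z) = of_real (4 * U1)" unfolding wpd_minus 2 by simp
    ultimately show ?thesis using that[of "- z"] w by (simp add: wp_minus)
  qed
qed

end

context positive_spectral
begin

text \<open>For f^2 > b the value 3b - f^2 lies below 2b < g, so P (x + \<omega>1) differs from P(v)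
  at every regular real x, and the sigma quotient has no zero there. Starting from 1 at x = 0, it
  keeps its sign on the strip.\<close>

lemma positive_mode_exists:
  assumes f: "f ^ 3 - 3 * b * f + 2 * U2 = 0" and fb: "f\<^sup>2 > b"
  obtains h where "mode f h" "\<And>x. - \<omega>1 < x \<Longrightarrow> x < \<omega>1 \<Longrightarrow> Re (h (of_real x)) > 0"
proof -
  obtain v where v: "v \<notin> \<Lambda>" "wp \<Lambda> v + of_real b = of_real (3 * b - f\<^sup>2)" "wpd v = of_real (4 * U1)"
    using spectral_value_exists[OF f] by blast
  have m: "mode f (baker v)" by (rule baker_mode[OF f v])
  have v': "of_real \<omega>1 - v \<notin> \<Lambda>"
  proof
    assume "of_real \<omega>1 - v \<in> \<Lambda>"
    from wpd_periodic[OF this, of v] have "wpd v = 0" by (simp add: wpd_\<omega>1)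
    then show False using v(3) U1 by simp
  qed
  have ne: "baker v (of_real x) \<noteq> 0" if x: "of_real x \<in> pdom" for x
  proof
    assume "baker v (of_real x) = 0"
    then have "wsigma \<Lambda> (of_real x + of_real \<omega>1 - v) = 0"
      unfolding baker_def using wsigma_nonzero[OF v'] wsigma_nonzero[OF \<omega>1_not_lattice] x wsigma_nonzero[of "of_real x + of_real \<omega>1"]
      by (auto simp: dom_iff)
    then have "of_real x + of_real \<omega>1 - v \<in> \<Lambda>" using wsigma_nonzero by blast
    from wp_periodic[OF this v(1)] have "wp \<Lambda> (of_real x + of_real \<omega>1) = wp \<Lambda> v" by simp
    then have "GG (of_real x) = of_real (3 * b - f\<^sup>2)" unfolding GG_def using v(2) by simp
    then have "g x = 3 * b - f\<^sup>2" unfolding g_def by simp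
    then show False using g_gt[OF x] fb by simp
  qed
  have "Re (baker v (of_real x)) > 0" if x: "- \<omega>1 < x" "x < \<omega>1" for x
  proof (rule ccontr)
    assume n: "\<not> Re (baker v (of_real x)) > 0"
    let ?H = "\<lambda>x. Re (baker v (of_real x))" and ?I = "{-\<omega>1<..<\<omega>1}"
    have "continuous_on ?I ?H"
      by (intro continuous_at_imp_continuous_on ballI DERIV_isCont[OF Re_has_real_derivative[OF mode_deriv[OF m strip_pdom]]]) auto
    then have "connected (?H ` ?I)" by (intro connected_continuous_image connected_Ioo)
    moreover have "?H x \<in> ?H ` ?I" "?H 0 \<in> ?H ` ?I" by (rule imageI, use x \<omega>1_pos in simp)+
    moreover have "?H x \<le> 0" "0 \<le> ?H 0" using n baker_0[OF v'] by auto
    ultimately have "0 \<in> ?H ` ?I" using connectedD_interval by blast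
    then obtain u where u: "u \<in> ?I" "?H u = 0" by force
    have pu: "of_real u \<in> pdom" using u(1) by (intro strip_pdom) auto
    have "baker v (of_real u) = of_real (?H u)" using mode_real[OF m pu] by simp
    then show False using ne[OF pu] u(2) by simp
  qed
  then show ?thesis using that m by blast
qed

text \<open>
  Let \<open>w(x)\<close> solve \<open>w e\<^sup>\<phi> = 4 (g' - 4 U\<^sub>1) / sqrt (p + q)\<close>.  The cubic satisfied by
  \<open>\<xi> = 1 + w \<phi>'\<close> then becomes the differential equation of \<open>g\<close> and gives \<open>\<xi> = 4 g - 8 b\<close>.
  Put \<open>\<mu> = \<kappa> y + ln A - ln B\<close> with the two positive modes \<open>A\<close> and \<open>B\<close>.  Since
  \<open>\<phi> - 3 ln A + 3 a (ln A - ln B)\<close> is constant along \<open>w(x)\<close>, the first two coordinates are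
  multiples of \<open>A exp (\<kappa> a y)\<close> and \<open>B exp (\<kappa> (a - 1) y)\<close>; \<open>mode_product\<close> gives the third.
\<close>

lemma hildebrand_wave:
  assumes p: "2 \<le> p" and q: "1 / p + 1 / q = 1" and c: "- 2 * (p + q) < c" "c < 0"
    and \<alpha>: "0 < \<alpha>" "\<alpha> < 1" and profile: "hildebrand_profile p q c \<alpha> \<phi>"
    and b: "12 * b = p + q - 1" and bU: "256 * (b ^ 3 - U2\<^sup>2) = p + q" and cU: "32 * sqrt (p + q) * U1 = c"
    and \<kappa>: "\<kappa> \<noteq> 0" "\<kappa>\<^sup>2 * (a * (1 - a)) = 2 * b + 1 / 4" "\<kappa>\<^sup>2 * (3 * a\<^sup>2 - 3 * a + 1) = 3 * b"
      "2 * U2 = - ((\<kappa> * a) * (\<kappa> * (a - 1)) * (\<kappa> * (1 - 2 * a)))"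
    and gt: "\<kappa>\<^sup>2 * a\<^sup>2 > b" "\<kappa>\<^sup>2 * (1 - a)\<^sup>2 > b" and a3: "3 * a \<noteq> 1" "3 * a \<noteq> 2"
    and a: "(q + 1) / (3 * q) = a" "- (p + 1) / (3 * p) = a - 1" "- (p - q) / (3 * (p + q)) = 1 - 2 * a"
  defines "\<S> \<equiv> {-\<omega>1<..<\<omega>1} \<times> (UNIV :: real set)"
  obtains k \<Theta> where "k > 0" "bij_betw \<Theta> \<S> ({-\<alpha><..<1} \<times> UNIV)"
    "\<And>z. z \<in> \<S> \<Longrightarrow> 1 + fst (\<Theta> z) * deriv \<phi> (fst (\<Theta> z)) = 4 * g (fst z) - 8 * b"
    "affine_sphere_data \<S> (\<lambda>z. k *\<^sub>R hildebrand_sphere p q \<phi> (\<Theta> z)) (\<lambda>z. g (fst z)) (-1) (\<lambda>z. Complex U1 U2)"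
proof -
  note prof = p q c \<alpha> profile
  define I where "I = {-\<alpha><..<1}"
  define J where "J = {-\<omega>1<..<\<omega>1}"
  define S where "S = sqrt (p + q)"
  note pq = conjugate_exponents(1,3)[OF p q]
  have S: "S > 0" "S\<^sup>2 = p + q" using p pq by (auto simp: S_def)
  have cS: "c = 32 * S * U1" using cU by (simp add: S_def)
  define E where "E = (\<lambda>w. w * exp (\<phi> w))"
  define \<xi> where "\<xi> w = 1 + w * deriv \<phi> w" for w
  define V where "V = inv_into I E"
  have bijE: "bij_betw E I UNIV" unfolding E_def I_def by (rule profile_E_bij[OF prof])
  have VI: "V y \<in> I" and EV: "E (V y) = y" for y
    using bijE unfolding V_def bij_betw_def by (auto intro: inv_into_into f_inv_into_f)
  have VE: "V (E w) = w" if "w \<in> I" for w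
    using bijE that unfolding V_def bij_betw_def by (auto intro: inv_into_f_f)
  have bijV: "bij_betw V UNIV I" unfolding V_def by (rule bij_betw_inv_into[OF bijE])
  have Ed: "(E has_real_derivative \<xi> w * exp (\<phi> w)) (at w)" and \<xi>pos: "\<xi> w > 0" if "w \<in> I" for w
    using profile_E_deriv[OF prof] profile_pos[OF prof] that unfolding E_def \<xi>_def I_def by auto
  have Vcont: "isCont V y" for y
  proof -
    have "V y \<in> I" by (rule VI)
    then have "- \<alpha> < V y" "V y < 1" by (auto simp: I_def)
    then obtain l u where lu: "- \<alpha> < l" "l < V y" "V y < u" "u < 1" using dense by meson
    then have "w \<in> I" if "l \<le> w" "w \<le> u" for w using that unfolding I_def by simp
    then have "isCont V (E (V y))"
      using VE DERIV_isCont[OF Ed] by (intro isCont_inverse_function2[where f = E and g = V, OF lu(2,3)]) blast+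
    then show ?thesis unfolding EV .
  qed
  have Vd: "(V has_real_derivative inverse (\<xi> (V y) * exp (\<phi> (V y)))) (at y)" for y
    by (rule DERIV_inverse_function[where f = E and a = "y - 1" and b = "y + 1"])
      (use Ed[OF VI] \<xi>pos[OF VI, of y] EV Vcont in \<open>auto simp: less_imp_neq[symmetric]\<close>)
  define Y where "Y x = g1 x - 4 * U1" for x
  define W where "W x = V (4 / S * Y x)" for x
  have WI: "W x \<in> I" and EW: "W x * exp (\<phi> (W x)) = 4 / S * Y x" for x
    unfolding W_def using VI EV[unfolded E_def] by auto
  have pJ: "of_real x \<in> pdom" if "x \<in> J" for x using that strip_pdom by (auto simp: J_def)
  have gg: "g x > 2 * b" if "x \<in> J" for x by (rule g_gt[OF pJ[OF that]])
  have \<xi>W: "\<xi> (W x) = 4 * g x - 8 * b" if x: "x \<in> J" for x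
  proof -
    define X where "X = \<xi> (W x)"
    define X' where "X' = 4 * g x - 8 * b"
    have X: "X > 0" "X' > 0" using \<xi>pos[OF WI] gg[OF x] by (auto simp: X_def X'_def)
    have "W x * deriv \<phi> (W x) = X - 1" by (simp add: X_def \<xi>_def)
    moreover have "W x * deriv \<phi> (W x) * (W x * deriv \<phi> (W x) + p + 1) * (W x * deriv \<phi> (W x) + q + 1)
       = (p + q) * (4 / S * Y x)\<^sup>2 + c * (4 / S * Y x)"
      using profile_deriv(3)[OF prof WI[unfolded I_def]] unfolding EW .
    ultimately have "(X - 1) * (X - 1 + p + 1) * (X - 1 + q + 1) = S\<^sup>2 * (4 / S * Y x)\<^sup>2 + c * (4 / S * Y x)"
      unfolding S(2) by simp
    then have "(X - 1) * (X + p) * (X + q) = S\<^sup>2 * (4 / S * Y x)\<^sup>2 + c * (4 / S * Y x)" by simp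
    also have "\<dots> = 16 * (Y x)\<^sup>2 + 128 * U1 * Y x"
      unfolding cS using S(1) by (simp add: power_mult_distrib power_divide)
    finally have "(X - 1) * (X + p) * (X + q) = 16 * (Y x)\<^sup>2 + 128 * U1 * Y x" .
    \<comment> \<open>For conjugate exponents the linear coefficient p q - p - q vanishes. Thus X
      and X' give the same value of a cubic that is strictly increasing on the positive
      reals.\<close>
    moreover have "(X - 1) * (X + p) * (X + q) = X ^ 3 + 12 * b * X\<^sup>2 - (p + q)"
      using pq(1) b by algebra
    moreover have "16 * (Y x)\<^sup>2 + 128 * U1 * Y x = X' ^ 3 + 12 * b * X'\<^sup>2 - (p + q)"
      using real_eqs(3)[OF pJ[OF x]] bU unfolding Y_def X'_def by algebra
    ultimately have e: "X ^ 3 + 12 * b * X\<^sup>2 = X' ^ 3 + 12 * b * X'\<^sup>2" by simp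
    have "u ^ 3 + 12 * b * u\<^sup>2 < v ^ 3 + 12 * b * v\<^sup>2" if "0 < u" "u < v" for u v :: real
      using that b_pos by (intro add_strict_mono power_strict_mono mult_strict_left_mono) auto
    then have "X = X'" using e X by (metis less_irrefl linorder_neqE)
    then show ?thesis by (simp add: X_def X'_def)
  qed
  have Wd: "(W has_real_derivative 6 * g x / (S * exp (\<phi> (W x)))) (at x)" if x: "x \<in> J" for x
  proof -
    have "((\<lambda>x. 4 / S * Y x) has_real_derivative 4 / S * (6 * g x * (g x - 2 * b))) (at x)"
      using DERIV_cmult[OF DERIV_diff[OF g1_deriv[OF pJ[OF x]] DERIV_const], of "4 / S" "4 * U1"]
      by (simp only: Y_def diff_zero)
    from DERIV_chain2[OF Vd this]
    have "(W has_real_derivative inverse (\<xi> (W x) * exp (\<phi> (W x))) * (4 / S * (6 * g x * (g x - 2 * b)))) (at x)"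
      unfolding W_def .
    also have "inverse (\<xi> (W x) * exp (\<phi> (W x))) * (4 / S * (6 * g x * (g x - 2 * b))) = 6 * g x / (S * exp (\<phi> (W x)))"
    proof -
      define m where "m = g x - 2 * b"
      have m: "m > 0" using gg[OF x] by (simp add: m_def)
      have "4 * g x - 8 * b = 4 * m" by (simp add: m_def)
      show ?thesis unfolding \<xi>W[OF x] \<open>4 * g x - 8 * b = 4 * m\<close> m_def[symmetric]
        using m S(1) by (simp add: divide_simps)
    qed
    finally show ?thesis .
  qed
  have bijW: "bij_betw W J I"
  proof -
    have "bij_betw (\<lambda>y. 4 / S * (y - 4 * U1)) UNIV UNIV"
      by (rule bij_betwI[where g = "\<lambda>y. S / 4 * y + 4 * U1"]) (use S(1) in \<open>auto simp: field_simps\<close>)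
    from bij_betw_trans[OF bij_betw_trans[OF g1_bij this] bijV]
    show ?thesis by (simp add: W_def[abs_def] Y_def J_def comp_def)
  qed
  have root: "f ^ 3 - 3 * b * f + 2 * U2 = 0" if "f = \<kappa> * a \<or> f = \<kappa> * (a - 1) \<or> f = \<kappa> * (1 - 2 * a)" for f
  proof -
    have "(f - \<kappa> * a) * (f - \<kappa> * (a - 1)) * (f - \<kappa> * (1 - 2 * a)) = 0" using that by auto
    moreover have "(f - \<kappa> * a) * (f - \<kappa> * (a - 1)) * (f - \<kappa> * (1 - 2 * a))
      = f ^ 3 - \<kappa>\<^sup>2 * (3 * a\<^sup>2 - 3 * a + 1) * f - (\<kappa> * a) * (\<kappa> * (a - 1)) * (\<kappa> * (1 - 2 * a))" by algebra
    ultimately show ?thesis using \<kappa>(3,4) by simp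
  qed
  have sq: "(\<kappa> * (a - 1))\<^sup>2 > b" using gt(2) by (simp add: power2_eq_square algebra_simps)
  obtain ha where ha: "mode (\<kappa> * a) ha" and hap: "\<And>x. - \<omega>1 < x \<Longrightarrow> x < \<omega>1 \<Longrightarrow> Re (ha (of_real x)) > 0"
    using positive_mode_exists[OF root[of "\<kappa> * a"]] gt(1) by (auto simp: power_mult_distrib)
  obtain hb where hb: "mode (\<kappa> * (a - 1)) hb" and hbp: "\<And>x. - \<omega>1 < x \<Longrightarrow> x < \<omega>1 \<Longrightarrow> Re (hb (of_real x)) > 0"
    using positive_mode_exists[OF root[of "\<kappa> * (a - 1)"] sq] by auto
  obtain hd where hd: "mode (\<kappa> * (1 - 2 * a)) hd"
    using spectral_value_exists[OF root[of "\<kappa> * (1 - 2 * a)"]] baker_mode[OF root[of "\<kappa> * (1 - 2 * a)"]] by metis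
  define A B D where "A x = Re (ha (of_real x))" and "B x = Re (hb (of_real x))" and "D x = Re (hd (of_real x))" for x
  have A: "A x > 0" and B: "B x > 0" if "x \<in> J" for x using hap hbp that by (auto simp: A_def B_def J_def)
  have ln_deriv: "\<exists>l. ((\<lambda>x. ln (Re (h (of_real x)))) has_real_derivative l) (at x) \<and> l * Y x = 2 * ((g x)\<^sup>2 - f\<^sup>2 * g x - 2 * U2 * f)"
    if h: "mode f h" and x: "x \<in> J" and pos: "Re (h (of_real x)) > 0" for f h x
  proof (intro exI conjI)
    let ?H = "Re (h (of_real x))" and ?H1 = "Re (deriv h (of_real x))"
    show "((\<lambda>x. ln (Re (h (of_real x)))) has_real_derivative inverse ?H * ?H1) (at x)"
      by (rule DERIV_chain2[OF DERIV_ln[OF pos] Re_has_real_derivative[OF mode_deriv[OF h pJ[OF x]]]])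
    have "?H1 * Y x = 2 * ((g x)\<^sup>2 - f\<^sup>2 * g x - 2 * U2 * f) * ?H"
      using mode_Re(2)[OF h pJ[OF x]] by (simp add: Y_def g_def g1_def)
    then have "inverse ?H * (?H1 * Y x) = inverse ?H * (2 * ((g x)\<^sup>2 - f\<^sup>2 * g x - 2 * U2 * f) * ?H)" by simp
    then show "inverse ?H * ?H1 * Y x = 2 * ((g x)\<^sup>2 - f\<^sup>2 * g x - 2 * U2 * f)" using pos by (simp add: field_simps)
  qed
  define \<delta> where "\<delta> x = ln (A x) - ln (B x)" for x
  define \<Phi> where "\<Phi> x = \<phi> (W x) - 3 * ln (A x) + 3 * a * \<delta> x" for x
  have \<Phi>d: "\<exists>d. (\<Phi> has_real_derivative d) (at x) \<and> d * Y x = 0" if x: "x \<in> J" for x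
  proof -
    obtain l where l: "((\<lambda>x. ln (A x)) has_real_derivative l) (at x)" "l * Y x = 2 * ((g x)\<^sup>2 - (\<kappa> * a)\<^sup>2 * g x - 2 * U2 * (\<kappa> * a))"
      using ln_deriv[OF ha x] A[OF x] unfolding A_def by blast
    obtain m where m: "((\<lambda>x. ln (B x)) has_real_derivative m) (at x)" "m * Y x = 2 * ((g x)\<^sup>2 - (\<kappa> * (a - 1))\<^sup>2 * g x - 2 * U2 * (\<kappa> * (a - 1)))"
      using ln_deriv[OF hb x] B[OF x] unfolding B_def by blast
    define n where "n = deriv \<phi> (W x) * (6 * g x / (S * exp (\<phi> (W x))))"
    have n: "((\<lambda>x. \<phi> (W x)) has_real_derivative n) (at x)"
      unfolding n_def by (rule DERIV_chain2[OF profile_deriv(1)[OF prof WI[unfolded I_def]] Wd[OF x]])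
    have "Y x = S / 4 * (W x * exp (\<phi> (W x)))" unfolding EW using S(1) by simp
    then have "n * Y x = 3 / 2 * g x * (W x * deriv \<phi> (W x))"
      unfolding n_def using S(1) by (simp add: field_simps)
    also have "W x * deriv \<phi> (W x) = 4 * g x - 8 * b - 1" using \<xi>W[OF x] by (simp add: \<xi>_def)
    finally have n': "n * Y x = 3 / 2 * g x * (4 * g x - 8 * b - 1)" .
    have "(\<Phi> has_real_derivative n - 3 * l + 3 * a * (l - m)) (at x)"
      unfolding \<Phi>_def[abs_def] \<delta>_def by (intro DERIV_add DERIV_diff DERIV_cmult n l(1) m(1))
    moreover have "(n - 3 * l + 3 * a * (l - m)) * Y x = n * Y x - 3 * (1 - a) * (l * Y x) - 3 * a * (m * Y x)"
      by (simp add: algebra_simps)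
    \<comment> \<open>The terms with g^2 and with U2 cancel for every a; what is left vanishes by
      the relation for \<kappa>^2 a (1 - a).\<close>
    moreover have "\<dots> = g x * (6 * (\<kappa>\<^sup>2 * (a * (1 - a))) - 12 * b - 3 / 2)"
      unfolding n' l(2) m(2) by (simp add: power2_eq_square algebra_simps)
    ultimately show ?thesis unfolding \<kappa>(2) by (intro exI conjI) auto
  qed
  have "\<exists>c. \<forall>x\<in>J. \<Phi> x = c"
  proof -
    \<comment> \<open>Where Y = 0 the preceding fact does not determine the derivative of \<Phi>. As
      g1 is injective, this is at most one point, and continuity bridges it.\<close>
    let ?K = "{x \<in> J. Y x = 0}"
    have "inj_on g1 J" using g1_bij by (simp add: bij_betw_def J_def)
    have "finite (g1 -` {4 * U1} \<inter> J)" by (rule finite_vimage_IntI) (use \<open>inj_on g1 J\<close> in auto)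
    moreover have "g1 -` {4 * U1} \<inter> J = ?K" by (auto simp: Y_def)
    ultimately have fin: "finite ?K" by simp
    have con: "continuous_on J \<Phi>" by (intro continuous_at_imp_continuous_on ballI) (use \<Phi>d DERIV_isCont in blast)
    have "\<forall>x\<in>J - ?K. (\<Phi> has_real_derivative 0) (at x)"
    proof
      fix x assume x: "x \<in> J - ?K"
      obtain d where d: "(\<Phi> has_real_derivative d) (at x)" "d * Y x = 0" using \<Phi>d x by blast
      then have "d = 0" using x by simp
      then show "(\<Phi> has_real_derivative 0) (at x)" using d(1) by simp
    qed
    moreover have "connected J" "open J" by (auto simp: J_def)
    ultimately show ?thesis using DERIV_zero_connected_constant[OF _ _ fin con] by metis
  qed
  then obtain C0 where C0: "\<And>x. x \<in> J \<Longrightarrow> \<Phi> x = C0" by blast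
  define \<Theta> where "\<Theta> z = (W (fst z), \<kappa> * snd z + \<delta> (fst z))" for z :: "real \<times> real"
  have Sz: "fst z \<in> J \<longleftrightarrow> z \<in> \<S>" for z by (cases z) (simp add: J_def \<S>_def)
  have bij: "bij_betw \<Theta> \<S> (I \<times> UNIV)"
    unfolding bij_betw_def
  proof
    show "inj_on \<Theta> \<S>"
    proof (rule inj_onI)
      fix u v assume uv: "u \<in> \<S>" "v \<in> \<S>" "\<Theta> u = \<Theta> v"
      then have "fst u = fst v" using bijW unfolding \<Theta>_def bij_betw_def inj_on_def Sz[symmetric] by blast
      then show "u = v" using uv(3) \<kappa>(1) by (simp add: \<Theta>_def prod_eq_iff)
    qed
    show "\<Theta> ` \<S> = I \<times> UNIV"
    proof
      show "\<Theta> ` \<S> \<subseteq> I \<times> UNIV" using WI by (auto simp: \<Theta>_def)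
      show "I \<times> UNIV \<subseteq> \<Theta> ` \<S>"
      proof
        fix v :: "real \<times> real" assume "v \<in> I \<times> UNIV"
        then obtain x where x: "x \<in> J" "W x = fst v" using bijW unfolding bij_betw_def by force
        then have "\<Theta> (x, (snd v - \<delta> x) / \<kappa>) = v" using \<kappa>(1) by (simp add: \<Theta>_def prod_eq_iff)
        moreover have "(x, (snd v - \<delta> x) / \<kappa>) \<in> \<S>" using x(1) by (simp add: Sz[symmetric])
        ultimately show "v \<in> \<Theta> ` \<S>" by (metis imageI)
      qed
    qed
  qed
  define V3 where "V3 = (\<kappa> * a - \<kappa> * (a - 1)) * (\<kappa> * (a - 1) - \<kappa> * (1 - 2 * a)) * (\<kappa> * (1 - 2 * a) - \<kappa> * a)"
  have "V3 = \<kappa> ^ 3 * ((3 * a - 2) * (1 - 3 * a))" unfolding V3_def by algebra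
  then have V3: "V3 \<noteq> 0" using \<kappa>(1) a3 by simp
  \<comment> \<open>Forced by the volume condition: the three constants multiply to - 16 U1 k^3 / S,
    and together with V3 this must have modulus 2 |U1|.\<close>
  define k where "k = root 3 (S / (8 * \<bar>V3\<bar>))"
  have k: "k > 0" "k ^ 3 = S / (8 * \<bar>V3\<bar>)" using S(1) V3 by (auto simp: k_def)
  define f :: "3 \<Rightarrow> real" where "f i = (if i = 1 then \<kappa> * a else if i = 2 then \<kappa> * (a - 1) else \<kappa> * (1 - 2 * a))" for i
  define h :: "3 \<Rightarrow> complex \<Rightarrow> complex" where "h i = (if i = 1 then ha else if i = 2 then hb else hd)" for i
  \<comment> \<open>The third constant comes from w = 4 Y e^(-phi) / S and Y = - 4 U1 A B D. The
    integration constant C0 enters with the exponents 1/3, 1/3 and -2/3, which cancel in the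
    product.\<close>
  define C :: "3 \<Rightarrow> real" where "C i = (if i = 1 \<or> i = 2 then k * exp (C0 / 3) else k * (- 16 * U1 / S) * exp (- 2 * C0 / 3))" for i
  have fv: "f 1 = \<kappa> * a" "f 2 = \<kappa> * (a - 1)" "f 3 = \<kappa> * (1 - 2 * a)" by (auto simp: f_def)
  have hv: "h 1 = ha" "h 2 = hb" "h 3 = hd" by (auto simp: h_def)
  have Cv: "C 1 = k * exp (C0 / 3)" "C 2 = k * exp (C0 / 3)" "C 3 = k * (- 16 * U1 / S) * exp (- 2 * C0 / 3)" by (auto simp: C_def)
  have m: "mode (f i) (h i)" for i using exhaust_3[of i] ha hb hd by (auto simp: fv hv)
  have fs: "f 1 + f 2 + f 3 = 0" by (simp add: fv algebra_simps)
  have fs2: "(f 1)\<^sup>2 + (f 2)\<^sup>2 + (f 3)\<^sup>2 = 6 * b"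
  proof -
    have "(f 1)\<^sup>2 + (f 2)\<^sup>2 + (f 3)\<^sup>2 = 2 * (\<kappa>\<^sup>2 * (3 * a\<^sup>2 - 3 * a + 1))" unfolding fv by algebra
    then show ?thesis unfolding \<kappa>(3) by simp
  qed
  have prod: "Y x = - 4 * U1 * (A x * B x * D x)" if x: "x \<in> J" for x
  proof -
    have "of_real (Y x) = complex_of_real (- 4 * U1 * (A x * B x * D x))"
      using mode_product[OF ha hb hd _ _ pJ[OF x]] fs fs2 real_eqs(2)[OF pJ[OF x]]
        mode_real[OF ha pJ[OF x]] mode_real[OF hb pJ[OF x]] mode_real[OF hd pJ[OF x]]
      by (simp add: fv Y_def A_def B_def D_def)
    then show ?thesis by (simp only: of_real_eq_iff)
  qed
  have vol: "\<bar>C 1 * C 2 * C 3 * ((f 1 - f 2) * (f 2 - f 3) * (f 3 - f 1))\<bar> = 2 * \<bar>U1\<bar>"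
  proof -
    have e: "exp (C0 / 3) * exp (C0 / 3) * exp (- 2 * C0 / 3) = 1" by (simp add: exp_add[symmetric])
    have "C 1 * C 2 * C 3 = k ^ 3 * (- 16 * U1 / S) * (exp (C0 / 3) * exp (C0 / 3) * exp (- 2 * C0 / 3))"
      unfolding Cv by (simp add: power3_eq_cube mult_ac)
    then have "C 1 * C 2 * C 3 * ((f 1 - f 2) * (f 2 - f 3) * (f 3 - f 1)) = k ^ 3 * (- 16 * U1 / S) * V3"
      unfolding e V3_def fv by simp
    also have "\<bar>\<dots>\<bar> = S / (8 * \<bar>V3\<bar>) * (16 * \<bar>U1\<bar> / S) * \<bar>V3\<bar>" unfolding k(2) using S(1) by (simp add: abs_mult)
    also have "\<dots> = 2 * \<bar>U1\<bar>" using S(1) V3 by simp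
    finally show ?thesis .
  qed
  have open\<S>: "open \<S>" unfolding \<S>_def by (intro open_Times) auto
  have gpos: "g (fst z) > 0" if "z \<in> \<S>" for z using gg[of "fst z"] that b_pos by (simp add: Sz)
  have data: "affine_sphere_data \<S> (wave (\<lambda>i x. of_real (C i) * h i x) f) (\<lambda>z. g (fst z)) (-1) (\<lambda>z. Complex U1 U2)"
    by (rule wave_data[OF m fs fs2 vol open\<S>]) (use gpos pJ Sz in \<open>auto simp: g_def\<close>)
  \<comment> \<open>The identity matrix brings an equality on the strip into the form of
    \<open>affine_sphere_data_linear\<close>, which transfers the data although the two maps may
    differ elsewhere.\<close>
  have eq: "k *\<^sub>R hildebrand_sphere p q \<phi> (\<Theta> z) = mat 1 *v wave (\<lambda>i x. of_real (C i) * h i x) f z" if z: "z \<in> \<S>" for z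
  proof -
    define x y where "x = fst z" and "y = snd z"
    have x: "x \<in> J" using z by (simp add: x_def Sz)
    have "\<phi> (W x) = C0 + 3 * ln (A x) - 3 * a * \<delta> x" using C0[OF x] by (simp add: \<Phi>_def)
    then have \<phi>3: "\<phi> (W x) / 3 = C0 / 3 + ln (A x) - a * \<delta> x" by simp
    have eA: "exp (ln (A x)) = A x" and eB: "exp (ln (B x)) = B x" using A[OF x] B[OF x] by auto
    have 1: "exp (\<phi> (W x) / 3) * exp (a * (\<kappa> * y + \<delta> x)) = exp (C0 / 3) * A x * exp (\<kappa> * a * y)"
    proof -
      have "\<phi> (W x) / 3 + a * (\<kappa> * y + \<delta> x) = C0 / 3 + ln (A x) + \<kappa> * a * y" unfolding \<phi>3 by (simp add: algebra_simps)
      then show ?thesis by (simp only: exp_add[symmetric]) (simp only: exp_add eA)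
    qed
    have 2: "exp (\<phi> (W x) / 3) * exp ((a - 1) * (\<kappa> * y + \<delta> x)) = exp (C0 / 3) * B x * exp (\<kappa> * (a - 1) * y)"
    proof -
      have "\<phi> (W x) / 3 + (a - 1) * (\<kappa> * y + \<delta> x) = C0 / 3 + ln (B x) + \<kappa> * (a - 1) * y" unfolding \<phi>3 \<delta>_def by (simp add: algebra_simps)
      then show ?thesis by (simp only: exp_add[symmetric]) (simp only: exp_add eB)
    qed
    have 3: "exp (\<phi> (W x) / 3) * (exp ((1 - 2 * a) * (\<kappa> * y + \<delta> x)) * W x)
        = (- 16 * U1 / S) * exp (- 2 * C0 / 3) * D x * exp (\<kappa> * (1 - 2 * a) * y)"
    proof -
      have "W x = 4 / S * Y x * exp (- \<phi> (W x))" unfolding EW[symmetric] by (simp add: exp_minus)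
      then have "exp (\<phi> (W x) / 3) * (exp ((1 - 2 * a) * (\<kappa> * y + \<delta> x)) * W x)
         = exp (\<phi> (W x) / 3) * (exp ((1 - 2 * a) * (\<kappa> * y + \<delta> x)) * (4 / S * Y x * exp (- \<phi> (W x))))"
        by (rule arg_cong)
      also have "\<dots> = 4 / S * Y x * exp (\<phi> (W x) / 3 + (1 - 2 * a) * (\<kappa> * y + \<delta> x) + - \<phi> (W x))"
        by (simp only: exp_add mult_ac)
      also have "\<phi> (W x) / 3 + (1 - 2 * a) * (\<kappa> * y + \<delta> x) + - \<phi> (W x)
         = - 2 * C0 / 3 + \<kappa> * (1 - 2 * a) * y + - (ln (A x) + ln (B x))"
      proof -
        have "\<phi> (W x) / 3 + - \<phi> (W x) = - 2 * (\<phi> (W x) / 3)" by simp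
        then show ?thesis unfolding \<phi>3 \<delta>_def by (simp add: algebra_simps)
      qed
      also have "exp \<dots> = exp (- 2 * C0 / 3) * exp (\<kappa> * (1 - 2 * a) * y) / (A x * B x)"
        by (simp only: exp_add exp_minus eA eB divide_inverse)
      also have "4 / S * Y x * (exp (- 2 * C0 / 3) * exp (\<kappa> * (1 - 2 * a) * y) / (A x * B x))
         = (- 16 * U1 / S) * exp (- 2 * C0 / 3) * D x * exp (\<kappa> * (1 - 2 * a) * y)"
        unfolding prod[OF x] using A[OF x] B[OF x] by simp
      finally show ?thesis .
    qed
    have w: "wave (\<lambda>i x. of_real (C i) * h i x) f z $ i = C i * Re (h i (of_real x)) * exp (f i * y)" for i
      by (simp add: wave_def x_def y_def)
    have s: "(k *\<^sub>R hildebrand_sphere p q \<phi> (\<Theta> z)) $ i = k * (exp (\<phi> (W x) / 3) *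
       (vector [exp (a * (\<kappa> * y + \<delta> x)), exp ((a - 1) * (\<kappa> * y + \<delta> x)), exp ((1 - 2 * a) * (\<kappa> * y + \<delta> x)) * W x] :: real^3) $ i)" for i
      unfolding hildebrand_sphere_def \<Theta>_def prod.case a x_def y_def by simp
    have "(k *\<^sub>R hildebrand_sphere p q \<phi> (\<Theta> z)) $ i = wave (\<lambda>i x. of_real (C i) * h i x) f z $ i" for i
      unfolding s w using exhaust_3[of i] 1 2 3
      by (elim disjE) (simp_all add: fv hv Cv A_def B_def D_def mult.assoc)
    then show ?thesis by (simp add: vec_eq_iff)
  qed
  have "affine_sphere_data \<S> (\<lambda>z. k *\<^sub>R hildebrand_sphere p q \<phi> (\<Theta> z)) (\<lambda>z. g (fst z)) (-1) (\<lambda>z. Complex U1 U2)"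
    by (rule affine_sphere_data_linear[where g = g and ?g1.0 = g1 and ?U1.0 = U1 and ?U2.0 = U2, OF open\<S> _ _ _ _ data _ eq])
      (use gpos g_deriv pJ Sz in auto)
  moreover have "1 + fst (\<Theta> z) * deriv \<phi> (fst (\<Theta> z)) = 4 * g (fst z) - 8 * b" if "z \<in> \<S>" for z
    using \<xi>W[of "fst z"] that by (simp add: \<Theta>_def \<xi>_def Sz)
  ultimately show ?thesis using that[OF k(1) bij[unfolded I_def]] by blast
qed

end

section \<open>Parameters and frequencies\<close>

text \<open>Vieta's formulas for w^3 - 3 b w + 2 u, whose discriminant is 4 (3 b)^3 - 27 (2
  u)^2.\<close>

lemma cubic_root_relations:
  fixes x y z b u :: real
  assumes s: "x + y + z = 0" "x\<^sup>2 + y\<^sup>2 + z\<^sup>2 = 6 * b" "x * y * z = - 2 * u"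
  shows "w = x \<or> w = y \<or> w = z \<Longrightarrow> w ^ 3 - 3 * b * w + 2 * u = 0"
    "((x - y) * (y - z) * (z - x))\<^sup>2 = 108 * (b ^ 3 - u\<^sup>2)"
proof -
  have z: "z = - x - y" using s(1) by simp
  have e: "3 * b = x\<^sup>2 + x * y + y\<^sup>2" using s(2) unfolding z by (simp add: power2_eq_square algebra_simps)
  have u: "2 * u = x * y * (x + y)" using s(3) unfolding z by (simp add: algebra_simps)
  show "w ^ 3 - 3 * b * w + 2 * u = 0" if "w = x \<or> w = y \<or> w = z"
  proof -
    have "(w - x) * (w - y) * (w - z) = 0" using that by auto
    then show ?thesis unfolding e u z by algebra
  qed
  have "108 * (b ^ 3 - u\<^sup>2) = 4 * (3 * b) ^ 3 - 27 * (2 * u)\<^sup>2" by algebra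
  then show "((x - y) * (y - z) * (z - x))\<^sup>2 = 108 * (b ^ 3 - u\<^sup>2)" unfolding e u z by algebra
qed

locale hildebrand_parameters =
  fixes p q c :: real
  assumes p: "2 \<le> p" and q: "1 / p + 1 / q = 1" and c: "- 2 * (p + q) < c" "c < 0"
begin

text \<open>One quarter of b1: expanding (\<xi> - 1)(\<xi> + p)(\<xi> + q) gives 3 b1 = p + q - 1 =
  12 b.\<close>

definition b :: real where "b = (p\<^sup>2 - p + 1) / (12 * (p - 1))"
abbreviation (input) "M \<equiv> cubic_modulus p c"

lemma sum_conjugate: "p + q = p\<^sup>2 / (p - 1)" "p * q = p + q"
  using conjugate_exponents[OF p q] p by (simp_all add: field_simps power2_eq_square)

lemma b_eq: "12 * b = p + q - 1"
  unfolding sum_conjugate(1) b_def using p by (simp add: field_simps)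

lemma b_pos: "b > 0"
proof -
  have "p\<^sup>2 \<ge> 2 * p" using p by (simp add: power2_eq_square)
  then show ?thesis unfolding b_def using p by (intro divide_pos_pos) auto
qed

text \<open>This rests on 4 (p^2 - p + 1)^3 = (p - 2)^2 (2p - 1)^2 (p + 1)^2 + 27 p^2 (p - 1)^2,
  known from the j-invariant in Legendre form. It expresses the second summand under the root in
  \<open>cubic_modulus\<close> through b and p + q.\<close>

lemma b_cube: "b ^ 3 = (p - 2)\<^sup>2 * (2 * p - 1)\<^sup>2 * (p + 1)\<^sup>2 / (4 * (12 * (p - 1)) ^ 3) + (p + q) / 256"
proof -
  define d where "d = p - 1"
  have d: "d > 0" "p = d + 1" using p by (auto simp: d_def)
  have "b ^ 3 = ((p\<^sup>2 - p + 1) ^ 3) / (12 * d) ^ 3" by (simp add: b_def d_def power_divide)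
  also have "(p\<^sup>2 - p + 1) ^ 3 = ((p - 2)\<^sup>2 * (2 * p - 1)\<^sup>2 * (p + 1)\<^sup>2 + 27 * p\<^sup>2 * d\<^sup>2) / 4"
  proof -
    have "4 * (p\<^sup>2 - p + 1) ^ 3 = (p - 2)\<^sup>2 * (2 * p - 1)\<^sup>2 * (p + 1)\<^sup>2 + 27 * p\<^sup>2 * d\<^sup>2" unfolding d_def by algebra
    then show ?thesis by simp
  qed
  also have "\<dots> / (12 * d) ^ 3 = (p - 2)\<^sup>2 * (2 * p - 1)\<^sup>2 * (p + 1)\<^sup>2 / (4 * (12 * d) ^ 3) + (27 * p\<^sup>2 * d\<^sup>2) / (4 * (12 * d) ^ 3)"
    by (simp add: add_divide_distrib)
  also have "(27 * p\<^sup>2 * d\<^sup>2) / (4 * (12 * d) ^ 3) = (p\<^sup>2 / d) / 256"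
    using d(1) by (simp add: power2_eq_square power3_eq_cube field_simps)
  finally show ?thesis unfolding sum_conjugate(1) d_def .
qed

lemma M_square: "M\<^sup>2 = c\<^sup>2 / (1024 * (p + q)) + b ^ 3 - (p + q) / 256"
proof -
  have "M\<^sup>2 = c\<^sup>2 * (p - 1) / (32 * p)\<^sup>2 + (p - 2)\<^sup>2 * (2 * p - 1)\<^sup>2 * (p + 1)\<^sup>2 / (4 * (12 * (p - 1)) ^ 3)"
    unfolding cubic_modulus_def using p by (intro real_sqrt_pow2 add_nonneg_nonneg divide_nonneg_pos mult_nonneg_nonneg) auto
  moreover have "c\<^sup>2 * (p - 1) / (32 * p)\<^sup>2 = c\<^sup>2 / (1024 * (p + q))"
    unfolding sum_conjugate(1) by (simp add: power_mult_distrib)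
  ultimately show ?thesis using b_cube by simp
qed

lemma pq_pos: "p + q > 0" using sum_conjugate(1) p by simp

text \<open>Here the lower bound for c enters: c^2 < 4 (p + q)^2 is the inequality |U|^2 < b^3 of
  \<open>positive_spectral\<close>.\<close>

lemma M_less: "M\<^sup>2 < b ^ 3"
proof -
  have "c\<^sup>2 < (2 * (p + q))\<^sup>2" using c by (intro power2_strict_mono) auto
  then have "c\<^sup>2 / (1024 * (p + q)) < (2 * (p + q))\<^sup>2 / (1024 * (p + q))"
    using pq_pos by (intro divide_strict_right_mono) auto
  also have "\<dots> = (p + q) / 256"
  proof -
    have "(2 * s)\<^sup>2 / (1024 * s) = s / 256" if "s > 0" for s :: real using that by (simp add: power2_eq_square)
    then show ?thesis using pq_pos by blast
  qed
  finally show ?thesis unfolding M_square by simp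
qed

lemma M_pos: "M > 0"
  unfolding cubic_modulus_def using p c by (intro real_sqrt_gt_zero add_pos_nonneg divide_pos_pos mult_pos_pos divide_nonneg_pos mult_nonneg_nonneg) auto

text \<open>The exponents of \<mu> in Hildebrand's sphere are a, a - 1 and 1 - 2a. Scaled by
  \<kappa> they must be the roots of f^3 - 3 b f + 2 U2: the linear coefficient fixes \<kappa>^2 and
  the product of the roots fixes U2. U1 is read off by comparing the profile equation with the
  differential equation of g.\<close>

definition \<kappa> :: real where "\<kappa> = sqrt 3 * p / (2 * sqrt (p - 1))"
definition a :: real where "a = (2 * p - 1) / (3 * p)"
definition U1 :: real where "U1 = c / (32 * sqrt (p + q))"
definition U2 :: real where "U2 = - ((\<kappa> * a) * (\<kappa> * (a - 1)) * (\<kappa> * (1 - 2 * a))) / 2"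

lemma \<kappa>_square: "\<kappa>\<^sup>2 = 3 * p\<^sup>2 / (4 * (p - 1))"
  unfolding \<kappa>_def using p by (simp add: power_divide power_mult_distrib)

lemma \<kappa>_ne: "\<kappa> \<noteq> 0"
  using p by (simp add: \<kappa>_def)

text \<open>The inequalities make the modes of the first two coordinates positive; the last two
  facts say that a, a - 1 and 1 - 2a are distinct, so that the Vandermonde product is
  nonzero.\<close>

lemma \<kappa>_relations:
  "\<kappa>\<^sup>2 * (a * (1 - a)) = 2 * b + 1 / 4" "\<kappa>\<^sup>2 * (3 * a\<^sup>2 - 3 * a + 1) = 3 * b"
  "\<kappa>\<^sup>2 * a\<^sup>2 > b" "\<kappa>\<^sup>2 * (1 - a)\<^sup>2 > b" "3 * a \<noteq> 1" "3 * a \<noteq> 2"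
proof -
  define d where "d = p - 1"
  have d: "d > 0" "d = p - 1" "p > 0" using p by (auto simp: d_def)
  have pa: "p * a = (2 * p - 1) / 3" "p * (1 - a) = (p + 1) / 3" using d by (auto simp: a_def field_simps)
  have aa: "\<kappa>\<^sup>2 * a\<^sup>2 = (2 * p - 1)\<^sup>2 / (12 * d)" "\<kappa>\<^sup>2 * (1 - a)\<^sup>2 = (p + 1)\<^sup>2 / (12 * d)" "\<kappa>\<^sup>2 * (a * (1 - a)) = (2 * p - 1) * (p + 1) / (12 * d)"
  proof -
    have "\<kappa>\<^sup>2 * a\<^sup>2 = 3 * (p * a)\<^sup>2 / (4 * d)" "\<kappa>\<^sup>2 * (1 - a)\<^sup>2 = 3 * (p * (1 - a))\<^sup>2 / (4 * d)"
      "\<kappa>\<^sup>2 * (a * (1 - a)) = 3 * ((p * a) * (p * (1 - a))) / (4 * d)"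
      unfolding \<kappa>_square d_def power_mult_distrib by (simp_all add: power2_eq_square mult_ac)
    then show "\<kappa>\<^sup>2 * a\<^sup>2 = (2 * p - 1)\<^sup>2 / (12 * d)" "\<kappa>\<^sup>2 * (1 - a)\<^sup>2 = (p + 1)\<^sup>2 / (12 * d)" "\<kappa>\<^sup>2 * (a * (1 - a)) = (2 * p - 1) * (p + 1) / (12 * d)"
      unfolding pa by (simp_all add: power_divide)
  qed
  have b: "b = (p\<^sup>2 - p + 1) / (12 * d)" by (simp add: b_def d_def)
  have "(2 * p - 1) * (p + 1) = 2 * (p\<^sup>2 - p + 1) + 3 * d" unfolding d(2) by algebra
  then show 1: "\<kappa>\<^sup>2 * (a * (1 - a)) = 2 * b + 1 / 4"
    unfolding aa b using d(1) by (simp add: add_divide_distrib)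
  have "\<kappa>\<^sup>2 * (3 * a\<^sup>2 - 3 * a + 1) = \<kappa>\<^sup>2 * a\<^sup>2 + \<kappa>\<^sup>2 * (1 - a)\<^sup>2 - \<kappa>\<^sup>2 * (a * (1 - a))" by algebra
  also have "\<dots> = ((2 * p - 1)\<^sup>2 + (p + 1)\<^sup>2 - (2 * p - 1) * (p + 1)) / (12 * d)"
    unfolding aa by (simp add: add_divide_distrib diff_divide_distrib)
  also have "(2 * p - 1)\<^sup>2 + (p + 1)\<^sup>2 - (2 * p - 1) * (p + 1) = 3 * (p\<^sup>2 - p + 1)" by algebra
  finally show "\<kappa>\<^sup>2 * (3 * a\<^sup>2 - 3 * a + 1) = 3 * b" unfolding b by simp
  have "p * p > p" using p by simp
  then show "\<kappa>\<^sup>2 * a\<^sup>2 > b" "\<kappa>\<^sup>2 * (1 - a)\<^sup>2 > b"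
    unfolding aa b using d(1,3) by (auto intro!: divide_strict_right_mono simp: power2_eq_square algebra_simps)
  show "3 * a \<noteq> 1" "3 * a \<noteq> 2" using p by (auto simp: a_def field_simps)
qed

lemma a_relations: "(q + 1) / (3 * q) = a" "- (p + 1) / (3 * p) = a - 1" "- (p - q) / (3 * (p + q)) = 1 - 2 * a"
proof -
  have pp: "p > 0" "p - 1 > 0" using p by auto
  note q = conjugate_exponents(2)[OF p q]
  have "q \<noteq> 0" using q pp by simp
  then have "(q + 1) / (3 * q) = (1 + 1 / q) / 3" by (simp add: field_simps)
  also have "1 / q = 1 - 1 / p" using hildebrand_parameters_axioms by (simp add: hildebrand_parameters_def)
  finally show "(q + 1) / (3 * q) = a" using pp by (simp add: a_def field_simps)
  show "- (p + 1) / (3 * p) = a - 1" using pp by (simp add: a_def field_simps)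
  have "p - q = p * (p - 2) / (p - 1)" unfolding q using pp by (simp add: field_simps)
  then have "- (p - q) / (3 * (p + q)) = - (p * (p - 2)) / (3 * p\<^sup>2)" unfolding sum_conjugate(1) using pp by simp
  also have "\<dots> = 1 - 2 * a" using pp by (simp add: a_def power2_eq_square field_simps)
  finally show "- (p - q) / (3 * (p + q)) = 1 - 2 * a" .
qed

text \<open>This matches the constant term - (p + q) of the profile cubic with that of the
  differential equation of g in the variable 4 g - 8 b.\<close>

lemma U2_square: "256 * (b ^ 3 - U2\<^sup>2) = p + q"
proof -
  define d where "d = p - 1"
  have d: "d > 0" "p > 0" using p by (auto simp: d_def)
  have "(p * a) * (p * (a - 1)) * (p * (1 - 2 * a)) = (2 * p - 1) * (p + 1) * (p - 2) / 27"
  proof -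
    have e: "p * a = (2 * p - 1) / 3" "p * (a - 1) = - (p + 1) / 3" "p * (1 - 2 * a) = - (p - 2) / 3"
      using d by (auto simp: a_def field_simps)
    show ?thesis unfolding e by (simp add: field_simps)
  qed
  note P = this
  have e: "((p * a) * (p * (a - 1)) * (p * (1 - 2 * a)))\<^sup>2 = ((2 * p - 1) * (p + 1) * (p - 2))\<^sup>2 / 729"
    unfolding P power_divide by simp
  have "U2\<^sup>2 = (\<kappa>\<^sup>2) ^ 3 * (a * (a - 1) * (1 - 2 * a))\<^sup>2 / 4" unfolding U2_def by (simp add: power_divide) algebra
  also have "\<dots> = 27 / (64 * d ^ 3) * ((p * a) * (p * (a - 1)) * (p * (1 - 2 * a)))\<^sup>2 / 4"
  proof -
    have "(\<kappa>\<^sup>2) ^ 3 = 27 / (64 * d ^ 3) * (p\<^sup>2) ^ 3"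
      unfolding \<kappa>_square d_def[symmetric] by (simp add: power_divide power_mult_distrib)
    moreover have "(p\<^sup>2) ^ 3 * (a * (a - 1) * (1 - 2 * a))\<^sup>2 = ((p * a) * (p * (a - 1)) * (p * (1 - 2 * a)))\<^sup>2" by algebra
    ultimately show ?thesis by simp
  qed
  also have "\<dots> = (p - 2)\<^sup>2 * (2 * p - 1)\<^sup>2 * (p + 1)\<^sup>2 / (4 * (12 * (p - 1)) ^ 3)"
    unfolding e d_def[symmetric] using d(1) by (simp add: power_mult_distrib mult_ac)
  finally show ?thesis unfolding b_cube by simp
qed

lemma U1_eq: "32 * sqrt (p + q) * U1 = c" "U1 \<noteq> 0" "U1\<^sup>2 + U2\<^sup>2 = M\<^sup>2"
proof -
  have s: "sqrt (p + q) > 0" using pq_pos by simp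
  then show "32 * sqrt (p + q) * U1 = c" "U1 \<noteq> 0" using c by (auto simp: U1_def)
  have "U1\<^sup>2 = c\<^sup>2 / (1024 * (p + q))" unfolding U1_def using pq_pos by (simp add: power_divide power_mult_distrib)
  moreover have "U2\<^sup>2 = b ^ 3 - 256 * (b ^ 3 - U2\<^sup>2) / 256" by (simp add: diff_divide_distrib)
  then have "U2\<^sup>2 = b ^ 3 - (p + q) / 256" unfolding U2_square .
  ultimately show "U1\<^sup>2 + U2\<^sup>2 = M\<^sup>2" unfolding M_square by linarith
qed

text \<open>By \<open>U1_eq\<close> the point (U1, U2) lies on the circle of radius M, and 3t runs
  once around it. The resulting t0 is the parameter of Hildebrand's own surface.\<close>

lemma base_angle:
  obtains t0 where "t0 \<in> {0..2 * pi / 3}" "M * cos (3 * t0) = U1" "M * sin (3 * t0) = U2"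
proof -
  have "(U1 / M)\<^sup>2 + (U2 / M)\<^sup>2 = 1"
    using U1_eq(3) M_pos by (simp add: power_divide add_divide_distrib[symmetric])
  then obtain \<theta> where \<theta>: "0 \<le> \<theta>" "\<theta> < 2 * pi" "U1 / M = cos \<theta>" "U2 / M = sin \<theta>" by (rule sincos_total_2pi) blast
  show ?thesis by (rule that[of "\<theta> / 3"]) (use \<theta> M_pos in \<open>auto simp: field_simps\<close>)
qed

lemma sin_less: "(M * sin u)\<^sup>2 < b ^ 3"
proof -
  have "(sin u)\<^sup>2 \<le> 1" by (simp add: abs_square_le_1)
  then have "(M * sin u)\<^sup>2 \<le> M\<^sup>2 * 1" unfolding power_mult_distrib by (intro mult_left_mono) auto
  then show ?thesis using M_less by simp
qed

lemma homothety_eq: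
  "homothety p c t = root 3 (2 * p\<^sup>2 * \<bar>M * cos (3 * t)\<bar> / ((p - 1) * \<bar>c\<bar> * sqrt (b ^ 3 - (M * sin (3 * t))\<^sup>2)))"
  unfolding homothety_def b_def using M_pos by (simp add: abs_mult mult.assoc)

text \<open>At this parameter sqrt (b^3 - U2^2) = sqrt (p + q) / 16 and |U1| = |c| / (32 sqrt (p +
  q)); with p^2 / (p - 1) = p + q all factors cancel.\<close>

lemma homothety_base:
  assumes "M * cos (3 * t) = U1" "M * sin (3 * t) = U2"
  shows "homothety p c t = 1"
proof -
  define r where "r = sqrt (p + q)"
  have r: "r > 0" "r\<^sup>2 = p + q" using pq_pos by (auto simp: r_def)
  have "b ^ 3 - U2\<^sup>2 = (r / 16)\<^sup>2" using U2_square r(2) by (simp add: power_divide)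
  then have s: "sqrt (b ^ 3 - U2\<^sup>2) = r / 16" using r(1) by simp
  have u: "\<bar>U1\<bar> = \<bar>c\<bar> / (32 * r)" using r(1) by (simp add: U1_def r_def[symmetric] abs_mult)
  have "p\<^sup>2 = (p - 1) * r\<^sup>2" using sum_conjugate(1) p r(2) by (simp add: field_simps)
  then have p2: "2 * p\<^sup>2 * \<bar>U1\<bar> / ((p - 1) * \<bar>c\<bar> * sqrt (b ^ 3 - U2\<^sup>2))
      = 2 * ((p - 1) * r\<^sup>2) * (\<bar>c\<bar> / (32 * r)) / ((p - 1) * \<bar>c\<bar> * (r / 16))"
    unfolding s u by simp
  have one: "2 * (d * r\<^sup>2) * (e / (32 * r)) / (d * e * (r / 16)) = 1" if "d > 0" "e > 0" for d e
    using that r(1) by (simp add: power2_eq_square field_simps)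
  have "2 * p\<^sup>2 * \<bar>U1\<bar> / ((p - 1) * \<bar>c\<bar> * sqrt (b ^ 3 - U2\<^sup>2)) = 1"
    unfolding p2 by (rule one) (use p c in auto)
  then show ?thesis unfolding homothety_eq assms by (simp only: real_root_one)
qed

abbreviation (input) "f \<equiv> freq p c (- 1)"

section \<open>Frequencies, spectral points and amplitudes\<close>

lemma freq_eq:
  defines "\<beta> \<equiv> sqrt b" and "A \<equiv> \<lambda>t. arccos (- (M * sin (3 * t) / sqrt (b ^ 3)))"
  shows "f t $ 1 = - (2 * \<beta> * sin (pi / 6 + A t / 3))" "f t $ 2 = - (2 * \<beta> * cos (pi / 3 + A t / 3))"
    "f t $ 3 = 2 * \<beta> * cos (A t / 3)"
proof -
  have "sqrt ((p\<^sup>2 - p + 1) / (p - 1)) / sqrt 3 = sqrt (4 * b)"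
    unfolding real_sqrt_divide[symmetric] b_def by (rule arg_cong[where f = sqrt]) (use p in \<open>simp add: field_simps\<close>)
  then have K: "sqrt ((p\<^sup>2 - p + 1) / (p - 1)) / sqrt 3 = 2 * \<beta>" by (simp add: \<beta>_def real_sqrt_mult)
  show "f t $ 1 = - (2 * \<beta> * sin (pi / 6 + A t / 3))" "f t $ 2 = - (2 * \<beta> * cos (pi / 3 + A t / 3))"
    "f t $ 3 = 2 * \<beta> * cos (A t / 3)"
    unfolding freq_def Let_def K b_def[symmetric] A_def by simp_all
qed

lemma freq_argument: "- 1 < - (M * sin u / sqrt (b ^ 3))" "- (M * sin u / sqrt (b ^ 3)) < 1"
proof -
  have "\<bar>M * sin u\<bar> < sqrt (b ^ 3)" using real_sqrt_less_mono[OF sin_less] by simp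
  moreover have "sqrt (b ^ 3) > 0" using b_pos by simp
  ultimately show "- 1 < - (M * sin u / sqrt (b ^ 3))" "- (M * sin u / sqrt (b ^ 3)) < 1" by (auto simp: field_simps abs_less_iff)
qed

text \<open>Viete's trigonometric solution: with x = cos (A/3), y = sin (A/3) and \<beta> = sqrt b
  the frequencies are 2 \<beta> x and - \<beta> (x +- sqrt 3 y), and the triple-angle formula turns
  their product into 2 \<beta>^3 cos A.\<close>

lemma freq_symmetric:
  "f t $ 1 + f t $ 2 + f t $ 3 = 0" "(f t $ 1)\<^sup>2 + (f t $ 2)\<^sup>2 + (f t $ 3)\<^sup>2 = 6 * b"
  "f t $ 1 * f t $ 2 * f t $ 3 = - 2 * (M * sin (3 * t))"
proof -
  define \<beta> where "\<beta> = sqrt b"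
  define A where "A = arccos (- (M * sin (3 * t) / sqrt (b ^ 3)))"
  define x y where "x = cos (A / 3)" and "y = sin (A / 3)"
  have \<beta>: "\<beta>\<^sup>2 = b" "\<beta> > 0" "sqrt (b ^ 3) = \<beta> ^ 3" using b_pos by (auto simp: \<beta>_def real_sqrt_power)
  have xy: "x\<^sup>2 + y\<^sup>2 = 1" by (simp add: x_def y_def)
  define \<rho> where "\<rho> = sqrt (3::real)"
  have \<rho>: "\<rho>\<^sup>2 = 3" by (simp add: \<rho>_def)
  have f1: "f t $ 1 = - (\<beta> * (x + \<rho> * y))"
    unfolding freq_eq(1) \<beta>_def[symmetric] A_def[symmetric] sin_add by (simp add: x_def y_def \<rho>_def sin_30 cos_30 algebra_simps)
  have f2: "f t $ 2 = - (\<beta> * (x - \<rho> * y))"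
    unfolding freq_eq(2) \<beta>_def[symmetric] A_def[symmetric] cos_add by (simp add: x_def y_def \<rho>_def sin_60 cos_60 algebra_simps)
  have f3: "f t $ 3 = 2 * \<beta> * x"
    unfolding freq_eq(3) \<beta>_def[symmetric] A_def[symmetric] x_def ..
  show "f t $ 1 + f t $ 2 + f t $ 3 = 0" unfolding f1 f2 f3 by (simp add: algebra_simps)
  show "(f t $ 1)\<^sup>2 + (f t $ 2)\<^sup>2 + (f t $ 3)\<^sup>2 = 6 * b" unfolding f1 f2 f3 \<beta>(1)[symmetric] using xy \<rho> by algebra
  have "cos A = - (M * sin (3 * t) / sqrt (b ^ 3))"
    unfolding A_def using freq_argument[of "3 * t"] by (intro cos_arccos) auto
  moreover have "cos A = 4 * x ^ 3 - 3 * x" using cos_treble_cos[of "A / 3"] by (simp add: x_def)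
  ultimately have "\<beta> ^ 3 * (4 * x ^ 3 - 3 * x) = - (M * sin (3 * t))" using \<beta>(2,3) by (simp add: field_simps)
  then show "f t $ 1 * f t $ 2 * f t $ 3 = - 2 * (M * sin (3 * t))" unfolding f1 f2 f3 using xy \<rho> by algebra
qed

lemma freq_root: "(f t $ i) ^ 3 - 3 * b * f t $ i + 2 * (M * sin (3 * t)) = 0"
  by (rule cubic_root_relations(1)[OF freq_symmetric[of t]]) (use exhaust_3[of i] in auto)

lemma freq_vandermonde:
  "\<bar>(f t $ 1 - f t $ 2) * (f t $ 2 - f t $ 3) * (f t $ 3 - f t $ 1)\<bar> = 6 * sqrt 3 * sqrt (b ^ 3 - (M * sin (3 * t))\<^sup>2)"
proof -
  have "\<bar>(f t $ 1 - f t $ 2) * (f t $ 2 - f t $ 3) * (f t $ 3 - f t $ 1)\<bar> = sqrt (36 * 3 * (b ^ 3 - (M * sin (3 * t))\<^sup>2))"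
    using cubic_root_relations(2)[OF freq_symmetric[of t]] by (simp flip: real_sqrt_abs)
  also have "\<dots> = sqrt 36 * sqrt 3 * sqrt (b ^ 3 - (M * sin (3 * t))\<^sup>2)" by (simp only: real_sqrt_mult)
  also have "sqrt 36 = (6 :: real)" by (rule real_sqrt_unique) auto
  finally show ?thesis .
qed

lemma freq_isCont: "isCont (\<lambda>t. f t $ i) t"
proof -
  have A: "isCont (\<lambda>t. arccos (- (M * sin (3 * t) / sqrt (b ^ 3)))) t"
  proof (rule isCont_o2[where g = arccos])
    show "isCont (\<lambda>t. - (M * sin (3 * t) / sqrt (b ^ 3))) t" using b_pos by (intro continuous_intros) auto
    show "isCont arccos (- (M * sin (3 * t) / sqrt (b ^ 3)))" by (rule isCont_arccos[OF freq_argument])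
  qed
  show ?thesis using exhaust_3[of i]
    by (elim disjE) (simp_all only: freq_eq, intro continuous_intros A; simp)+
qed

text \<open>For a nonzero frequency this is the cubic divided by it. The right side is continuous in
  t, so the formula persists at a zero of the frequency, where the quotient is read as its
  limit.\<close>

lemma sin_over_freq_eq: "2 * M * sin_over_freq p c (- 1) i t = 3 * b - (f t $ i)\<^sup>2"
proof (cases "f t $ i = 0")
  case False
  have "f t $ i * (3 * b - (f t $ i)\<^sup>2) = 2 * M * sin (3 * t)"
    using freq_root[of t i] by (simp add: power2_eq_square power3_eq_cube algebra_simps)
  then show ?thesis using False by (simp add: sin_over_freq_def field_simps)
next
  case True
  then have s: "sin (3 * t) = 0" using freq_root[of t i] M_pos by simp
  \<comment> \<open>The zero of the sine at t is isolated. Where the sine is nonzero the cubic keeps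
    the frequency nonzero, so the quotient near t is obtained by division.\<close>
  have "sin (3 * u) \<noteq> 0" if "u \<noteq> t" "dist u t < pi / 3" for u
  proof -
    have "sin (3 * u) = sin (3 * t + 3 * (u - t))" by simp
    also have "\<dots> = cos (3 * t) * sin (3 * (u - t))" unfolding sin_add s by simp
    finally have "sin (3 * u) = cos (3 * t) * sin (3 * (u - t))" .
    moreover have "cos (3 * t) \<noteq> 0" using sin_cos_squared_add[of "3 * t"] s by auto
    moreover have "\<bar>3 * (u - t)\<bar> < pi" unfolding abs_mult using that(2) by (simp add: dist_real_def)
    then have "sin (3 * (u - t)) \<noteq> 0" using that(1) by (simp add: sin_zero_pi_iff)
    ultimately show ?thesis by simp
  qed
  then have "\<forall>\<^sub>F u in at t. sin (3 * u) \<noteq> 0" unfolding eventually_at by (intro exI[of _ "pi / 3"]) auto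
  then have ev: "\<forall>\<^sub>F u in at t. (3 * b - (f u $ i)\<^sup>2) / (2 * M) = sin (3 * u) / f u $ i"
  proof eventually_elim
    case (elim u)
    have r: "f u $ i * (3 * b - (f u $ i)\<^sup>2) = 2 * M * sin (3 * u)"
      using freq_root[of u i] by (simp add: power2_eq_square power3_eq_cube algebra_simps)
    then have "f u $ i \<noteq> 0" using elim M_pos by auto
    then show ?case using r M_pos by (simp add: field_simps)
  qed
  have "((\<lambda>u. (3 * b - (f u $ i)\<^sup>2) / (2 * M)) \<longlongrightarrow> (3 * b - (f t $ i)\<^sup>2) / (2 * M)) (at t)"
    by (intro tendsto_divide tendsto_diff tendsto_power tendsto_const freq_isCont[unfolded isCont_def]) (use M_pos in simp)
  then have "((\<lambda>u. sin (3 * u) / f u $ i) \<longlongrightarrow> (3 * b - (f t $ i)\<^sup>2) / (2 * M)) (at t)"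
    by (rule Lim_transform_eventually[OF _ ev])
  then have "Lim (at t) (\<lambda>u. sin (3 * u) / f u $ i) = (3 * b - (f t $ i)\<^sup>2) / (2 * M)"
    by (rule tendsto_Lim[OF trivial_limit_at])
  then show ?thesis using True M_pos by (simp add: sin_over_freq_def)
qed

text \<open>In this form the condition has no exceptional case at zero frequency and fits the
  first-order equation in \<open>mode\<close>.\<close>

lemma spectral_point_iff:
  "spectral_point \<Lambda> (4 * b) p c (- 1) t i m \<longleftrightarrow> m \<notin> \<Lambda> \<and> wp \<Lambda> m + of_real b = of_real (3 * b - (f t $ i)\<^sup>2) \<and>
     deriv (wp \<Lambda>) m \<in> \<real> \<and> Re (deriv (wp \<Lambda>) m) < 0"
proof -
  have e: "2 * (- 1) * M * sin_over_freq p c (- 1) i t = - (3 * b - (f t $ i)\<^sup>2)"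
    unfolding sin_over_freq_eq[symmetric] by simp
  show ?thesis
    unfolding spectral_point_def e by (simp add: eq_diff_eq add_eq_0_iff algebra_simps)
qed

text \<open>The volume condition of \<open>wave_data\<close> with U1 = M cos (3t). The cube of
  \<open>homothety\<close> is the factor by which the prefactors of \<open>r_lambda\<close> miss it,
  the Vandermonde product being 6 sqrt 3 sqrt (b^3 - (M sin (3t))^2).\<close>

lemma amplitude:
  "\<bar>homothety p c t ^ 3 * ((1 / (3 * p)) * (1 / (3 * p)) * (sqrt 3 * (p - 1) * c / 2)) *
     ((f t $ 1 - f t $ 2) * (f t $ 2 - f t $ 3) * (f t $ 3 - f t $ 1))\<bar> = 2 * \<bar>M * cos (3 * t)\<bar>"
proof -
  define d where "d = sqrt (b ^ 3 - (M * sin (3 * t))\<^sup>2)"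
  have d: "d > 0" using sin_less[of "3 * t"] by (simp add: d_def)
  have "homothety p c t ^ 3 = 2 * p\<^sup>2 * \<bar>M * cos (3 * t)\<bar> / ((p - 1) * \<bar>c\<bar> * d)"
    unfolding homothety_eq d_def[symmetric] using d p by (intro real_root_pow_pos2) auto
  moreover have "0 \<le> 2 * p\<^sup>2 * \<bar>M * cos (3 * t)\<bar> / ((p - 1) * \<bar>c\<bar> * d)" using d p by auto
  ultimately have X: "\<bar>homothety p c t ^ 3\<bar> = 2 * p\<^sup>2 * \<bar>M * cos (3 * t)\<bar> / ((p - 1) * \<bar>c\<bar> * d)" by (simp only: abs_of_nonneg)
  have Z: "\<bar>(1 / (3 * p)) * (1 / (3 * p)) * (sqrt 3 * (p - 1) * c / 2)\<bar> = sqrt 3 * (p - 1) * \<bar>c\<bar> / (18 * p\<^sup>2)"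
    using p by (simp add: abs_mult power2_eq_square)
  have "\<bar>homothety p c t ^ 3 * ((1 / (3 * p)) * (1 / (3 * p)) * (sqrt 3 * (p - 1) * c / 2)) *
     ((f t $ 1 - f t $ 2) * (f t $ 2 - f t $ 3) * (f t $ 3 - f t $ 1))\<bar>
    = \<bar>homothety p c t ^ 3\<bar> * \<bar>(1 / (3 * p)) * (1 / (3 * p)) * (sqrt 3 * (p - 1) * c / 2)\<bar>
      * \<bar>(f t $ 1 - f t $ 2) * (f t $ 2 - f t $ 3) * (f t $ 3 - f t $ 1)\<bar>"
    by (simp only: abs_mult)
  also have "\<dots> = 2 * p\<^sup>2 * \<bar>M * cos (3 * t)\<bar> / ((p - 1) * \<bar>c\<bar> * d) * (sqrt 3 * (p - 1) * \<bar>c\<bar> / (18 * p\<^sup>2)) * (6 * sqrt 3 * d)"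
    unfolding X Z freq_vandermonde d_def[symmetric] ..
  also have "\<dots> = 2 * \<bar>M * cos (3 * t)\<bar> * ((sqrt 3)\<^sup>2 / 3)"
  proof -
    have "p\<^sup>2 \<noteq> 0" "p - 1 \<noteq> 0" "\<bar>c\<bar> \<noteq> 0" "d \<noteq> 0" using p c d by auto
    then show ?thesis by (simp add: power2_eq_square field_simps del: real_sqrt_mult_self)
  qed
  finally show ?thesis by simp
qed

end

section \<open>The associated family\<close>

lemma exp_ii_eq_cis: "exp (3 * \<i> * of_real t) = cis (3 * t)"
  by (simp add: cis_conv_exp mult_ac)

text \<open>By \<open>affine_sphere_data_unique\<close> the quantified data must be those of r0; the
  unit factor then only has to rotate the phase 3 t0 to 3 t.\<close>

lemma associated_member_iff:
  assumes r0: "affine_sphere_data \<Omega> r0 G H (\<lambda>z. exp (3 * \<i> * of_real t0) * of_real M)"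
    and ne: "\<Omega> \<noteq> {}" and M: "0 \<le> M"
  shows "associated_member \<Omega> r0 t r \<longleftrightarrow> affine_sphere_data \<Omega> r G H (\<lambda>z. exp (3 * \<i> * of_real t) * of_real M)"
proof
  have \<Omega>: "open \<Omega>" using r0 by (simp add: affine_sphere_data_def affine_sphere_on_def)
  have norm: "norm (exp (3 * \<i> * of_real u) * of_real M) = M" for u using M by (simp add: exp_ii_eq_cis norm_mult)
  {
    assume "associated_member \<Omega> r0 t r"
    then obtain G' H' U \<theta> where d: "affine_sphere_data \<Omega> r0 G' H' U"
      and \<theta>: "\<And>z. z \<in> \<Omega> \<Longrightarrow> \<theta> * U z = exp (3 * \<i> * of_real t) * of_real (norm (U z))"
      and r: "affine_sphere_data \<Omega> r G' H' (\<lambda>z. \<theta> * U z)"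
      unfolding associated_member_def by blast
    note u = affine_sphere_data_unique[OF r0 d ne]
    have "affine_sphere_data \<Omega> r G' H' (\<lambda>z. \<theta> * U z) \<longleftrightarrow> affine_sphere_data \<Omega> r G H' (\<lambda>z. exp (3 * \<i> * of_real t) * of_real M)"
    proof (rule affine_sphere_data_cong[OF \<Omega>])
      fix z assume z: "z \<in> \<Omega>"
      show "G' z = G z" by (rule u(2)[OF z])
      have "norm (U z) = M" unfolding u(3)[OF z] norm ..
      with \<theta>[OF z] show "\<theta> * U z = exp (3 * \<i> * of_real t) * of_real M" by simp
    qed
    then show "affine_sphere_data \<Omega> r G H (\<lambda>z. exp (3 * \<i> * of_real t) * of_real M)" using r u(1) by simp
  }
  {
    assume r: "affine_sphere_data \<Omega> r G H (\<lambda>z. exp (3 * \<i> * of_real t) * of_real M)"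
    let ?\<theta> = "cis (3 * t - 3 * t0)"
    have e: "?\<theta> * (exp (3 * \<i> * of_real t0) * of_real M) = exp (3 * \<i> * of_real t) * of_real M"
      by (simp add: exp_ii_eq_cis cis_mult flip: mult.assoc)
    have r': "affine_sphere_data \<Omega> r G H (\<lambda>z. ?\<theta> * (exp (3 * \<i> * of_real t0) * of_real M))" unfolding e by (rule r)
    have "\<forall>z\<in>\<Omega>. ?\<theta> * (exp (3 * \<i> * of_real t0) * of_real M)
        = exp (3 * \<i> * of_real t) * of_real (norm (exp (3 * \<i> * of_real t0) * of_real M))" unfolding norm e by blast
    moreover have "norm ?\<theta> = 1" by simp
    ultimately show "associated_member \<Omega> r0 t r" unfolding associated_member_def using r0 r' by blast
  }
qed

context positive_spectral
begin

text \<open>P' takes the values 4 U1 and - 4 U1 at v and - v, and one of them is negative.\<close>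

lemma spectral_value_negative:
  assumes f: "f ^ 3 - 3 * b * f + 2 * U2 = 0"
  obtains m where "m \<notin> \<Lambda>" "wp \<Lambda> m + of_real b = of_real (3 * b - f\<^sup>2)" "deriv (wp \<Lambda>) m \<in> \<real>" "Re (deriv (wp \<Lambda>) m) < 0"
proof -
  obtain v where v: "v \<notin> \<Lambda>" "wp \<Lambda> v + of_real b = of_real (3 * b - f\<^sup>2)" "wpd v = of_real (4 * U1)"
    using spectral_value_exists[OF f] by blast
  have v': "- v \<notin> \<Lambda>" "wp \<Lambda> (- v) + of_real b = of_real (3 * b - f\<^sup>2)" "wpd (- v) = of_real (- 4 * U1)"
    using v by (simp_all add: lattice_uminus_iff wp_minus wpd_minus)
  show ?thesis
  proof (cases "U1 < 0")
    case True
    then show ?thesis using that[OF v(1,2)] unfolding deriv_wp[OF v(1)] v(3) by (simp del: of_real_mult)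
  next
    case False
    then show ?thesis using that[OF v'(1,2)] U1 unfolding deriv_wp[OF v'(1)] v'(3) by (simp del: of_real_mult)
  qed
qed

text \<open>P'(m) < 0 means P'(m) = - 4 |U1|, whereas a mode needs 4 U1. Multiplying m by - sgn U1
  repairs the sign; this is the origin of s in \<open>r_lambda\<close>, as U1 = M cos (3t) with M >
  0.\<close>

lemma spectral_value_mode:
  assumes f: "f ^ 3 - 3 * b * f + 2 * U2 = 0"
    and m: "m \<notin> \<Lambda>" "wp \<Lambda> m + of_real b = of_real (3 * b - f\<^sup>2)" "deriv (wp \<Lambda>) m \<in> \<real>" "Re (deriv (wp \<Lambda>) m) < 0"
  shows "mode f (baker (of_real (- sgn U1) * m))" "wzeta \<Lambda> (of_real (- sgn U1) * m) = of_real (- sgn U1) * wzeta \<Lambda> m"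
proof -
  define w where "w = Re (wpd m)"
  have w: "wpd m = of_real w" "w < 0" using m(3,4) unfolding deriv_wp[OF m(1)] w_def by auto
  have "of_real (w\<^sup>2) = complex_of_real (16 * U1\<^sup>2)" using wpd_square[OF f m(1,2)] unfolding w(1) by simp
  then have "w\<^sup>2 = (4 * U1)\<^sup>2" by (simp only: of_real_eq_iff) (simp add: power2_eq_square)
  then have "\<bar>w\<bar> = \<bar>4 * U1\<bar>" by (metis real_sqrt_abs)
  then have w4: "w = - 4 * \<bar>U1\<bar>" using w(2) by simp
  consider "U1 > 0" | "U1 < 0" using U1 by linarith
  then show "mode f (baker (of_real (- sgn U1) * m))" "wzeta \<Lambda> (of_real (- sgn U1) * m) = of_real (- sgn U1) * wzeta \<Lambda> m"
  proof (atomize(full), cases)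
    case 1
    have "mode f (baker (- m))"
      by (rule baker_mode[OF f]) (use m w w4 1 in \<open>simp_all add: lattice_uminus_iff wp_minus wpd_minus\<close>)
    then show "mode f (baker (of_real (- sgn U1) * m)) \<and> wzeta \<Lambda> (of_real (- sgn U1) * m) = of_real (- sgn U1) * wzeta \<Lambda> m"
      using 1 by (simp add: wzeta_minus)
  next
    case 2
    have "mode f (baker m)"
      by (rule baker_mode[OF f m(1,2)]) (use w w4 2 in simp)
    then show "mode f (baker (of_real (- sgn U1) * m)) \<and> wzeta \<Lambda> (of_real (- sgn U1) * m) = of_real (- sgn U1) * wzeta \<Lambda> m"
      using 2 by simp
  qed
qed

end

lemma (in half_periods) assoc_immersion_wave:
  fixes p c H t :: real and m :: "complex^3"
  defines "s \<equiv> - sgn (cos (3 * t))"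
    and "C \<equiv> \<lambda>i::3. if i = 3 then sqrt 3 * (p - 1) * c / 2 else 1 / (3 * p)"
  assumes \<zeta>: "\<And>i. wzeta \<Lambda> (of_real s * m $ i) = of_real s * wzeta \<Lambda> (m $ i)"
  shows "r_lambda \<Lambda> \<omega>1 p c H t m z $ i
      = of_real (C i) * baker (of_real s * m $ i) (of_real (fst z)) * of_real (exp (freq p c H t $ i * snd z))"
    "assoc_immersion \<Lambda> \<omega>1 p c H t m z
      = wave (\<lambda>i x. of_real (homothety p c t * C i) * baker (of_real s * m $ i) x) (\<lambda>i. freq p c H t $ i) z"
proof -
  have k: "r_lambda \<Lambda> \<omega>1 p c H t m z $ i
      = of_real (C i) * baker (of_real s * m $ i) (of_real (fst z)) * of_real (exp (freq p c H t $ i * snd z))" for z i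
  proof (cases z)
    case (Pair x y)
    have e: "exp (of_real s * wzeta \<Lambda> (m $ i) * of_real x + of_real (freq p c H t $ i * y))
       = exp (wzeta \<Lambda> (of_real s * m $ i) * of_real x) * of_real (exp (freq p c H t $ i * y))" for i
      unfolding \<zeta> exp_add by (simp only: exp_of_real)
    have "r_lambda \<Lambda> \<omega>1 p c H t m (x, y) $ i
      = of_real (C i) * (wsigma \<Lambda> (of_real x + of_real \<omega>1 - of_real s * m $ i) * wsigma \<Lambda> (of_real \<omega>1)
                    / (wsigma \<Lambda> (of_real x + of_real \<omega>1) * wsigma \<Lambda> (of_real \<omega>1 - of_real s * m $ i))
                  * exp (of_real s * wzeta \<Lambda> (m $ i) * of_real x + of_real (freq p c H t $ i * y)))"
      unfolding r_lambda_def Let_def prod.case s_def[symmetric] using exhaust_3[of i] by (auto simp: C_def)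
    then show ?thesis unfolding Pair fst_conv snd_conv e baker_def by (simp only: mult.assoc)
  qed
  show "r_lambda \<Lambda> \<omega>1 p c H t m z $ i
      = of_real (C i) * baker (of_real s * m $ i) (of_real (fst z)) * of_real (exp (freq p c H t $ i * snd z))" by (rule k)
  have re: "h * Re (of_real u * w * of_real e) = Re (of_real (h * u) * w) * e" for h u e :: real and w :: complex
    by (simp add: algebra_simps)
  show "assoc_immersion \<Lambda> \<omega>1 p c H t m z
      = wave (\<lambda>i x. of_real (homothety p c t * C i) * baker (of_real s * m $ i) x) (\<lambda>i. freq p c H t $ i) z"
    unfolding assoc_immersion_def wave_def k by (simp add: vec_eq_iff re)
qed

text \<open>The data are obtained on the whole regular set, but uniqueness is asserted on one strip:
  the regular set falls apart into strips, and the rigidity argument works on a convex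
  domain.\<close>

lemma (in hildebrand_parameters) associated_family:
  fixes \<omega>1 :: real and \<omega>3 :: complex and m :: "complex^3"
  defines "L \<equiv> period_lattice \<omega>1 \<omega>3"
  assumes per: "0 < \<omega>1" "0 < Im \<omega>3" "invariant_g2 L = of_real (12 * b\<^sup>2)" "invariant_g3 L = of_real (8 * b ^ 3 - 16 * M\<^sup>2)"
    and t: "cos (3 * t) \<noteq> 0"
  defines "\<gamma> \<equiv> \<lambda>x. Re (wp L (of_real (x + \<omega>1)) + of_real b)"
    and "R \<equiv> {z :: real \<times> real. complex_of_real (fst z + \<omega>1) \<notin> L}"
    and "\<S> \<equiv> {-\<omega>1<..<\<omega>1} \<times> (UNIV :: real set)"
    and "U \<equiv> \<lambda>z :: real \<times> real. exp (3 * \<i> * of_real t) * of_real M"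
  shows "\<exists>m. spectral_point L (4 * b) p c (- 1) t i m"
    and "(\<And>i. spectral_point L (4 * b) p c (- 1) t i (m $ i)) \<Longrightarrow>
      (\<forall>z\<in>R. \<forall>i. r_lambda L \<omega>1 p c (- 1) t m z $ i \<in> \<real>) \<and>
      affine_sphere_data R (assoc_immersion L \<omega>1 p c (- 1) t m) (\<lambda>z. \<gamma> (fst z)) (- 1) U \<and>
      (\<forall>r. affine_sphere_data \<S> r (\<lambda>z. \<gamma> (fst z)) (- 1) U \<longleftrightarrow> unimodular_equivalent \<S> (assoc_immersion L \<omega>1 p c (- 1) t m) r)"
proof -
  define u1 u2 where "u1 = M * cos (3 * t)" and "u2 = M * sin (3 * t)"
  have u: "u1\<^sup>2 + u2\<^sup>2 = M\<^sup>2" by (simp add: u1_def u2_def power_mult_distrib flip: distrib_left)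
  interpret positive_spectral \<omega>1 \<omega>3 b u1 u2
    by unfold_locales (use per t M_pos b_pos M_less u in \<open>simp_all add: L_def u1_def\<close>)
  have U: "U z = Complex u1 u2" for z
    by (simp add: U_def exp_ii_eq_cis complex_eq_iff u1_def u2_def)
  have \<gamma>: "\<gamma> x = g x" for x by (simp add: \<gamma>_def g_def GG_def L_def)
  have root: "(f t $ i) ^ 3 - 3 * b * f t $ i + 2 * u2 = 0" for i unfolding u2_def by (rule freq_root)
  show "\<exists>m. spectral_point L (4 * b) p c (- 1) t i m"
    unfolding spectral_point_iff L_def using spectral_value_negative[OF root[of i]] by metis
  assume "\<And>i. spectral_point L (4 * b) p c (- 1) t i (m $ i)"
  then have m: "m $ i \<notin> period_lattice \<omega>1 \<omega>3" "wp (period_lattice \<omega>1 \<omega>3) (m $ i) + of_real b = of_real (3 * b - (f t $ i)\<^sup>2)"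
    "deriv (wp (period_lattice \<omega>1 \<omega>3)) (m $ i) \<in> \<real>" "Re (deriv (wp (period_lattice \<omega>1 \<omega>3)) (m $ i)) < 0" for i
    unfolding spectral_point_iff L_def by auto
  have s: "- sgn u1 = - sgn (cos (3 * t))" using M_pos by (simp add: u1_def sgn_mult)
  note mode = spectral_value_mode(1)[OF root m, unfolded s]
  note w = assoc_immersion_wave[OF spectral_value_mode(2)[OF root m, unfolded s]]
  have R: "z \<in> R \<longleftrightarrow> of_real (fst z) \<in> pdom" for z by (simp add: R_def dom_iff L_def)
  have "open ((\<lambda>z::real \<times> real. complex_of_real (fst z)) -` pdom)" by (intro open_vimage open_dom continuous_intros)
  moreover have "(\<lambda>z::real \<times> real. complex_of_real (fst z)) -` pdom = R" using R by auto
  ultimately have openR: "open R" by simp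
  have \<S>R: "\<S> \<subseteq> R" using strip_pdom R by (auto simp: \<S>_def)
  have open\<S>: "open \<S>" unfolding \<S>_def by (intro open_Times) auto
  have gpos: "g (fst z) > 0" if "z \<in> R" for z using g_gt[of "fst z"] b_pos that R by auto
  have data: "affine_sphere_data \<Omega> (assoc_immersion L \<omega>1 p c (- 1) t m) (\<lambda>z. \<gamma> (fst z)) (- 1) U"
    if \<Omega>: "open \<Omega>" "\<Omega> \<subseteq> R" for \<Omega>
  proof -
    define C :: "3 \<Rightarrow> real" where "C i = homothety p c t * (if i = 3 then sqrt 3 * (p - 1) * c / 2 else 1 / (3 * p))" for i
    have "C 1 * C 2 * C 3 = homothety p c t ^ 3 * ((1 / (3 * p)) * (1 / (3 * p)) * (sqrt 3 * (p - 1) * c / 2))"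
      by (simp add: C_def power3_eq_cube mult_ac)
    then have vol: "\<bar>C 1 * C 2 * C 3 * ((f t $ 1 - f t $ 2) * (f t $ 2 - f t $ 3) * (f t $ 3 - f t $ 1))\<bar> = 2 * \<bar>u1\<bar>"
      using amplitude[of t] by (simp only: u1_def)
    have eq: "assoc_immersion L \<omega>1 p c (- 1) t m
        = wave (\<lambda>i x. of_real (C i) * baker (of_real (- sgn (cos (3 * t))) * m $ i) x) (\<lambda>i. f t $ i)"
      unfolding L_def C_def by (rule ext, rule w(2))
    show ?thesis unfolding eq
      by (rule wave_data[OF mode freq_symmetric(1,2) vol \<Omega>(1)])
        (use \<Omega>(2) R gpos in \<open>auto simp: \<gamma> U g_def[symmetric]\<close>)
  qed
  have "r_lambda L \<omega>1 p c (- 1) t m z $ i \<in> \<real>" if "z \<in> R" for z i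
    unfolding L_def w(1) using mode_real[OF mode[of i]] that R by (intro Reals_mult Reals_of_real) auto
  moreover have "affine_sphere_data \<S> r (\<lambda>z. \<gamma> (fst z)) (- 1) U \<longleftrightarrow> unimodular_equivalent \<S> (assoc_immersion L \<omega>1 p c (- 1) t m) r" for r
  proof (rule affine_sphere_data_unimodular[where g = g and ?g1.0 = g1 and ?U1.0 = u1 and ?U2.0 = u2])
    show "convex \<S>" unfolding \<S>_def by (intro convex_Times) auto
    show "\<S> \<noteq> {}" using \<omega>1_pos by (auto simp: \<S>_def intro!: exI[of _ 0])
    show "affine_sphere_data \<S> (assoc_immersion L \<omega>1 p c (- 1) t m) (\<lambda>z. \<gamma> (fst z)) (- 1) U" by (rule data[OF open\<S> \<S>R])
  qed (use open\<S> \<S>R R gpos g_deriv \<gamma> U in auto)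
  ultimately show "(\<forall>z\<in>R. \<forall>i. r_lambda L \<omega>1 p c (- 1) t m z $ i \<in> \<real>) \<and>
      affine_sphere_data R (assoc_immersion L \<omega>1 p c (- 1) t m) (\<lambda>z. \<gamma> (fst z)) (- 1) U \<and>
      (\<forall>r. affine_sphere_data \<S> r (\<lambda>z. \<gamma> (fst z)) (- 1) U \<longleftrightarrow> unimodular_equivalent \<S> (assoc_immersion L \<omega>1 p c (- 1) t m) r)"
    using data[OF openR order_refl] by blast
qed

text \<open>If cos (3t) = 0, then U1 = 0 and sin (3t) is 1 or -1, whence the two signs in the cubic.
  The computation of \<open>wpd_square\<close> now gives P' = 0, so P'(m) < 0 is impossible.\<close>

lemma (in half_periods) deriv_wp_branch_point:
  assumes "cos (3 * t) = 0" and g: "invariant_g2 \<Lambda> = of_real (12 * b\<^sup>2)" "invariant_g3 \<Lambda> = of_real (8 * b ^ 3 - 16 * u\<^sup>2)"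
    and f: "f ^ 3 - 3 * b * f + 2 * u = 0 \<or> f ^ 3 - 3 * b * f - 2 * u = 0"
    and m: "m \<notin> \<Lambda>" "wp \<Lambda> m + of_real b = of_real (3 * b - f\<^sup>2)"
  shows "deriv (wp \<Lambda>) m = 0"
proof -
  have w: "wp \<Lambda> m = of_real (2 * b - f\<^sup>2)" using m(2) by (simp add: algebra_simps)
  have "(wpd m)\<^sup>2 = of_real (4 * (2 * b - f\<^sup>2) ^ 3 - 12 * b\<^sup>2 * (2 * b - f\<^sup>2) - (8 * b ^ 3 - 16 * u\<^sup>2))"
    unfolding wp_ode[OF m(1)] g w by (simp only: of_real_add of_real_mult of_real_diff of_real_power of_real_numeral)
  also have "4 * (2 * b - f\<^sup>2) ^ 3 - 12 * b\<^sup>2 * (2 * b - f\<^sup>2) - (8 * b ^ 3 - 16 * u\<^sup>2) = 0"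
    using f by (elim disjE) algebra+
  finally show ?thesis by (simp add: deriv_wp[OF m(1)])
qed

theorem theorem3p2:
  fixes p q c \<alpha> b1 b2 b3 g2 g3 \<omega>1 H :: real
    and \<omega>3 :: complex
    and \<Lambda> :: "complex set"
    and \<phi> :: "real \<Rightarrow> real"
    and G :: "real \<times> real \<Rightarrow> real"
    and strip regular :: "(real \<times> real) set"
  assumes p: "2 \<le> p" and q: "1 / p + 1 / q = 1"
    and c: "- 2 * (p + q) < c" "c < 0"
    and H: "H = - 1"
    and sphere: "0 < \<alpha>" "\<alpha> < 1" "hildebrand_profile p q c \<alpha> \<phi>"
    and cubic: "\<And>\<xi>::real. c\<^sup>2 / (4 * (p + q)) + (\<xi> - 1) * (\<xi> + p) * (\<xi> + q)
                  = \<xi> ^ 3 + 3 * b1 * \<xi>\<^sup>2 + 3 * b2 * \<xi> + b3"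
    and invariants: "g2 = 3 / 4 * (b1\<^sup>2 - b2)" "g3 = 1 / 16 * (3 * b1 * b2 - 2 * b1 ^ 3 - b3)"
    and half_periods: "0 < \<omega>1" "0 < Im \<omega>3" "\<Lambda> = period_lattice \<omega>1 \<omega>3"
      "invariant_g2 \<Lambda> = of_real g2" "invariant_g3 \<Lambda> = of_real g3"
    and strip: "strip = {-\<omega>1<..<\<omega>1} \<times> UNIV"
    and regular: "regular = {z. complex_of_real (fst z + \<omega>1) \<notin> \<Lambda>}"
    and G: "G = (\<lambda>z. Re (wp \<Lambda> (of_real (fst z + \<omega>1))) + (2 * (p + q - 1) - 3 * b1) / 12)"
  shows "\<exists>k > 0. \<exists>\<Theta> :: real \<times> real \<Rightarrow> real \<times> real. \<exists>t0 \<in> {0..2 * pi / 3}.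
    bij_betw \<Theta> strip ({-\<alpha><..<1} \<times> UNIV) \<and>
    (\<forall>z\<in>strip. complex_of_real (1 + fst (\<Theta> z) * deriv \<phi> (fst (\<Theta> z)))
                 = 4 * wp \<Lambda> (of_real (fst z + \<omega>1)) - of_real b1) \<and>
    affine_sphere_data strip (\<lambda>z. k *\<^sub>R hildebrand_sphere p q \<phi> (\<Theta> z)) G H
      (\<lambda>z. exp (3 * \<i> * of_real t0) * of_real (cubic_modulus p c)) \<and>
    homothety p c t0 = 1 \<and>
    (\<forall>t \<in> {0..2 * pi / 3}.
       (cos (3 * t) \<noteq> 0 \<longrightarrow> (\<forall>i. \<exists>m. spectral_point \<Lambda> b1 p c H t i m)) \<and>
       (\<forall>m :: complex^3. (\<forall>i. spectral_point \<Lambda> b1 p c H t i (m $ i)) \<longrightarrow>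
          (\<forall>z\<in>regular. \<forall>i. r_lambda \<Lambda> \<omega>1 p c H t m z $ i \<in> \<real>) \<and>
          affine_sphere_data regular (assoc_immersion \<Lambda> \<omega>1 p c H t m) G H
            (\<lambda>z. exp (3 * \<i> * of_real t) * of_real (cubic_modulus p c)) \<and>
          (\<forall>r. associated_member strip (\<lambda>z. k *\<^sub>R hildebrand_sphere p q \<phi> (\<Theta> z)) t r
               \<longleftrightarrow> unimodular_equivalent strip (assoc_immersion \<Lambda> \<omega>1 p c H t m) r)))"
proof -
  interpret P: hildebrand_parameters p q c by unfold_locales (use p q c in auto)
  define M where "M = cubic_modulus p c"
  \<comment> \<open>The values at 0, 1 and -1 determine the coefficients; with p q = p + q they give
    b2 = 0 and b1 = 4 b.\<close>
  have b3: "b3 = c\<^sup>2 / (4 * (p + q)) - p * q" using cubic[of 0] by simp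
  have e1: "c\<^sup>2 / (4 * (p + q)) = 1 + 3 * b1 + 3 * b2 + b3" using cubic[of 1] by simp
  have e2: "c\<^sup>2 / (4 * (p + q)) + - 2 * (p - 1) * (q - 1) = - 1 + 3 * b1 - 3 * b2 + b3" using cubic[of "- 1"] by simp
  have "(p - 1) * (q - 1) = 1" using P.sum_conjugate(2) by (simp add: algebra_simps)
  then have "- 2 * (p - 1) * (q - 1) = - 2" by (simp only: mult.assoc)
  then have b: "b2 = 0" "b1 = 4 * P.b"
    using b3 e1 e2 P.b_eq P.sum_conjugate(2) by linarith+
  have g2: "g2 = 12 * P.b\<^sup>2" unfolding invariants b by (simp add: power2_eq_square)
  have "1 / 16 * (3 * (4 * B) * 0 - 2 * (4 * B) ^ 3 - (X - s)) = 8 * B ^ 3 - 16 * (X / 256 + B ^ 3 - s / 256)" for B X s :: real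
    by (simp add: power_mult_distrib field_simps)
  moreover have "c\<^sup>2 / (1024 * (p + q)) = (c\<^sup>2 / (4 * (p + q))) / 256" by simp
  ultimately have g3: "g3 = 8 * P.b ^ 3 - 16 * M\<^sup>2"
    unfolding invariants M_def P.M_square b b3 P.sum_conjugate(2) by (simp only:)
  have G: "G = (\<lambda>z. Re (wp (period_lattice \<omega>1 \<omega>3) (of_real (fst z + \<omega>1)) + of_real P.b))"
    unfolding G b half_periods(3) using P.b_eq by (simp add: fun_eq_iff)
  note per = half_periods(1,2) half_periods(4,5)[unfolded g2 g3 M_def half_periods(3)]
  interpret L: half_periods \<omega>1 \<omega>3 by unfold_locales (use half_periods in auto)
  obtain t0 where t0: "t0 \<in> {0..2 * pi / 3}" "M * cos (3 * t0) = P.U1" "M * sin (3 * t0) = P.U2"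
    using P.base_angle unfolding M_def by blast
  interpret S: positive_spectral \<omega>1 \<omega>3 P.b P.U1 P.U2
    by unfold_locales (use per P.U1_eq P.b_pos P.M_less in simp_all)
  have g: "S.g x = Re (wp \<Lambda> (of_real (x + \<omega>1)) + of_real P.b)" for x by (simp add: S.g_def S.GG_def half_periods(3))
  have U0: "exp (3 * \<i> * of_real t0) * of_real M = Complex P.U1 P.U2"
    using t0(2,3) unfolding exp_ii_eq_cis by (simp add: complex_eq_iff mult.commute)
  have U2: "2 * P.U2 = - ((P.\<kappa> * P.a) * (P.\<kappa> * (P.a - 1)) * (P.\<kappa> * (1 - 2 * P.a)))" by (simp add: P.U2_def)
  obtain k \<Theta> where k: "k > 0" and \<Theta>: "bij_betw \<Theta> strip ({-\<alpha><..<1} \<times> UNIV)"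
    and \<xi>: "\<And>z. z \<in> strip \<Longrightarrow> 1 + fst (\<Theta> z) * deriv \<phi> (fst (\<Theta> z)) = 4 * S.g (fst z) - 8 * P.b"
    and data: "affine_sphere_data strip (\<lambda>z. k *\<^sub>R hildebrand_sphere p q \<phi> (\<Theta> z)) (\<lambda>z. S.g (fst z)) (- 1) (\<lambda>z. Complex P.U1 P.U2)"
    using S.hildebrand_wave[OF p q c sphere P.b_eq P.U2_square P.U1_eq(1) P.\<kappa>_ne P.\<kappa>_relations(1,2) U2 P.\<kappa>_relations(3-6) P.a_relations]
    unfolding strip by blast
  let ?r = "\<lambda>z. k *\<^sub>R hildebrand_sphere p q \<phi> (\<Theta> z)"
  have data0: "affine_sphere_data strip ?r G H (\<lambda>z. exp (3 * \<i> * of_real t0) * of_real M)"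
  proof -
    have eG: "G = (\<lambda>z. S.g (fst z))" unfolding G g ..
    have eU: "(\<lambda>z :: real \<times> real. exp (3 * \<i> * of_real t0) * of_real M) = (\<lambda>z. Complex P.U1 P.U2)" unfolding U0 ..
    show ?thesis unfolding eG eU H by (rule data)
  qed
  have "complex_of_real (1 + fst (\<Theta> z) * deriv \<phi> (fst (\<Theta> z))) = 4 * wp \<Lambda> (of_real (fst z + \<omega>1)) - of_real b1" if z: "z \<in> strip" for z
  proof -
    have "of_real (fst z) \<in> L.pdom" using z by (intro L.strip_pdom) (auto simp: strip)
    then have "complex_of_real (S.g (fst z)) = wp \<Lambda> (of_real (fst z + \<omega>1)) + of_real P.b"
      using S.real_eqs(1)[of "fst z"] by (simp add: S.GG_def half_periods(3))
    then show ?thesis unfolding \<xi>[OF z] b by (simp add: algebra_simps)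
  qed
  moreover have "homothety p c t0 = 1" using P.homothety_base t0 unfolding M_def by blast
  moreover have "\<exists>m. spectral_point \<Lambda> b1 p c H t i m" if "cos (3 * t) \<noteq> 0" for t i
    unfolding b H half_periods(3) by (rule P.associated_family(1)[OF per that])
  moreover have "(\<forall>z\<in>regular. \<forall>i. r_lambda \<Lambda> \<omega>1 p c H t m z $ i \<in> \<real>) \<and>
          affine_sphere_data regular (assoc_immersion \<Lambda> \<omega>1 p c H t m) G H
            (\<lambda>z. exp (3 * \<i> * of_real t) * of_real (cubic_modulus p c)) \<and>
          (\<forall>r. associated_member strip ?r t r \<longleftrightarrow> unimodular_equivalent strip (assoc_immersion \<Lambda> \<omega>1 p c H t m) r)"
    if m: "\<forall>i. spectral_point \<Lambda> b1 p c H t i (m $ i)" for t and m :: "complex^3"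
  proof -
    have m': "spectral_point (period_lattice \<omega>1 \<omega>3) (4 * P.b) p c (- 1) t i (m $ i)" for i
      using m unfolding b H half_periods(3) by blast
    \<comment> \<open>At cos (3t) = 0 the claim about m is vacuous, because P' would vanish at
      m.\<close>
    have t: "cos (3 * t) \<noteq> 0"
    proof
      assume c0: "cos (3 * t) = 0"
      then have "sin (3 * t) = 1 \<or> sin (3 * t) = - 1" using sin_cos_squared_add[of "3 * t"] by (simp add: power2_eq_1_iff)
      then have "deriv (wp (period_lattice \<omega>1 \<omega>3)) (m $ 1) = 0"
        using m'[of 1] P.freq_root[of t 1] unfolding P.spectral_point_iff
        by (intro L.deriv_wp_branch_point[OF c0 per(3,4), where f = "freq p c (- 1) t $ 1"]) auto
      then show False using m'[of 1] unfolding P.spectral_point_iff by simp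
    qed
    have ne: "strip \<noteq> {}" using half_periods(1) by (auto simp: strip intro!: exI[of _ 0])
    have am: "associated_member strip ?r t r \<longleftrightarrow> affine_sphere_data strip r G H (\<lambda>z. exp (3 * \<i> * of_real t) * of_real M)" for r
      by (rule associated_member_iff[OF data0 ne]) (use P.M_pos M_def in simp)
    show ?thesis
      using P.associated_family(2)[OF per t m'] unfolding am unfolding M_def G H regular strip half_periods(3) .
  qed
  ultimately show ?thesis
    using k \<Theta> data0 t0(1) unfolding M_def half_periods(3) by blast
qed

end
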